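(* In the setting of the context (in particular $m>1$ and $\sum_{k\ge1}(k\log k)p_k<\infty$), suppose the spatial motion $\xi$ satisfies the following three assumptions. (A1) There exist a (positive) non-decreasing function $h_t$ with $h_t\uparrow\infty$ and a measure $\pi\in\mathcal{M}(\overline{\mathbb{R}}_0)$ such that for every $s>0$ and every $g\in C_c^+(\overline{\mathbb{R}}_0)$, $\lim_{t\to\infty}e^{\lambda t}\mathrm{E}\big(g(h_t^{-1}\xi_s)\big)=s\int_{\mathbb{R}_0}g(x)\,\pi(dx)$. (A2) For every $\theta>0$, $e^{\lambda t}p_t^2\to0$ as $t\to\infty$, where $p_t:=\sup_{s\le t}\mathrm{P}(|\xi_s|>h_t\theta/t)$. (A3) For every $\theta>0$, $\sup_{t>1}\sup_{s\le t}s^{-1}e^{\lambda t}\,\mathrm{P}(|\xi_s|>h_t\theta)<\infty$. Then, under $\mathbb{P}$, $\mathcal{N}_t:=\sum_{v\in\mathcal{L}_t}\delta_{h_t^{-1}\xi^v_t}$ converges weakly as $t\to\infty$ to a random measure $\mathcal{N}_\infty\in\mathcal{M}(\overline{\mathbb{R}}_0)$, defined on some extension $(\Omega,\mathcal{G},P)$ (with expectation $E$) of the probability space of the branching Lévy process, with $$E\big(e^{-\mathcal{N}_\infty(g)}\big)=\mathbb{E}\left(\exp\left\{-W\int_0^\infty e^{-\lambda r}\int_{\mathbb{R}_0}\mathbb{E}\big(1-e^{-Z_r g(x)}\big)\,\pi(dx)\,dr\right\}\right),\qquad g\in C_c^+(\overline{\mathbb{R}}_0).$$ Moreover $\mathcal{N}_\infty=\sum_jT_j\delta_{e_j}$,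 where, given $W$, $\sum_j\delta_{e_j}$ is a Poisson random measure on $\mathbb{R}_0$ with intensity $\vartheta W\pi(dx)$, $\{T_j,j\ge1\}$ are i.i.d. with $P(T_j=k)=\vartheta^{-1}\int_0^\infty e^{-\lambda r}\mathbb{P}(Z_r=k)\,dr$, $k\ge1$, $\vartheta=\int_0^\infty e^{-\lambda r}\mathbb{P}(Z_r>0)\,dr$, and $\sum_j\delta_{e_j}$ and $\{T_j\}$ are independent. In particular, (A1)–(A3), and hence this conclusion, hold with $h_t=e^{\lambda t}$ and $\pi(dx)=n(dx)$ when $\xi$ is a non-symmetric $1$-stable process with Lévy measure $n(dx)=c_1x^{-2}\mathbf{1}_{(0,\infty)}(x)dx+c_2|x|^{-2}\mathbf{1}_{(-\infty,0)}(x)dx$, where $c_1,c_2\ge0$, $c_1+c_2>0$, $c_1\ne c_2$, and with Lévy exponent, for $\theta>0$, $\psi(\theta)=-\frac{\pi}{2}(c_1+c_2)\theta-i(c_1-c_2)\theta\log\theta+ia(c_1-c_2)\theta$, $a\in\mathbb{R}$ constant (here $\pi$ in $\frac{\pi}{2}$ is the number).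
   Context: Branching Lévy process: at time $0$ a single particle starts at $0$ and moves according to a real-valued Lévy process $\xi=(\xi_t)_{t\ge0}$ with $\mathrm{P}(\xi_0=0)=1$ and Lévy exponent $\psi(\theta)=\log \mathrm{E}(e^{i\theta\xi_1})$. Each particle lives an exponential time with parameter $\beta>0$, and at death splits into $k$ new particles with probability $p_k$, $k\ge0$, born at the parent's death position. Once born, particles independently move (same Lévy process) and split (same lifetime and offspring laws). The law and expectation of the branching process are $\mathbb{P},\mathbb{E}$. $\mathcal{L}_t$ is the set of particles alive at time $t$, $Z_t$ its cardinality, and $\xi^v_t$ the position of $v\in\mathcal{L}_t$. Standing assumptions: $m:=\sum_k kp_k>1$ and $\sum_{k\ge1}(k\log k)p_k<\infty$. Put $\lambda:=\beta(m-1)$ and $W:=\lim_{t\to\infty}e^{-\lambda t}Z_t$ (exists a.s.). $\mathbb{R}_0=\mathbb{R}\setminus\{0\}$, $\overline{\mathbb{R}}_0=[-\infty,\infty]\setminus\{0\}$. $C_c^+(\overline{\mathbb{R}}_0)$ is the set of non-negative continuous functions $g$ on $\overline{\mathbb{R}}_0$ with $g=0$ on $(-\delta,0)\cup(0,\delta)$ for some $\delta>0$ (put $g(0)=0$ when evaluating at $0$). $\mathcal{M}(\overline{\mathbb{R}}_0)$ is the set of Radon measures on $\overline{\mathbb{R}}_0$ with the vague topology; $\mu(g)=\int g\,d\mu$; point measures on $\mathbb{R}$ are viewed in $\mathcal{M}(\overline{\mathbb{R}}_0)$ by ignoring atoms at $0$. Random elements $\nu_t$ of $\mathcal{M}(\overline{\mathbb{R}}_0)$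 converge weakly to $\nu$ iff $\nu_t(g)$ converges in distribution to $\nu(g)$ for all $g\in C_c^+(\overline{\mathbb{R}}_0)$. *)

theory Defs
  imports "HOL-Probability.Probability"
begin

section \<open>The state space $[-\infty,\infty]\setminus\{0\}$ and its Radon measures\<close>

definition R0bar :: "ereal measure" where
  "R0bar = restrict_space borel (- {0})"

definition R0 :: "ereal set" where
  "R0 = {x. x \<noteq> 0 \<and> \<bar>x\<bar> \<noteq> \<infinity>}"

text \<open>The space is locally compact with a countable base, so a Borel measure that is finite on
  compact sets is automatically regular. The compact subsets are the closed sets
  of extended reals that stay away from 0.\<close>

definition radon_R0bar :: "ereal measure set" where
  "radon_R0bar = {\<mu>. sets \<mu> = sets R0bar \<and>
     (\<forall>K. compact K \<and> K \<subseteq> - {0} \<longrightarrow> emeasure \<mu> K < \<infinity>)}"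

definition Cc_plus :: "(ereal \<Rightarrow> real) set" where
  "Cc_plus = {g. continuous_on (- {0}) g \<and> (\<forall>x. 0 \<le> g x) \<and> g 0 = 0 \<and>
     (\<exists>\<delta>>0. \<forall>x. x \<noteq> 0 \<and> \<bar>x\<bar> < ereal \<delta> \<longrightarrow> g x = 0)}"

text \<open>A Borel measure on the real line, seen as a measure on \<^const>\<open>R0bar\<close> by
  discarding its mass at 0.\<close>

definition to_R0bar :: "real measure \<Rightarrow> ereal measure" where
  "to_R0bar \<mu> = restrict_space (distr \<mu> borel ereal) (- {0})"

text \<open>The measure $\sum_{i\in I} w_i\,\delta_{x_i}$.\<close>

definition point_sum :: "'i set \<Rightarrow> ('i \<Rightarrow> ennreal) \<Rightarrow> ('i \<Rightarrow> real) \<Rightarrow> ereal measure" where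
  "point_sum I w x = to_R0bar (distr (point_measure I w) borel x)"

text \<open>The \<open>\<sigma>\<close>-algebra on the space of Radon measures is the Borel \<open>\<sigma>\<close>-algebra of the vague
  topology, which is generated by the evaluations at Borel sets.\<close>

definition random_measure_R0bar :: "'w measure \<Rightarrow> ('w \<Rightarrow> ereal measure) \<Rightarrow> bool" where
  "random_measure_R0bar P \<nu> \<longleftrightarrow>
     (\<forall>\<omega>\<in>space P. \<nu> \<omega> \<in> radon_R0bar) \<and>
     (\<forall>B\<in>sets R0bar. (\<lambda>\<omega>. emeasure (\<nu> \<omega>) B) \<in> borel_measurable P)"

text \<open>Convergence in distribution as $t\to\infty$ over the reals, in the form of
  \<^const>\<open>weak_conv_m\<close> (which is restricted to sequences).\<close>

definition converges_in_distribution ::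
  "'w measure \<Rightarrow> (real \<Rightarrow> 'w \<Rightarrow> real) \<Rightarrow> 'v measure \<Rightarrow> ('v \<Rightarrow> real) \<Rightarrow> bool" where
  "converges_in_distribution M Y P Y' \<longleftrightarrow>
     (\<forall>x. isCont (cdf (distr P borel Y')) x \<longrightarrow>
        ((\<lambda>t. cdf (distr M borel (Y t)) x) \<longlongrightarrow> cdf (distr P borel Y') x) at_top)"

definition converges_weakly_R0bar ::
  "'w measure \<Rightarrow> (real \<Rightarrow> 'w \<Rightarrow> ereal measure) \<Rightarrow> 'v measure \<Rightarrow> ('v \<Rightarrow> ereal measure) \<Rightarrow> bool" where
  "converges_weakly_R0bar M \<nu> P \<nu>' \<longleftrightarrow>
     (\<forall>g\<in>Cc_plus. converges_in_distribution
        M (\<lambda>t \<omega>. LINT x|\<nu> t \<omega>. g x) P (\<lambda>\<omega>. LINT x|\<nu>' \<omega>. g x))"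


section \<open>Levy processes\<close>

text \<open>All sample paths are cadlag (right-continuous with left limits), so that the process can be evaluated measurably
  at random times without completing the probability space. Only times $t \ge 0$ matter.\<close>

definition cadlag :: "(real \<Rightarrow> real) \<Rightarrow> bool" where
  "cadlag f \<longleftrightarrow> (\<forall>t\<ge>0. continuous (at_right t) f) \<and> (\<forall>t>0. \<exists>l. (f \<longlongrightarrow> l) (at_left t))"

definition levy_process :: "'w measure \<Rightarrow> (real \<Rightarrow> 'w \<Rightarrow> real) \<Rightarrow> bool" where
  "levy_process N \<xi> \<longleftrightarrow> prob_space N \<and>
     (\<forall>t\<ge>0. \<xi> t \<in> borel_measurable N) \<and>
     (AE \<omega> in N. \<xi> 0 \<omega> = 0) \<and>
     (\<forall>(n::nat) t. 0 \<le> t 0 \<and> mono t \<longrightarrow>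
        prob_space.indep_vars N (\<lambda>_. borel) (\<lambda>i \<omega>. \<xi> (t (Suc i)) \<omega> - \<xi> (t i) \<omega>) {..<n}) \<and>
     (\<forall>s\<ge>0. \<forall>t\<ge>0. distr N borel (\<lambda>\<omega>. \<xi> (s + t) \<omega> - \<xi> s \<omega>) = distr N borel (\<xi> t)) \<and>
     (\<forall>\<omega>\<in>space N. cadlag (\<lambda>t. \<xi> t \<omega>))"

abbreviation path_space :: "(real \<Rightarrow> real) measure" where
  "path_space \<equiv> Pi\<^sub>M {0..} (\<lambda>_. borel)"

definition path :: "(real \<Rightarrow> 'w \<Rightarrow> real) \<Rightarrow> 'w \<Rightarrow> (real \<Rightarrow> real)" where
  "path \<xi> \<omega> = (\<lambda>t\<in>{0..}. \<xi> t \<omega>)"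

definition process_law :: "'w measure \<Rightarrow> (real \<Rightarrow> 'w \<Rightarrow> real) \<Rightarrow> (real \<Rightarrow> real) measure" where
  "process_law N \<xi> = distr N path_space (path \<xi>)"

text \<open>The logarithm is the one that is continuous and vanishes at 0.\<close>

definition levy_exponent_of ::
  "'w measure \<Rightarrow> (real \<Rightarrow> 'w \<Rightarrow> real) \<Rightarrow> (real \<Rightarrow> complex) \<Rightarrow> bool" where
  "levy_exponent_of N \<xi> \<psi> \<longleftrightarrow> continuous_on UNIV \<psi> \<and> \<psi> 0 = 0 \<and>
     (\<forall>\<theta>. char (distr N borel (\<xi> 1)) \<theta> = exp (\<psi> \<theta>))"

text \<open>Levy--Khintchine formula.\<close>

definition levy_measure_of ::
  "'w measure \<Rightarrow> (real \<Rightarrow> 'w \<Rightarrow> real) \<Rightarrow> real measure \<Rightarrow> bool" where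
  "levy_measure_of N \<xi> \<nu> \<longleftrightarrow> sets \<nu> = sets borel \<and> emeasure \<nu> {0} = 0 \<and>
     (\<integral>\<^sup>+x. ennreal (min 1 (x\<^sup>2)) \<partial>\<nu>) < \<infinity> \<and>
     (\<exists>b \<sigma>2. 0 \<le> \<sigma>2 \<and>
        levy_exponent_of N \<xi> (\<lambda>\<theta>. \<i> * complex_of_real (b * \<theta>) - complex_of_real (\<sigma>2 * \<theta>\<^sup>2 / 2)
          + (CLINT x|\<nu>. iexp (\<theta> * x) - 1
               - (if \<bar>x\<bar> \<le> 1 then \<i> * complex_of_real (\<theta> * x) else 0))))"

text \<open>Stability in the wide sense, i.e. up to a deterministic translation.\<close>

definition stable_process :: "real \<Rightarrow> 'w measure \<Rightarrow> (real \<Rightarrow> 'w \<Rightarrow> real) \<Rightarrow> bool" where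
  "stable_process \<alpha> N \<xi> \<longleftrightarrow> levy_process N \<xi> \<and>
     (\<forall>t>0. \<exists>c. distr N borel (\<xi> t) = distr N borel (\<lambda>\<omega>. t powr (1 / \<alpha>) * \<xi> 1 \<omega> + c))"

definition cauchy_levy_measure :: "real \<Rightarrow> real \<Rightarrow> real measure" where
  "cauchy_levy_measure c1 c2 = density lborel (\<lambda>x. ennreal
     (c1 * x powi (-2) * indicator {0<..} x + c2 * \<bar>x\<bar> powi (-2) * indicator {..<0} x))"

definition nonsymmetric_1_stable ::
  "real \<Rightarrow> real \<Rightarrow> real \<Rightarrow> 'w measure \<Rightarrow> (real \<Rightarrow> 'w \<Rightarrow> real) \<Rightarrow> bool" where
  "nonsymmetric_1_stable c1 c2 a N \<xi> \<longleftrightarrow>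
     0 \<le> c1 \<and> 0 \<le> c2 \<and> 0 < c1 + c2 \<and> c1 \<noteq> c2 \<and>
     stable_process 1 N \<xi> \<and> levy_measure_of N \<xi> (cauchy_levy_measure c1 c2) \<and>
     (\<exists>\<psi>. levy_exponent_of N \<xi> \<psi> \<and>
        (\<forall>\<theta>>0. \<psi> \<theta> = - complex_of_real (pi / 2 * (c1 + c2) * \<theta>)
            - \<i> * complex_of_real ((c1 - c2) * \<theta> * ln \<theta>)
            + \<i> * complex_of_real (a * (c1 - c2) * \<theta>)))"


section \<open>Branching Levy processes\<close>

text \<open>Particles carry Ulam--Harris labels: \<open>[]\<close> is the initial particle and \<open>i # v\<close>, for \<open>i\<close>
  less than the number of children of \<open>v\<close>, is a child of \<open>v\<close>. Every label \<open>v\<close> has a lifetime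
  \<open>life v\<close>, an offspring number \<open>offs v\<close> and a displacement process \<open>motion v\<close>,
  which is run from the birth of \<open>v\<close>.\<close>

primrec born :: "(nat list \<Rightarrow> 'w \<Rightarrow> nat) \<Rightarrow> nat list \<Rightarrow> 'w \<Rightarrow> bool" where
  "born offs [] \<omega> = True"
| "born offs (i # v) \<omega> = (born offs v \<omega> \<and> i < offs v \<omega>)"

primrec birth_time :: "(nat list \<Rightarrow> 'w \<Rightarrow> real) \<Rightarrow> nat list \<Rightarrow> 'w \<Rightarrow> real" where
  "birth_time life [] \<omega> = 0"
| "birth_time life (i # v) \<omega> = birth_time life v \<omega> + life v \<omega>"

primrec birth_place ::
  "(nat list \<Rightarrow> 'w \<Rightarrow> real) \<Rightarrow> (nat list \<Rightarrow> real \<Rightarrow> 'w \<Rightarrow> real) \<Rightarrow> nat list \<Rightarrow> 'w \<Rightarrow> real" where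
  "birth_place life motion [] \<omega> = 0"
| "birth_place life motion (i # v) \<omega> = birth_place life motion v \<omega> + motion v (life v \<omega>) \<omega>"

definition alive ::
  "(nat list \<Rightarrow> 'w \<Rightarrow> real) \<Rightarrow> (nat list \<Rightarrow> 'w \<Rightarrow> nat) \<Rightarrow> real \<Rightarrow> 'w \<Rightarrow> nat list set" where
  "alive life offs t \<omega> = {v. born offs v \<omega> \<and>
     birth_time life v \<omega> \<le> t \<and> t < birth_time life v \<omega> + life v \<omega>}"

definition population ::
  "(nat list \<Rightarrow> 'w \<Rightarrow> real) \<Rightarrow> (nat list \<Rightarrow> 'w \<Rightarrow> nat) \<Rightarrow> real \<Rightarrow> 'w \<Rightarrow> nat" where
  "population life offs t \<omega> = card (alive life offs t \<omega>)"

definition position ::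
  "(nat list \<Rightarrow> 'w \<Rightarrow> real) \<Rightarrow> (nat list \<Rightarrow> real \<Rightarrow> 'w \<Rightarrow> real) \<Rightarrow> nat list \<Rightarrow> real \<Rightarrow> 'w \<Rightarrow> real" where
  "position life motion v t \<omega> =
     birth_place life motion v \<omega> + motion v (t - birth_time life v \<omega>) \<omega>"

text \<open>The spatial motion \<open>\<xi>\<close> lives on its own probability space \<open>N\<close>. The product law in the
  last clause states that lifetime, offspring number and motion of a particle are independent,
  with the exponential law, the law \<open>p\<close> and the law of \<open>\<xi>\<close>.\<close>

definition branching_levy_process ::
  "'w measure \<Rightarrow> real \<Rightarrow> nat pmf \<Rightarrow> 'b measure \<Rightarrow> (real \<Rightarrow> 'b \<Rightarrow> real) \<Rightarrow>
   (nat list \<Rightarrow> 'w \<Rightarrow> real) \<Rightarrow> (nat list \<Rightarrow> 'w \<Rightarrow> nat) \<Rightarrow> (nat list \<Rightarrow> real \<Rightarrow> 'w \<Rightarrow> real) \<Rightarrow> bool" where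
  "branching_levy_process M \<beta> p N \<xi> life offs motion \<longleftrightarrow>
     prob_space M \<and> 0 < \<beta> \<and> levy_process N \<xi> \<and>
     (\<forall>v. \<forall>\<omega>\<in>space M. 0 \<le> life v \<omega> \<and> cadlag (\<lambda>t. motion v t \<omega>)) \<and>
     prob_space.indep_vars M (\<lambda>_. borel \<Otimes>\<^sub>M (count_space UNIV \<Otimes>\<^sub>M path_space))
       (\<lambda>v \<omega>. (life v \<omega>, offs v \<omega>, path (motion v) \<omega>)) UNIV \<and>
     (\<forall>v. distr M (borel \<Otimes>\<^sub>M (count_space UNIV \<Otimes>\<^sub>M path_space))
            (\<lambda>\<omega>. (life v \<omega>, offs v \<omega>, path (motion v) \<omega>)) =
          density lborel (exponential_density \<beta>) \<Otimes>\<^sub>M (measure_pmf p \<Otimes>\<^sub>M process_law N \<xi>))"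

definition offspring_mean :: "nat pmf \<Rightarrow> real" where
  "offspring_mean p = (\<Sum>k. real k * pmf p k)"

definition growth_rate :: "real \<Rightarrow> nat pmf \<Rightarrow> real" where
  "growth_rate \<beta> p = \<beta> * (offspring_mean p - 1)"

definition particle_measure ::
  "(nat list \<Rightarrow> 'w \<Rightarrow> real) \<Rightarrow> (nat list \<Rightarrow> 'w \<Rightarrow> nat) \<Rightarrow> (nat list \<Rightarrow> real \<Rightarrow> 'w \<Rightarrow> real) \<Rightarrow>
   (real \<Rightarrow> real) \<Rightarrow> real \<Rightarrow> 'w \<Rightarrow> ereal measure" where
  "particle_measure life offs motion h t \<omega> =
     point_sum (alive life offs t \<omega>) (\<lambda>_. 1) (\<lambda>v. position life motion v t \<omega> / h t)"


section \<open>The assumptions on the spatial motion\<close>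

definition assumption_A1 ::
  "'b measure \<Rightarrow> (real \<Rightarrow> 'b \<Rightarrow> real) \<Rightarrow> real \<Rightarrow> (real \<Rightarrow> real) \<Rightarrow> ereal measure \<Rightarrow> bool" where
  "assumption_A1 N \<xi> lam h \<pi> \<longleftrightarrow>
     (\<forall>t>0. 0 < h t) \<and> mono_on {0<..} h \<and> filterlim h at_top at_top \<and> \<pi> \<in> radon_R0bar \<and>
     (\<forall>s>0. \<forall>g\<in>Cc_plus.
        ((\<lambda>t. exp (lam * t) * (LINT \<omega>|N. g (ereal (\<xi> s \<omega> / h t))))
           \<longlongrightarrow> s * (LINT x:R0|\<pi>. g x)) at_top)"

definition assumption_A2 ::
  "'b measure \<Rightarrow> (real \<Rightarrow> 'b \<Rightarrow> real) \<Rightarrow> real \<Rightarrow> (real \<Rightarrow> real) \<Rightarrow> bool" where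
  "assumption_A2 N \<xi> lam h \<longleftrightarrow>
     (\<forall>\<theta>>0. ((\<lambda>t. exp (lam * t) *
        (SUP s\<in>{0..t}. measure N {\<omega>\<in>space N. \<bar>\<xi> s \<omega>\<bar> > h t * \<theta> / t})\<^sup>2) \<longlongrightarrow> 0) at_top)"

definition assumption_A3 ::
  "'b measure \<Rightarrow> (real \<Rightarrow> 'b \<Rightarrow> real) \<Rightarrow> real \<Rightarrow> (real \<Rightarrow> real) \<Rightarrow> bool" where
  "assumption_A3 N \<xi> lam h \<longleftrightarrow>
     (\<forall>\<theta>>0. (SUP t\<in>{1<..}. SUP s\<in>{0<..t}.
        ereal (inverse s * exp (lam * t) * measure N {\<omega>\<in>space N. \<bar>\<xi> s \<omega>\<bar> > h t * \<theta>})) < \<infinity>)"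


section \<open>The limit\<close>

definition is_extension :: "'w measure \<Rightarrow> 'v measure \<Rightarrow> ('v \<Rightarrow> 'w) \<Rightarrow> bool" where
  "is_extension M P \<phi> \<longleftrightarrow> prob_space P \<and> \<phi> \<in> measurable P M \<and> distr P M \<phi> = M"

text \<open>The Poisson law with mean \<open>\<infinity>\<close> is the point mass at \<open>\<infinity>\<close>.\<close>

definition poisson_mass :: "ennreal \<Rightarrow> enat \<Rightarrow> real" where
  "poisson_mass a k = (case k of
       enat n \<Rightarrow> if a = \<infinity> then 0 else exp (- enn2real a) * enn2real a ^ n / fact n
     | \<infinity> \<Rightarrow> if a = \<infinity> then 1 else 0)"

text \<open>Given the sub-\<open>\<sigma>\<close>-algebra \<open>F\<close>, the random measure \<open>\<zeta>\<close> is a Poisson random measure on the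
  measurable space \<open>S\<close> with (\<open>F\<close>-measurable) intensity \<open>\<Lambda>\<close>.\<close>

definition cond_poisson_random_measure ::
  "'v measure \<Rightarrow> 'v measure \<Rightarrow> 'a measure \<Rightarrow> ('v \<Rightarrow> 'a measure) \<Rightarrow> ('v \<Rightarrow> 'a measure) \<Rightarrow> bool" where
  "cond_poisson_random_measure P F S \<Lambda> \<zeta> \<longleftrightarrow>
     (\<forall>\<omega>\<in>space P. sets (\<zeta> \<omega>) = sets S) \<and>
     (\<forall>B\<in>sets S. (\<lambda>\<omega>. emeasure (\<zeta> \<omega>) B) \<in> borel_measurable P) \<and>
     (\<forall>(n::nat) B k. (\<forall>i<n. B i \<in> sets S) \<and> disjoint_family_on B {..<n} \<longrightarrow>
        (AE \<omega> in P.
           real_cond_exp P F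
             (indicator {\<omega>\<in>space P. \<forall>i<n. emeasure (\<zeta> \<omega>) (B i) = ennreal_of_enat (k i)}) \<omega> =
           (\<Prod>i<n. poisson_mass (emeasure (\<Lambda> \<omega>) (B i)) (k i))))"

definition theta_const ::
  "'w measure \<Rightarrow> real \<Rightarrow> (real \<Rightarrow> 'w \<Rightarrow> nat) \<Rightarrow> real" where
  "theta_const M lam Z =
     (LBINT r:{0..}. exp (- lam * r) * measure M {\<omega>\<in>space M. Z r \<omega> > 0})"

text \<open>\<open>\<nu>\<close> is $\sum_{j<J} T_j\,\delta_{e_j}$, where \<open>J\<close> is the random and possibly infinite number
  of points. The sequence of marks is independent of \<open>W\<close> together with the whole enumeration of
  the points: this is needed, because independence of the unordered collection of points alone
  would allow the enumeration to depend on the marks.\<close>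

definition cluster_representation ::
  "'w measure \<Rightarrow> real \<Rightarrow> (real \<Rightarrow> 'w \<Rightarrow> nat) \<Rightarrow> ereal measure \<Rightarrow>
   'v measure \<Rightarrow> ('v \<Rightarrow> real) \<Rightarrow> ('v \<Rightarrow> ereal measure) \<Rightarrow> bool" where
  "cluster_representation M lam Z \<pi> P W \<nu> \<longleftrightarrow>
     (\<exists>(J :: 'v \<Rightarrow> enat) (e :: nat \<Rightarrow> 'v \<Rightarrow> real) (T :: nat \<Rightarrow> 'v \<Rightarrow> nat).
        J \<in> measurable P (count_space UNIV) \<and>
        (\<forall>j. e j \<in> borel_measurable P) \<and>
        (\<forall>\<omega>\<in>space P. \<forall>j. enat j < J \<omega> \<longrightarrow> e j \<omega> \<noteq> 0) \<and>
        (AE \<omega> in P. \<nu> \<omega> =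
           point_sum {j. enat j < J \<omega>} (\<lambda>j. of_nat (T j \<omega>)) (\<lambda>j. e j \<omega>)) \<and>
        cond_poisson_random_measure P (vimage_algebra (space P) W borel) (restrict_space borel R0)
          (\<lambda>\<omega>. scale_measure (ennreal (theta_const M lam Z * W \<omega>)) (restrict_space \<pi> R0))
          (\<lambda>\<omega>. restrict_space (point_sum {j. enat j < J \<omega>} (\<lambda>_. 1) (\<lambda>j. e j \<omega>)) R0) \<and>
        prob_space.indep_vars P (\<lambda>_. count_space UNIV) T UNIV \<and>
        (\<forall>j. \<forall>k\<ge>1. measure P {\<omega>\<in>space P. T j \<omega> = k} =
           inverse (theta_const M lam Z) *
           (LBINT r:{0..}. exp (- lam * r) * measure M {\<omega>\<in>space M. Z r \<omega> = k})) \<and>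
        prob_space.indep_set P
          (sets (vimage_algebra (space P) (\<lambda>\<omega> j. T j \<omega>) (Pi\<^sub>M UNIV (\<lambda>_. count_space UNIV))))
          (sets (vimage_algebra (space P) (\<lambda>\<omega>. (W \<omega>, J \<omega>, \<lambda>j. e j \<omega>))
             (borel \<Otimes>\<^sub>M (count_space UNIV \<Otimes>\<^sub>M Pi\<^sub>M UNIV (\<lambda>_. borel))))))"

text \<open>HOL cannot quantify existentially over the type of the extended sample space. Products with
  a sequence space are rich enough to carry all the additional randomness.\<close>

definition branching_limit ::
  "'w measure \<Rightarrow> real \<Rightarrow> (real \<Rightarrow> 'w \<Rightarrow> nat) \<Rightarrow> ('w \<Rightarrow> real) \<Rightarrow> ereal measure \<Rightarrow>
   (real \<Rightarrow> 'w \<Rightarrow> ereal measure) \<Rightarrow> bool" where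
  "branching_limit M lam Z W \<pi> \<N> \<longleftrightarrow>
     (\<exists>(P :: ('w \<times> (nat \<Rightarrow> real)) measure) \<N>inf.
        is_extension M P fst \<and>
        random_measure_R0bar P \<N>inf \<and>
        converges_weakly_R0bar M \<N> P \<N>inf \<and>
        (\<forall>g\<in>Cc_plus.
           (LINT \<omega>|P. exp (- (LINT x|\<N>inf \<omega>. g x))) =
           (LINT \<omega>|M. exp (- W \<omega> * (LBINT r:{0..}. exp (- lam * r) *
              (LINT x:R0|\<pi>. (LINT \<omega>'|M. 1 - exp (- real (Z r \<omega>') * g x))))))) \<and>
        cluster_representation M lam Z \<pi> P (\<lambda>\<omega>. W (fst \<omega>)) \<N>inf)"

end

(* Let U t G y be the expectation of the product of G over the positions at time t of the population
started from y. Conditioning on the first split gives an integral equation, which in terms of 1 - U is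
linear with growth rate lam up to a loss term that is superlinear at 0. Together with A1 this yields the
limit of e^(lam t) (1 - U s G 0) for G = exp (- g (. / h t)) and a fixed time s. Now cut the tree at time
T - s. By A3 and two-jump estimates all particles are then within eps * h T of the origin, up to an
error that vanishes as T and then s tend to infinity, so the subtrees contribute independently as if started
at 0, and their number is asymptotically W e^(lam (T - s)). Letting s tend to infinity identifies the limit
of the Laplace functional, which is that of a Poisson process of intensity theta W pi carrying independent
cluster sizes as multiplicities; the latter is built explicitly on an extension of the space.

For the 1-stable motion the scaling relation for psi has a correction that is linear in the frequency
(it comes from the logarithm), so the second differences of psi scale exactly. They are the Fourier
transforms of the law weighted by 1 - cos (u x), and Levy's continuity theorem gives A1. A2 and A3
follow from the usual bound of a tail by the characteristic function near 0. *)
theory Submission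
 imports Defs "HOL-Real_Asymp.Real_Asymp"
begin

text \<open>Nothing excludes in advance that infinitely many particles are alive, and G may be the
  indicator of a ball, which vanishes somewhere. Products over particles are therefore exponentials
  of minus a sum in [0, \<infinity>], with \<open>nlog 0\<close> = \<infinity>. The tree is moved to
  a product space over the labels, where the subtrees of the children are coordinate shifts of the
  whole. The Markov property at time T - s never appears as conditioning on the past: it is the
  identity \<open>U_semigroup\<close>, a consequence of uniqueness for the first-split equation. W
  enters only through the generating function \<open>V\<close> of the population without motion, at
  an argument 1 - O(e^(-lam T)). The factor e^(-lam r) in the exponent is read as the density, up to
  lam, of an independent exponential time; the cluster size is the population at that time,
  conditioned to be nonzero. For the stable motion a test function cannot be divided by a single
  weight 1 - cos (u x), which has zeros away from 0; averaging over u in [0, 1] removes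
  them.\<close>

abbreviation (input) Bm :: "'a measure => ('a => 'b::topological_space) set" where
 "Bm \<equiv> borel_measurable"

section \<open>Sums over the particles alive\<close>

text \<open>\<open>nexp\<close> and \<open>nlog\<close> extend exp (- x) and - ln x to mutually
  inverse maps between [0, \<infinity>] and [0, 1]. Sums in [0, \<infinity>] always exist, so
  infinite products raise no question of convergence.\<close>

definition nexp :: "ennreal => ennreal" where
 "nexp x = (if x = \<infinity> then 0 else ennreal (exp (- enn2real x)))"

definition nlog :: "real => ennreal" where
 "nlog x = (if x <= 0 then \<infinity> else ennreal (- ln x))"

lemma nexp_add: "nexp (x + y) = nexp x * nexp y"
proof (cases "x = \<infinity> \<or> y = \<infinity>")
 case False
 hence "enn2real (x + y) = enn2real x + enn2real y" by (simp add: enn2real_plus less_top)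
 thus ?thesis using False by (auto simp: nexp_def ennreal_mult[symmetric] mult_exp_exp)
qed (auto simp: nexp_def)

lemma nexp_0 [simp]: "nexp 0 = 1" by (simp add: nexp_def)

lemma nexp_top [simp]: "nexp \<infinity> = 0" "nexp top = 0" by (auto simp: nexp_def)

lemma nexp_le_1: "nexp x <= 1" by (simp add: nexp_def)

lemma nexp_sum: "finite A ==> nexp (\<Sum>i\<in>A. f i) = (\<Prod>i\<in>A. nexp (f i))"
 by (induction A rule: finite_induct) (auto simp: nexp_add)

lemma nexp_measurable [measurable]: "nexp \<in> Bm borel" unfolding nexp_def by measurable

lemma nlog_measurable [measurable]: "nlog \<in> Bm borel" unfolding nlog_def by measurable

lemma nexp_nlog: "0 <= x ==> x <= 1 ==> nexp (nlog x) = ennreal x" by (auto simp: nexp_def nlog_def ln_le_zero_iff)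

lemma nexp_ennreal: "0 <= x ==> nexp (ennreal x) = ennreal (exp (- x))" by (auto simp: nexp_def)

lemma nlog_exp: "0 <= x ==> nlog (exp (- x)) = ennreal x" by (auto simp: nlog_def)

text \<open>An integral against counting measure, because finiteness of the set of particles alive
  is known only almost surely and only later (\<open>AE_alive_finite\<close>). The starting point
  \<open>y\<close> is added by hand since the process itself starts at 0.\<close>

definition tot :: "(nat list => 'w => real) => (nat list => 'w => nat) =>
  (nat list => real => 'w => real) => real => (real => ennreal) => real => 'w => ennreal" where
 "tot life offs motion t ph y w =
   (\<integral>\<^sup>+v. (if v \<in> alive life offs t w then ph (y + position life motion v t w) else 0)
    \<partial>count_space UNIV)"

lemma born_cong:
 assumes "!!v. offs v w = offs' v w'"
 shows "born offs v w = born offs' v w'" by (induction v) (auto simp: assms)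

lemma birth_time_cong:
 assumes "!!v. life v w = life' v w'"
 shows "birth_time life v w = birth_time life' v w'" by (induction v) (auto simp: assms)

lemma birth_place_cong:
 assumes "!!v. life v w = life' v w'" and "!!v. 0 <= life v w"
  and "!!v s. 0 <= s ==> motion v s w = motion' v s w'"
 shows "birth_place life motion v w = birth_place life' motion' v w'"
 by (induction v) (auto simp: assms(1)[symmetric] assms(2) assms(3)[symmetric])

lemma alive_cong:
 assumes "!!v. life v w = life' v w'" and "!!v. offs v w = offs' v w'"
 shows "alive life offs t w = alive life' offs' t w'" unfolding alive_def
 using born_cong[of offs w offs' w'] birth_time_cong[of life w life' w'] assms by auto

lemma position_cong:
 assumes "v \<in> alive life offs t w"
  and "!!v. life v w = life' v w'" and "!!v. 0 <= life v w"
  and "!!v s. 0 <= s ==> motion v s w = motion' v s w'"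
 shows "position life motion v t w = position life' motion' v t w'"
proof -
 have "birth_time life v w = birth_time life' v w'" by (rule birth_time_cong) (rule assms)
 moreover have "birth_place life motion v w = birth_place life' motion' v w'"
  by (rule birth_place_cong) (use assms in auto)
 moreover have "0 <= t - birth_time life v w" using assms(1) by (auto simp: alive_def)
 ultimately show ?thesis using assms(4) by (simp add: position_def)
qed

text \<open>Transfers the sum from the given process to the canonical one. Motions have to agree at
  nonnegative times only: the age of a particle alive and all lifetimes are nonnegative.\<close>

lemma tot_cong:
 assumes "!!v. life v w = life' v w'" and "!!v. offs v w = offs' v w'" and "!!v. 0 <= life v w"
  and "!!v s. 0 <= s ==> motion v s w = motion' v s w'"
 shows "tot life offs motion t ph y w = tot life' offs' motion' t ph y w'"
proof -
 have a: "alive life offs t w = alive life' offs' t w'" by (rule alive_cong) (use assms in auto)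
 have p: "position life motion v t w = position life' motion' v t w'" if "v \<in> alive life offs t w" for v
  by (rule position_cong[OF that]) (use assms in auto)
 show ?thesis unfolding tot_def by (intro nn_integral_cong) (use a p in auto)
qed

text \<open>A label lists the youngest generation first, so the child of the root from which a
  particle descends is its last entry. The labels \<open>u @ [i]\<close> form the subtree of child
  i, and deleting that entry turns it into a full tree again.\<close>

lemma born_snoc:
 "born offs (u @ [i]) w \<longleftrightarrow> i < offs [] w \<and> born (%v. offs (v @ [i])) u w"
 by (induction u) auto

lemma birth_time_snoc:
 "birth_time life (u @ [i]) w = life [] w + birth_time (%v. life (v @ [i])) u w" by (induction u) auto

lemma birth_place_snoc:
 "birth_place life motion (u @ [i]) w =
   motion [] (life [] w) w + birth_place (%v. life (v @ [i])) (%v. motion (v @ [i])) u w" by (induction u) auto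

lemma birth_time_nonneg: "(!!v. 0 <= life v w) ==> 0 <= birth_time life v w" by (induction v) auto

lemma alive_snoc:
 "u @ [i] \<in> alive life offs t w \<longleftrightarrow> i < offs [] w \<and>
   u \<in> alive (%v. life (v @ [i])) (%v. offs (v @ [i])) (t - life [] w) w"
 by (auto simp: alive_def born_snoc birth_time_snoc)

lemma position_snoc:
 "position life motion (u @ [i]) t w = motion [] (life [] w) w +
   position (%v. life (v @ [i])) (%v. motion (v @ [i])) u (t - life [] w) w"
 by (simp add: position_def birth_time_snoc birth_place_snoc algebra_simps)

lemma alive_neg:
 assumes "!!v. 0 <= life v w" "t < 0"
 shows "alive life offs t w = {}"
proof -
 have "0 <= birth_time life v w" for v by (rule birth_time_nonneg) (rule assms)
 hence "\<not> birth_time life v w <= t" for v using assms(2) by (metis leD order_trans)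
 thus ?thesis by (auto simp: alive_def)
qed

lemma nn_integral_labels:
 "(\<integral>\<^sup>+v. f v \<partial>count_space UNIV) =
   f [] + (\<integral>\<^sup>+i. \<integral>\<^sup>+u. f (u @ [i]) \<partial>count_space UNIV \<partial>count_space UNIV)" for f :: "nat list => ennreal"
proof -
 have "(\<integral>\<^sup>+v. f v \<partial>count_space UNIV) = (\<integral>\<^sup>+v. f v * indicator ({[]} \<union> - {[]}) v \<partial>count_space UNIV)"
  by (intro nn_integral_cong) (auto split: split_indicator)
 also have "... = (\<integral>\<^sup>+v\<in>{[]}. f v \<partial>count_space UNIV) + (\<integral>\<^sup>+v\<in>- {[]}. f v \<partial>count_space UNIV)"
  by (rule nn_integral_disjoint_pair_countspace) auto
 also have "(\<integral>\<^sup>+v\<in>{[]}. f v \<partial>count_space UNIV) = f []"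
  by (subst nn_integral_count_space'[where A="{[]}"]) auto
 also have "(\<integral>\<^sup>+v\<in>- {[]}. f v \<partial>count_space UNIV) = (\<integral>\<^sup>+v. f v \<partial>count_space (- {[]}))"
  by (rule nn_integral_count_space_indicator[symmetric]) auto
 also have "... = (\<integral>\<^sup>+p. f (snd p @ [fst p]) \<partial>count_space UNIV)"
 proof (rule nn_integral_bij_count_space[symmetric])
  show "bij_betw (%p::nat \<times> nat list. snd p @ [fst p]) UNIV (- {[]})"
   by (rule bij_betwI[where g="%v. (last v, butlast v)"]) auto
 qed
 also have "... = (\<integral>\<^sup>+i. \<integral>\<^sup>+u. f (u @ [i]) \<partial>count_space UNIV \<partial>count_space UNIV)"
  by (subst nn_integral_fst_count_space[symmetric]) simp
 finally show ?thesis .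
qed

lemma tot_root:
 assumes "!!v. 0 <= life v w" and "0 <= t"
 shows "tot life offs motion t ph y w =
  (if t < life [] w then ph (y + motion [] t w)
   else \<Sum>i<offs [] w. tot (%v. life (v @ [i])) (%v. offs (v @ [i])) (%v. motion (v @ [i]))
       (t - life [] w) ph (y + motion [] (life [] w) w) w)"
proof -
 let ?T = "%i. tot (%v. life (v @ [i])) (%v. offs (v @ [i])) (%v. motion (v @ [i]))
       (t - life [] w) ph (y + motion [] (life [] w) w) w"
 have root: "[] \<in> alive life offs t w \<longleftrightarrow> t < life [] w" using assms by (auto simp: alive_def)
 have pos: "position life motion [] t w = motion [] t w" by (simp add: position_def)
 have "tot life offs motion t ph y w = (if t < life [] w then ph (y + motion [] t w) else 0) +
   (\<integral>\<^sup>+i. (if i < offs [] w then ?T i else 0) \<partial>count_space UNIV)" unfolding tot_def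
  by (subst nn_integral_labels)
    (auto simp: root pos alive_snoc position_snoc add.assoc intro!: arg_cong2[where f=plus] nn_integral_cong)
 also have "(\<integral>\<^sup>+i. (if i < offs [] w then ?T i else 0) \<partial>count_space UNIV) = (\<Sum>i<offs [] w. ?T i)"
  by (subst nn_integral_count_space'[where A="{..<offs [] w}"]) auto
 \<comment> \<open>The sum over the children is formally present while the root lives, but the
   subtrees are then observed at a negative time, when nothing is alive.\<close>
 also have "(\<Sum>i<offs [] w. ?T i) = 0" if "t < life [] w"
 proof (rule sum.neutral, safe)
  fix i
  have "alive (%v. life (v @ [i])) (%v. offs (v @ [i])) (t - life [] w) w = {}"
   by (rule alive_neg) (use assms that in auto)
  thus "?T i = 0" by (simp add: tot_def)
 qed
 hence "(if t < life [] w then ph (y + motion [] t w) else 0) + (\<Sum>i<offs [] w. ?T i) =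
   (if t < life [] w then ph (y + motion [] t w) else (\<Sum>i<offs [] w. ?T i))" by simp
 finally show ?thesis .
qed

section \<open>Evaluation of paths\<close>

text \<open>Coordinates of the product space cannot be evaluated measurably at a random time. A
  limit along dyadic times from the right can, and it returns the value of a right-continuous path.
  The 1 after the floor makes the approximation strictly larger than s; \<open>max 0\<close> keeps
  the index in the time set of \<open>path_space\<close>.\<close>

definition ev_path :: "(real => real) => real => real" where
 "ev_path x s = lim (%n. x (max 0 ((of_int \<lfloor>2 ^ n * s\<rfloor> + 1) / 2 ^ n)))"

lemma dyadic_above:
 "(%n. (of_int \<lfloor>2 ^ n * s\<rfloor> + 1) / 2 ^ n :: real) \<longlonglongrightarrow> s"
 "(of_int \<lfloor>2 ^ n * s\<rfloor> + 1) / 2 ^ n > (s::real)"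
proof -
 have *: "s < (of_int \<lfloor>2 ^ n * s\<rfloor> + 1) / 2 ^ n" "(of_int \<lfloor>2 ^ n * s\<rfloor> + 1) / 2 ^ n <= s + 1 / 2 ^ n"
  for n :: nat using floor_correct[of "2 ^ n * s"] by (simp_all add: field_simps)
 thus "(of_int \<lfloor>2 ^ n * s\<rfloor> + 1) / 2 ^ n > s" by blast
 have lim: "(%n. s + (1/2::real) ^ n) \<longlonglongrightarrow> s"
  using tendsto_add[OF tendsto_const[of s] LIMSEQ_power_zero[of "1/2::real"]] by simp
 have le: "(of_int \<lfloor>2 ^ n * s\<rfloor> + 1) / 2 ^ n <= s + (1 / 2) ^ n" for n :: nat
  using *(2)[of n] by (simp only: power_one_over)
 show "(%n. (of_int \<lfloor>2 ^ n * s\<rfloor> + 1) / 2 ^ n :: real) \<longlonglongrightarrow> s"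
  by (rule tendsto_sandwich[OF _ _ tendsto_const lim])
    (auto intro!: always_eventually le less_imp_le[OF *(1)])
qed

lemma ev_path_eq:
 assumes "!!s. 0 <= s ==> x s = f s" and "cadlag f" and "0 <= s"
 shows "ev_path x s = f s"
proof -
 let ?d = "%n. (of_int \<lfloor>2 ^ n * s\<rfloor> + 1) / 2 ^ n :: real"
 have "(f \<longlongrightarrow> f s) (at_right s)" using assms by (auto simp: cadlag_def continuous_within)
 moreover have "filterlim ?d (at_right s) sequentially"
  by (rule tendsto_imp_filterlim_at_right) (use dyadic_above in auto)
 ultimately have "(%n. f (?d n)) \<longlonglongrightarrow> f s" by (rule filterlim_compose)
 moreover have "x (max 0 (?d n)) = f (?d n)" for n using dyadic_above(2)[of s n] assms(1,3) by (simp add: max_def)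
 ultimately show ?thesis unfolding ev_path_def by (auto intro: limI)
qed

lemma ev_path_measurable [measurable (raw)]:
 assumes [measurable]: "f \<in> M \<rightarrow>\<^sub>M path_space" "g \<in> Bm M"
 shows "(%w. ev_path (f w) (g w)) \<in> Bm M"
proof -
 have "(%w. f w (max 0 ((of_int \<lfloor>2 ^ n * g w\<rfloor> + 1) / 2 ^ n))) \<in> Bm M" for n
 proof (rule measurable_compose_countable[where g="%w. \<lfloor>2 ^ n * g w\<rfloor>" and
    f="%i w. f w (max 0 ((of_int i + 1) / 2 ^ n))"])
  show "(%w. f w (max 0 ((of_int i + 1) / 2 ^ n))) \<in> Bm M" for i :: int
   by (rule measurable_compose[OF assms(1)], rule measurable_component_singleton) auto
 qed measurable
 thus ?thesis unfolding ev_path_def by measurable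
qed

section \<open>The root decomposition on the canonical product space\<close>

locale blevy =
 fixes \<beta> :: real and p :: "nat pmf" and N :: "'b measure" and \<xi> :: "real => 'b => real"
 assumes levy: "levy_process N \<xi>" and \<beta>_pos: "0 < \<beta>"
begin

lemma prob_N: "prob_space N" using levy by (simp add: levy_process_def)

sublocale N: prob_space N by (rule prob_N)

lemma path_measurable [measurable]: "path \<xi> \<in> N \<rightarrow>\<^sub>M path_space"
 unfolding path_def using levy by (intro measurable_restrict) (auto simp: levy_process_def)

text \<open>A jointly measurable version of \<xi>, so that the motion can be integrated over time;
  it agrees with \<xi> at all nonnegative times (\<open>X_eq\<close>).\<close>

definition X :: "real => 'b => real" where
 "X s w = ev_path (path \<xi> w) (max 0 s)"

lemma X_measurable [measurable (raw)]:
 assumes [measurable]: "f \<in> Bm M" "g \<in> M \<rightarrow>\<^sub>M N"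
 shows "(%x. X (f x) (g x)) \<in> Bm M" unfolding X_def by measurable

lemma X_eq: "0 <= s ==> w \<in> space N ==> X s w = \<xi> s w" unfolding X_def using levy
 by (auto simp: path_def levy_process_def intro!: ev_path_eq)

definition Q :: "real => (real => real) => real => real" where
 "Q s ph y = (LINT w|N. ph (y + X s w))"

definition pgf :: "real => real" where
 "pgf z = measure_pmf.expectation p (%k. z ^ k)"

definition K :: "(real => real) measure" where "K = process_law N \<xi>"

definition D :: "(real \<times> nat \<times> (real => real)) measure" where
 "D = density lborel (exponential_density \<beta>) \<Otimes>\<^sub>M (measure_pmf p \<Otimes>\<^sub>M K)"

definition TM :: "(nat list => real \<times> nat \<times> (real => real)) measure" where
 "TM = Pi\<^sub>M UNIV (%_. D)"

lemma sets_K [measurable_cong]: "sets K = sets path_space" by (simp add: K_def process_law_def)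

lemma prob_K: "prob_space K" unfolding K_def process_law_def by (rule N.prob_space_distr) measurable

lemma prob_E: "prob_space (density lborel (exponential_density \<beta>))"
 by (rule prob_space_exponential_density) (rule \<beta>_pos)

sublocale K: prob_space K by (rule prob_K)
sublocale E: prob_space "density lborel (exponential_density \<beta>)" by (rule prob_E)
sublocale pK: pair_prob_space "measure_pmf p" K ..
sublocale EpK: pair_prob_space "density lborel (exponential_density \<beta>)" "measure_pmf p \<Otimes>\<^sub>M K" ..

lemma sets_D [measurable_cong]: "sets D = sets (borel \<Otimes>\<^sub>M (count_space UNIV \<Otimes>\<^sub>M path_space))"
 unfolding D_def by (intro sets_pair_measure_cong) (auto simp: sets_K)

lemma prob_D: "prob_space D" unfolding D_def by (rule EpK.prob_space_axioms)

sublocale D: prob_space D by (rule prob_D)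

lemma prob_TM: "prob_space TM" unfolding TM_def by (rule prob_space_PiM) (rule prob_D)

sublocale TM: prob_space TM by (rule prob_TM)

definition cL :: "nat list => (nat list => real \<times> nat \<times> (real => real)) => real" where
 "cL v ta = fst (ta v)"
definition cO :: "nat list => (nat list => real \<times> nat \<times> (real => real)) => nat" where
 "cO v ta = fst (snd (ta v))"
definition cX :: "nat list => real => (nat list => real \<times> nat \<times> (real => real)) => real" where
 "cX v s ta = ev_path (snd (snd (ta v))) s"

abbreviation MS :: "(real \<times> nat \<times> (real => real)) measure" where
 "MS \<equiv> borel \<Otimes>\<^sub>M (count_space UNIV \<Otimes>\<^sub>M path_space)"

lemma sets_TM [measurable_cong]: "sets TM = sets (Pi\<^sub>M UNIV (%_. MS))"
 unfolding TM_def by (intro sets_PiM_cong) (auto simp: sets_D)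

lemma cL_measurable [measurable]: "cL v \<in> Bm (Pi\<^sub>M UNIV (%_. MS))"
 and cO_measurable [measurable]: "cO v \<in> Pi\<^sub>M UNIV (%_. MS) \<rightarrow>\<^sub>M count_space UNIV"
 unfolding cL_def cO_def by measurable

lemma cX_measurable [measurable (raw)]:
 assumes [measurable]: "f \<in> Bm M" "g \<in> M \<rightarrow>\<^sub>M Pi\<^sub>M UNIV (%_. MS)"
 shows "(%x. cX v (f x) (g x)) \<in> Bm M" unfolding cX_def by measurable

lemma birth_time_measurable [measurable]:
 "birth_time cL v \<in> Bm (Pi\<^sub>M UNIV (%_. MS))"
proof (induction v)
 case (Cons a v)
 note [measurable] = Cons
 show ?case by (simp add: birth_time.simps[abs_def])
qed (simp add: birth_time.simps[abs_def])

lemma birth_place_measurable [measurable]: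
 "birth_place cL cX v \<in> Bm (Pi\<^sub>M UNIV (%_. MS))"
proof (induction v)
 case (Cons a v)
 note [measurable] = Cons
 show ?case by (simp add: birth_place.simps[abs_def])
qed (simp add: birth_place.simps[abs_def])

lemma born_measurable [measurable]:
 "Measurable.pred (Pi\<^sub>M UNIV (%_. MS)) (born cO v)"
proof (induction v)
 case (Cons a v)
 note [measurable] = Cons
 show ?case by (simp add: born.simps[abs_def])
qed (simp add: born.simps[abs_def])

lemma tot_measurable [measurable (raw)]:
 assumes [measurable]: "ph \<in> Bm borel" "f \<in> Bm M" "h \<in> Bm M"
  "g \<in> M \<rightarrow>\<^sub>M Pi\<^sub>M UNIV (%_. MS)"
 shows "(%x. tot cL cO cX (f x) ph (h x) (g x)) \<in> Bm M"
proof -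
 interpret sigma_finite_measure "count_space (UNIV :: nat list set)" by (rule sigma_finite_measure_count_space)
 have *: "(%x. if v \<in> alive cL cO (f x) (g x) then ph (h x + position cL cX v (f x) (g x)) else 0)
   \<in> Bm M" for v unfolding alive_def position_def by simp
 have "(%(v, x). if v \<in> alive cL cO (f x) (g x) then ph (h x + position cL cX v (f x) (g x)) else 0)
   \<in> Bm (count_space UNIV \<Otimes>\<^sub>M M)" by (rule measurable_pair_measure_countable1) (use * in auto)
 from measurable_compose[OF measurable_pair_swap' this]
 show ?thesis unfolding tot_def by (intro borel_measurable_nn_integral) (simp add: split_beta' cong: if_cong)
qed

definition cU :: "real => (real => real) => real => ennreal" where
 "cU t G y = (\<integral>\<^sup>+ta. nexp (tot cL cO cX t (%z. nlog (G z)) y ta) \<partial>TM)"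

lemma cU_measurable [measurable (raw)]:
 assumes [measurable]: "G \<in> Bm borel" "f \<in> Bm M" "h \<in> Bm M"
 shows "(%x. cU (f x) G (h x)) \<in> Bm M" unfolding cU_def by measurable

lemma cU_le_1: "cU t G y <= 1"
proof -
 have "cU t G y <= (\<integral>\<^sup>+ta. 1 \<partial>TM)" unfolding cU_def by (intro nn_integral_mono nexp_le_1)
 thus ?thesis by (simp add: TM.emeasure_space_1)
qed

definition sub :: "nat => (nat list => 'x) => (nat list => 'x)" where
 "sub i ta = (%u. ta (u @ [i]))"

lemma sub_tot:
 "tot (%v. cL (v @ [i])) (%v. cO (v @ [i])) (%v. cX (v @ [i])) t ph y ta = tot cL cO cX t ph y (sub i ta)"
proof -
 have "position (%v. cL (v @ [i])) (%v. cX (v @ [i])) v t ta = position cL cX v t (sub i ta)" for v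
 proof -
  have 1: "birth_time (%v. cL (v @ [i])) v ta = birth_time cL v (sub i ta)"
   by (rule birth_time_cong) (simp add: cL_def sub_def)
  have 2: "birth_place (%v. cL (v @ [i])) (%v. cX (v @ [i])) v ta = birth_place cL cX v (sub i ta)"
   by (induction v) (simp_all add: cL_def cX_def sub_def)
  show ?thesis unfolding position_def 1 2 by (simp add: cX_def sub_def)
 qed
 moreover have "alive (%v. cL (v @ [i])) (%v. cO (v @ [i])) t ta = alive cL cO t (sub i ta)"
  by (rule alive_cong) (simp_all add: cL_def cO_def sub_def)
 ultimately show ?thesis unfolding tot_def by (simp cong: if_cong)
qed

abbreviation RM :: "(nat list => real \<times> nat \<times> (real => real)) measure" where
 "RM \<equiv> Pi\<^sub>M (UNIV - {[]}) (%_. D)"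

lemma prob_RM: "prob_space RM" by (rule prob_space_PiM) (rule prob_D)

text \<open>For conditioning on the lifetime, offspring number and motion of the root: its
  coordinate is independent of all others.\<close>

lemma nn_integral_TM:
 assumes [measurable]: "F \<in> Bm TM"
 shows "(\<integral>\<^sup>+ta. F ta \<partial>TM) = (\<integral>\<^sup>+x. \<integral>\<^sup>+ta. F (ta([] := x)) \<partial>RM \<partial>D)"
proof -
 interpret R: prob_space RM by (rule prob_RM)
 have ins: "insert [] (UNIV - {[]}) = (UNIV :: nat list set)" by auto
 have eq: "TM = distr (D \<Otimes>\<^sub>M RM) TM (%(x, ta). ta([] := x))"
  using distr_pair_PiM_eq_PiM[of "UNIV - {[]}" "%_. D" "[] :: nat list", OF prob_D prob_D]
  unfolding TM_def ins by (rule sym)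
 have meas: "(%(x, ta). ta([] := x)) \<in> D \<Otimes>\<^sub>M RM \<rightarrow>\<^sub>M TM"
  using measurable_compose[OF measurable_pair_swap' measurable_add_dim[of "[]" "UNIV - {[]}" "%_. D"]]
  unfolding TM_def ins by (simp add: split_beta')
 have "(\<integral>\<^sup>+ta. F ta \<partial>TM) = (\<integral>\<^sup>+z. F ((%(x, ta). ta([] := x)) z) \<partial>(D \<Otimes>\<^sub>M RM))"
  by (subst eq, rule nn_integral_distr[OF meas]) measurable
 also have "... = (\<integral>\<^sup>+x. \<integral>\<^sup>+ta. F (ta([] := x)) \<partial>RM \<partial>D)"
  using measurable_compose[OF meas assms] by (subst R.nn_integral_fst[symmetric]) (auto simp: split_beta')
 finally show ?thesis .
qed

lemma distr_sub: "distr RM TM (sub i) = TM"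
proof -
 have "distr (Pi\<^sub>M (UNIV - {[]}) (%_. D)) (Pi\<^sub>M UNIV (%_::nat list. D)) (%w. \<lambda>n\<in>UNIV. w (n @ [i])) =
  Pi\<^sub>M UNIV (%_::nat list. D)"
  by (rule distr_PiM_reindex[where M="%_. D" and f="%n. n @ [i]"]) (auto simp: inj_on_def prob_D)
 thus ?thesis by (simp add: TM_def sub_def[abs_def] restrict_UNIV)
qed

lemma sub_measurable [measurable]: "sub i \<in> RM \<rightarrow>\<^sub>M TM"
proof -
 have "(%ta. \<lambda>u\<in>UNIV. ta (u @ [i])) \<in> RM \<rightarrow>\<^sub>M TM"
  unfolding TM_def by (intro measurable_restrict measurable_component_singleton) auto
 thus ?thesis by (simp add: sub_def[abs_def] restrict_UNIV)
qed

text \<open>The subtrees of different children use disjoint sets of coordinates, namely the labels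
  ending in i, and each of them is a copy of the whole tree (\<open>distr_sub\<close>).\<close>

lemma indep_sub:
 assumes [measurable]: "h \<in> Bm TM"
 shows "(\<integral>\<^sup>+ta. (\<Prod>i<k. h (sub i ta)) \<partial>RM) = (\<integral>\<^sup>+ta. h ta \<partial>TM) ^ (k::nat)"
proof -
 interpret R: prob_space RM by (rule prob_RM)
 let ?I = "UNIV - {[]} :: nat list set"
 let ?S = "%i. range (%u. u @ [i]) :: nat list set"
 have comp: "distr RM D (%ta. ta v) = D" if "v \<in> ?I" for v by (rule distr_PiM_component) (use that prob_D in auto)
 have "distr RM (Pi\<^sub>M ?I (%_. D)) (%ta. \<lambda>v\<in>?I. ta v) = distr RM RM (%ta. ta)"
  by (rule distr_cong) (auto simp: space_PiM PiE_def extensional_restrict)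
 also have "... = Pi\<^sub>M ?I (%v. distr RM D (%ta. ta v))" unfolding distr_id by (rule PiM_cong) (use comp in auto)
 finally have "R.indep_vars (%_. D) (%v ta. ta v) ?I" by (subst R.indep_vars_iff_distr_eq_PiM') auto
 hence "R.indep_vars (%i. Pi\<^sub>M (?S i) (%_. D)) (%i ta. restrict (%v. ta v) (?S i)) {..<k}"
  by (rule R.indep_vars_restrict) (auto simp: disjoint_family_on_def)
 hence "R.indep_vars (%_. borel) (%i ta. h (%u. (restrict (%v. ta v) (?S i)) (u @ [i]))) {..<k}"
 proof (rule R.indep_vars_compose2)
  fix i assume "i \<in> {..<k}"
  have "(%ta. \<lambda>u\<in>UNIV. ta (u @ [i])) \<in> Pi\<^sub>M (?S i) (%_. D) \<rightarrow>\<^sub>M TM"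
   unfolding TM_def by (intro measurable_restrict measurable_component_singleton) auto
  from measurable_compose[OF this assms]
  show "(%ta. h (%u. ta (u @ [i]))) \<in> Bm (Pi\<^sub>M (?S i) (%_. D))" by (simp add: restrict_UNIV)
 qed
 hence "R.indep_vars (%_. borel) (%i ta. h (sub i ta)) {..<k}" by (simp add: sub_def)
 hence "(\<integral>\<^sup>+ta. (\<Prod>i<k. h (sub i ta)) \<partial>RM) = (\<Prod>i<k. \<integral>\<^sup>+ta. h (sub i ta) \<partial>RM)"
  by (intro R.indep_vars_nn_integral) auto
 also have "... = (\<Prod>i<k. \<integral>\<^sup>+ta. h ta \<partial>distr RM TM (sub i))"
  by (intro prod.cong refl nn_integral_distr[symmetric]) measurable
 finally show ?thesis by (simp add: distr_sub)
qed

lemma AE_D: "AE x in D. 0 <= fst x"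
proof -
 have "AE r in density lborel (exponential_density \<beta>). 0 <= r"
  by (subst AE_density) (auto simp: exponential_density_def)
 hence "AE r in distr D (density lborel (exponential_density \<beta>)) fst. 0 <= r"
  unfolding D_def by (subst prob_space.distr_pair_fst[OF pK.prob_space_axioms])
 thus ?thesis by (subst (asm) AE_distr_iff) (auto simp: D_def)
qed

text \<open>On the canonical space lifetimes are nonnegative only almost surely, whereas
  \<open>tot_root\<close> asks for it at every label at once; countability of the labels bridges the
  two.\<close>

lemma AE_life_RM: "AE ta in RM. \<forall>v. v ~= [] --> 0 <= fst (ta v)" unfolding AE_all_countable
proof (intro allI AE_impI)
 fix v :: "nat list" assume "v ~= []"
 thus "AE ta in RM. 0 <= fst (ta v)" by (intro AE_PiM_component[where P="%x. 0 <= fst x"]) (auto simp: prob_D AE_D)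
qed

text \<open>Conditioning on the root: if it survives t, only its own position counts; otherwise its
  k children start independent copies at the place of its death, whence the k-th power.\<close>

lemma cU_root:
 assumes [measurable]: "G \<in> Bm borel" and G: "!!z. 0 <= G z" "!!z. G z <= 1" and "0 <= t"
 shows "cU t G y = (\<integral>\<^sup>+x. (if t < fst x then ennreal (G (y + ev_path (snd (snd x)) t))
   else cU (t - fst x) G (y + ev_path (snd (snd x)) (fst x)) ^ fst (snd x)) \<partial>D)"
proof -
 interpret R: prob_space RM by (rule prob_RM)
 let ?ph = "%z. nlog (G z)"
 have "cU t G y = (\<integral>\<^sup>+x. \<integral>\<^sup>+ta. nexp (tot cL cO cX t ?ph y (ta([] := x))) \<partial>RM \<partial>D)"
  unfolding cU_def by (rule nn_integral_TM) measurable
 also have "... = (\<integral>\<^sup>+x. (if t < fst x then ennreal (G (y + ev_path (snd (snd x)) t))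
   else cU (t - fst x) G (y + ev_path (snd (snd x)) (fst x)) ^ fst (snd x)) \<partial>D)"
 proof (rule nn_integral_cong_AE, rule AE_mp[OF AE_D], rule AE_I2, rule impI)
  fix x :: "real \<times> nat \<times> (real => real)" assume "0 <= fst x"
  let ?y = "y + ev_path (snd (snd x)) (fst x)"
  let ?h = "%ta. nexp (tot cL cO cX (t - fst x) ?ph ?y ta)"
  have "AE ta in RM. nexp (tot cL cO cX t ?ph y (ta([] := x))) =
   (if t < fst x then ennreal (G (y + ev_path (snd (snd x)) t)) else (\<Prod>i<fst (snd x). ?h (sub i ta)))"
   using AE_life_RM
  proof eventually_elim
   case (elim ta)
   have life: "0 <= cL v (ta([] := x))" for v using elim \<open>0 <= fst x\<close> by (auto simp: cL_def)
   have sub: "sub i (ta([] := x)) = sub i ta" for i by (auto simp: sub_def fun_eq_iff)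
   show ?case using tot_root[of cL "ta([] := x)" t cO cX ?ph y] life \<open>0 <= t\<close>
    by (auto simp: sub_tot sub cL_def cX_def cO_def nexp_nlog G nexp_sum)
  qed
  hence "(\<integral>\<^sup>+ta. nexp (tot cL cO cX t ?ph y (ta([] := x))) \<partial>RM) =
   (\<integral>\<^sup>+ta. (if t < fst x then ennreal (G (y + ev_path (snd (snd x)) t)) else (\<Prod>i<fst (snd x). ?h (sub i ta))) \<partial>RM)"
   by (rule nn_integral_cong_AE)
  also have "... = (if t < fst x then ennreal (G (y + ev_path (snd (snd x)) t))
    else cU (t - fst x) G ?y ^ fst (snd x))" by (auto simp: indep_sub[of ?h] cU_def R.emeasure_space_1)
  finally show "(\<integral>\<^sup>+ta. nexp (tot cL cO cX t ?ph y (ta([] := x))) \<partial>RM) = ..." .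
 qed
 finally show ?thesis .
qed

lemma nn_integral_K:
 assumes [measurable]: "F \<in> Bm borel" and "0 <= s"
 shows "(\<integral>\<^sup>+x. F (ev_path x s) \<partial>K) = (\<integral>\<^sup>+w. F (X s w) \<partial>N)"
 unfolding K_def process_law_def X_def
 by (subst nn_integral_distr) (use assms(2) in \<open>auto simp: max_def\<close>)

lemma nn_integral_D:
 assumes [measurable]: "F \<in> Bm MS"
 shows "(\<integral>\<^sup>+x. F x \<partial>D) = (\<integral>\<^sup>+r. ennreal (exponential_density \<beta> r) *
   (\<integral>\<^sup>+x. (\<integral>\<^sup>+k. F (r, k, x) \<partial>measure_pmf p) \<partial>K) \<partial>lborel)"
proof -
 have [measurable]: "F \<in> Bm (density lborel (exponential_density \<beta>) \<Otimes>\<^sub>M (measure_pmf p \<Otimes>\<^sub>M K))"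
  using assms by (subst measurable_cong_sets[OF sets_D[unfolded D_def] refl])
 have m: "(%(k, x). F (r, k, x)) \<in> Bm (measure_pmf p \<Otimes>\<^sub>M K)" for r by measurable
 have "(\<integral>\<^sup>+x. F x \<partial>D) = (\<integral>\<^sup>+r. (\<integral>\<^sup>+z. F (r, z) \<partial>(measure_pmf p \<Otimes>\<^sub>M K)) \<partial>density lborel (exponential_density \<beta>))"
  unfolding D_def by (subst pK.nn_integral_fst[symmetric]) auto
 also have "... = (\<integral>\<^sup>+r. (\<integral>\<^sup>+x. (\<integral>\<^sup>+k. F (r, k, x) \<partial>measure_pmf p) \<partial>K) \<partial>density lborel (exponential_density \<beta>))"
  using m by (intro nn_integral_cong, subst pK.nn_integral_snd[symmetric]) (auto simp: split_beta')
 finally show ?thesis by (subst (asm) nn_integral_density) auto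
qed

end

section \<open>Integrals of bounded functions over compact time intervals\<close>

lemma set_integrable_bounded_Icc:
 fixes h :: "real => real"
 assumes [measurable]: "h \<in> Bm borel" and "!!r. a <= r ==> r <= b ==> \<bar>h r\<bar> <= B"
 shows "set_integrable lborel {a..b} h" unfolding set_integrable_def
proof (rule Bochner_Integration.integrable_bound)
 show "integrable lborel (%r. indicator {a..b} r * B)"
  by (intro integrable_mult_left integrable_real_indicator) (auto simp: emeasure_lborel_Icc_eq)
 show "AE r in lborel. norm (indicator {a..b} r *\<^sub>R h r) <= norm (indicator {a..b} r * B)"
  using assms(2) by (intro AE_I2) (force split: split_indicator)
qed measurable

lemma triangle_Fubini:
 fixes ph k :: "real => real"
 assumes [measurable]: "ph \<in> Bm borel" "k \<in> Bm borel"
  and bph: "!!r. 0 <= r ==> r <= t ==> \<bar>ph r\<bar> <= A" and bk: "!!r. 0 <= r ==> r <= t ==> \<bar>k r\<bar> <= B"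
 shows "(LBINT r:{0..t}. ph r * (LBINT rh:{r..t}. k rh)) = (LBINT rh:{0..t}. k rh * (LBINT r:{0..rh}. ph r))"
proof -
 define F where "F = (%(r, rh). indicator {0..t} r * indicator {0..t} rh * indicator {0..} (rh - r) * ph r * k rh :: real)"
 have [measurable]: "F \<in> Bm (lborel \<Otimes>\<^sub>M lborel)" unfolding F_def by measurable
 have int: "integrable (lborel \<Otimes>\<^sub>M lborel) F"
 proof (rule Bochner_Integration.integrable_bound)
  show "integrable (lborel \<Otimes>\<^sub>M lborel) (%z. indicator ({0..t} \<times> {0..t}) z * (A * B) :: real)"
   by (intro integrable_mult_left integrable_real_indicator)
     (auto simp: lborel.emeasure_pair_measure_Times ennreal_mult_less_top emeasure_lborel_Icc_eq)
  show "AE z in lborel \<Otimes>\<^sub>M lborel. norm (F z) <= norm (indicator ({0..t} \<times> {0..t}) z * (A * B) :: real)"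
  proof (rule AE_I2)
   fix z :: "real \<times> real"
   obtain r rh where z: "z = (r, rh)" by (cases z)
   have "\<bar>ph r\<bar> * \<bar>k rh\<bar> <= \<bar>A\<bar> * \<bar>B\<bar>" if "r \<in> {0..t}" "rh \<in> {0..t}"
    using bph[of r] bk[of rh] that by (intro mult_mono) auto
   thus "norm (F z) <= norm (indicator ({0..t} \<times> {0..t}) z * (A * B) :: real)"
    unfolding z F_def by (auto simp: abs_mult split: split_indicator)
  qed
 qed measurable
 have "(LBINT r:{0..t}. ph r * (LBINT rh:{r..t}. k rh)) = (LBINT r. LBINT rh. F (r, rh))"
  unfolding set_lebesgue_integral_def F_def by (intro Bochner_Integration.integral_cong refl)
    (auto split: split_indicator simp flip: Bochner_Integration.integral_mult_right_zero
       intro!: Bochner_Integration.integral_cong)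
 also have "... = (LBINT rh. LBINT r. F (r, rh))" using lborel_pair.Fubini_integral[of "%r rh. F (r, rh)"] int by simp
 also have "... = (LBINT rh:{0..t}. k rh * (LBINT r:{0..rh}. ph r))"
 proof -
  have "F (r, rh) = indicator {0..t} rh * k rh * (indicator {0..rh} r * ph r)" for r rh
   unfolding F_def by (auto split: split_indicator)
  thus ?thesis unfolding set_lebesgue_integral_def by (simp add: mult.assoc)
 qed
 finally show ?thesis .
qed

lemma LBINT_exp_Icc:
 fixes a :: real
 assumes "a ~= 0" "u <= v"
 shows "(LBINT r:{u..v}. exp (a * r)) = (exp (a * v) - exp (a * u)) / a"
proof -
 have "(LBINT r:{u..v}. exp (a * r)) = (%r. exp (a * r) / a) v - (%r. exp (a * r) / a) u"
  unfolding set_lebesgue_integral_def by (subst integral_FTC_Icc_real[symmetric, where f="%r. exp (a * r)"])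
    (use assms in \<open>auto intro!: derivative_eq_intros continuous_intros
     Bochner_Integration.integral_cong simp: \<close>)
 thus ?thesis by (simp add: diff_divide_distrib)
qed

lemma LBINT_shift:
 fixes h :: "real => real"
 shows "(LBINT r:{0..t - s}. h (s + r)) = (LBINT rh:{s..t}. h rh)" unfolding set_lebesgue_integral_def
 by (subst (2) lborel_integral_real_affine[where c=1 and t=s])
   (auto intro!: Bochner_Integration.integral_cong split: split_indicator)

section \<open>The transition semigroup of the motion\<close>

context blevy
begin

lemma integrable_Q:
 assumes [measurable]: "ph \<in> Bm borel" and "!!z. \<bar>ph z\<bar> <= (B::real)"
 shows "integrable N (%w. ph (y + X s w))" by (rule N.integrable_const_bound[where B=B]) (use assms in auto)

lemma Q_measurable [measurable (raw)]:
 assumes [measurable]: "case_prod ph \<in> Bm (M \<Otimes>\<^sub>M borel)"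
  "f \<in> Bm M" "g \<in> Bm M"
 shows "(%x. Q (f x) (ph x) (g x)) \<in> Bm M" unfolding Q_def
proof (rule N.borel_measurable_lebesgue_integral)
 have "(%(x, w). (case_prod ph) (x, g x + X (f x) w)) \<in> Bm (M \<Otimes>\<^sub>M N)" by measurable
 thus "(%(x, w). ph x (g x + X (f x) w)) \<in> Bm (M \<Otimes>\<^sub>M N)" by simp
qed

lemma Q_mono:
 assumes "ph \<in> Bm borel" "!!z. \<bar>ph z\<bar> <= (B::real)" "\<psi> \<in> Bm borel" "!!z. \<bar>\<psi> z\<bar> <= (C::real)"
  and "!!z. ph z <= \<psi> z"
 shows "Q s ph y <= Q s \<psi> y"
 unfolding Q_def by (intro integral_mono integrable_Q[OF assms(1,2)] integrable_Q[OF assms(3,4)] assms(5))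

lemma Q_const [simp]: "Q s (%_. c) y = c" by (simp add: Q_def N.prob_space)

lemma Q_abs:
 assumes "ph \<in> Bm borel" "!!z. \<bar>ph z\<bar> <= (B::real)"
 shows "\<bar>Q s ph y\<bar> <= B"
proof -
 have "\<bar>Q s ph y\<bar> <= (LINT w|N. \<bar>ph (y + X s w)\<bar>)" unfolding Q_def by (rule integral_abs_bound)
 also have "... <= (LINT w|N. B)" using assms by (intro integral_mono integrable_abs integrable_Q[OF assms]) auto
 finally show ?thesis by (simp add: N.prob_space)
qed

lemma Q_nonneg: "(!!z. 0 <= ph z) ==> 0 <= Q s ph y"
 unfolding Q_def by (rule Bochner_Integration.integral_nonneg) simp

lemma Q_add:
 assumes "ph \<in> Bm borel" "!!z. \<bar>ph z\<bar> <= (B::real)" "\<psi> \<in> Bm borel" "!!z. \<bar>\<psi> z\<bar> <= (C::real)"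
 shows "Q s (%z. ph z + \<psi> z) y = Q s ph y + Q s \<psi> y"
 unfolding Q_def by (intro Bochner_Integration.integral_add integrable_Q[OF assms(1,2)] integrable_Q[OF assms(3,4)])

lemma Q_diff:
 assumes "ph \<in> Bm borel" "!!z. \<bar>ph z\<bar> <= (B::real)" "\<psi> \<in> Bm borel" "!!z. \<bar>\<psi> z\<bar> <= (C::real)"
 shows "Q s (%z. ph z - \<psi> z) y = Q s ph y - Q s \<psi> y"
 unfolding Q_def by (intro Bochner_Integration.integral_diff integrable_Q[OF assms(1,2)] integrable_Q[OF assms(3,4)])

lemma Q_cmult: "Q s (%z. c * ph z) y = c * Q s ph y" unfolding Q_def by simp

lemma increments_indep:
 assumes "0 <= r" "0 <= s"
 shows "N.indep_var borel (%w. \<xi> r w - \<xi> 0 w) borel (%w. \<xi> (r + s) w - \<xi> r w)"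
proof -
 \<comment> \<open>The process starts at 0 only almost surely, so the first increment is taken from
   the value at time 0. The times 0, r, r + s are completed to a monotone sequence, as the
   definition of a Levy process requires.\<close>
 define t where "t = (%i::nat. if i = 0 then 0 else if i = 1 then r else r + s)"
 have t: "0 <= t 0" "mono t" using assms by (auto simp: t_def mono_def)
 hence "N.indep_vars (%_. borel) (%i w. \<xi> (t (Suc i)) w - \<xi> (t i) w) {..<2}"
  using levy unfolding levy_process_def by blast
 hence "N.indep_var (Pi\<^sub>M {0} (%_. borel)) (%w. restrict (%i. \<xi> (t (Suc i)) w - \<xi> (t i) w) {0})
   (Pi\<^sub>M {1} (%_. borel)) (%w. restrict (%i. \<xi> (t (Suc i)) w - \<xi> (t i) w) {1})"
  by (rule N.indep_var_restrict) auto
 from N.indep_var_compose[OF this, of "%x. x 0" borel "%x. x 1" borel]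
 have "N.indep_var borel ((%x. x 0) \<circ> (%w. restrict (%i. \<xi> (t (Suc i)) w - \<xi> (t i) w) {0}))
   borel ((%x. x 1) \<circ> (%w. restrict (%i. \<xi> (t (Suc i)) w - \<xi> (t i) w) {1}))"
  by (simp add: measurable_component_singleton)
 thus ?thesis by (simp add: comp_def t_def)
qed

lemma \<xi>_measurable: "0 <= s ==> \<xi> s \<in> Bm N" using levy by (simp add: levy_process_def)

lemma AE_\<xi>0: "AE w in N. \<xi> 0 w = 0" using levy by (simp add: levy_process_def)

text \<open>Independence and stationarity of the increments make their joint law the product of the
  laws at times r and s; the rest is Fubini.\<close>

lemma Q_semigroup:
 assumes [measurable]: "ph \<in> Bm borel" and b: "!!z. \<bar>ph z\<bar> <= (B::real)" and "0 <= r" "0 <= s"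
 shows "Q r (Q s ph) y = Q (r + s) ph y"
proof -
 note [measurable] = \<xi>_measurable
 have m[measurable]: "\<xi> r \<in> Bm N" "\<xi> s \<in> Bm N" "\<xi> (r + s) \<in> Bm N"
  "\<xi> 0 \<in> Bm N" using assms by (auto intro: \<xi>_measurable)
 have eq0: "distr N borel (%w. \<xi> r w - \<xi> 0 w) = distr N borel (\<xi> r)"
  by (rule distr_cong_AE) (use AE_\<xi>0 in auto)
 have eq1: "distr N borel (%w. \<xi> (r + s) w - \<xi> r w) = distr N borel (\<xi> s)"
  using levy assms by (simp add: levy_process_def)
 have D2: "distr N borel (\<xi> r) \<Otimes>\<^sub>M distr N borel (\<xi> s) =
   distr N (borel \<Otimes>\<^sub>M borel) (%w. (\<xi> r w - \<xi> 0 w, \<xi> (r + s) w - \<xi> r w))"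
  using N.indep_var_distribution_eq[THEN iffD1, OF increments_indep[OF assms(3,4)]] by (simp add: eq0 eq1)
 interpret P1: prob_space "distr N borel (\<xi> r)" by (rule N.prob_space_distr) simp
 interpret P2: prob_space "distr N borel (\<xi> s)" by (rule N.prob_space_distr) simp
 interpret PP: pair_prob_space "distr N borel (\<xi> r)" "distr N borel (\<xi> s)" ..
 have "Q (r + s) ph y = (LINT w|N. ph (y + \<xi> (r + s) w))"
  unfolding Q_def using assms by (intro Bochner_Integration.integral_cong) (auto simp: X_eq)
 also have "... = (LINT w|N. (%(a, b). ph (y + a + b)) (\<xi> r w - \<xi> 0 w, \<xi> (r + s) w - \<xi> r w))"
  by (rule integral_cong_AE) (use AE_\<xi>0 in auto)
 also have "... = (LINT z|(distr N borel (\<xi> r) \<Otimes>\<^sub>M distr N borel (\<xi> s)). (%(a, b). ph (y + a + b)) z)"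
  unfolding D2 by (rule integral_distr[symmetric]) measurable
 also have "... = (LINT a|distr N borel (\<xi> r). LINT b|distr N borel (\<xi> s). ph (y + a + b))"
  by (subst PP.integral_fst'[symmetric])
    (auto intro!: PP.integrable_const_bound[where B=B] b simp: split_beta')
 also have "... = (LINT w|N. LINT w'|N. ph (y + \<xi> r w + \<xi> s w'))"
  by (subst integral_distr, simp, measurable, subst integral_distr) simp_all
 also have "... = Q r (Q s ph) y" unfolding Q_def using assms
  by (intro Bochner_Integration.integral_cong refl) (auto simp: X_eq intro!: Bochner_Integration.integral_cong)
 finally show ?thesis by simp
qed

lemma Q_0:
 assumes [measurable]: "ph \<in> Bm borel"
 shows "Q 0 ph y = ph y"
proof -
 have "AE w in N. ph (y + X 0 w) = ph y" using AE_\<xi>0 AE_space by eventually_elim (simp add: X_eq)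
 hence "Q 0 ph y = (LINT w|N. ph y)" unfolding Q_def by (intro integral_cong_AE) auto
 thus ?thesis by (simp add: N.prob_space)
qed

lemma Q_LBINT:
 fixes h :: "real => real => real"
 assumes [measurable]: "case_prod h \<in> Bm (borel \<Otimes>\<^sub>M borel)"
  and b: "!!r z. a <= r ==> r <= b ==> \<bar>h r z\<bar> <= B"
 shows "Q s (%z. LBINT r:{a..b}. h r z) y = (LBINT r:{a..b}. Q s (h r) y)"
proof -
 interpret pair_sigma_finite N lborel ..
 let ?F = "%w r. indicator {a..b} r * h r (y + X s w)"
 have m[measurable]: "(%(w, r). h r (y + X s w)) \<in> Bm (N \<Otimes>\<^sub>M lborel)"
 proof -
  have "(%(w, r). case_prod h (r, y + X s w)) \<in> Bm (N \<Otimes>\<^sub>M lborel)" by measurable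
  thus ?thesis by simp
 qed
 have int: "integrable (N \<Otimes>\<^sub>M lborel) (%(w, r). ?F w r)"
 proof (rule Bochner_Integration.integrable_bound)
  have "space N \<times> {a..b} \<in> sets (N \<Otimes>\<^sub>M lborel)" by (intro pair_measureI) auto
  thus "integrable (N \<Otimes>\<^sub>M lborel) (%z. indicator (space N \<times> {a..b}) z * B)"
   by (intro integrable_mult_left integrable_real_indicator)
     (auto simp: lborel.emeasure_pair_measure_Times ennreal_mult_less_top N.emeasure_space_1 emeasure_lborel_Icc_eq)
  show "AE z in N \<Otimes>\<^sub>M lborel. norm (case z of (w, r) => ?F w r) <= norm (indicator (space N \<times> {a..b}) z * B)"
   by (intro AE_I2) (auto simp: space_pair_measure abs_mult indicator_def
     intro!: order_trans[OF b abs_ge_self])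
 qed measurable
 have "Q s (%z. LBINT r:{a..b}. h r z) y = (LINT w|N. (LBINT r. ?F w r))"
  by (simp add: Q_def set_lebesgue_integral_def)
 also have "... = (LBINT r. (LINT w|N. ?F w r))" by (rule Fubini_integral[OF int, symmetric])
 also have "... = (LBINT r:{a..b}. Q s (h r) y)" by (simp add: Q_def set_lebesgue_integral_def)
 finally show ?thesis .
qed

end

lemma LBINT_Icc_cmult: "(LBINT r:{a..b}. c * h r) = c * (LBINT r:{a..b}. h r)" for c :: real
 by (rule set_integral_mult_right)

lemma LBINT_Icc_cong:
 fixes h h' :: "real => real"
 assumes "!!r. a <= r ==> r <= b ==> h r = h' r"
 shows "(LBINT r:{a..b}. h r) = (LBINT r:{a..b}. h' r)" by (rule set_lebesgue_integral_cong) (use assms in auto)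

lemma LBINT_Icc_add:
 fixes h h' :: "real => real"
 assumes "h \<in> Bm borel" "h' \<in> Bm borel"
  and "!!r. a <= r ==> r <= b ==> \<bar>h r\<bar> <= B" "!!r. a <= r ==> r <= b ==> \<bar>h' r\<bar> <= C"
 shows "(LBINT r:{a..b}. h r + h' r) = (LBINT r:{a..b}. h r) + (LBINT r:{a..b}. h' r)"
 by (intro set_integral_add(2) set_integrable_bounded_Icc[OF assms(1,3)] set_integrable_bounded_Icc[OF assms(2,4)])

lemma LBINT_Icc_diff:
 fixes h h' :: "real => real"
 assumes "h \<in> Bm borel" "h' \<in> Bm borel"
  and "!!r. a <= r ==> r <= b ==> \<bar>h r\<bar> <= B" "!!r. a <= r ==> r <= b ==> \<bar>h' r\<bar> <= C"
 shows "(LBINT r:{a..b}. h r - h' r) = (LBINT r:{a..b}. h r) - (LBINT r:{a..b}. h' r)"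
 by (intro set_integral_diff(2) set_integrable_bounded_Icc[OF assms(1,3)] set_integrable_bounded_Icc[OF assms(2,4)])

lemma LBINT_Icc_mono:
 fixes h h' :: "real => real"
 assumes "h \<in> Bm borel" "h' \<in> Bm borel"
  and "!!r. a <= r ==> r <= b ==> \<bar>h r\<bar> <= B" "!!r. a <= r ==> r <= b ==> \<bar>h' r\<bar> <= C"
  and "!!r. a <= r ==> r <= b ==> h r <= h' r"
 shows "(LBINT r:{a..b}. h r) <= (LBINT r:{a..b}. h' r)"
 by (intro set_integral_mono set_integrable_bounded_Icc[OF assms(1,3)] set_integrable_bounded_Icc[OF assms(2,4)])
   (use assms(5) in auto)

text \<open>One step of the iteration in \<open>gronwall\<close>: the kernel of powers over
  factorials reproduces itself with the exponent raised by one.\<close>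

lemma LBINT_power_Icc:
 fixes c t :: real
 assumes "0 <= t"
 shows "(LBINT r:{0..t}. c * ((c * (t - r)) ^ n / fact n)) = (c * t) ^ Suc n / fact (Suc n)"
proof -
 let ?F = "%r. - ((c * (t - r)) ^ Suc n / fact (Suc n))"
 have "(\<integral>r. (c * ((c * (t - r)) ^ n / fact n)) * indicator {0..t} r \<partial>lborel) = ?F t - ?F 0"
 proof (rule integral_FTC_Icc_real[OF assms])
  fix x
  have "((%r. - ((c * (t - r)) ^ Suc n / fact (Suc n))) has_real_derivative
   - ((real (Suc n) * ((c * (0 - 1)) * (c * (t - x)) ^ n)) / fact (Suc n))) (at x)"
   by (rule derivative_eq_intros refl | simp)+
  also have "- ((real (Suc n) * ((c * (0 - 1)) * (c * (t - x)) ^ n)) / fact (Suc n)) = c * ((c * (t - x)) ^ n / fact n)"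
   by (simp del: of_nat_Suc)
  finally show "(?F has_real_derivative c * ((c * (t - x)) ^ n / fact n)) (at x)" .
 qed (auto intro!: continuous_intros)
 thus ?thesis unfolding set_lebesgue_integral_def by (simp add: mult.commute)
qed

lemma exp_mult_abs_le:
 fixes a x B :: real
 assumes "a <= 0" "\<bar>x\<bar> <= B"
 shows "exp a * \<bar>x\<bar> <= B"
proof -
 have "exp a * \<bar>x\<bar> <= 1 * \<bar>x\<bar>" using assms(1) by (intro mult_right_mono) auto
 thus ?thesis using assms(2) by simp
qed

section \<open>Uniqueness and change of the exponential rate in integral equations\<close>

context blevy
begin

abbreviation (input) eb :: "real => real" where
 "eb r \<equiv> exp (- \<beta> * r)"

text \<open>Iterating the inequality n times bounds d by B (c t)^n / n!, which tends to 0. Being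
  one-sided, it applies to functions such as |u - u'| - l.\<close>

lemma gronwall:
 fixes d :: "real => real => real"
 assumes m[measurable]: "case_prod d \<in> Bm (borel \<Otimes>\<^sub>M borel)"
  and b: "!!t y. 0 <= t ==> t <= T ==> \<bar>d t y\<bar> <= B"
  and ie: "!!t y. 0 <= t ==> t <= T ==> d t y <= (LBINT r:{0..t}. c * eb r * Q r (d (t - r)) y)"
  and "0 <= c" "0 <= t" "t <= T"
 shows "d t y <= 0"
proof -
 have B: "0 <= B" using b[OF assms(5,6), of y] by linarith
 have dm[measurable]: "d s \<in> Bm borel" for s using measurable_compose[OF measurable_Pair1' m, of s] by simp
 have *: "d t y <= B * ((c * t) ^ n / fact n)" if "0 <= t" "t <= T" for n t y using that
 proof (induction n arbitrary: t y)
  case 0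
  thus ?case using b[of t y] by auto
 next
  case (Suc n)
  let ?p = "%r. (c * (t - r)) ^ n / fact n" and ?q = "%r. c * eb r * Q r (d (t - r)) y"
  have 1: "?q r <= B * (c * ?p r)"
   if r: "0 <= r" "r <= t" for r
  proof -
   have "Q r (d (t - r)) y <= Q r (%_. B * ?p r) y"
    using r Suc.prems by (intro Q_mono[OF _ b _ order_refl] Suc.IH) auto
   hence "Q r (d (t - r)) y <= B * ?p r" by simp
   moreover have "0 <= c * eb r" "c * eb r <= c"
    using \<open>0 <= c\<close> r \<beta>_pos by (auto intro!: mult_left_le)
   moreover have "0 <= B * ?p r" using B \<open>0 <= c\<close> r by auto
   ultimately have "?q r <= c * (B * ?p r)" by (meson mult_left_mono mult_right_mono order_trans)
   thus ?thesis by (simp add: mult_ac)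
  qed
  have "d t y <= (LBINT r:{0..t}. ?q r)" using Suc.prems by (rule ie)
  also have "... <= (LBINT r:{0..t}. B * (c * ?p r))"
  proof (rule LBINT_Icc_mono[where B="c * B" and C="B * (c * (c * t) ^ n)"])
   fix r assume r: "0 <= r" "r <= t"
   show "\<bar>?q r\<bar> <= c * B" unfolding abs_mult using r Suc.prems \<open>0 <= c\<close> \<beta>_pos b
    by (intro mult_mono Q_abs) (auto intro!: mult_left_le)
   have "?p r <= (c * t) ^ n / 1" using r \<open>0 <= c\<close> by (intro frac_le power_mono mult_left_mono) auto
   hence "B * (c * ?p r) <= B * (c * (c * t) ^ n)" using \<open>0 <= c\<close> B by (intro mult_left_mono) auto
   moreover have "0 <= B * (c * ?p r)"
    using r \<open>0 <= c\<close> B by (intro mult_nonneg_nonneg divide_nonneg_nonneg zero_le_power) auto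
   ultimately show "\<bar>B * (c * ?p r)\<bar> <= B * (c * (c * t) ^ n)" by simp
  qed (use 1 in \<open>auto\<close>)
  also have "... = B * ((c * t) ^ Suc n / fact (Suc n))"
   by (subst LBINT_Icc_cmult, subst LBINT_power_Icc[OF Suc.prems(1)], rule refl)
  finally show ?case .
 qed
 have "(%n. B * ((c * t) ^ n / fact n)) \<longlonglongrightarrow> B * 0"
  using summable_LIMSEQ_zero[OF summable_exp[of "c * t"]]
  by (intro tendsto_mult tendsto_const) (simp add: field_simps)
 thus ?thesis using *[OF assms(5,6)] by (intro LIMSEQ_le_const[of _ 0]) auto
qed

text \<open>Duhamel's principle. With A the generator of \<open>Q\<close>, the mild form of w' = (A
  - \<beta>) w + q is also that of w' = (A + al) w + (q - (al + \<beta>) w), with the same initial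
  value. The generator itself does not appear: \<open>Q r (w (t - r)) y\<close> is computed from the
  equation, multiplied by (al + \<beta>) e^(al r) and integrated over r, and the order of
  integration is exchanged.\<close>

lemma change_rate:
 fixes w q :: "real => real => real"
 assumes wm[measurable]: "case_prod w \<in> Bm (borel \<Otimes>\<^sub>M borel)"
  and qm[measurable]: "case_prod q \<in> Bm (borel \<Otimes>\<^sub>M borel)"
  and Km[measurable]: "G \<in> Bm borel"
  and bK: "!!y. \<bar>G y\<bar> <= B" and bw: "!!t y. \<bar>w t y\<bar> <= B" and bq: "!!t y. \<bar>q t y\<bar> <= B"
  and ie: "!!t y. 0 <= t ==>
    w t y = eb t * Q t G y + (LBINT r:{0..t}. eb r * Q r (q (t - r)) y)"
  and t: "0 <= t"
 shows "w t y = exp (al * t) * Q t G y +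
   (LBINT r:{0..t}. exp (al * r) * Q r (%z. q (t - r) z - (al + \<beta>) * w (t - r) z) y)"
proof -
 have wm'[measurable]: "w s \<in> Bm borel" for s using measurable_compose[OF measurable_Pair1' wm, of s] by simp
 have qm'[measurable]: "q s \<in> Bm borel" for s using measurable_compose[OF measurable_Pair1' qm, of s] by simp
 have B: "0 <= B" using bK[of 0] by auto
 define k where "k = (%rh. Q rh (q (t - rh)) y)"
 define c where "c = Q t G y"
 let ?ab = "al + \<beta>" and ?j = "%rh. eb rh * k rh" and ?h = "%z r r'. eb r' * Q r' (q (t - r - r')) z"
 let ?J = "%r. LBINT rh:{r..t}. ?j rh" and ?H = "%r z. LBINT r':{0..t - r}. ?h z r r'"
 have km[measurable]: "k \<in> Bm borel" unfolding k_def by measurable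
 have bk: "\<bar>k rh\<bar> <= B" for rh unfolding k_def by (rule Q_abs[OF _ bq]) measurable
 \<comment> \<open>Propagating the equation at time t - r over a further time r shifts its time
   integral: what remains of the integral up to t is the part beyond r.\<close>
 have char: "Q r (w (t - r)) y = eb t * c * exp (\<beta> * r) +
   exp (\<beta> * r) * ?J r" if r: "0 <= r" "r <= t" for r
 proof -
  have "w (t - r) = (%z. eb (t - r) * Q (t - r) G z +
    ?H r z)" using ie[of "t - r"] r by (intro ext) auto
  hence "Q r (w (t - r)) y = Q r (%z. eb (t - r) * Q (t - r) G z +
    ?H r z) y" by (simp only:)
  also have "... = Q r (%z. eb (t - r) * Q (t - r) G z) y +
    Q r (%z. ?H r z) y"
  proof (rule Q_add)
   show 1: "\<bar>eb (t - r) * Q (t - r) G z\<bar> <= B" for z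
    unfolding abs_mult abs_exp_cancel using r \<beta>_pos by (intro exp_mult_abs_le Q_abs[OF Km bK]) auto
   have "?H r z =
     w (t - r) z - eb (t - r) * Q (t - r) G z" for z using ie[of "t - r" z] r by simp
   thus "\<bar>?H r z\<bar> <= B + B" for z using bw[of "t - r" z] 1[of z] by (auto simp: abs_if split: if_splits)
   show "(%z. ?H r z) \<in> Bm borel" unfolding set_lebesgue_integral_def by measurable
  qed measurable
  also have "Q r (%z. eb (t - r) * Q (t - r) G z) y = eb (t - r) * c"
   using r by (simp add: Q_cmult Q_semigroup[OF Km bK] c_def)
  also have "Q r (%z. ?H r z) y =
    (LBINT r':{0..t - r}. Q r (%z. ?h z r r') y)"
  proof (rule Q_LBINT[where B=B])
   fix r' z assume r': "0 <= r'" "r' <= t - r"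
   show "\<bar>?h z r r'\<bar> <= B"
    unfolding abs_mult abs_exp_cancel using r' \<beta>_pos by (intro exp_mult_abs_le Q_abs[OF qm' bq]) auto
  qed measurable
  also have "... = (LBINT r':{0..t - r}. (%rh. exp (\<beta> * r) * ?j rh) (r + r'))"
  proof (rule LBINT_Icc_cong)
   fix r' assume r': "0 <= r'" "r' <= t - r"
   have "Q r (Q r' (q (t - r - r'))) y = k (r + r')"
    unfolding k_def using r r' by (subst Q_semigroup[OF qm' bq]) (auto simp: algebra_simps)
   thus "Q r (%z. ?h z r r') y =
     (%rh. exp (\<beta> * r) * ?j rh) (r + r')" by (simp add: Q_cmult algebra_simps flip: exp_add)
  qed
  also have "... = exp (\<beta> * r) * ?J r" by (subst LBINT_shift) (rule LBINT_Icc_cmult)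
  finally show ?thesis by (simp add: algebra_simps flip: exp_add)
 qed
 \<comment> \<open>Stated as a product rather than a quotient, which includes the case al + \<beta>
   = 0.\<close>
 have expint: "?ab * (LBINT r:{0..rh}. exp (?ab * r)) = exp (?ab * rh) - 1" if "0 <= rh" for rh
  using that by (cases "al + \<beta> = 0") (simp_all add: LBINT_exp_Icc)
 have bexp: "exp (a * r) <= exp (\<bar>a\<bar> * t)" if "0 <= r" "r <= t" for a r
 proof -
  have "a * r <= \<bar>a\<bar> * t" using that by (intro mult_mono) auto
  thus ?thesis by simp
 qed
 have Qwm[measurable]: "(%r. Q r (w (t - r)) y) \<in> Bm borel" by measurable
 have bint: "\<bar>?J r\<bar> <= exp (\<bar>\<beta>\<bar> * t) * (B + \<bar>c\<bar> + B)" if r: "0 <= r" "r <= t" for r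
 proof -
  have "?J r = eb r * Q r (w (t - r)) y - eb t * c" using char[OF r] by (simp add: algebra_simps flip: exp_add)
  also have "\<bar>...\<bar> <= 1 * B + 1 * \<bar>c\<bar>"
  proof (rule order_trans[OF abs_triangle_ineq4 add_mono])
   show "\<bar>eb r * Q r (w (t - r)) y\<bar> <= 1 * B"
    unfolding abs_mult using r \<beta>_pos by (intro mult_mono Q_abs[OF _ bw]) auto
   show "\<bar>eb t * c\<bar> <= 1 * \<bar>c\<bar>" unfolding abs_mult using r \<beta>_pos by (intro mult_mono) auto
  qed
  also have "... <= 1 * (B + \<bar>c\<bar> + B)" using B by simp
  also have "... <= exp (\<bar>\<beta>\<bar> * t) * (B + \<bar>c\<bar> + B)" using B t by (intro mult_right_mono) auto
  finally show ?thesis .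
 qed
 have LBm[measurable]: "(%r. ?J r) \<in> Bm borel"
  unfolding set_lebesgue_integral_def atLeastAtMost_iff[abs_def] indicator_def by measurable
 have "(LBINT r:{0..t}. exp (al * r) * (?ab * Q r (w (t - r)) y)) =
   (LBINT r:{0..t}. (eb t * c * ?ab) * exp (?ab * r) +
     ?ab * (exp (?ab * r) * ?J r))" by (rule LBINT_Icc_cong) (simp add: char algebra_simps exp_add)
 also have "... = (LBINT r:{0..t}. (eb t * c * ?ab) * exp (?ab * r)) +
   (LBINT r:{0..t}. ?ab * (exp (?ab * r) * ?J r))"
 proof (rule LBINT_Icc_add)
  fix r assume r: "0 <= r" "r <= t"
  show "\<bar>(eb t * c * ?ab) * exp (?ab * r)\<bar> <=
    \<bar>eb t * c * ?ab\<bar> * exp (\<bar>?ab\<bar> * t)"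
   using bexp[OF r, of ?ab] by (simp add: abs_mult mult_left_mono)
  show "\<bar>?ab * (exp (?ab * r) * ?J r)\<bar> <=
    \<bar>?ab\<bar> * (exp (\<bar>?ab\<bar> * t) * (exp (\<bar>\<beta>\<bar> * t) * (B + \<bar>c\<bar> + B)))"
   unfolding abs_mult using bexp[OF r, of ?ab] bint[OF r] by (intro mult_mono) auto
 qed measurable
 also have "(LBINT r:{0..t}. (eb t * c * ?ab) * exp (?ab * r)) =
   eb t * c * (exp (?ab * t) - 1)" unfolding LBINT_Icc_cmult expint[OF t, symmetric] by simp
 also have "(LBINT r:{0..t}. ?ab * (exp (?ab * r) * ?J r)) =
   ?ab * (LBINT rh:{0..t}. ?j rh * (LBINT r:{0..rh}. exp (?ab * r)))" unfolding LBINT_Icc_cmult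
 proof (subst triangle_Fubini[where A="exp (\<bar>?ab\<bar> * t)" and B=B])
  fix r assume r: "0 <= r" "r <= t"
  show "\<bar>eb r * k r\<bar> <= B"
   unfolding abs_mult abs_exp_cancel using r \<beta>_pos by (intro exp_mult_abs_le bk) auto
 qed (use bexp in auto)
 also have "... = (LBINT rh:{0..t}. ?j rh * (exp (?ab * rh) - 1))" unfolding LBINT_Icc_cmult[symmetric]
  by (rule LBINT_Icc_cong) (subst expint[symmetric], simp_all)
 also have "... = (LBINT rh:{0..t}. exp (al * rh) * k rh - ?j rh)"
  by (rule LBINT_Icc_cong) (simp add: algebra_simps exp_add exp_minus field_simps)
 also have "... = (LBINT rh:{0..t}. exp (al * rh) * k rh) - (LBINT rh:{0..t}. ?j rh)"
 proof (rule LBINT_Icc_diff)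
  fix r assume r: "0 <= r" "r <= t"
  show "\<bar>exp (al * r) * k r\<bar> <= exp (\<bar>al\<bar> * t) * B" "\<bar>eb r * k r\<bar> <= exp (\<bar>- \<beta>\<bar> * t) * B"
   unfolding abs_mult using bexp[OF r, of al] bexp[OF r, of "- \<beta>"] bk[of r] by (auto intro!: mult_mono)
 qed measurable
 finally have main: "(LBINT r:{0..t}. exp (al * r) * (?ab * Q r (w (t - r)) y)) =
   exp (al * t) * c - eb t * c + ((LBINT rh:{0..t}. exp (al * rh) * k rh) - (LBINT rh:{0..t}. ?j rh))"
  by (simp add: algebra_simps flip: exp_add)
 have "(LBINT r:{0..t}. exp (al * r) * Q r (%z. q (t - r) z - ?ab * w (t - r) z) y) =
   (LBINT r:{0..t}. exp (al * r) * k r - exp (al * r) * (?ab * Q r (w (t - r)) y))"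
 proof (rule LBINT_Icc_cong)
  fix r
  have "Q r (%z. q (t - r) z - ?ab * w (t - r) z) y = k r - ?ab * Q r (w (t - r)) y" unfolding k_def using bw
   by (subst Q_diff[OF _ bq, where C="\<bar>?ab\<bar> * B"]) (auto simp: Q_cmult abs_mult intro!: mult_left_mono)
  thus "exp (al * r) * Q r (%z. q (t - r) z - ?ab * w (t - r) z) y =
   exp (al * r) * k r - exp (al * r) * (?ab * Q r (w (t - r)) y)" by (simp only: right_diff_distrib)
 qed
 also have "... = (LBINT r:{0..t}. exp (al * r) * k r) - (LBINT r:{0..t}. exp (al * r) * (?ab * Q r (w (t - r)) y))"
 proof (rule LBINT_Icc_diff)
  fix r assume r: "0 <= r" "r <= t"
  show "\<bar>exp (al * r) * k r\<bar> <= exp (\<bar>al\<bar> * t) * B"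
   unfolding abs_mult using bexp[OF r, of al] bk[of r] by (auto intro!: mult_mono)
  show "\<bar>exp (al * r) * (?ab * Q r (w (t - r)) y)\<bar> <= exp (\<bar>al\<bar> * t) * (\<bar>?ab\<bar> * B)"
   unfolding abs_mult using bexp[OF r, of al] by (intro mult_mono Q_abs[OF _ bw]) auto
 qed measurable
 finally show ?thesis using ie[OF t, of y] main by (simp add: k_def c_def)
qed

end

section \<open>The offspring generating function and the first-split equation\<close>

lemma abs_power_diff_le:
 fixes a b :: real
 assumes "0 <= a" "a <= 1" "0 <= b" "b <= 1"
 shows "\<bar>a ^ k - b ^ k\<bar> <= real k * \<bar>a - b\<bar>"
proof (induction k)
 case (Suc k)
 have "a ^ Suc k - b ^ Suc k = a * (a ^ k - b ^ k) + (a - b) * b ^ k" by (simp add: algebra_simps)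
 also have "\<bar>...\<bar> <= \<bar>a\<bar> * \<bar>a ^ k - b ^ k\<bar> + \<bar>a - b\<bar> * \<bar>b ^ k\<bar>"
  by (metis abs_mult abs_triangle_ineq)
 also have "... <= 1 * (real k * \<bar>a - b\<bar>) + \<bar>a - b\<bar> * 1"
  using assms Suc by (intro add_mono mult_mono) (auto simp: power_le_one)
 finally show ?case by (simp add: algebra_simps)
qed simp

locale blevy_mean = blevy +
 fixes m lam :: real
 assumes m_sums: "(%k. real k * pmf p k) sums m" and lam_eq: "lam = \<beta> * (m - 1)" and m_gt1: "1 < m"
begin

abbreviation (input) el :: "real => real" where
 "el r \<equiv> exp (lam * r)"

abbreviation (input) en :: "real => real" where
 "en r \<equiv> exp (- lam * r)"

lemma lam_pos: "0 < lam" using lam_eq \<beta>_pos m_gt1 by simp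

lemma p_int_real: "integrable (measure_pmf p) real" "measure_pmf.expectation p real = m"
proof -
 have "(\<integral>\<^sup>+k. ennreal (real k) \<partial>measure_pmf p) = (\<integral>\<^sup>+k. ennreal (real k * pmf p k) \<partial>count_space UNIV)"
  by (subst nn_integral_measure_pmf) (simp add: ennreal_mult mult.commute)
 also have "... = ennreal m" using m_sums by (subst nn_integral_count_space_nat) (auto intro!: suminf_ennreal_eq)
 finally have *: "(\<integral>\<^sup>+k. ennreal (real k) \<partial>measure_pmf p) = ennreal m" .
 show "integrable (measure_pmf p) real" by (rule integrableI_nonneg) (auto simp: *)
 thus "measure_pmf.expectation p real = m" using m_gt1 * by (intro integral_eq_nn_integral[THEN trans]) auto
qed

lemma pgf_int: "0 <= (z::real) ==> z <= 1 ==> integrable (measure_pmf p) (%k. z ^ k)"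
 by (rule measure_pmf.integrable_const_bound[where B=1]) (auto simp: power_le_one)

lemma pgf_nonneg: "0 <= z ==> 0 <= pgf z" unfolding pgf_def by (rule Bochner_Integration.integral_nonneg) simp

lemma pgf_le_1: "0 <= z ==> z <= 1 ==> pgf z <= 1" unfolding pgf_def
 by (rule order_trans[OF integral_mono[where g="%_. 1"]]) (auto simp: pgf_int power_le_one)

lemma pgf_1 [simp]: "pgf 1 = 1" by (simp add: pgf_def)

lemma pgf_lipschitz:
 assumes "0 <= a" "a <= 1" "0 <= b" "b <= 1"
 shows "\<bar>pgf a - pgf b\<bar> <= m * \<bar>a - b\<bar>"
proof -
 have "\<bar>pgf a - pgf b\<bar> = \<bar>measure_pmf.expectation p (%k. a ^ k - b ^ k)\<bar>"
  unfolding pgf_def using pgf_int assms by (subst Bochner_Integration.integral_diff) auto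
 also have "... <= measure_pmf.expectation p (%k. \<bar>a ^ k - b ^ k\<bar>)" by (rule integral_abs_bound)
 also have "... <= measure_pmf.expectation p (%k. real k * \<bar>a - b\<bar>)" using assms p_int_real(1) pgf_int
  by (intro integral_mono abs_power_diff_le integrable_abs Bochner_Integration.integrable_diff) auto
 finally show ?thesis using p_int_real(2) by simp
qed

lemma pgf_measurable [measurable]: "pgf \<in> Bm borel" unfolding pgf_def by measurable

text \<open>For w = 1 - u the equation u' = \<beta> (f(u) - u) of a population without motion, f the
  offspring generating function, reads w' = lam w - \<Phi>(w). Thus \<Phi> is the remainder after
  linearizing at w = 0.\<close>

definition \<Phi> :: "real => real" where "\<Phi> w = \<beta> * (m * w - 1 + pgf (1 - w))"

lemma \<Phi>_measurable [measurable]: "\<Phi> \<in> Bm borel" unfolding \<Phi>_def by measurable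

lemma \<Phi>_0 [simp]: "\<Phi> 0 = 0" by (simp add: \<Phi>_def)

lemma \<Phi>_nonneg: "0 <= w ==> w <= 1 ==> 0 <= \<Phi> w"
 using pgf_lipschitz[of 1 "1 - w"] \<beta>_pos pgf_le_1[of "1 - w"] unfolding \<Phi>_def
 by (intro mult_nonneg_nonneg) auto

lemma \<Phi>_le: "0 <= w ==> w <= 1 ==> \<Phi> w <= \<beta> * m * w"
 using pgf_le_1[of "1 - w"] \<beta>_pos unfolding \<Phi>_def by (simp add: mult.assoc mult_left_mono)

lemma \<Phi>_lipschitz:
 assumes "0 <= a" "a <= 1" "0 <= b" "b <= 1"
 shows "\<bar>\<Phi> a - \<Phi> b\<bar> <= 2 * \<beta> * m * \<bar>a - b\<bar>"
proof -
 have "\<bar>\<Phi> a - \<Phi> b\<bar> = \<beta> * \<bar>m * (a - b) + (pgf (1 - a) - pgf (1 - b))\<bar>"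
  using \<beta>_pos unfolding \<Phi>_def by (simp add: abs_mult flip: right_diff_distrib) (simp add: algebra_simps)
 also have "... <= \<beta> * (m * \<bar>a - b\<bar> + m * \<bar>(1 - a) - (1 - b)\<bar>)"
  using \<beta>_pos m_gt1 assms
  by (intro mult_left_mono order_trans[OF abs_triangle_ineq] add_mono pgf_lipschitz) (auto simp: abs_mult)
 finally show ?thesis by (simp add: algebra_simps abs_minus_commute)
qed

text \<open>\<open>\<Phi>\<close> is superlinear at 0, since \<open>pgf\<close> has left derivative \<open>m\<close> at 1.\<close>

lemma \<Phi>_small:
 assumes "0 < rh"
 shows "\<exists>kp>0. \<forall>w. 0 <= w --> w <= kp --> w <= 1 --> \<Phi> w <= rh * w"
proof -
 let ?g = "%n k. real k - (1 - (1 - 1 / real (Suc n)) ^ k) / (1 / real (Suc n))"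
 let ?E = "measure_pmf.expectation p" and ?d = "%n. 1 / real (Suc n)"
 have bern: "1 - (1 - w) ^ k <= real k * w" if "0 <= w" "w <= 1" for w :: real and k :: nat
  using abs_power_diff_le[of 1 "1 - w" k] that by auto
 have g: "0 <= ?g n k" "?g n k <= real k" for n k
 proof -
  let ?w = "?d n"
  have w: "0 < ?w" "?w <= 1" by auto
  have "(1 - (1 - ?w) ^ k) / ?w <= real k" using bern[of ?w k] w by (subst pos_divide_le_eq) (auto simp: field_simps)
  thus "0 <= ?g n k" by simp
  have "(1 - ?w) ^ k <= 1" using w by (intro power_le_one) auto
  hence "0 <= (1 - (1 - ?w) ^ k) / ?w" using w by (intro divide_nonneg_pos) auto
  thus "?g n k <= real k" by simp
 qed
 \<comment> \<open>Dominated convergence; k itself is the majorant, integrable since the offspring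
   mean is finite.\<close>
 have "(%n. ?E (?g n)) \<longlonglongrightarrow> ?E (%_. 0)"
 proof (rule integral_dominated_convergence[where w=real])
  show "AE k in measure_pmf p. (%n. ?g n k) \<longlonglongrightarrow> 0"
  proof (rule AE_I2)
   fix k :: nat
   have "((%x. (1 - x) ^ k) has_real_derivative - real k) (at 0)" by (auto intro!: derivative_eq_intros)
   hence "((%h. ((1 - h) ^ k - 1) / h) \<longlongrightarrow> - real k) (at 0)" by (simp add: DERIV_def)
   moreover have "filterlim (%n. ?d n) (at 0) sequentially"
    unfolding filterlim_at using LIMSEQ_inverse_real_of_nat by (auto simp: inverse_eq_divide)
   ultimately have "(%n. ((1 - ?d n) ^ k - 1) / ?d n) \<longlonglongrightarrow> - real k" by (rule filterlim_compose)
   from tendsto_add[OF tendsto_const[of "real k"] this]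
   have "(%n. real k + ((1 - ?d n) ^ k - 1) / ?d n) \<longlonglongrightarrow> 0" by simp
   moreover have "real k + ((1 - ?d n) ^ k - 1) / ?d n = ?g n k" for n by (simp only: diff_divide_distrib)
   ultimately show "(%n. ?g n k) \<longlonglongrightarrow> 0" by (simp only:)
  qed
  show "AE k in measure_pmf p. norm (?g n k) <= real k" for n
   using g by (intro AE_I2) (simp only: real_norm_def abs_of_nonneg)
 qed (auto simp: p_int_real)
 hence lim: "(%n. ?E (?g n)) \<longlonglongrightarrow> 0" by simp
 have "0 < rh / \<beta>" using assms \<beta>_pos by simp
 then obtain n where n: "?E (?g n) < rh / \<beta>"
  using eventually_happens[OF order_tendstoD(2)[OF lim]] by (metis sequentially_bot)
 let ?kp = "?d n"
 have kp: "0 < ?kp" "?kp <= 1" by auto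
 \<comment> \<open>\<open>w \<mapsto> (1 - (1 - w) ^ k) / w\<close> is the sum of \<open>(1 - w) ^ i\<close> over \<open>i < k\<close>, hence decreasing\<close>
 have geo: "1 - (1 - w) ^ k = w * (\<Sum>i<k. (1 - w) ^ i)" for w :: real and k :: nat
  using one_diff_power_eq[of "1 - w" k] by simp
 show ?thesis
 proof (intro exI[of _ ?kp] conjI allI impI)
  fix w :: real assume w: "0 <= w" "w <= ?kp" "w <= 1"
  have le: "real k * w - (1 - (1 - w) ^ k) <= ?g n k * w" for k
  proof -
   have "(\<Sum>i<k. (1 - ?kp) ^ i) <= (\<Sum>i<k. (1 - w) ^ i)" using w kp by (intro sum_mono power_mono) auto
   hence "w * (real k - (\<Sum>i<k. (1 - w) ^ i)) <= w * (real k - (\<Sum>i<k. (1 - ?kp) ^ i))"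
    using w by (intro mult_left_mono) auto
   moreover have eq: "(1 - (1 - ?kp) ^ k) / ?kp = (\<Sum>i<k. (1 - ?kp) ^ i)"
    unfolding geo using kp by (simp only: nonzero_mult_div_cancel_left)
   ultimately show ?thesis unfolding eq geo[of w] by (simp only: algebra_simps)
  qed
  have gi: "integrable (measure_pmf p) (?g n)" by (rule Bochner_Integration.integrable_bound[OF p_int_real(1)])
     (use g in \<open>auto simp only: real_norm_def abs_of_nonneg of_nat_0_le_iff intro!: AE_I2\<close>, auto)
  have "m * w - 1 + pgf (1 - w) = ?E (%k. real k * w - (1 - (1 - w) ^ k))"
   unfolding pgf_def p_int_real(2)[symmetric] using w p_int_real(1) pgf_int[of "1 - w"]
   by (simp add: measure_pmf.prob_space)
  also have "... <= ?E (%k. ?g n k * w)" using w p_int_real(1) pgf_int[of "1 - w"] gi by (intro integral_mono le) auto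
  also have "... = ?E (?g n) * w" by simp
  also have "... <= rh / \<beta> * w" using n w by (intro mult_right_mono) auto
  finally show "\<Phi> w <= rh * w" unfolding \<Phi>_def using \<beta>_pos by (simp add: field_simps)
 qed (use kp in auto)
qed

text \<open>The first-split equation as a property of a function u rather than of \<open>U\<close>:
  \<open>U_semigroup\<close> verifies it for a time-shifted function, which is then identified by
  uniqueness.\<close>

definition solves :: "(real => real) => (real => real => real) => bool" where
 "solves G u \<longleftrightarrow> case_prod u \<in> Bm (borel \<Otimes>\<^sub>M borel) \<and> (\<forall>t y. 0 <= u t y \<and> u t y <= 1) \<and>
   (\<forall>t\<ge>0. \<forall>y. u t y = eb t * Q t G y +
    (LBINT r:{0..t}. eb r * Q r (%z. \<beta> * pgf (u (t - r) z)) y))"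

definition unit_fun :: "(real => real) => bool" where
 "unit_fun G \<longleftrightarrow> G \<in> Bm borel \<and> (\<forall>z. 0 <= G z \<and> G z <= 1)"

definition U :: "real => (real => real) => real => real" where
 "U t G y = enn2real (cU t G y)"

lemma ennreal_U: "ennreal (U t G y) = cU t G y"
 unfolding U_def using cU_le_1[of t G y] by (intro ennreal_enn2real le_less_trans[of "cU t G y" 1 top]) auto

lemma U_nonneg: "0 <= U t G y" and U_le_1: "U t G y <= 1"
proof -
 show "0 <= U t G y" by (simp add: U_def)
 show "U t G y <= 1"
  using cU_le_1[of t G y] unfolding ennreal_U[symmetric] by (simp add: ennreal_le_iff flip: ennreal_1)
qed

lemma U_measurable [measurable (raw)]:
 assumes [measurable]: "G \<in> Bm borel" "f \<in> Bm M" "h \<in> Bm M"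
 shows "(%x. U (f x) G (h x)) \<in> Bm M" unfolding U_def by measurable

lemma emeasure_exponential_gt:
 assumes "0 <= t"
 shows "(\<integral>\<^sup>+r. ennreal (exponential_density \<beta> r) * indicator {t<..} r \<partial>lborel) = ennreal (eb t)"
proof -
 have "prob_space.prob (density lborel (exponential_density \<beta>)) {r \<in> space lborel. t < r} = eb t"
 proof -
  have "distributed (density lborel (exponential_density \<beta>)) lborel (%x. x) (exponential_density \<beta>)"
   unfolding distributed_def by (auto simp: exponential_density_def distr_id2)
  from E.exponential_distributedD_gt[OF this assms \<beta>_pos] show ?thesis by (simp add: mult.commute)
 qed
 hence "emeasure (density lborel (exponential_density \<beta>)) {t<..} = ennreal (eb t)"
  by (simp add: E.emeasure_eq_measure greaterThan_def)
 thus ?thesis by (simp add: emeasure_density)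
qed

text \<open>Integrates \<open>cU_root\<close> over the exponential lifetime r of the root: r > t has
  probability e^(- \<beta> t) and gives the first term, r <= t gives the convolution, and averaging
  the k-th power over the offspring number gives \<open>pgf\<close>.\<close>

lemma U_solves:
 assumes "unit_fun G"
 shows "solves G (%t y. U t G y)" unfolding solves_def
proof (intro conjI allI impI)
 have [measurable]: "G \<in> Bm borel" and G: "!!z. 0 <= G z" "!!z. G z <= 1" using assms by (auto simp: unit_fun_def)
 show "(%(t, y). U t G y) \<in> Bm (borel \<Otimes>\<^sub>M borel)" by measurable
 show "0 <= U t G y" "U t G y <= 1" for t y by (rule U_nonneg U_le_1)+
 fix t y :: real assume t: "0 <= t"
 define a where "a = Q t G y"
 define b where "b = (%r. Q r (%z. pgf (U (t - r) G z)) y)"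
 let ?b = "%r. \<beta> * eb r * b r" and ?e = "%r. ennreal (exponential_density \<beta> r)"
 have pU: "0 <= pgf (U s G z)" "pgf (U s G z) <= 1" for s z by (auto intro!: pgf_nonneg pgf_le_1 U_nonneg U_le_1)
 have bm[measurable]: "b \<in> Bm borel" unfolding b_def by measurable
 have b: "0 <= b r" "b r <= 1" for r
  using Q_nonneg[where ph="%z. pgf (U (t - r) G z)" and s=r and y=y] Q_abs[where ph="%z. pgf (U (t - r) G z)" and B=1 and s=r and y=y] pU by (auto simp: b_def)
 have a: "0 <= a" "a <= 1"
  using Q_nonneg[where ph=G and s=t and y=y] Q_abs[where ph=G and B=1 and s=t and y=y] G by (auto simp: a_def)
 let ?F = "%x. (if t < fst x then ennreal (G (y + ev_path (snd (snd x)) t))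
   else cU (t - fst x) G (y + ev_path (snd (snd x)) (fst x)) ^ fst (snd x))"
 let ?k = "%r x. \<integral>\<^sup>+k. ?F (r, k, x) \<partial>measure_pmf p"
 have inner: "?e r *
   (\<integral>\<^sup>+x. ?k r x \<partial>K) =
   ?e r * indicator {t<..} r * ennreal a +
   ennreal (indicator {0..t} r * ?b r)" for r
 proof -
  consider "r < 0" | "0 <= r" "r <= t" | "t < r" by linarith
  thus ?thesis
  proof cases
   case 1 thus ?thesis using t by (auto simp: exponential_density_def)
  next
   case 3
   have "(\<integral>\<^sup>+x. ?k r x \<partial>K) = (\<integral>\<^sup>+x. ennreal (G (y + ev_path x t)) \<partial>K)"
    using 3 by (simp add: measure_pmf.emeasure_space_1)
   also have "... = (\<integral>\<^sup>+w. ennreal (G (y + X t w)) \<partial>N)"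
    by (rule nn_integral_K[where F="%x. ennreal (G (y + x))"]) (use t in auto)
   also have "... = ennreal a"
    unfolding a_def Q_def using G by (intro nn_integral_eq_integral integrable_Q[where B=1]) auto
   finally show ?thesis using 3 by simp
  next
   case 2
   have "?k r x = ennreal (pgf (U (t - r) G (y + ev_path x r)))" for x
   proof -
    have "?k r x =
      (\<integral>\<^sup>+k. ennreal (U (t - r) G (y + ev_path x r) ^ k) \<partial>measure_pmf p)"
     using 2 by (simp add: ennreal_U[symmetric] U_nonneg ennreal_power)
    also have "... = ennreal (pgf (U (t - r) G (y + ev_path x r)))"
     unfolding pgf_def by (intro nn_integral_eq_integral pgf_int) (auto simp: U_nonneg U_le_1)
    finally show ?thesis .
   qed
   hence "(\<integral>\<^sup>+x. ?k r x \<partial>K) =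
     (\<integral>\<^sup>+x. ennreal (pgf (U (t - r) G (y + ev_path x r))) \<partial>K)" by simp
   also have "... = (\<integral>\<^sup>+w. ennreal (pgf (U (t - r) G (y + X r w))) \<partial>N)"
    by (rule nn_integral_K[where F="%x. ennreal (pgf (U (t - r) G (y + x)))"]) (use 2 in auto)
   also have "... = ennreal (b r)" unfolding b_def Q_def using pU
    by (intro nn_integral_eq_integral integrable_Q[where B=1 and ph="%z. pgf (U (t - r) G z)"]) auto
   finally show ?thesis using 2 b[of r] \<beta>_pos by (simp add: exponential_density_def ennreal_mult mult.commute)
  qed
 qed
 have "ennreal (U t G y) = (\<integral>\<^sup>+x. ?F x \<partial>D)"
  unfolding ennreal_U by (rule cU_root) (use G t in auto)
 also have "... = (\<integral>\<^sup>+r. ?e r *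
   (\<integral>\<^sup>+x. ?k r x \<partial>K) \<partial>lborel)" by (rule nn_integral_D) measurable
 also have "... = (\<integral>\<^sup>+r. ?e r * indicator {t<..} r * ennreal a \<partial>lborel) +
   (\<integral>\<^sup>+r. ennreal (indicator {0..t} r * ?b r) \<partial>lborel)"
  unfolding inner by (rule nn_integral_add) measurable
 also have "(\<integral>\<^sup>+r. ?e r * indicator {t<..} r * ennreal a \<partial>lborel) =
   ennreal (eb t * a)" using a t by (subst nn_integral_multc) (auto simp: emeasure_exponential_gt ennreal_mult)
 also have "(\<integral>\<^sup>+r. ennreal (indicator {0..t} r * ?b r) \<partial>lborel) =
   ennreal (LBINT r:{0..t}. ?b r)" unfolding set_lebesgue_integral_def real_scaleR_def
 proof (rule nn_integral_eq_integral)
  have "set_integrable lborel {0..t} ?b"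
  proof (rule set_integrable_bounded_Icc[where B=\<beta>])
   fix r assume r: "0 <= r" "r <= t"
   show "\<bar>?b r\<bar> <= \<beta>"
    using exp_mult_abs_le[of "- \<beta> * r" "b r" 1] r b[of r] \<beta>_pos by (simp add: abs_mult mult.assoc mult_left_le)
  qed measurable
  thus "integrable lborel (%r. indicat_real {0..t} r * ?b r)" by (simp add: set_integrable_def)
  show "AE r in lborel. 0 <= indicat_real {0..t} r * ?b r"
   using b \<beta>_pos by (intro AE_I2 mult_nonneg_nonneg) auto
 qed
 also have "ennreal (eb t * a) + ennreal (LBINT r:{0..t}. ?b r) =
   ennreal (eb t * a + (LBINT r:{0..t}. ?b r))"
  using a b \<beta>_pos by (intro ennreal_plus[symmetric] mult_nonneg_nonneg)
   (auto simp: set_lebesgue_integral_def intro!: Bochner_Integration.integral_nonneg)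
 finally have "U t G y = eb t * a + (LBINT r:{0..t}. ?b r)" using a b \<beta>_pos U_nonneg
  by (subst (asm) ennreal_inj) (auto simp: set_lebesgue_integral_def
    intro!: Bochner_Integration.integral_nonneg add_nonneg_nonneg mult_nonneg_nonneg)
 also have "(LBINT r:{0..t}. ?b r) =
   (LBINT r:{0..t}. eb r * Q r (%z. \<beta> * pgf (U (t - r) G z)) y)" by (simp add: b_def Q_cmult mult_ac)
 finally show "U t G y = eb t * Q t G y +
   (LBINT r:{0..t}. eb r * Q r (%z. \<beta> * pgf (U (t - r) G z)) y)" by (simp add: a_def)
qed

end

lemma LBINT_Icc_split:
 fixes h :: "real => real"
 assumes "0 <= s" "0 <= t" "h \<in> Bm borel" "!!r. 0 <= r ==> r <= s + t ==> \<bar>h r\<bar> <= B"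
 shows "(LBINT r:{0..s + t}. h r) = (LBINT r:{0..s}. h r) + (LBINT r:{s..s + t}. h r)"
proof -
 have i: "set_integrable lborel {0..s + t} h" by (rule set_integrable_bounded_Icc[OF assms(3,4)])
 have eq: "{0..s + t} = {0..s} \<union> {s<..s + t}" using assms by auto
 have "(LBINT r:{0..s + t}. h r) = (LBINT r:{0..s}. h r) + (LBINT r:{s<..s + t}. h r)" unfolding eq using assms
  by (intro set_integral_Un set_integrable_subset[OF i]) auto
 also have "(LBINT r:{s<..s + t}. h r) = (LBINT r:{s..s + t}. h r)" unfolding set_lebesgue_integral_def
 proof (rule integral_cong_AE)
  show "AE x in lborel. indicat_real {s<..s + t} x *\<^sub>R h x = indicat_real {s..s + t} x *\<^sub>R h x"
   using AE_lborel_singleton[of s] by eventually_elim (auto split: split_indicator)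
 qed (use assms(3) in measurable)
 finally show ?thesis .
qed

section \<open>The linear form of the equation, uniqueness and the semigroup property\<close>

context blevy_mean
begin

lemma unit_funD:
 assumes "unit_fun G"
 shows "G \<in> Bm borel" "0 <= G z" "G z <= 1" "\<bar>G z\<bar> <= 1" "\<bar>1 - G z\<bar> <= 1"
 using assms by (auto simp: unit_fun_def abs_le_iff intro: order_trans[of "- _" 0])

lemma unit_fun_const [simp]: "0 <= c ==> c <= 1 ==> unit_fun (%_. c)" by (simp add: unit_fun_def)

lemma unit_fun_U: "unit_fun G ==> unit_fun (%y. U t G y)" by (auto simp: unit_fun_def U_nonneg U_le_1)

lemma solvesD:
 assumes "solves G u"
 shows "case_prod u \<in> Bm (borel \<Otimes>\<^sub>M borel)" "u t \<in> Bm borel"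
  "0 <= u t y" "u t y <= 1" "\<bar>u t y\<bar> <= 1" "\<bar>1 - u t y\<bar> <= 1"
  "0 <= pgf (u t y)" "pgf (u t y) <= 1" "\<bar>pgf (u t y)\<bar> <= 1"
  "0 <= t ==> u t y = eb t * Q t G y +
    (LBINT r:{0..t}. eb r * Q r (%z. \<beta> * pgf (u (t - r) z)) y)"
proof -
 show m: "case_prod u \<in> Bm (borel \<Otimes>\<^sub>M borel)" using assms by (simp add: solves_def)
 show "u t \<in> Bm borel" using measurable_compose[OF measurable_Pair1' m, of t] by simp
 have *: "0 <= u t y \<and> u t y <= 1" using assms by (auto simp: solves_def)
 thus "0 <= u t y" "u t y <= 1" "\<bar>u t y\<bar> <= 1" "\<bar>1 - u t y\<bar> <= 1" by auto
 show "0 <= pgf (u t y)" "pgf (u t y) <= 1" using * by (auto intro: pgf_nonneg pgf_le_1)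
 thus "\<bar>pgf (u t y)\<bar> <= 1" by auto
qed (use assms in \<open>auto simp: solves_def\<close>)

lemma exp_int: "0 <= t ==> (LBINT r:{0..t}. \<beta> * eb r) = 1 - eb t"
 using \<beta>_pos by (simp add: LBINT_exp_Icc del: mult_minus_left) (simp add: LBINT_exp_Icc[of "- \<beta>", simplified])

lemma Q_uminus: "Q s (%z. - ph z) y = - Q s ph y" unfolding Q_def by simp

text \<open>\<open>change_rate\<close> for w = 1 - u with al = lam: since lam + \<beta> = \<beta> m,
  the new source \<beta> (1 - f(u)) - (lam + \<beta>) w is exactly -\<Phi>(w).\<close>

lemma solves_linear:
 assumes u: "solves G u" and G: "unit_fun G" and t: "0 <= t"
 shows "1 - u t y = el t * Q t (%z. 1 - G z) y -
  (LBINT r:{0..t}. el r * Q r (%z. \<Phi> (1 - u (t - r) z)) y)"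
proof -
 note [measurable] = solvesD(1,2)[OF u] unit_funD(1)[OF G]
 have um[measurable]: "(%(t, y). u t y) \<in> Bm (borel \<Otimes>\<^sub>M borel)" by (rule solvesD(1)[OF u])
 have "1 - u t y = el t * Q t (%z. 1 - G z) y +
   (LBINT r:{0..t}. el r * Q r (%z. \<beta> * (1 - pgf (u (t - r) z)) - (lam + \<beta>) * (1 - u (t - r) z)) y)"
 proof (rule change_rate[where w="%t y. 1 - u t y" and q="%t y. \<beta> * (1 - pgf (u t y))" and G="%z. 1 - G z" and B="max 1 \<beta>" and al=lam])
  show "(%(t, y). 1 - u t y) \<in> Bm (borel \<Otimes>\<^sub>M borel)"
   "(%(t, y). \<beta> * (1 - pgf (u t y))) \<in> Bm (borel \<Otimes>\<^sub>M borel)" by measurable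
  show "\<bar>1 - G y\<bar> <= max 1 \<beta>" for y using unit_funD(5)[OF G, of y] by simp
  show "\<bar>1 - u t y\<bar> <= max 1 \<beta>" for t y using solvesD(6)[OF u, of t y] by simp
  show "\<bar>\<beta> * (1 - pgf (u t y))\<bar> <= max 1 \<beta>" for t y
   using solvesD(7,8)[OF u, of t y] \<beta>_pos by (auto simp: abs_mult intro!: max.coboundedI2 mult_left_le)
  fix s z :: real assume s: "0 <= s"
  let ?P = "%r. Q r (%x. \<beta> * pgf (u (s - r) x)) z" and ?P' = "%r. Q r (%x. \<beta> * (1 - pgf (u (s - r) x))) z"
  have "(LBINT r:{0..s}. eb r * ?P' r) =
    (LBINT r:{0..s}. \<beta> * eb r - eb r * ?P r)"
  proof (rule LBINT_Icc_cong)
   fix r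
   have "Q r (%x. 1 - pgf (u (s - r) x)) z = 1 - Q r (%x. pgf (u (s - r) x)) z"
    by (subst Q_diff[where B=1 and C=1]) (auto simp: solvesD(1-9)[OF u])
   thus "eb r * ?P' r =
    \<beta> * eb r - eb r * ?P r"
    unfolding Q_cmult by (simp only: right_diff_distrib mult_1_right mult.left_commute mult.commute[of \<beta>])
  qed
  also have "... = 1 - eb s - (LBINT r:{0..s}. eb r * ?P r)" unfolding exp_int[OF s, symmetric]
  proof (rule LBINT_Icc_diff[where B=\<beta> and C=\<beta>])
   fix r assume r: "0 <= r" "r <= s"
   show "\<bar>\<beta> * eb r\<bar> <= \<beta>" using \<beta>_pos r by (simp add: abs_mult)
   have "\<bar>?P r\<bar> <= \<beta>"
    by (rule Q_abs) (use \<beta>_pos solvesD(1-9)[OF u] in \<open>auto simp: abs_mult intro!: mult_left_le\<close>)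
   thus "\<bar>eb r * ?P r\<bar> <= \<beta>"
    unfolding abs_mult abs_exp_cancel using \<beta>_pos r by (intro exp_mult_abs_le) auto
  qed measurable
  finally show "1 - u s z = eb s * Q s (%z. 1 - G z) z +
   (LBINT r:{0..s}. eb r * ?P' r)"
   using solvesD(10)[OF u s, of z] by (simp add: Q_diff[where B=1 and C=1] unit_funD[OF G] algebra_simps)
 qed (use t in auto)
 also have "(LBINT r:{0..t}. el r * Q r (%z. \<beta> * (1 - pgf (u (t - r) z)) - (lam + \<beta>) * (1 - u (t - r) z)) y) =
   - (LBINT r:{0..t}. el r * Q r (%z. \<Phi> (1 - u (t - r) z)) y)"
 proof -
  have "\<beta> * (1 - pgf (u s z)) - (lam + \<beta>) * (1 - u s z) = - \<Phi> (1 - u s z)" for s z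
   by (simp add: \<Phi>_def lam_eq algebra_simps)
  thus ?thesis by (simp add: Q_uminus set_lebesgue_integral_def)
 qed
 finally show ?thesis by simp
qed

text \<open>As \<Phi> is nonnegative, dropping the loss term leaves an upper bound. It is the
  first-moment bound, e^(lam t) being the mean number of particles.\<close>

lemma solves_le:
 assumes u: "solves G u" and G: "unit_fun G" and t: "0 <= t"
 shows "1 - u t y <= el t * Q t (%z. 1 - G z) y"
proof -
 have "0 <= (LBINT r:{0..t}. el r * Q r (%z. \<Phi> (1 - u (t - r) z)) y)" unfolding set_lebesgue_integral_def
  by (intro Bochner_Integration.integral_nonneg)
    (auto intro!: mult_nonneg_nonneg Q_nonneg \<Phi>_nonneg simp: solvesD(1-9)[OF u])
 thus ?thesis using solves_linear[OF assms] by simp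
qed

text \<open>The generating function is m-Lipschitz, so the difference is dominated by the solution l
  of the linear first-split equation with kernel \<beta> m e^(- \<beta> r); l is explicit because
  lam = \<beta> m - \<beta>. The case G = G' is uniqueness.\<close>

lemma solves_lipschitz:
 assumes u: "solves G u" and G: "unit_fun G" and u': "solves G' u'" and G': "unit_fun G'" and t: "0 <= t"
 shows "\<bar>u t y - u' t y\<bar> <= el t * Q t (%z. \<bar>G z - G' z\<bar>) y"
proof -
 note [measurable] = solvesD(1,2)[OF u] unit_funD(1)[OF G] solvesD(1,2)[OF u'] unit_funD(1)[OF G']
 have um[measurable]: "(%(t, y). u t y) \<in> Bm (borel \<Otimes>\<^sub>M borel)" by (rule solvesD(1)[OF u])
 have um'[measurable]: "(%(t, y). u' t y) \<in> Bm (borel \<Otimes>\<^sub>M borel)" by (rule solvesD(1)[OF u'])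
 define k where "k = (%z. \<bar>G z - G' z\<bar>)"
 have km[measurable]: "k \<in> Bm borel" unfolding k_def by measurable
 have k0: "0 <= k z" and k1: "k z <= 1" and ka: "\<bar>k z\<bar> <= 1" for z
  using unit_funD(2,3)[OF G, of z] unit_funD(2,3)[OF G', of z] by (auto simp: k_def abs_if)
 have du: "\<bar>u s z - u' s z\<bar> <= 1" for s z
  using solvesD(3,4)[OF u, of s z] solvesD(3,4)[OF u', of s z] by (auto simp: abs_if)
 define l where "l = (%s z. el s * Q s k z)"
 have lm[measurable]: "(%(s, z). l s z) \<in> Bm (borel \<Otimes>\<^sub>M borel)" unfolding l_def by measurable
 have lm'[measurable]: "l s \<in> Bm borel" for s unfolding l_def by measurable
 have Qk: "0 <= Q s k z" "Q s k z <= 1" for s z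
  using Q_nonneg[where ph=k and s=s and y=z] k0 Q_abs[where ph=k and s=s and y=z and B=1] ka by auto
 have lb: "0 <= l s z" "\<bar>l s z\<bar> <= el t" if "s <= t" for s z
 proof -
  show "0 <= l s z" unfolding l_def using Qk by simp
  have "el s * Q s k z <= el t * 1" using that lam_pos Qk by (intro mult_mono) auto
  thus "\<bar>l s z\<bar> <= el t" using \<open>0 <= l s z\<close> unfolding l_def by simp
 qed
 have bm: "0 < \<beta> * m" using \<beta>_pos m_gt1 by simp
 have "\<bar>u t y - u' t y\<bar> - l t y <= 0"
 proof (rule gronwall[where d="%t y. \<bar>u t y - u' t y\<bar> - l t y" and c="\<beta> * m" and B="1 + el t" and T=t])
  show "(%(t, y). \<bar>u t y - u' t y\<bar> - l t y) \<in> Bm (borel \<Otimes>\<^sub>M borel)" by measurable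
  show "\<bar>\<bar>u s z - u' s z\<bar> - l s z\<bar> <= 1 + el t" if "0 <= s" "s <= t" for s z
   using du[of s z] lb[of s z] that by auto
  fix s z assume s: "0 <= s" "s <= t"
  let ?P = "%v r. Q r (%x. \<beta> * pgf (v (s - r) x)) z" and ?R = "%r. Q r (%x. \<bar>u (s - r) x - u' (s - r) x\<bar>) z"
  let ?c = "%r. \<beta> * m * eb r"
  define I where "I v = (LBINT r:{0..s}. eb r * ?P v r)" for v :: "real => real => real"
  have Ib: "\<bar>eb r * ?P v r\<bar> <= \<beta>"
   if "0 <= r" and v: "solves g v" for r v g
  proof -
   have [measurable]: "v (s - r) \<in> Bm borel" by (rule solvesD(2)[OF v])
   have "\<bar>?P v r\<bar> <= \<beta>"
    by (rule Q_abs) (use \<beta>_pos solvesD(1-9)[OF v] in \<open>auto simp: abs_mult intro!: mult_left_le\<close>)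
   thus ?thesis unfolding abs_mult abs_exp_cancel using \<beta>_pos that by (intro exp_mult_abs_le) auto
  qed
  have Qd: "\<bar>Q r (%x. u (s - r) x - u' (s - r) x) z\<bar> <= 1" for r by (rule Q_abs) (use du in auto)
  have Ql: "Q r (l (s - r)) z = el (s - r) * Q s k z" if "0 <= r" "r <= s" for r
   unfolding l_def using that by (simp add: Q_cmult Q_semigroup[OF km ka])
  have Idiff: "I u - I u' = (LBINT r:{0..s}. eb r * ?P u r -
     eb r * ?P u' r)" unfolding I_def by (rule LBINT_Icc_diff[symmetric, OF _ _ Ib[OF _ u] Ib[OF _ u']]) measurable
  have "\<bar>I u - I u'\<bar> <= (LBINT r:{0..s}. \<bar>eb r * ?P u r -
     eb r * ?P u' r\<bar>)"
   unfolding Idiff set_lebesgue_integral_def by (rule order_trans[OF integral_abs_bound]) (simp add: abs_mult)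
  also have "... <= (LBINT r:{0..s}. ?c r * ?R r)"
  proof (rule LBINT_Icc_mono[where B="\<beta> + \<beta>" and C="\<beta> * m"])
   fix r assume r: "0 <= r" "r <= s"
   show "\<bar>\<bar>eb r * ?P u r -
     eb r * ?P u' r\<bar>\<bar> <= \<beta> + \<beta>"
    unfolding abs_abs by (rule order_trans[OF abs_triangle_ineq4 add_mono[OF Ib[OF r(1) u] Ib[OF r(1) u']]])
   have "\<bar>?R r\<bar> <= 1" by (rule Q_abs) (use du in auto)
   hence "eb r * \<bar>?R r\<bar> <= 1" using r \<beta>_pos by (intro exp_mult_abs_le) auto
   thus "\<bar>?c r * ?R r\<bar> <= \<beta> * m" using mult_left_mono[of "eb r * \<bar>?R r\<bar>" 1 "\<beta> * m"] bm
     \<beta>_pos m_gt1 by (simp add: abs_mult mult.assoc)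
   have "\<bar>?P u r - ?P u' r\<bar>
     = \<bar>Q r (%x. \<beta> * pgf (u (s - r) x) - \<beta> * pgf (u' (s - r) x)) z\<bar>"
    by (subst Q_diff[where B=\<beta> and C=\<beta>])
      (use \<beta>_pos solvesD(1-9)[OF u] solvesD(1-9)[OF u'] in \<open>auto simp: abs_mult intro!: mult_left_le\<close>)
   also have "... <= Q r (%x. \<bar>\<beta> * pgf (u (s - r) x) - \<beta> * pgf (u' (s - r) x)\<bar>) z"
    unfolding Q_def by (rule integral_abs_bound)
   also have "... <= Q r (%x. \<beta> * m * \<bar>u (s - r) x - u' (s - r) x\<bar>) z"
   proof (rule Q_mono[where B="\<beta> * m" and C="\<beta> * m"])
    fix x
    show *: "\<bar>\<beta> * pgf (u (s - r) x) - \<beta> * pgf (u' (s - r) x)\<bar> <= \<beta> * m * \<bar>u (s - r) x - u' (s - r) x\<bar>"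
     using pgf_lipschitz[OF solvesD(3,4)[OF u] solvesD(3,4)[OF u'], of "s - r" x "s - r" x] \<beta>_pos
     by (simp add: abs_mult mult.assoc flip: right_diff_distrib)
    have "\<beta> * m * \<bar>u (s - r) x - u' (s - r) x\<bar> <= \<beta> * m"
     using bm du[of "s - r" x] by (intro mult_left_le) auto
    thus "\<bar>\<bar>\<beta> * pgf (u (s - r) x) - \<beta> * pgf (u' (s - r) x)\<bar>\<bar> <= \<beta> * m"
     "\<bar>\<beta> * m * \<bar>u (s - r) x - u' (s - r) x\<bar>\<bar> <= \<beta> * m"
     using * bm by (auto simp: abs_mult)
   qed measurable
   finally have *: "\<bar>?P u r - ?P u' r\<bar> <=
     \<beta> * m * ?R r" unfolding Q_cmult .
   thus "\<bar>eb r * ?P u r -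
     eb r * ?P u' r\<bar> <=
     ?c r * ?R r" using mult_left_mono[OF *, of "eb r"] by (simp add: abs_mult mult_ac flip: right_diff_distrib)
  qed measurable
  finally have 1: "\<bar>I u - I u'\<bar> <= (LBINT r:{0..s}. ?c r * ?R r)" .
  have "\<bar>Q s G z - Q s G' z\<bar> = \<bar>Q s (%x. G x - G' x) z\<bar>"
   by (subst Q_diff[where B=1 and C=1]) (auto simp: unit_funD[OF G] unit_funD[OF G'])
  also have "... <= Q s k z" unfolding Q_def k_def by (rule integral_abs_bound)
  finally have 2: "\<bar>eb s * Q s G z - eb s * Q s G' z\<bar> <= eb s * Q s k z"
   by (simp add: abs_mult flip: right_diff_distrib)
  \<comment> \<open>\<open>l\<close> satisfies the linear equation with equality, so subtracting it
    cancels the initial terms and leaves an inequality to which \<open>gronwall\<close>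
    applies.\<close>
  have 3: "l s z = eb s * Q s k z + (LBINT r:{0..s}. ?c r * Q r (l (s - r)) z)"
  proof -
   have "(LBINT r:{0..s}. ?c r * Q r (l (s - r)) z) =
     (LBINT r:{0..s}. (\<beta> * m * el s * Q s k z) * exp (- (\<beta> * m) * r))"
    by (rule LBINT_Icc_cong) (simp add: Ql lam_eq algebra_simps flip: exp_add)
   also have "... = (\<beta> * m * el s * Q s k z) * ((exp (- (\<beta> * m) * s) - exp (- (\<beta> * m) * 0)) / (- (\<beta> * m)))"
    by (subst LBINT_Icc_cmult, subst LBINT_exp_Icc) (use bm s in auto)
   also have "... = el s * Q s k z * (1 - exp (- (\<beta> * m) * s))"
   proof -
    have "c * b * q * ((e - 1) / (- c)) = b * q * (1 - e)" if "0 < c" for c b q e :: real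
     using that by (simp add: field_simps)
    from this[OF bm] show ?thesis by simp
   qed
   also have "... = l s z - eb s * Q s k z" by (simp add: l_def lam_eq algebra_simps flip: exp_add)
   finally show ?thesis by simp
  qed
  have "\<bar>u s z - u' s z\<bar> <= eb s * Q s k z + \<bar>I u - I u'\<bar>"
  proof -
   have "u s z - u' s z = (eb s * Q s G z - eb s * Q s G' z) + (I u - I u')"
    unfolding I_def solvesD(10)[OF u s(1), of z] solvesD(10)[OF u' s(1), of z] by simp
   thus ?thesis using 2 abs_triangle_ineq[of "eb s * Q s G z - eb s * Q s G' z" "I u - I u'"] by simp
  qed
  hence "\<bar>u s z - u' s z\<bar> - l s z <=
    (LBINT r:{0..s}. ?c r * ?R r) -
    (LBINT r:{0..s}. ?c r * Q r (l (s - r)) z)" using 1 3 by linarith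
  also have "... = (LBINT r:{0..s}. ?c r * ?R r -
    ?c r * Q r (l (s - r)) z)"
  proof (rule LBINT_Icc_diff[symmetric, where B="\<beta> * m" and C="\<beta> * m * el t"])
   fix r assume r: "0 <= r" "r <= s"
   have 1: "\<bar>?R r\<bar> <= 1" by (rule Q_abs) (use du in auto)
   have 2: "\<bar>Q r (l (s - r)) z\<bar> <= el t" by (rule Q_abs) (use lb r s in auto)
   have 3: "?c r <= \<beta> * m" "0 <= ?c r" using bm r \<beta>_pos m_gt1 by (auto intro!: mult_left_le)
   show "\<bar>?c r * ?R r\<bar> <= \<beta> * m" unfolding abs_mult[of "?c r"] abs_of_nonneg[OF 3(2)]
    using mult_mono[OF 3(1) 1] bm by simp
   show "\<bar>?c r * Q r (l (s - r)) z\<bar> <= \<beta> * m * el t"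
    unfolding abs_mult[of "?c r"] abs_of_nonneg[OF 3(2)] using mult_mono[OF 3(1) 2] bm by simp
  qed measurable
  also have "... = (LBINT r:{0..s}. ?c r * Q r (%x. \<bar>u (s - r) x - u' (s - r) x\<bar> - l (s - r) x) z)"
  proof (rule LBINT_Icc_cong)
   fix r assume r: "0 <= r" "r <= s"
   have "Q r (%x. \<bar>u (s - r) x - u' (s - r) x\<bar> - l (s - r) x) z =
     ?R r - Q r (l (s - r)) z" by (rule Q_diff[where B=1 and C="el t"]) (use du lb r s in auto)
   thus "?c r * ?R r -
     ?c r * Q r (l (s - r)) z =
     ?c r * Q r (%x. \<bar>u (s - r) x - u' (s - r) x\<bar> - l (s - r) x) z" by (simp add: right_diff_distrib)
  qed
  finally show "\<bar>u s z - u' s z\<bar> - l s z <= (LBINT r:{0..s}. ?c r * Q r (%x. \<bar>u (s - r) x - u' (s - r) x\<bar> - l (s - r) x) z)" .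
 qed (use bm t in auto)
 thus ?thesis by (simp add: l_def k_def)
qed

text \<open>The Markov property of the branching process at time s. In the first-split equation at
  time s + t, the initial term together with the part of the time integral beyond s is the equation
  at time t transported by \<open>Q s\<close>. So the shifted function v solves the equation with
  initial value \<open>U t G\<close>, and uniqueness identifies it.\<close>

lemma U_semigroup:
 assumes G: "unit_fun G" and s: "0 <= s" and t: "0 <= t"
 shows "U (s + t) G y = U s (%y. U t G y) y"
proof -
 note sol = U_solves[OF G]
 have Gm[measurable]: "G \<in> Bm borel" by (rule unit_funD(1)[OF G])
 define q where "q = (%r z. \<beta> * pgf (U r G z))"
 have qm[measurable]: "(%(r, z). q r z) \<in> Bm (borel \<Otimes>\<^sub>M borel)" unfolding q_def by measurable
 have qm'[measurable]: "q r \<in> Bm borel" for r unfolding q_def by measurable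
 have qb: "\<bar>q r z\<bar> <= \<beta>" for r z
  unfolding q_def using solvesD(7-9)[OF sol, of r z] \<beta>_pos by (auto simp: abs_mult intro!: mult_left_le)
 define v where "v = (%s y. U (max 0 s + t) G y)"
 have "solves (%y. U t G y) v" unfolding solves_def
 proof (intro conjI allI impI)
  show "(%(s, y). v s y) \<in> Bm (borel \<Otimes>\<^sub>M borel)" unfolding v_def by measurable
  show "0 <= v s y" "v s y <= 1" for s y by (auto simp: v_def U_nonneg U_le_1)
  fix s y :: real assume s: "0 <= s"
  have Qqb: "\<bar>eb r * Q r (q r') y\<bar> <= \<beta>" if "0 <= r" for r r' y
   unfolding abs_mult abs_exp_cancel using that \<beta>_pos by (intro exp_mult_abs_le Q_abs[OF _ qb]) auto
  let ?q = "%r z. eb r * Q r (q (t - r)) z" and ?q' = "%r. eb r * Q r (q (s + t - r)) y"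
  let ?v = "LBINT r:{0..s}. eb r * Q r (%z. \<beta> * pgf (v (s - r) z)) y" and ?g = "%z. eb t * Q t G z"
  have "v s y = eb (s + t) * Q (s + t) G y + (LBINT r:{0..s + t}. ?q' r)"
   unfolding v_def q_def using solvesD(10)[OF sol, of "s + t" y] s t by simp
  also have "(LBINT r:{0..s + t}. ?q' r) =
   (LBINT r:{0..s}. ?q' r) + (LBINT r:{s..s + t}. ?q' r)"
   by (rule LBINT_Icc_split[OF s t, where B=\<beta>]) (use Qqb in auto)
  also have "(LBINT r:{0..s}. ?q' r) =
    ?v" by (rule LBINT_Icc_cong) (simp add: q_def v_def algebra_simps)
  also have "(LBINT r:{s..s + t}. ?q' r) =
    (LBINT r:{0..t}. eb (s + r) * Q (s + r) (q (s + t - (s + r))) y)"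
   using LBINT_shift[of "s + t" s "%r. ?q' r"] by simp
  also have "... = (LBINT r:{0..t}. eb s * Q s (%z. ?q r z) y)"
  proof (rule LBINT_Icc_cong)
   fix r assume r: "0 <= r" "r <= t"
   have "eb (s + r) = eb s * eb r" by (simp add: algebra_simps flip: exp_add)
   thus "eb (s + r) * Q (s + r) (q (s + t - (s + r))) y =
     eb s * Q s (%z. ?q r z) y" using r s by (simp add: Q_cmult Q_semigroup[OF qm' qb])
  qed
  also have "... = eb s * Q s (%z. LBINT r:{0..t}. ?q r z) y"
   unfolding LBINT_Icc_cmult by (subst Q_LBINT[where B=\<beta>]) (use Qqb in auto)
  also have "eb (s + t) * Q (s + t) G y = eb s * Q s ?g y"
  proof -
   have "eb (s + t) = eb s * eb t" by (simp add: algebra_simps flip: exp_add)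
   thus ?thesis using s t by (simp add: Q_cmult Q_semigroup[OF Gm unit_funD(4)[OF G]])
  qed
  also have "eb s * Q s ?g y +
    (?v +
     eb s * Q s (%z. LBINT r:{0..t}. ?q r z) y) =
   eb s * (Q s ?g y + Q s (%z. LBINT r:{0..t}. ?q r z) y) +
   ?v" by (simp add: algebra_simps)
  also have "Q s ?g y + Q s (%z. LBINT r:{0..t}. ?q r z) y =
    Q s (%z. ?g z + (LBINT r:{0..t}. ?q r z)) y"
  proof (rule Q_add[symmetric])
   show 1: "\<bar>?g z\<bar> <= 1" for z
    unfolding abs_mult abs_exp_cancel using t \<beta>_pos by (intro exp_mult_abs_le Q_abs[OF _ unit_funD(4)[OF G]]) auto
   have "(LBINT r:{0..t}. ?q r z) = U t G z - ?g z" for z using solvesD(10)[OF sol t, of z] by (simp add: q_def)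
   thus "\<bar>LBINT r:{0..t}. ?q r z\<bar> <= 2" for z
    using 1[of z] U_nonneg[of t G z] U_le_1[of t G z] by (simp only: abs_le_iff) linarith
   show "(%z. LBINT r:{0..t}. ?q r z) \<in> Bm borel" unfolding set_lebesgue_integral_def by measurable
  qed measurable
  also have "(%z. ?g z + (LBINT r:{0..t}. ?q r z)) = (%z. U t G z)" using solvesD(10)[OF sol t] by (simp add: q_def)
  finally show "v s y = eb s * Q s (%y. U t G y) y +
    ?v" .
 qed
 from solves_lipschitz[OF this unit_fun_U[OF G] U_solves[OF unit_fun_U[OF G, of t]] unit_fun_U[OF G] s, of y]
 show ?thesis using s by (simp add: v_def)
qed

end

section \<open>Comparison near the origin and escape from a ball\<close>

lemma nlog_antimono: "x <= y ==> nlog y <= nlog x" by (auto simp: nlog_def intro!: ennreal_leI)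

lemma nexp_antimono:
 assumes "x <= y"
 shows "nexp y <= nexp x"
proof (cases "y = \<infinity>")
 case False
 hence "x ~= \<infinity>" using assms by (auto simp: top_unique)
 thus ?thesis using False assms by (auto simp: nexp_def less_top intro!: ennreal_leI enn2real_mono)
qed simp

text \<open>With G the indicator of the ball, \<open>U t G y\<close> is the probability that no
  particle is outside at time t: one zero factor makes the sum of the \<open>nlog\<close>
  infinite.\<close>

definition in_ball :: "real => real => real" where
 "in_ball E z = (if \<bar>z\<bar> <= E then 1 else 0)"

definition out_ball :: "real => real => real" where
 "out_ball E z = (if E < \<bar>z\<bar> then 1 else 0)"

lemma ball_measurable [measurable]:
 "in_ball E \<in> Bm borel" "out_ball E \<in> Bm borel" unfolding in_ball_def out_ball_def by measurable

lemma out_ball_bounds: "0 <= out_ball E z" "out_ball E z <= 1" "\<bar>out_ball E z\<bar> <= 1"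
 by (auto simp: out_ball_def)

context blevy_mean
begin

lemma unit_fun_in_ball [simp]: "unit_fun (in_ball E)" by (auto simp: unit_fun_def in_ball_def)

lemma U_0:
 assumes G: "unit_fun G"
 shows "U 0 G y = G y"
proof -
 have "(LBINT r:{0..0}. h r) = 0" for h :: "real => real" unfolding set_lebesgue_integral_def
  by (rule integral_eq_zero_AE) (use AE_lborel_singleton[of 0] in eventually_elim, auto)
 thus ?thesis using solvesD(10)[OF U_solves[OF G], of 0 y] Q_0[OF unit_funD(1)[OF G], of y] by simp
qed

text \<open>Comparison of two functions that are ordered only near 0: if all particles stay in the
 ball then the products are ordered, and otherwise the product of \<^const>\<open>in_ball\<close> vanishes.\<close>

lemma U_compare:
 assumes G[measurable]: "unit_fun G" and G'[measurable]: "unit_fun G'" and le: "!!z. \<bar>z\<bar> <= E ==> G z <= G' z"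
 shows "U t G y + U t (in_ball E) y <= U t G' y + 1"
proof -
 have [measurable]: "G \<in> Bm borel" "G' \<in> Bm borel" using G G' by (auto simp: unit_fun_def)
 let ?n = "%G ta. nexp (tot cL cO cX t (%z. nlog (G z)) y ta)"
 have pt: "?n G ta + ?n (in_ball E) ta <= ?n G' ta + 1" for ta
 proof (cases "\<forall>v\<in>alive cL cO t ta. \<bar>y + position cL cX v t ta\<bar> <= E")
  case True
  hence "tot cL cO cX t (%z. nlog (G' z)) y ta <= tot cL cO cX t (%z. nlog (G z)) y ta"
   unfolding tot_def by (intro nn_integral_mono) (auto intro!: nlog_antimono le)
  thus ?thesis by (intro add_mono nexp_antimono nexp_le_1)
 next
  case False
  then obtain v where v: "v \<in> alive cL cO t ta" "E < \<bar>y + position cL cX v t ta\<bar>" by auto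
  have "nlog (in_ball E (y + position cL cX v t ta)) <= tot cL cO cX t (%z. nlog (in_ball E z)) y ta"
   unfolding tot_def
   using nn_integral_ge_point[of v UNIV "%v. if v \<in> alive cL cO t ta then nlog (in_ball E (y + position cL cX v t ta)) else 0"] v
   by simp
  hence "?n (in_ball E) ta = 0" using v by (simp add: in_ball_def nlog_def top_unique)
  thus ?thesis using nexp_le_1 by (simp add: add_increasing)
 qed
 have "cU t G y + cU t (in_ball E) y = (\<integral>\<^sup>+ta. ?n G ta + ?n (in_ball E) ta \<partial>TM)"
  unfolding cU_def by (rule nn_integral_add[symmetric]) measurable
 also have "... <= (\<integral>\<^sup>+ta. ?n G' ta + 1 \<partial>TM)" by (intro nn_integral_mono pt)
 also have "... = cU t G' y + 1" unfolding cU_def by (subst nn_integral_add) (auto simp: TM.emeasure_space_1)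
 finally have "ennreal (U t G y + U t (in_ball E) y) <= ennreal (U t G' y + 1)"
  unfolding ennreal_U[symmetric] by (simp add: U_nonneg ennreal_plus flip: ennreal_1)
 thus ?thesis by (subst (asm) ennreal_le_iff) (auto simp: U_nonneg)
qed

lemma U_mono:
 assumes "unit_fun G" "unit_fun G'" "!!z. G z <= G' z"
 shows "U t G y <= U t G' y"
proof -
 let ?n = "%G ta. nexp (tot cL cO cX t (%z. nlog (G z)) y ta)"
 have "tot cL cO cX t (%z. nlog (G' z)) y ta <= tot cL cO cX t (%z. nlog (G z)) y ta" for ta
  unfolding tot_def by (intro nn_integral_mono) (auto intro!: nlog_antimono assms)
 hence "ennreal (U t G y) <= ennreal (U t G' y)" unfolding ennreal_U cU_def by (intro nn_integral_mono nexp_antimono)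
 thus ?thesis by (simp add: U_nonneg)
qed

definition tail :: "real => real => real" where
 "tail s x = Q s (out_ball x) 0"

lemma tail_nonneg: "0 <= tail s x" unfolding tail_def by (rule Q_nonneg) (rule out_ball_bounds)

lemma tail_eq:
 assumes "0 <= s"
 shows "tail s x = measure N {w\<in>space N. \<bar>\<xi> s w\<bar> > x}"
proof -
 have "tail s x = (LINT w|N. indicator {w\<in>space N. \<bar>\<xi> s w\<bar> > x} w)"
  unfolding tail_def Q_def using assms
  by (intro Bochner_Integration.integral_cong) (auto simp: out_ball_def X_eq split: split_indicator)
 thus ?thesis by (simp add: Collect_conj_eq Int_commute Int_left_commute)
qed

lemma Q_out_ball_le_tail:
 assumes "!!z. E < \<bar>y + z\<bar> ==> x < \<bar>z\<bar>"
 shows "Q s (out_ball E) y <= tail s x" unfolding tail_def Q_def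
 by (intro integral_mono integrable_Q[where ph="out_ball E" and B=1] integrable_Q[where ph="out_ball x" and B=1])
   (use assms in \<open>auto simp: out_ball_def\<close>)

text \<open>The probability that the walk with step law \<open>X dl\<close>, started at y, takes k
  steps, all of size at most E / 3, and ends outside the ball of radius E. The skeleton at multiples
  of \<open>dl\<close> stands in for the path, so that no supremum over time enters.\<close>

primrec step_prob :: "real => real => nat => real => real" where
 "step_prob dl E 0 y = out_ball E y"
| "step_prob dl E (Suc k) y = (LINT w|N. in_ball (E / 3) (X dl w) * step_prob dl E k (y + X dl w))"

lemma step_prob_measurable [measurable]: "step_prob dl E k \<in> Bm borel"
proof (induction k)
 case 0 thus ?case by (simp add: step_prob.simps[abs_def])
next
 case (Suc k)
 note [measurable] = Suc
 have "(%y. (LINT w|N. in_ball (E / 3) (X dl w) * step_prob dl E k (y + X dl w))) \<in> Bm borel" by measurable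
 thus ?case by (simp add: step_prob.simps[abs_def])
qed

lemma step_prob_int:
 assumes [measurable]: "ph \<in> Bm borel" and "!!z. 0 <= ph z" "!!z. ph z <= 1"
 shows "integrable N (%w. in_ball (E / 3) (X dl w) * ph (y + X dl w))"
 by (rule N.integrable_const_bound[where B=1]) (use assms in \<open>auto simp: in_ball_def abs_mult\<close>)

lemma step_prob_bounds: "0 <= step_prob dl E k y \<and> step_prob dl E k y <= 1"
proof (induction k arbitrary: y)
 case 0 thus ?case by (simp add: out_ball_def)
next
 case (Suc k)
 have "step_prob dl E (Suc k) y <= (LINT w|N. 1)" unfolding step_prob.simps using Suc
  by (intro integral_mono step_prob_int) (auto simp: in_ball_def)
 thus ?case using Suc by (auto simp: N.prob_space in_ball_def intro!: Bochner_Integration.integral_nonneg)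
qed

lemma step_prob_le_Q:
 assumes "0 <= dl"
 shows "step_prob dl E k y <= Q (real k * dl) (out_ball E) y"
proof (induction k arbitrary: y)
 case 0 thus ?case by (simp add: Q_0)
next
 case (Suc k)
 have "step_prob dl E (Suc k) y <= Q dl (Q (real k * dl) (out_ball E)) y" unfolding step_prob.simps Q_def[of dl]
 proof (intro integral_mono step_prob_int integrable_Q[where B=1])
  show "in_ball (E / 3) (X dl w) * step_prob dl E k (y + X dl w) <= Q (real k * dl) (out_ball E) (y + X dl w)" for w
   using Suc[of "y + X dl w"] by (auto simp: in_ball_def intro!: Q_nonneg out_ball_bounds)
  show "\<bar>Q (real k * dl) (out_ball E) z\<bar> <= 1" for z by (rule Q_abs) (auto simp: out_ball_bounds)
 qed (use step_prob_bounds in auto)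
 also have "... = Q (dl + real k * dl) (out_ball E) y"
  by (rule Q_semigroup[where B=1]) (use assms in \<open>auto simp: out_ball_bounds\<close>)
 finally show ?case by (simp add: algebra_simps)
qed

lemma step_prob_le_tail:
 assumes "0 <= dl" "\<bar>y\<bar> <= 2 * E / 3"
 shows "step_prob dl E k y <= tail (real k * dl) (E / 3)"
 by (rule order_trans[OF step_prob_le_Q[OF assms(1)] Q_out_ball_le_tail]) (use assms in auto)

text \<open>To leave the ball of radius \<open>E\<close> with steps of size at most \<open>E / 3\<close>, the walk has to be between
 \<open>E / 3\<close> and \<open>2 * E / 3\<close> at some time and then make a second displacement larger than \<open>E / 3\<close>.\<close>

lemma step_prob_two_jumps:
 assumes dl: "0 <= dl" and q: "!!j. j <= k ==> tail (real j * dl) (E / 3) <= q" and y: "\<bar>y\<bar> <= E / 3"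
 shows "step_prob dl E k y <= q * (\<Sum>j<k. Q (real (Suc j) * dl) (out_ball (E / 3)) y)" using q y
proof (induction k arbitrary: y)
 case 0 thus ?case by (auto simp: out_ball_def)
next
 case (Suc k)
 let ?I = "out_ball (E / 3)"
 let ?S = "%y. \<Sum>j<k. Q (real (Suc j) * dl) ?I y"
 have q0: "0 <= q" using Suc.prems(1)[of 0] tail_nonneg[of 0 "E / 3"] by auto
 have QI: "0 <= Q s ?I z" "\<bar>Q s ?I z\<bar> <= 1" for s z by (auto intro!: Q_nonneg Q_abs simp: out_ball_bounds)
 have S0: "0 <= ?S z" for z by (intro sum_nonneg QI)
 have Sb: "\<bar>?S z\<bar> <= real k" for z
  using sum_mono[of "{..<k}" "%j. Q (real (Suc j) * dl) ?I z" "%_. 1"] S0[of z] QI(2) by (auto simp: abs_le_iff)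
 have Sm[measurable]: "?S \<in> Bm borel" by measurable
 have "step_prob dl E (Suc k) y <= Q dl (%z. q * (?S z + ?I z)) y"
  unfolding step_prob.simps Q_def[of dl "%z. q * (?S z + ?I z)"]
 proof (intro integral_mono step_prob_int integrable_Q[where B="q * (real k + 1)"])
  show "\<bar>q * (?S z + ?I z)\<bar> <= q * (real k + 1)" for z
   unfolding abs_mult using q0 Sb[of z] out_ball_bounds[of "E / 3" z]
   by (intro mult_mono order_trans[OF abs_triangle_ineq add_mono]) auto
  fix w
  let ?z = "y + X dl w"
  show "in_ball (E / 3) (X dl w) * step_prob dl E k ?z <= q * (?S ?z + ?I ?z)"
  proof (cases "\<bar>X dl w\<bar> <= E / 3")
   case True
   show ?thesis
   proof (cases "\<bar>?z\<bar> <= E / 3")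
    case z: True
    have "step_prob dl E k ?z <= q * ?S ?z" by (rule Suc.IH) (use Suc.prems z in auto)
    thus ?thesis using True z by (simp add: in_ball_def out_ball_def)
   next
    case False
    \<comment> \<open>At its first step beyond E / 3 the walk is still within 2 E / 3: it came from
      within E / 3 by a step of at most E / 3.\<close>
    have "step_prob dl E k ?z <= tail (real k * dl) (E / 3)"
     using abs_triangle_ineq[of y "X dl w"] True Suc.prems(2) by (intro step_prob_le_tail[OF dl]) linarith
    also have "... <= q" by (rule Suc.prems(1)) simp
    also have "... <= q * (?S ?z + ?I ?z)"
     using q0 S0[of ?z] False mult_left_mono[of 1 "?S ?z + 1" q] by (simp add: out_ball_def)
    finally show ?thesis using True by (simp add: in_ball_def)
   qed
  next
   case False
   thus ?thesis using q0 S0[of ?z] out_ball_bounds(1)[of "E / 3" ?z]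
    by (auto simp: in_ball_def intro!: mult_nonneg_nonneg add_nonneg_nonneg)
  qed
 qed (use step_prob_bounds in auto)
 also have "... = q * (Q dl ?S y + Q dl ?I y)"
  unfolding Q_cmult by (subst Q_add[OF Sm Sb, where C=1]) (auto simp: out_ball_bounds)
 also have "Q dl ?S y = (\<Sum>j<k. Q (real (Suc (Suc j)) * dl) ?I y)"
 proof -
  have "Q dl ?S y = (\<Sum>j<k. Q dl (Q (real (Suc j) * dl) ?I) y)" unfolding Q_def[of dl]
   by (rule Bochner_Integration.integral_sum) (rule integrable_Q[OF _ QI(2)], measurable)
  also have "... = (\<Sum>j<k. Q (real (Suc (Suc j)) * dl) ?I y)"
   by (intro sum.cong refl, subst Q_semigroup[where B=1])
     (use dl in \<open>auto simp: out_ball_bounds algebra_simps\<close>)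
  finally show ?thesis .
 qed
 also have "(\<Sum>j<k. Q (real (Suc (Suc j)) * dl) ?I y) + Q dl ?I y = (\<Sum>j<Suc k. Q (real (Suc j) * dl) ?I y)"
  by (subst sum.lessThan_Suc_shift) simp
 finally show ?case .
qed

text \<open>The first-moment bound \<open>solves_le\<close>, applied to one period \<open>dl\<close>
  after the other: a particle outside either descends from one that moved by more than E / 3 in some
  period, or its line made small steps only. The powers of e^(lam dl) are the mean numbers of
  particles after the respective periods.\<close>

lemma U_in_ball_steps:
 assumes dl: "0 <= dl"
 shows "1 - U (real k * dl) (in_ball E) y <=
  (\<Sum>j<k. el dl ^ Suc j) * tail dl (E / 3) + el dl ^ k * step_prob dl E k y"
proof (induction k arbitrary: y)
 case 0
 have "U (real 0 * dl) (in_ball E) y = in_ball E y" by (simp add: U_0)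
 thus ?case by (simp only:) (simp add: in_ball_def out_ball_def)
next
 case (Suc k)
 let ?e = "el dl" and ?q = "tail dl (E / 3)"
 let ?A = "(\<Sum>j<k. ?e ^ Suc j) * ?q"
 let ?p = "%w. in_ball (E / 3) (X dl w) * step_prob dl E k (y + X dl w)" and ?o = "%w. out_ball (E / 3) (0 + X dl w)"
 let ?u = "%z. U (real k * dl) (in_ball E) z"
 have A0: "0 <= ?A" by (intro mult_nonneg_nonneg sum_nonneg tail_nonneg) auto
 have "U (real (Suc k) * dl) (in_ball E) y = U dl ?u y"
  using U_semigroup[of "in_ball E" dl "real k * dl" y] dl by (simp add: algebra_simps)
 hence "1 - U (real (Suc k) * dl) (in_ball E) y <= ?e * Q dl (%z. 1 - ?u z) y"
  using solves_le[OF U_solves[OF unit_fun_U] unit_fun_U dl, of "in_ball E" "real k * dl" y] by simp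
 also have "Q dl (%z. 1 - ?u z) y <= ?A + ?e ^ k * step_prob dl E (Suc k) y + ?q"
 proof -
  have "Q dl (%z. 1 - ?u z) y <= (LINT w|N. ?A + ?e ^ k * ?p w + ?o w)" unfolding Q_def
  proof (intro integral_mono)
   show "integrable N (%w. 1 - ?u (y + X dl w))"
    by (rule integrable_Q[where B=1 and ph="%z. 1 - ?u z"]) (auto simp: abs_le_iff U_nonneg U_le_1 intro: order_trans[OF U_le_1])
   show "integrable N (%w. ?A + ?e ^ k * ?p w + ?o w)"
    by (intro Bochner_Integration.integrable_add integrable_mult_right step_prob_int
      integrable_Q[where B=1 and ph="out_ball (E / 3)"]) (use step_prob_bounds in \<open>auto simp: out_ball_bounds\<close>)
   fix w
   show "1 - ?u (y + X dl w) <= ?A + ?e ^ k * ?p w + ?o w"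
    using Suc.IH[of "y + X dl w"] A0 U_nonneg[of "real k * dl" "in_ball E" "y + X dl w"]
    by (auto simp: in_ball_def[of "E / 3"] out_ball_def[of "E / 3"])
  qed
  also have "... = ?A + ?e ^ k * step_prob dl E (Suc k) y + ?q"
  proof -
   have 1: "integrable N (%w. ?e ^ k * ?p w)"
    by (intro integrable_mult_right step_prob_int) (use step_prob_bounds in auto)
   have 2: "integrable N (%w. ?o w)"
    by (rule integrable_Q[where B=1 and ph="out_ball (E / 3)"]) (auto simp: out_ball_bounds)
   have 3: "integrable N (%w. ?A)" by simp
   have "(LINT w|N. ?A + ?e ^ k * ?p w + ?o w)
    = (LINT w|N. ?A) + (LINT w|N. ?e ^ k * ?p w) + (LINT w|N. ?o w)"
    by (subst Bochner_Integration.integral_add[OF Bochner_Integration.integrable_add[OF 3 1] 2],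
      subst Bochner_Integration.integral_add[OF 3 1], rule refl)
   thus ?thesis by (simp add: tail_def Q_def N.prob_space)
  qed
  finally show ?thesis .
 qed
 also have "?e * (?A + ?e ^ k * step_prob dl E (Suc k) y + ?q) =
   (\<Sum>j<Suc k. ?e ^ Suc j) * ?q + ?e ^ Suc k * step_prob dl E (Suc k) y"
  by (subst sum.lessThan_Suc_shift) (simp add: algebra_simps sum_distrib_left sum_distrib_right)
 finally show ?case by (simp add: mult_left_mono)
qed

text \<open>One big jump costs a multiple of e^(lam (r - t)), small when r is well before t. Two
  displacements cost the square of the tail, and against the at most e^(lam t) particles a factor
  e^(-lam t) survives, up to powers of t.\<close>

lemma U_in_ball_bound:
 assumes r: "0 < r" "r <= t" and E: "0 < E" and C: "0 <= C"
  and tail: "!!s. 0 < s ==> s <= t ==> tail s (E / 3) <= C * s * en t"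
 shows "1 - U r (in_ball E) 0 <= C * exp lam / lam * el (r - t) + (t + 1) * (C * t)\<^sup>2 * en t"
proof -
 \<comment> \<open>An integral number of steps of length at most 1: e^(lam dl) stays below e^lam,
   and the geometric sum, of size e^(lam r) / (lam dl), meets the tail bound C dl e^(-lam t), so
   that \<open>dl\<close> cancels.\<close>
 define k where "k = nat \<lceil>r\<rceil>"
 define dl where "dl = r / real k"
 have k: "0 < k" "r <= real k" "real k <= r + 1" using r unfolding k_def by (auto simp: of_nat_nat)
 have dl: "0 < dl" "dl <= 1" "real k * dl = r" using k r by (auto simp: dl_def)
 let ?e = "el dl"
 have dlt: "dl <= t" using mult_right_mono[of 1 "real k" dl] dl k r by simp
 have tail0: "tail 0 (E / 3) = 0" using E by (simp add: tail_def Q_0 out_ball_def)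
 have q: "tail (real j * dl) (E / 3) <= C * t * en t" if "j <= k" for j
 proof (cases "j = 0")
  case True
  thus ?thesis using tail0 C r by simp
 next
  case False
  have jt: "real j * dl <= t" using that dl r mult_right_mono[of "real j" "real k" dl] by auto
  have "tail (real j * dl) (E / 3) <= C * (real j * dl) * en t" by (rule tail) (use False dl jt in auto)
  also have "... <= C * t * en t" using jt C by (intro mult_right_mono mult_left_mono) auto
  finally show ?thesis .
 qed
 have ek: "?e ^ k = el r" using dl(3) by (metis exp_of_nat_mult mult.left_commute)
 have "step_prob dl E k 0 <= C * t * en t * (\<Sum>j<k. tail (real (Suc j) * dl) (E / 3))"
  unfolding tail_def by (rule step_prob_two_jumps) (use dl E q in \<open>auto simp: tail_def\<close>)
 also have "... <= C * t * en t * (\<Sum>j<k. C * t * en t)" using C r by (intro mult_left_mono sum_mono q) auto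
 also have "... = real k * (C * t)\<^sup>2 * (en t)\<^sup>2" by (simp add: power2_eq_square)
 also have "... <= (t + 1) * (C * t)\<^sup>2 * (en t)\<^sup>2" using k r by (intro mult_right_mono) auto
 finally have b: "step_prob dl E k 0 <= (t + 1) * (C * t)\<^sup>2 * (en t)\<^sup>2" .
 have "el r * step_prob dl E k 0 <= el t * ((t + 1) * (C * t)\<^sup>2 * (en t)\<^sup>2)"
  using r lam_pos b step_prob_bounds by (intro mult_mono) auto
 also have "... = (t + 1) * (C * t)\<^sup>2 * en t" by (simp add: power2_eq_square exp_minus field_simps)
 finally have 2: "el r * step_prob dl E k 0 <= (t + 1) * (C * t)\<^sup>2 * en t" .
 have e1: "lam * dl <= ?e - 1" using exp_ge_add_one_self[of "lam * dl"] by linarith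
 have ne: "?e ~= 1" using lam_pos dl by simp
 have "(\<Sum>j<k. ?e ^ Suc j) = ?e * ((?e ^ k - 1) / (?e - 1))"
  by (simp only: power_Suc sum_distrib_left[symmetric] geometric_sum[OF ne])
 also have "... <= exp lam * (el r / (lam * dl))"
 proof (rule mult_mono)
  show "(?e ^ k - 1) / (?e - 1) <= el r / (lam * dl)"
   unfolding ek by (rule frac_le[OF _ _ _ e1]) (use lam_pos dl in auto)
  have "1 <= ?e" using lam_pos dl by simp
  thus "0 <= (?e ^ k - 1) / (?e - 1)" by (intro divide_nonneg_nonneg) (auto simp: one_le_power)
 qed (use lam_pos dl in auto)
 finally have "(\<Sum>j<k. ?e ^ Suc j) * tail dl (E / 3) <= exp lam * (el r / (lam * dl)) * (C * dl * en t)"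
  using dl dlt lam_pos by (intro mult_mono tail) (auto simp: tail_nonneg)
 also have "... = C * exp lam / lam * el (r - t)" using dl lam_pos by (simp add: field_simps exp_diff exp_minus)
 finally have 1: "(\<Sum>j<k. ?e ^ Suc j) * tail dl (E / 3) <= C * exp lam / lam * el (r - t)" .
 show ?thesis using U_in_ball_steps[of dl k E 0] 1 2 dl ek by simp
qed

end

section \<open>Test functions\<close>

lemma Cc_plusD:
 assumes "g \<in> Cc_plus"
 shows "continuous_on (- {0}) g" "0 <= g x" "g 0 = 0" using assms by (auto simp: Cc_plus_def)

lemma Cc_plus_zero:
 assumes "g \<in> Cc_plus"
 obtains dl where "0 < dl" "!!x. \<bar>x\<bar> < ereal dl ==> g x = 0"
proof -
 obtain dl where "0 < dl" "!!x. x ~= 0 ==> \<bar>x\<bar> < ereal dl ==> g x = 0"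
  using assms by (auto simp: Cc_plus_def)
 thus ?thesis using that Cc_plusD(3)[OF assms] by metis
qed

text \<open>A test function is 0 in a neighbourhood of 0, so it is continuous there too, and hence
  on the whole compact extended line.\<close>

lemma continuous_on_Cc_plus:
 assumes "g \<in> Cc_plus"
 shows "continuous_on UNIV (g :: ereal => real)"
proof -
 obtain dl where dl: "0 < dl" "!!x. \<bar>x\<bar> < ereal dl ==> g x = 0" using Cc_plus_zero[OF assms] by metis
 have o: "open {x::ereal. \<bar>x\<bar> < ereal dl}"
 proof -
  have "{x::ereal. \<bar>x\<bar> < ereal dl} = {- ereal dl<..<ereal dl}"
  proof (intro set_eqI)
   show "x \<in> {x. \<bar>x\<bar> < ereal dl} \<longleftrightarrow> x \<in> {- ereal dl<..<ereal dl}" for x :: ereal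
    by (cases x) auto
  qed
  thus ?thesis by simp
 qed
 have "continuous_on {x::ereal. \<bar>x\<bar> < ereal dl} g"
  by (rule continuous_on_eq[where f="%_. 0"]) (use dl in auto)
 hence "continuous_on (- {0} \<union> {x::ereal. \<bar>x\<bar> < ereal dl}) g"
  by (intro continuous_on_open_Un Cc_plusD(1)[OF assms] o) auto
 moreover have "- {0} \<union> {x::ereal. \<bar>x\<bar> < ereal dl} = UNIV" using dl by auto
 ultimately show ?thesis by simp
qed

lemma Cc_plus_measurable:
 assumes "g \<in> Cc_plus"
 shows "g \<in> Bm borel" "(%x. g (ereal x)) \<in> Bm borel"
proof -
 show m[measurable]: "g \<in> Bm borel" by (rule borel_measurable_continuous_onI[OF continuous_on_Cc_plus[OF assms]])
 show "(%x. g (ereal x)) \<in> Bm borel" by measurable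
qed

lemma Cc_plus_comp_Lipschitz:
 assumes g: "g \<in> Cc_plus" and F: "F 0 = 0" "!!y. 0 <= y ==> 0 <= F y"
  and L: "!!y y'. 0 <= y ==> 0 <= y' ==> \<bar>F y - F y'\<bar> <= L * \<bar>y - y'\<bar>"
 shows "(%x. F (g x) :: real) \<in> Cc_plus"
proof -
 have L0: "0 <= L" using L[of 0 1] by auto
 have "continuous_on {0..} F"
 proof (rule lipschitz_on_continuous_on)
  show "L-lipschitz_on {0..} F" by (rule lipschitz_onI) (use L L0 in \<open>auto simp: dist_real_def\<close>)
 qed
 hence "continuous_on (- {0}) (%x. F (g x))"
  by (rule continuous_on_compose2[OF _ Cc_plusD(1)[OF g]]) (use Cc_plusD[OF g] in auto)
 thus ?thesis using g F by (fastforce simp: Cc_plus_def)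
qed

lemma Cc_plus_cmult: "g \<in> Cc_plus ==> 0 <= c ==> (%x. c * g x) \<in> Cc_plus"
 by (rule Cc_plus_comp_Lipschitz[where L=c]) (auto simp: abs_mult simp flip: right_diff_distrib)

lemma abs_exp_diff_le:
 fixes a b :: real
 assumes "0 <= a" "0 <= b"
 shows "\<bar>exp (- a) - exp (- b)\<bar> <= \<bar>a - b\<bar>"
proof -
 have *: "exp (- x) - exp (- y) <= y - x" if "0 <= x" "x <= y" for x y :: real
 proof -
  have "exp (- x) - exp (- y) = exp (- x) * (1 - exp (- (y - x)))" by (simp add: algebra_simps flip: exp_add)
  also have "... <= 1 * (y - x)"
  proof (rule mult_mono)
   show "1 - exp (- (y - x)) <= y - x" using exp_ge_add_one_self[of "- (y - x)"] by linarith
  qed (use that in auto)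
  finally show ?thesis by simp
 qed
 show ?thesis using *[of a b] *[of b a] assms by (cases "a <= b") auto
qed

text \<open>By continuity on the extended line g has limits at both infinities, so its oscillation
  is small near them. In between a compact interval remains, enlarged by 1 so that two points at
  distance at most 1 always share one of the three regions.\<close>

lemma Cc_plus_uniform:
 assumes g: "g \<in> Cc_plus" and "0 < et"
 obtains ep where "0 < ep" "!!x y. \<bar>x - y\<bar> <= ep ==> \<bar>g (ereal x) - g (ereal y)\<bar> <= et"
proof -
 let ?f = "%x::real. g (ereal x)"
 have cont: "continuous_on UNIV ?f"
  using continuous_on_Cc_plus[OF g] by (auto intro!: continuous_intros intro: continuous_on_compose2)
 have "(g \<longlongrightarrow> g \<infinity>) (at_left \<infinity>)" "(g \<longlongrightarrow> g (- \<infinity>)) (at_right (- \<infinity>))"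
  using continuous_on_Cc_plus[OF g] unfolding continuous_on_def by (auto intro: tendsto_within_subset)
 hence "(?f \<longlongrightarrow> g \<infinity>) at_top" "(?f \<longlongrightarrow> g (- \<infinity>)) at_bot"
  unfolding at_left_PInf at_right_MInf by (auto simp: filterlim_filtermap)
 hence "eventually (%x. dist (?f x) (g \<infinity>) < et / 2) at_top" "eventually (%x. dist (?f x) (g (- \<infinity>)) < et / 2) at_bot"
  using \<open>0 < et\<close> by (auto dest!: tendstoD[where e="et / 2"])
 then obtain R1 R2 where R1: "!!x. R1 <= x ==> dist (?f x) (g \<infinity>) < et / 2"
  and R2: "!!x. x <= R2 ==> dist (?f x) (g (- \<infinity>)) < et / 2"
  unfolding eventually_at_top_linorder eventually_at_bot_linorder by auto
 have close: "\<bar>a - b\<bar> <= et" if "dist a c < et / 2" "dist b c < et / 2" for a b c :: real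
  using that by (auto simp: dist_real_def abs_if split: if_splits)
 have "uniformly_continuous_on {R2 - 1..R1 + 1} ?f"
  by (rule compact_uniformly_continuous) (auto intro: continuous_on_subset[OF cont])
 then obtain d where d: "0 < d" "!!x y. x \<in> {R2 - 1..R1 + 1} ==> y \<in> {R2 - 1..R1 + 1} ==> dist y x < d ==> dist (?f y) (?f x) < et"
  using \<open>0 < et\<close> unfolding uniformly_continuous_on_def by metis
 show ?thesis
 proof (rule that[of "min 1 (d / 2)"])
  show "0 < min 1 (d / 2)" using d by auto
  fix x y :: real assume xy: "\<bar>x - y\<bar> <= min 1 (d / 2)"
  consider "R1 <= x" "R1 <= y" | "x <= R2" "y <= R2" | "x \<in> {R2 - 1..R1 + 1}" "y \<in> {R2 - 1..R1 + 1}"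
   using xy by (auto simp: abs_if split: if_splits) linarith+
  thus "\<bar>?f x - ?f y\<bar> <= et"
  proof cases
   case 3
   thus ?thesis using d(2)[of y x] xy d(1) by (auto simp: dist_real_def)
  qed (use close R1 R2 in blast)+
 qed
qed

text \<open>Piecewise linear in |x|: 0 up to dl / 4 and 1 from dl / 2 on. Clamping x to [- dl, dl]
  first keeps \<open>real_of_ereal\<close> away from the infinite values, where it is not
  continuous.\<close>

definition cutoff :: "real => ereal => real" where
 "cutoff dl x = min 1 (max 0 (4 / dl * \<bar>real_of_ereal (max (- ereal dl) (min (ereal dl) x))\<bar> - 1))"

lemma cutoff_Cc_plus:
 assumes "0 < dl"
 shows "cutoff dl \<in> Cc_plus"
proof -
 have "continuous_on UNIV (%x. real_of_ereal (max (- ereal dl) (min (ereal dl) x)))"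
 proof (rule continuous_on_compose2[OF continuous_on_real])
  show "continuous_on UNIV (%x. max (- ereal dl) (min (ereal dl) x))"
   by (intro continuous_on_max continuous_on_min continuous_intros)
  have "max (- ereal dl) (min (ereal dl) x) ~= \<infinity>" "max (- ereal dl) (min (ereal dl) x) ~= - \<infinity>" for x
   by (cases x; simp add: max_def min_def)+
  thus "(%x. max (- ereal dl) (min (ereal dl) x)) ` UNIV \<subseteq> UNIV - {\<infinity>, - \<infinity>}" by auto
 qed
 hence "continuous_on (- {0}) (cutoff dl)"
  unfolding cutoff_def[abs_def] by (intro continuous_intros) (auto intro: continuous_on_subset)
 moreover have "cutoff dl x = 0" if "\<bar>x\<bar> < ereal (dl / 4)" for x
  using that assms by (cases x) (auto simp: cutoff_def max_def min_def field_simps)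
 ultimately show ?thesis
  using assms by (auto simp: Cc_plus_def intro!: exI[of _ "dl / 4"]) (auto simp: cutoff_def max_def min_def)
qed

lemma cutoff_1: "0 < dl ==> dl / 2 <= \<bar>x\<bar> ==> cutoff dl (ereal x) = 1"
 by (auto simp: cutoff_def max_def min_def field_simps)

lemma cutoff_bounds: "0 <= cutoff dl x" "cutoff dl x <= 1" by (auto simp: cutoff_def)

text \<open>Upper (\<open>et > 0\<close>) and lower (\<open>et < 0\<close>) envelopes of a test function under small translations.\<close>

definition envelope :: "(ereal => real) => real => real => ereal => real" where
 "envelope g dl et x = max 0 (g x + et * cutoff dl x)"

lemma envelope_Cc_plus:
 assumes g: "g \<in> Cc_plus" and "0 < dl"
 shows "envelope g dl et \<in> Cc_plus"
proof -
 obtain d where d: "0 < d" "!!x. \<bar>x\<bar> < ereal d ==> g x = 0" using Cc_plus_zero[OF g] by metis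
 obtain d' where d': "0 < d'" "!!x. \<bar>x\<bar> < ereal d' ==> cutoff dl x = 0"
  using Cc_plus_zero[OF cutoff_Cc_plus[OF assms(2)]] by metis
 have "continuous_on (- {0}) (envelope g dl et)" unfolding envelope_def[abs_def]
  by (intro continuous_intros Cc_plusD(1)[OF g] Cc_plusD(1)[OF cutoff_Cc_plus[OF assms(2)]])
 moreover have "envelope g dl et x = 0" if "\<bar>x\<bar> < ereal (min d d')" for x
  using d(2)[of x] d'(2)[of x] that by (cases x) (auto simp: envelope_def)
 ultimately show ?thesis using d(1) d'(1) by (auto simp: Cc_plus_def envelope_def intro!: exI[of _ "min d d'"])
qed

text \<open>Where |y| >= dl / 2 the cutoff is 1 and uniform continuity decides. Where |y| < dl / 2
  the shifted point x stays within \<open>dl\<close>, so g vanishes at both.\<close>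

lemma envelope_bounds:
 assumes dl: "0 < dl" and z: "!!x. \<bar>x\<bar> < ereal dl ==> g x = 0" and g0: "!!x. 0 <= g x"
  and eps: "0 < ep" "ep <= dl / 2" and u: "!!x y. \<bar>x - y\<bar> <= ep ==> \<bar>g (ereal x) - g (ereal y)\<bar> <= et"
  and xy: "\<bar>x - y\<bar> <= ep"
 shows "g (ereal x) <= envelope g dl et (ereal y)" "envelope g dl (- et) (ereal y) <= g (ereal x)"
proof -
 have et: "0 <= et" using u[of 0 0] eps by auto
 show "g (ereal x) <= envelope g dl et (ereal y)"
 proof (cases "dl / 2 <= \<bar>y\<bar>")
  case True
  thus ?thesis using u[OF xy] cutoff_1[OF dl, of y] by (auto simp: envelope_def)
 next
  case False
  hence "\<bar>x\<bar> < dl" using xy eps by (auto simp: abs_if split: if_splits)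
  thus ?thesis using z[of "ereal x"] by (simp add: envelope_def)
 qed
 show "envelope g dl (- et) (ereal y) <= g (ereal x)"
 proof (cases "dl / 2 <= \<bar>y\<bar>")
  case True
  thus ?thesis using u[OF xy] cutoff_1[OF dl, of y] g0[of "ereal x"] by (auto simp: envelope_def)
 next
  case False
  hence "\<bar>y\<bar> < dl" using dl by auto
  hence "envelope g dl (- et) (ereal y) = 0"
   using z[of "ereal y"] et cutoff_bounds(1)[of dl "ereal y"] by (simp add: envelope_def)
  thus ?thesis using g0 by simp
 qed
qed

lemma envelope_dist: "\<bar>envelope g dl et x - g x\<bar> <= \<bar>et\<bar>" if "0 <= g x"
proof -
 have "\<bar>et * cutoff dl x\<bar> <= \<bar>et\<bar> * 1"
  unfolding abs_mult using cutoff_bounds[of dl x] by (intro mult_left_mono) auto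
 moreover have "\<bar>max 0 (a + b) - a\<bar> <= \<bar>b\<bar>" if "0 <= a" for a b :: real
  using that by (auto simp: max_def)
 ultimately show ?thesis using that by (force simp: envelope_def intro: order_trans)
qed

lemma cutoff_zero: "0 < dl ==> \<bar>x\<bar> < ereal (dl / 4) ==> cutoff dl x = 0"
 by (cases x) (auto simp: cutoff_def max_def min_def field_simps)

lemma LBINT_reflect:
 fixes h :: "real => real"
 shows "(LBINT r:{0..s}. h (s - r)) = (LBINT r:{0..s}. h r)" unfolding set_lebesgue_integral_def
 by (subst (2) lborel_integral_real_affine[where c="-1" and t=s])
   (auto intro!: Bochner_Integration.integral_cong split: split_indicator)

section \<open>The population without motion\<close>

context blevy_mean
begin

text \<open>The generating function of the population size at time r
  (\<open>V_eq_expectation\<close>): for constant G the motion disappears.\<close>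

definition V :: "real => real => real" where
 "V r c = U r (%_. c) 0"

lemma tot_const: "tot l o' mo t (%_. k) y ta = k * tot l o' mo t (%_. 1) 0 ta"
proof -
 have "k * tot l o' mo t (%_. 1) 0 ta = (\<integral>\<^sup>+v. k * (if v \<in> alive l o' t ta then 1 else 0) \<partial>count_space UNIV)"
  unfolding tot_def by (rule nn_integral_cmult[symmetric]) simp
 also have "... = tot l o' mo t (%_. k) y ta" unfolding tot_def by (rule nn_integral_cong) simp
 finally show ?thesis by simp
qed

lemma U_const: "U r (%_. c) y = V r c"
proof -
 have "tot cL cO cX r (%z. nlog c) y ta = tot cL cO cX r (%z. nlog c) 0 ta" for ta unfolding tot_def by simp
 thus ?thesis unfolding V_def U_def cU_def by simp
qed

text \<open>Joint measurability in time and argument, whereas G is fixed in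
  \<open>cU_measurable\<close>. For constant G the factor \<open>nlog c\<close> comes out of the sum
  over particles.\<close>

lemma V_measurable [measurable (raw)]:
 assumes [measurable]: "f \<in> Bm M" "g \<in> Bm M"
 shows "(%x. V (f x) (g x)) \<in> Bm M"
proof -
 have "(%x. enn2real (\<integral>\<^sup>+ta. nexp (nlog (g x) * tot cL cO cX (f x) (%_. 1) 0 ta) \<partial>TM)) \<in> Bm M"
  by measurable
 thus ?thesis unfolding V_def U_def cU_def tot_const[of cL cO cX _ "nlog _" 0] .
qed

lemma V_bounds: "0 <= V r c" "V r c <= 1" by (auto simp: V_def U_nonneg U_le_1)

lemma V_1 [simp]: "V r 1 = 1"
proof -
 have "nlog 1 = 0" by (simp add: nlog_def)
 thus ?thesis by (simp add: V_def U_def cU_def tot_def TM.emeasure_space_1 cong: if_cong)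
qed

lemma V_Lipschitz:
 assumes "0 <= r" "0 <= c" "c <= 1" "0 <= c'" "c' <= 1"
 shows "\<bar>V r c - V r c'\<bar> <= el r * \<bar>c - c'\<bar>"
proof -
 have uf: "unit_fun (%_. c)" "unit_fun (%_. c')" using assms by simp_all
 show ?thesis
  using solves_lipschitz[OF U_solves[OF uf(1)] uf(1) U_solves[OF uf(2)] uf(2) assms(1), of 0] by (simp add: V_def)
qed

lemma V_linear:
 assumes "0 <= t" "0 <= c" "c <= 1"
 shows "1 - V t c = el t * (1 - c) - (LBINT r:{0..t}. el r * \<Phi> (1 - V (t - r) c))"
proof -
 have uf: "unit_fun (%_. c)" using assms by simp
 show ?thesis using solves_linear[OF U_solves[OF uf] uf assms(1), of 0] by (simp add: U_const)
qed

lemma LBINT_measurable_Icc [measurable (raw)]: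
 fixes k :: "'z => real => real"
 assumes [measurable]: "case_prod k \<in> Bm (M \<Otimes>\<^sub>M borel)" "a \<in> Bm M" "b \<in> Bm M"
 shows "(%x. LBINT r:{a x..b x}. k x r) \<in> Bm M"
 unfolding set_lebesgue_integral_def atLeastAtMost_iff[abs_def] indicator_def by measurable

text \<open>The convolution of the exponential with \<open>1 - V\<close>, obtained by integrating the linear equation
 against the renewal density.\<close>

lemma V_renewal:
 assumes s: "0 <= s" and c: "0 <= c" "c <= 1"
 shows "(LBINT r:{0..s}. el (s - r) * (1 - V r c)) =
  el s * s * (1 - c) - (LBINT r:{0..s}. el r * (r * \<Phi> (1 - V (s - r) c)))"
proof -
 define k where "k = (%q. en q * \<Phi> (1 - V q c))"
 have km[measurable]: "k \<in> Bm borel" unfolding k_def by measurable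
 let ?k = "%r. LBINT q:{0..r}. k q" and ?e = "el s"
 have \<Phi>b: "0 <= \<Phi> (1 - V q c)" "\<Phi> (1 - V q c) <= \<beta> * m" for q
 proof -
  show "0 <= \<Phi> (1 - V q c)" by (rule \<Phi>_nonneg) (auto simp: V_bounds)
  have "\<Phi> (1 - V q c) <= \<beta> * m * (1 - V q c)" by (rule \<Phi>_le) (auto simp: V_bounds)
  also have "... <= \<beta> * m * 1" using \<beta>_pos m_gt1 V_bounds by (intro mult_left_mono) auto
  finally show "\<Phi> (1 - V q c) <= \<beta> * m" by simp
 qed
 have kb: "\<bar>k q\<bar> <= \<beta> * m" if "0 <= q" for q
  unfolding k_def abs_mult abs_exp_cancel using that lam_pos \<Phi>b[of q] by (intro exp_mult_abs_le) auto
 have kint: "\<bar>?k r\<bar> <= \<beta> * m * s" if r: "0 <= r" "r <= s" for r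
 proof -
  have k0: "0 <= k q" for q using \<Phi>b by (auto simp: k_def)
  have 1: "?k r <= (LBINT q:{0..r}. \<beta> * m)"
   using kb k0 r by (intro LBINT_Icc_mono[where B="\<beta> * m" and C="\<beta> * m"]) (use \<beta>_pos m_gt1 in \<open>auto simp: k0 abs_of_nonneg\<close>)
  have 2: "0 <= ?k r" unfolding set_lebesgue_integral_def by (rule Bochner_Integration.integral_nonneg) (simp add: k0)
  have "(LBINT q:{0..r}. \<beta> * m) = \<beta> * m * r" using r by (simp add: set_lebesgue_integral_def)
  also have "... <= \<beta> * m * s" using r \<beta>_pos m_gt1 by (intro mult_left_mono) auto
  finally show ?thesis using 1 2 by simp
 qed
 have "(LBINT r:{0..s}. el (s - r) * (1 - V r c)) =
   (LBINT r:{0..s}. ?e * (1 - c) - ?e * ?k r)"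
 proof (rule LBINT_Icc_cong)
  fix r assume r: "0 <= r" "r <= s"
  have "(LBINT q:{0..r}. el q * \<Phi> (1 - V (r - q) c)) = (LBINT q:{0..r}. (%q. el r * k q) (r - q))"
   by (rule LBINT_Icc_cong) (simp add: k_def algebra_simps flip: exp_add)
  also have "... = el r * ?k r" by (subst LBINT_reflect) (rule LBINT_Icc_cmult)
  finally have e: "1 - V r c = el r * (1 - c) - el r * ?k r" using V_linear[OF r(1) c] by simp
  have x: "el (s - r) * el r = ?e" by (simp add: algebra_simps flip: exp_add)
  show "el (s - r) * (1 - V r c) = ?e * (1 - c) - ?e * ?k r"
  proof -
   have "A * (B * c' - B * d) = E * c' - E * d" if "A * B = E" for A B E c' d :: real
    using that by (auto simp: algebra_simps)
   from this[OF x] show ?thesis unfolding e .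
  qed
 qed
 also have "... = (LBINT r:{0..s}. ?e * (1 - c)) - (LBINT r:{0..s}. ?e * ?k r)"
 proof (rule LBINT_Icc_diff[where B="?e * (1 - c)" and C="?e * (\<beta> * m * s)"])
  fix r assume r: "0 <= r" "r <= s"
  show "\<bar>?e * ?k r\<bar> <= ?e * (\<beta> * m * s)"
   unfolding abs_mult[of "exp _"] abs_exp_cancel by (rule mult_left_mono[OF kint[OF r]]) simp
 qed (auto simp: abs_mult c)
 also have "(LBINT r:{0..s}. ?e * (1 - c)) = ?e * s * (1 - c)" using s by (simp add: set_lebesgue_integral_def)
 also have "(LBINT r:{0..s}. ?e * ?k r) =
   ?e * (LBINT r:{0..s}. 1 * ?k r)" by (simp add: LBINT_Icc_cmult)
 \<comment> \<open>Exchanging the order leaves the length s - r of the inner interval, which becomes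
   the factor r after reflection.\<close>
 also have "(LBINT r:{0..s}. 1 * ?k r) = (LBINT r:{0..s}. k r * (LBINT rh:{r..s}. 1))"
  using kb by (subst triangle_Fubini[where A="\<beta> * m" and B=1]) auto
 also have "?e * (LBINT r:{0..s}. k r * (LBINT rh:{r..s}. 1)) =
   (LBINT r:{0..s}. ?e * (k r * (s - r)))"
  unfolding LBINT_Icc_cmult by (intro arg_cong[where f="(*) _"] LBINT_Icc_cong) (simp add: set_lebesgue_integral_def)
 also have "... = (LBINT r:{0..s}. el (s - r) * ((s - r) * \<Phi> (1 - V (s - (s - r)) c)))"
 proof (rule LBINT_Icc_cong)
  fix r
  have "?e * en r = el (s - r)" by (simp add: algebra_simps flip: exp_add)
  thus "?e * (k r * (s - r)) = el (s - r) * ((s - r) * \<Phi> (1 - V (s - (s - r)) c))" by (simp add: k_def)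
 qed
 also have "... = (LBINT r:{0..s}. el r * (r * \<Phi> (1 - V (s - r) c)))"
  by (rule LBINT_reflect[of s "%r. el r * (r * \<Phi> (1 - V (s - r) c))"])
 finally show ?thesis .
qed

end

section \<open>The scaling limit at a fixed time\<close>

locale blevy_lim = blevy_mean +
 fixes h :: "real => real" and \<pi> :: "ereal measure"
 assumes A1: "assumption_A1 N \<xi> lam h \<pi>" and A3: "assumption_A3 N \<xi> lam h"
begin

lemma h_pos: "0 < t ==> 0 < h t" using A1 by (simp add: assumption_A1_def)

lemma sets_\<pi>: "sets \<pi> = sets R0bar" using A1 by (simp add: assumption_A1_def radon_R0bar_def)

lemma \<pi>_finite: "compact K' ==> K' \<subseteq> - {0} ==> emeasure \<pi> K' < \<infinity>"
 using A1 by (simp add: assumption_A1_def radon_R0bar_def)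

definition P :: "(ereal => real) => real" where
 "P f = (LINT x:R0|\<pi>. f x)"

lemma sets_\<pi>_iff: "A \<in> sets \<pi> \<longleftrightarrow> A \<in> sets borel \<and> 0 \<notin> A"
 unfolding sets_\<pi> R0bar_def by (subst sets_restrict_space_iff) auto

lemma R0_sets: "R0 \<in> sets \<pi>"
proof -
 have "R0 = UNIV - {0, \<infinity>, - \<infinity>}" by (auto simp: R0_def)
 moreover have "UNIV - {0, \<infinity>, - \<infinity>} \<in> sets (borel :: ereal measure)" by (intro sets.Diff) auto
 ultimately show ?thesis by (simp add: sets_\<pi>_iff) (simp add: R0_def)
qed

definition far :: "real => ereal set" where
 "far dl = {x\<in>R0. ereal dl <= \<bar>x\<bar>}"

lemma far_sets: "far dl \<in> sets \<pi>"
proof -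
 have "far dl = R0 \<inter> ({ereal dl..} \<union> {..- ereal dl})"
 proof (intro set_eqI)
  show "x \<in> far dl \<longleftrightarrow> x \<in> R0 \<inter> ({ereal dl..} \<union> {..- ereal dl})" for x
   by (cases x) (auto simp: far_def R0_def)
 qed
 moreover have "R0 \<in> sets borel" "0 \<notin> R0" using R0_sets unfolding sets_\<pi>_iff by blast+
 ultimately show ?thesis unfolding sets_\<pi>_iff by (simp add: sets.Int sets.Un)
qed

lemma far_finite:
 assumes "0 < dl"
 shows "emeasure \<pi> (far dl) < \<infinity>"
proof -
 have "compact ({ereal dl..} \<union> {..- ereal dl})" by (subst compact_eq_closed) auto
 hence "emeasure \<pi> ({ereal dl..} \<union> {..- ereal dl}) < \<infinity>"
  by (rule \<pi>_finite) (use assms in auto)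
 moreover have "far dl \<subseteq> {ereal dl..} \<union> {..- ereal dl}"
 proof
  fix x assume "x \<in> far dl" thus "x \<in> {ereal dl..} \<union> {..- ereal dl}"
   by (cases x) (auto simp: far_def R0_def)
 qed
 moreover have "{ereal dl..} \<union> {..- ereal dl} \<in> sets \<pi>" using assms by (auto simp: sets_\<pi>_iff)
 ultimately show ?thesis using emeasure_mono le_less_trans by metis
qed

text \<open>\<pi> may be infinite near 0, but the integrands considered vanish on a ball around 0.
  Restricting \<pi> to the complement of such a ball gives a finite measure, on which Fubini and
  dominated convergence apply.\<close>

definition \<pi>far :: "real => ereal measure" where
 "\<pi>far dl = restrict_space \<pi> (far dl)"

lemma finite_\<pi>far: "0 < dl ==> finite_measure (\<pi>far dl)" unfolding \<pi>far_def
proof (rule finite_measureI)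
 assume "0 < dl"
 have "far dl \<subseteq> space \<pi>" using far_sets sets.sets_into_space by blast
 thus "emeasure (restrict_space \<pi> (far dl)) (space (restrict_space \<pi> (far dl))) ~= \<infinity>"
  using far_finite[OF \<open>0 < dl\<close>] far_sets[of dl]
  by (subst emeasure_restrict_space) (auto simp: space_restrict_space Int_absorb2)
qed

lemma measurable_\<pi>far:
 assumes "f \<in> Bm borel"
 shows "f \<in> Bm (\<pi>far dl)" unfolding \<pi>far_def by (rule measurable_restrict_space1)
   (use measurable_restrict_space1[OF assms, of "- {0}"] in \<open>simp add: measurable_cong_sets[OF sets_\<pi> refl] R0bar_def\<close>)

lemma P_\<pi>far:
 assumes "!!x. x \<in> R0 ==> \<bar>x\<bar> < ereal dl ==> f x = 0"
 shows "P f = (LINT x|\<pi>far dl. f x)"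
proof -
 have "P f = (LINT x|\<pi>. indicator (far dl) x *\<^sub>R f x)" unfolding P_def set_lebesgue_integral_def using assms
  by (intro Bochner_Integration.integral_cong) (auto simp: far_def not_le split: split_indicator)
 thus ?thesis unfolding \<pi>far_def by (subst integral_restrict_space) (auto simp: far_sets)
qed

lemma P_LBINT:
 fixes F :: "real => ereal => real"
 assumes m[measurable]: "case_prod F \<in> Bm (borel \<Otimes>\<^sub>M borel)"
  and b: "!!r x. 0 <= r ==> r <= s ==> \<bar>F r x\<bar> <= B"
  and dl: "0 < dl" and z: "!!r x. 0 <= r ==> \<bar>x\<bar> < ereal dl ==> F r x = 0"
 shows "(LBINT r:{0..s}. P (F r)) = P (%x. LBINT r:{0..s}. F r x)"
proof -
 interpret F: finite_measure "\<pi>far dl" by (rule finite_\<pi>far[OF dl])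
 interpret pair_sigma_finite lborel "\<pi>far dl" ..
 have id: "(%x. x) \<in> \<pi>far dl \<rightarrow>\<^sub>M borel" by (rule measurable_\<pi>far) simp
 have m2: "(%(r, x). F r x) \<in> Bm (lborel \<Otimes>\<^sub>M \<pi>far dl)"
 proof -
  have "(%z. (fst z, snd z)) \<in> lborel \<Otimes>\<^sub>M \<pi>far dl \<rightarrow>\<^sub>M borel \<Otimes>\<^sub>M borel"
   using measurable_compose[OF measurable_snd id] by (intro measurable_Pair) auto
  from measurable_compose[OF this m] show ?thesis by (simp add: split_beta')
 qed
 have int: "integrable (lborel \<Otimes>\<^sub>M \<pi>far dl) (%(r, x). indicator {0..s} r * F r x)"
 proof (rule Bochner_Integration.integrable_bound)
  have "{0..s} \<times> space (\<pi>far dl) \<in> sets (lborel \<Otimes>\<^sub>M \<pi>far dl)" by (intro pair_measureI) auto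
  thus "integrable (lborel \<Otimes>\<^sub>M \<pi>far dl) (%z. indicator ({0..s} \<times> space (\<pi>far dl)) z * B)"
   by (intro integrable_mult_left integrable_real_indicator)
     (auto simp: F.emeasure_pair_measure_Times ennreal_mult_eq_top_iff emeasure_lborel_Icc_eq less_top[symmetric])
  show "AE z in lborel \<Otimes>\<^sub>M \<pi>far dl. norm (case z of (r, x) => indicator {0..s} r * F r x) <=
    norm (indicator ({0..s} \<times> space (\<pi>far dl)) z * B)"
   by (intro AE_I2) (auto simp: space_pair_measure abs_mult indicator_def intro!: order_trans[OF b abs_ge_self])
  show "(%(r, x). indicator {0..s} r * F r x) \<in> Bm (lborel \<Otimes>\<^sub>M \<pi>far dl)" using m2 by measurable
 qed
 have "(LBINT r:{0..s}. P (F r)) = (LBINT r:{0..s}. (LINT x|\<pi>far dl. F r x))"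
  by (rule LBINT_Icc_cong) (use z in \<open>auto intro!: P_\<pi>far\<close>)
 also have "... = (LBINT r. (LINT x|\<pi>far dl. indicator {0..s} r * F r x))"
  by (simp add: set_lebesgue_integral_def)
 also have "... = (LINT x|\<pi>far dl. (LBINT r. indicator {0..s} r * F r x))"
  by (rule Fubini_integral[OF int, symmetric])
 also have "... = P (%x. LBINT r:{0..s}. F r x)"
 proof (subst P_\<pi>far[of dl])
  fix x assume "\<bar>x\<bar> < ereal dl"
  hence "(LBINT r:{0..s}. F r x) = (LBINT r:{0..s}. 0)" by (intro LBINT_Icc_cong z)
  thus "(LBINT r:{0..s}. F r x) = 0" by simp
 qed (simp add: set_lebesgue_integral_def)
 finally show ?thesis .
qed

lemma P_cmult: "P (%x. c * f x) = c * P f" unfolding P_def by (rule set_integral_mult_right)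

lemma P_diff:
 assumes "f \<in> Bm borel" "f' \<in> Bm borel"
  and "!!x. \<bar>f x\<bar> <= B" "!!x. \<bar>f' x\<bar> <= B'" and dl: "0 < dl"
  and z: "!!x. \<bar>x\<bar> < ereal dl ==> f x = 0" "!!x. \<bar>x\<bar> < ereal dl ==> f' x = 0"
 shows "P (%x. f x - f' x) = P f - P f'"
proof -
 interpret F: finite_measure "\<pi>far dl" by (rule finite_\<pi>far[OF dl])
 have "P (%x. f x - f' x) = (LINT x|\<pi>far dl. f x - f' x)" by (rule P_\<pi>far) (simp add: z)
 also have "... = (LINT x|\<pi>far dl. f x) - (LINT x|\<pi>far dl. f' x)"
  by (intro Bochner_Integration.integral_diff F.integrable_const_bound[where B=B] F.integrable_const_bound[where B=B'])
    (use assms measurable_\<pi>far in auto)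
 finally show ?thesis by (simp add: P_\<pi>far[of dl] z)
qed

text \<open>A3 freed from its suprema. The bound is linear in the elapsed time s, which is what lets
  the step length cancel in \<open>U_in_ball_bound\<close>.\<close>

lemma A3_bound:
 assumes "0 < th"
 obtains C where "0 <= C" "!!t s. 1 < t ==> 0 < s ==> s <= t ==> tail s (h t * th) <= C * s * en t"
proof -
 let ?f = "%t s. ereal (inverse s * el t * measure N {w\<in>space N. \<bar>\<xi> s w\<bar> > h t * th})"
 let ?S = "SUP t\<in>{1<..}. SUP s\<in>{0<..t}. ?f t s"
 have "?S < \<infinity>" using A3 assms by (simp add: assumption_A3_def)
 then obtain C where C: "?S <= ereal C" by (cases ?S) auto
 show ?thesis
 proof (rule that[of "max 0 C"])
  fix t s :: real assume t: "1 < t" "0 < s" "s <= t"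
  have "?f t s <= (SUP s\<in>{0<..t}. ?f t s)" using t by (intro SUP_upper) auto
  also have "... <= ?S" using t by (intro SUP_upper[of t "{1<..}" "%t. SUP s\<in>{0<..t}. ?f t s"]) auto
  also have "... <= ereal C" by (rule C)
  finally have "inverse s * el t * tail s (h t * th) <= C" using t by (simp add: tail_eq)
  hence "tail s (h t * th) <= C * s * en t" using t by (simp add: exp_minus field_simps)
  also have "... <= max 0 C * s * en t" using t by (intro mult_right_mono) auto
  finally show "tail s (h t * th) <= max 0 C * s * en t" .
 qed simp
qed

lemma exp_lim: "((%t. c * en t) \<longlongrightarrow> 0) at_top"
proof -
 have "filterlim (%t. - lam * t) at_bot at_top"
  by (rule filterlim_tendsto_neg_mult_at_bot[OF tendsto_const]) (use lam_pos in \<open>auto intro: filterlim_ident\<close>)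
 hence "((%t. en t) \<longlongrightarrow> 0) at_top" by (rule filterlim_compose[OF exp_at_bot])
 thus ?thesis using tendsto_mult_right_zero by blast
qed

lemma tail_lim:
 assumes "0 < th" "0 < s"
 shows "((%t. tail s (h t * th)) \<longlongrightarrow> 0) at_top"
proof -
 obtain C where C: "0 <= C" "!!t s. 1 < t ==> 0 < s ==> s <= t ==> tail s (h t * th) <= C * s * en t"
  using A3_bound[OF assms(1)] by metis
 show ?thesis
 proof (rule tendsto_sandwich[OF _ _ tendsto_const exp_lim[of "C * s"]])
  show "eventually (%t. 0 <= tail s (h t * th)) at_top" by (simp add: tail_nonneg)
  show "eventually (%t. tail s (h t * th) <= C * s * en t) at_top"
   using eventually_gt_at_top[of "max 1 s"] by eventually_elim (use C assms in auto)
 qed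
qed

lemma lim_A1:
 assumes "ph \<in> Cc_plus" "0 < s"
 shows "((%t. el t * Q s (%z. ph (ereal (z / h t))) 0) \<longlongrightarrow> s * P ph) at_top"
proof -
 have "Q s (%z. ph (ereal (z / h t))) 0 = (LINT w|N. ph (ereal (\<xi> s w / h t)))" for t
  unfolding Q_def using assms by (intro Bochner_Integration.integral_cong) (auto simp: X_eq)
 thus ?thesis using A1 assms by (simp add: assumption_A1_def P_def)
qed

definition Gt :: "(ereal => real) => real => real => real" where
 "Gt g t z = exp (- g (ereal (z / h t)))"

lemma unit_fun_Gt:
 assumes "g \<in> Cc_plus"
 shows "unit_fun (Gt g t)"
proof -
 note [measurable] = Cc_plus_measurable(1)[OF assms]
 have "(%z. exp (- g (ereal (z / h t)))) \<in> Bm borel" by measurable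
 thus ?thesis using Cc_plusD(2)[OF assms] by (auto simp: unit_fun_def Gt_def[abs_def])
qed

end

context blevy_lim
begin

text \<open>1 - G is at most the indicator that the rescaled position has left the ball where g
  vanishes; the hypothesis on x absorbs the starting point y.\<close>

lemma Gt_bound:
 assumes g: "g \<in> Cc_plus" and dl: "!!x. \<bar>x\<bar> < ereal dl ==> g x = 0" and t: "0 < t"
  and x: "!!z. h t * dl <= \<bar>y + z\<bar> ==> x < \<bar>z\<bar>"
 shows "Q s (%z. 1 - Gt g t z) y <= tail s x" unfolding tail_def Q_def
proof (intro integral_mono)
 note G = unit_funD[OF unit_fun_Gt[OF g, of t]]
 have [measurable]: "Gt g t \<in> Bm borel" by (rule G(1))
 show "integrable N (%w. 1 - Gt g t (y + X s w))"
  by (rule integrable_Q[where B=1 and ph="%z. 1 - Gt g t z"]) (use G(5) in auto)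
 show "integrable N (%w. out_ball x (0 + X s w))"
  by (rule integrable_Q[where B=1 and ph="out_ball x"]) (auto simp: out_ball_bounds)
 fix w
 show "1 - Gt g t (y + X s w) <= out_ball x (0 + X s w)"
 proof (cases "h t * dl <= \<bar>y + X s w\<bar>")
  case True
  thus ?thesis using x[of "X s w"] G(2)[of "y + X s w"] by (simp add: out_ball_def)
 next
  case False
  hence "\<bar>(y + X s w) / h t\<bar> < dl" using h_pos[OF t] by (simp add: field_simps)
  hence "g (ereal ((y + X s w) / h t)) = 0" by (intro dl) simp
  thus ?thesis using out_ball_bounds by (simp add: Gt_def)
 qed
qed

text \<open>Makes A1 applicable to the localized loss term: these functions vanish where g does and
  depend on g in a Lipschitz way, so they are test functions again.\<close>

lemma V_comp_Cc_plus:
 assumes g: "g \<in> Cc_plus" and r: "0 <= r"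
 shows "(%x. \<Phi> (1 - V r (exp (- g x)))) \<in> Cc_plus" "(%x. 1 - V r (exp (- g x))) \<in> Cc_plus"
proof -
 have L: "\<bar>V r (exp (- y)) - V r (exp (- y'))\<bar> <= el r * \<bar>y - y'\<bar>" if "0 <= y" "0 <= y'" for y y' :: real
 proof -
  have "\<bar>V r (exp (- y)) - V r (exp (- y'))\<bar> <= el r * \<bar>exp (- y) - exp (- y')\<bar>"
   by (rule V_Lipschitz) (use r that in auto)
  also have "... <= el r * \<bar>y - y'\<bar>" by (intro mult_left_mono abs_exp_diff_le that) simp
  finally show ?thesis .
 qed
 show "(%x. 1 - V r (exp (- g x))) \<in> Cc_plus"
  by (rule Cc_plus_comp_Lipschitz[OF g, where L="el r" and F="%y. 1 - V r (exp (- y))"])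
    (use L r in \<open>auto simp: V_bounds abs_minus_commute\<close>)
 show "(%x. \<Phi> (1 - V r (exp (- g x)))) \<in> Cc_plus"
 proof (rule Cc_plus_comp_Lipschitz[OF g, where L="2 * \<beta> * m * el r" and F="%y. \<Phi> (1 - V r (exp (- y)))"])
  fix y y' :: real assume y: "0 <= y" "0 <= y'"
  have "\<bar>\<Phi> (1 - V r (exp (- y))) - \<Phi> (1 - V r (exp (- y')))\<bar> <= 2 * \<beta> * m * \<bar>(1 - V r (exp (- y))) - (1 - V r (exp (- y')))\<bar>"
   by (rule \<Phi>_lipschitz) (auto simp: V_bounds)
  also have "\<bar>(1 - V r (exp (- y))) - (1 - V r (exp (- y')))\<bar> = \<bar>V r (exp (- y)) - V r (exp (- y'))\<bar>"
   by simp
  also have "2 * \<beta> * m * \<bar>V r (exp (- y)) - V r (exp (- y'))\<bar> <= 2 * \<beta> * m * (el r * \<bar>y - y'\<bar>)"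
   using \<beta>_pos m_gt1 L[OF y] by (intro mult_left_mono) auto
  finally show "\<bar>\<Phi> (1 - V r (exp (- y))) - \<Phi> (1 - V r (exp (- y')))\<bar> <= 2 * \<beta> * m * el r * \<bar>y - y'\<bar>"
   by (simp add: mult.assoc)
 qed (use r in \<open>auto simp: V_bounds intro!: \<Phi>_nonneg\<close>)
qed

text \<open>The displacement up to time \<open>r\<close> decides where the population sits, and after that the
 particles do not move on the scale \<open>h t\<close>: the population seen from \<open>z\<close> is replaced by a
 population without motion.\<close>

lemma loss_pointwise:
 assumes g: "g \<in> Cc_plus" and dl: "0 < dl" "!!x. \<bar>x\<bar> < ereal dl ==> g x = 0"
  and r: "0 < r" "0 < s'" and rh: "0 < rh" and et: "0 < et"
 shows "eventually (%t. \<forall>z. \<bar>\<Phi> (1 - U s' (Gt g t) z) - \<Phi> (1 - V s' (exp (- g (ereal (z / h t)))))\<bar>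
   <= rh * (1 - U s' (Gt g t) z) + et * out_ball (h t * (dl / 3)) z) at_top"
proof -
 \<comment> \<open>Collects the constants of the far case: 2 \<beta> m from the Lipschitz bound on
   \<Phi>, e^(lam s') from that on U, and 2 for the two errors, the oscillation of g and a large
   displacement.\<close>
 define et' where "et' = et / (4 * \<beta> * m * el s')"
 have et': "0 < et'" using et \<beta>_pos m_gt1 by (simp add: et'_def)
 obtain ep where ep: "0 < ep" "!!x y. \<bar>x - y\<bar> <= ep ==> \<bar>g (ereal x) - g (ereal y)\<bar> <= et'"
  using Cc_plus_uniform[OF g et'] by metis
 obtain kp where kp: "0 < kp" "!!w. 0 <= w ==> w <= kp ==> w <= 1 ==> \<Phi> w <= rh * w"
  using \<Phi>_small[OF rh] by blast
 have "eventually (%t. tail s' (h t * (dl / 3)) < kp / el s') at_top"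
  by (rule order_tendstoD(2)[OF tail_lim]) (use dl r kp in auto)
 moreover have "eventually (%t. tail s' (h t * ep) < et') at_top"
  by (rule order_tendstoD(2)[OF tail_lim]) (use ep r et' in auto)
 moreover have "eventually (%t::real. 0 < t) at_top" by (rule eventually_gt_at_top)
 ultimately show ?thesis
 proof eventually_elim
  case (elim t)
  have ht: "0 < h t" by (rule h_pos) (rule elim)
  note uf = unit_fun_Gt[OF g, of t]
  have Gm[measurable]: "Gt g t \<in> Bm borel" by (rule unit_funD(1)[OF uf])
  have s': "0 <= s'" using r by simp
  show ?case
  proof
   fix z
   let ?w = "1 - U s' (Gt g t) z" and ?c = "exp (- g (ereal (z / h t)))"
   let ?U = "U s' (Gt g t) z - U s' (%_. ?c) z" and ?d = "%y. \<bar>Gt g t y - ?c\<bar>" and ?o = "out_ball (h t * ep)"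
   have w: "0 <= ?w" "?w <= 1" by (auto simp: U_nonneg U_le_1)
   show "\<bar>\<Phi> ?w - \<Phi> (1 - V s' ?c)\<bar> <= rh * ?w + et * out_ball (h t * (dl / 3)) z"
   \<comment> \<open>Near the origin g vanishes at z, and 1 - U is small because a displacement of
     order h t is required; superlinearity of \<Phi> then pays with rh (1 - U). Far from it U is
     compared with V directly, and the error is charged to the indicator of a large |z|, which is
     rare.\<close>
   proof (cases "h t * (dl / 3) < \<bar>z\<bar>")
    case False
    moreover have "h t * (dl / 3) < h t * dl" using ht dl(1) by simp
    ultimately have "\<bar>z\<bar> < h t * dl" by linarith
    hence "\<bar>z / h t\<bar> < dl" using ht by (simp add: field_simps)
    hence "g (ereal (z / h t)) = 0" by (intro dl) simp
    hence 0: "\<Phi> (1 - V s' ?c) = 0" using s' by simp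
    have "?w <= el s' * Q s' (%z. 1 - Gt g t z) z" by (rule solves_le[OF U_solves[OF uf] uf s'])
    also have "... <= el s' * tail s' (h t * (dl / 3))"
    proof (intro mult_left_mono Gt_bound[OF g dl(2) elim(3)])
     fix z' assume "h t * dl <= \<bar>z + z'\<bar>"
     hence "h t * dl <= \<bar>z\<bar> + \<bar>z'\<bar>" using abs_triangle_ineq[of z z'] by linarith
     moreover have "0 < h t * dl" using ht dl by simp
     ultimately show "h t * (dl / 3) < \<bar>z'\<bar>" using False by simp
    qed auto
    also have "... <= kp" using elim(1) by (simp add: field_simps)
    finally have "\<Phi> ?w <= rh * ?w" by (intro kp w)
    thus ?thesis using 0 \<Phi>_nonneg[OF w] et out_ball_bounds(1)[of "h t * (dl / 3)" z] by (simp add: add_increasing2)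
   next
    case True
    have c: "0 <= ?c" "?c <= 1" using Cc_plusD(2)[OF g] by auto
    have ufc: "unit_fun (%_. ?c)" using c by simp
    have "\<bar>?U\<bar> <= el s' * Q s' ?d z"
     by (rule solves_lipschitz[OF U_solves[OF uf] uf U_solves[OF ufc] ufc s'])
    also have "Q s' ?d z <= (LINT v|N. et' + ?o (0 + X s' v))" unfolding Q_def
    proof (intro integral_mono)
     have d1: "?d y <= 1" for y unfolding abs_le_iff using unit_funD(2,3)[OF uf, of y] c by linarith
     show "integrable N (%v. ?d (z + X s' v))" by (rule integrable_Q[where B=1 and ph="?d"]) (use d1 in auto)
     show "integrable N (%v. et' + ?o (0 + X s' v))"
      by (intro Bochner_Integration.integrable_add integrable_Q[where B=1 and ph="?o"])
        (auto simp: out_ball_bounds)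
     fix v
     show "?d (z + X s' v) <= et' + ?o (0 + X s' v)"
     proof (cases "h t * ep < \<bar>X s' v\<bar>")
      case True
      thus ?thesis using d1[of "z + X s' v"] et' by (simp add: out_ball_def)
     next
      case False
      have "?d (z + X s' v) <= \<bar>g (ereal ((z + X s' v) / h t)) - g (ereal (z / h t))\<bar>"
       unfolding Gt_def by (intro abs_exp_diff_le Cc_plusD(2)[OF g])
      also have "... <= et'"
      proof (rule ep(2))
       have "(z + X s' v) / h t - z / h t = X s' v / h t" by (simp add: diff_divide_distrib[symmetric])
       thus "\<bar>(z + X s' v) / h t - z / h t\<bar> <= ep" using False ht by (simp add: field_simps)
      qed
      finally show ?thesis using out_ball_bounds(1) by (simp add: add_increasing2)
     qed
    qed
    also have "... = et' + tail s' (h t * ep)" unfolding tail_def Q_def by (subst Bochner_Integration.integral_add)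
       (auto simp: N.prob_space out_ball_bounds intro!: N.integrable_const_bound[where B=1])
    also have "... <= 2 * et'" using elim(2) by simp
    finally have d: "\<bar>?U\<bar> <= el s' * (2 * et')" by (simp add: mult_left_mono)
    have "\<bar>\<Phi> ?w - \<Phi> (1 - V s' ?c)\<bar> <= 2 * \<beta> * m * \<bar>?w - (1 - V s' ?c)\<bar>"
     by (rule \<Phi>_lipschitz) (auto simp: V_bounds U_nonneg U_le_1)
    also have "\<bar>?w - (1 - V s' ?c)\<bar> = \<bar>?U\<bar>" by (simp add: U_const abs_minus_commute)
    also have "2 * \<beta> * m * \<bar>?U\<bar> <= 2 * \<beta> * m * (el s' * (2 * et'))"
     using \<beta>_pos m_gt1 by (intro mult_left_mono d) auto
    also have "... = et" using \<beta>_pos m_gt1 by (simp add: et'_def field_simps)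
    finally show ?thesis using True w rh by (simp add: out_ball_def add_increasing)
   qed
  qed
 qed
qed

text \<open>The semigroup property merges the stages r and s - r into one displacement over time s,
  to which A3 applies. The bound controls the \<open>rh\<close> term in \<open>loss_limit\<close>
  and supplies the majorant in \<open>fixed_time_limit\<close>.\<close>

lemma loss_bound:
 assumes g: "g \<in> Cc_plus" and dl: "0 < dl" "!!x. \<bar>x\<bar> < ereal dl ==> g x = 0"
  and s: "0 < s"
 obtains B where "0 <= B" "!!t r. 1 < t ==> s <= t ==> 0 <= r ==> r <= s ==>
   el t * Q r (%z. 1 - U (s - r) (Gt g t) z) 0 <= B"
proof -
 obtain C where C: "0 <= C" "!!t s. 1 < t ==> 0 < s ==> s <= t ==> tail s (h t * (dl / 2)) <= C * s * en t"
  using A3_bound[of "dl / 2"] dl by (metis half_gt_zero)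
 show ?thesis
 proof (rule that[of "el s * (C * s)"])
  show "0 <= el s * (C * s)" using C s by simp
  fix t r :: real assume t: "1 < t" "s <= t" and r: "0 <= r" "r <= s"
  note uf = unit_fun_Gt[OF g, of t]
  have Gm[measurable]: "Gt g t \<in> Bm borel" by (rule unit_funD(1)[OF uf])
  have b: "\<bar>1 - Gt g t z\<bar> <= 1" for z by (rule unit_funD(5)[OF uf])
  have ht: "0 < h t" using t by (intro h_pos) simp
  have "Q r (%z. 1 - U (s - r) (Gt g t) z) 0 <= Q r (%z. el (s - r) * Q (s - r) (%z. 1 - Gt g t z) z) 0"
  proof (rule Q_mono[where B=1 and C="el (s - r)"])
   show "\<bar>1 - U (s - r) (Gt g t) z\<bar> <= 1" for z using U_nonneg U_le_1 by (simp add: abs_le_iff add_increasing)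
   show "\<bar>el (s - r) * Q (s - r) (%z. 1 - Gt g t z) z\<bar> <= el (s - r)" for z
    unfolding abs_mult abs_exp_cancel by (rule mult_left_le[OF Q_abs[OF _ b]]) auto
   show "1 - U (s - r) (Gt g t) z <= el (s - r) * Q (s - r) (%z. 1 - Gt g t z) z" for z
    by (rule solves_le[OF U_solves[OF uf] uf]) (use r in auto)
  qed measurable
  also have "... = el (s - r) * Q s (%z. 1 - Gt g t z) 0" using r by (simp add: Q_cmult Q_semigroup[OF _ b])
  also have "... <= el s * tail s (h t * (dl / 2))"
  proof (intro mult_mono Gt_bound[OF g dl(2)])
   show "el (s - r) <= el s" using r lam_pos by simp
   show "h t * (dl / 2) < \<bar>z\<bar>" if "h t * dl <= \<bar>0 + z\<bar>" for z
   proof -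
    have "0 < h t * dl" using ht dl by simp
    thus ?thesis using that by simp
   qed
   show "0 <= Q s (%z. 1 - Gt g t z) 0" by (rule Q_nonneg) (use unit_funD(3)[OF uf] in simp)
  qed (use t in auto)
  also have "... <= el s * (C * s * en t)" using C(2)[of t s] t s by (intro mult_left_mono) auto
  finally show "el t * Q r (%z. 1 - U (s - r) (Gt g t) z) 0 <= el s * (C * s)" by (simp add: exp_minus field_simps)
 qed
qed

text \<open>Once the population seen at time r is replaced by one without motion
  (\<open>loss_pointwise\<close>), the loss is the expectation of a test function of the
  displacement over time r, and A1 gives its limit.\<close>

lemma loss_limit:
 assumes g: "g \<in> Cc_plus" and r: "0 < r" "r < s"
 shows "((%t. el t * Q r (%z. \<Phi> (1 - U (s - r) (Gt g t) z)) 0) \<longlongrightarrow>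
   r * P (%x. \<Phi> (1 - V (s - r) (exp (- g x))))) at_top"
proof -
 let ?s = "s - r"
 let ?w = "%t z. 1 - U ?s (Gt g t) z"
 let ?p = "%t z. \<Phi> (?w t z)"
 obtain dl where dl: "0 < dl" "!!x. \<bar>x\<bar> < ereal dl ==> g x = 0" using Cc_plus_zero[OF g] by metis
 obtain B where B: "0 <= B" "!!t r. 1 < t ==> s <= t ==> 0 <= r ==> r <= s ==>
   el t * Q r (%z. 1 - U (s - r) (Gt g t) z) 0 <= B" using loss_bound[OF g dl, of s] r by (metis less_trans)
 obtain C where C: "0 <= C" "!!t s. 1 < t ==> 0 < s ==> s <= t ==> tail s (h t * (dl / 3)) <= C * s * en t"
  using A3_bound[of "dl / 3"] dl by (metis divide_pos_pos zero_less_numeral)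
 define ph where "ph = (%x. \<Phi> (1 - V ?s (exp (- g x))))"
 have ph: "ph \<in> Cc_plus" unfolding ph_def by (rule V_comp_Cc_plus[OF g]) (use r in simp)
 let ?q = "%t z. ph (ereal (z / h t))"
 let ?Q = "%t. Q r (?p t) 0" and ?Q' = "%t. Q r (?q t) 0" and ?W = "%t. Q r (?w t) 0" and ?d = "%t. h t * (dl / 3)"
 have lim1: "((%t. el t * ?Q' t) \<longlongrightarrow> r * P ph) at_top" by (rule lim_A1[OF ph r(1)])
 have \<Phi>b: "\<bar>?p t z\<bar> <= \<beta> * m" "\<bar>?q t z\<bar> <= \<beta> * m" for t z
 proof -
  have *: "\<bar>\<Phi> w\<bar> <= \<beta> * m" if "0 <= w" "w <= 1" for w
  proof -
   have "\<beta> * m * w <= \<beta> * m" using that \<beta>_pos m_gt1 by (intro mult_left_le) auto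
   thus ?thesis using \<Phi>_nonneg[OF that] \<Phi>_le[OF that] by simp
  qed
  show "\<bar>?p t z\<bar> <= \<beta> * m" "\<bar>?q t z\<bar> <= \<beta> * m"
   unfolding ph_def by (rule *; simp add: U_nonneg U_le_1 V_bounds)+
 qed
 have lim2: "((%t. el t * ?Q t - el t * ?Q' t) \<longlongrightarrow> 0) at_top"
 proof (rule tendstoI)
  fix e :: real assume e: "0 < e"
  \<comment> \<open>The error is \<open>rh\<close> times a quantity bounded by B plus
    \<open>et\<close> times a tail that e^(lam t) enlarges to at most C r. The 1 in the denominators
    covers B = 0 and C = 0.\<close>
  define rh where "rh = e / (3 * (B + 1))"
  define et where "et = e / (3 * (C * r + 1))"
  have rh: "0 < rh" "rh * B <= e / 3" using e B by (auto simp: rh_def field_simps)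
  have Cr: "0 <= C * r" using C r by simp
  have et: "0 < et" "et * (C * r) <= e / 3" using e Cr
   by (auto simp: et_def field_simps intro!: divide_pos_pos add_nonneg_pos mult_nonneg_nonneg C less_imp_le[OF r(1)])
  have "eventually (%t. \<forall>z. \<bar>?p t z - ?q t z\<bar>
    <= rh * (?w t z) + et * out_ball (?d t) z) at_top"
   unfolding ph_def by (rule loss_pointwise[OF g dl r(1)]) (use r rh et in auto)
  moreover have "eventually (%t. max 1 s < t) at_top" by (rule eventually_gt_at_top)
  ultimately show "eventually (%t. dist (el t * ?Q t -
    el t * ?Q' t) 0 < e) at_top"
  proof eventually_elim
   case (elim t)
   have [measurable]: "Gt g t \<in> Bm borel" by (rule unit_funD(1)[OF unit_fun_Gt[OF g]])
   have [measurable]: "ph \<in> Bm borel" by (rule Cc_plus_measurable(1)[OF ph])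
   have ub: "\<bar>?w t z\<bar> <= 1" for z using U_nonneg U_le_1 by (simp add: abs_le_iff add_increasing)
   have "\<bar>?Q t - ?Q' t\<bar> =
     \<bar>Q r (%z. ?p t z - ?q t z) 0\<bar>" by (subst Q_diff[OF _ \<Phi>b(1) _ \<Phi>b(2)]) auto
   also have "... <= Q r (%z. \<bar>?p t z - ?q t z\<bar>) 0" unfolding Q_def by (rule integral_abs_bound)
   also have "... <= Q r (%z. rh * (?w t z) + et * out_ball (?d t) z) 0"
   proof (rule Q_mono[where B="\<beta> * m + \<beta> * m" and C="rh + et"])
    show "\<bar>\<bar>?p t z - ?q t z\<bar>\<bar> <= \<beta> * m + \<beta> * m" for z
     unfolding abs_abs by (rule order_trans[OF abs_triangle_ineq4 add_mono[OF \<Phi>b]])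
    show "\<bar>rh * (?w t z) + et * out_ball (?d t) z\<bar> <= rh + et" for z using rh et ub[of z] out_ball_bounds(3)
     by (intro order_trans[OF abs_triangle_ineq add_mono]) (auto simp: abs_mult intro!: mult_left_le)
   qed (use elim in auto)
   also have "... = rh * ?W t + et * tail r (?d t)" unfolding tail_def using rh et ub
    by (subst Q_add[where B="rh" and C="et"]) (auto simp: Q_cmult abs_mult out_ball_bounds intro!: mult_left_le)
   finally have d: "\<bar>?Q t - ?Q' t\<bar> <=
    rh * ?W t + et * tail r (?d t)" .
   have "el t * tail r (?d t) <= el t * (C * r * en t)" using C(2)[of t r] elim r by (intro mult_left_mono) auto
   also have "... = C * r" by (simp add: exp_minus)
   finally have t1: "el t * tail r (?d t) <= C * r" .
   have t2: "el t * ?W t <= B" by (rule B(2)) (use elim r in auto)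
   have "el t * \<bar>?Q t - ?Q' t\<bar> <=
    el t * (rh * ?W t + et * tail r (?d t))" by (rule mult_left_mono[OF d]) simp
   also have "... = rh * (el t * ?W t) + et * (el t * tail r (?d t))" by (simp add: distrib_left mult_ac)
   also have "... <= rh * B + et * (C * r)" using t1 t2 rh et by (intro add_mono mult_left_mono) auto
   also have "... < e" using rh et e by simp
   finally show ?case by (simp add: dist_real_def abs_mult flip: right_diff_distrib)
  qed
 qed
 have "((%t. (el t * ?Q t - el t * ?Q' t) +
   el t * ?Q' t) \<longlongrightarrow> 0 + r * P ph) at_top" by (rule tendsto_add[OF lim2 lim1])
 thus ?thesis by (simp add: ph_def)
qed

lemma P_nonneg: "(!!x. 0 <= f x) ==> 0 <= P f"
 unfolding P_def set_lebesgue_integral_def by (rule Bochner_Integration.integral_nonneg) simp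

text \<open>In \<open>solves_linear\<close> multiplied by e^(lam t) the first term converges by A1
  and the loss term by \<open>loss_limit\<close> under the time integral. The limit still contains
  \<Phi>; integrating \<open>V_renewal\<close> against \<pi> rewrites it in terms of V.\<close>

lemma fixed_time_limit:
 assumes g: "g \<in> Cc_plus" and s: "0 < s"
 shows "((%t. el t * (1 - U s (Gt g t) 0)) \<longlongrightarrow>
   (LBINT r:{0..s}. el (s - r) * P (%x. 1 - V r (exp (- g x))))) at_top"
proof -
 obtain dl where dl: "0 < dl" "!!x. \<bar>x\<bar> < ereal dl ==> g x = 0" using Cc_plus_zero[OF g] by metis
 obtain B where B: "0 <= B" "!!t r. 1 < t ==> s <= t ==> 0 <= r ==> r <= s ==>
   el t * Q r (%z. 1 - U (s - r) (Gt g t) z) 0 <= B" using loss_bound[OF g dl s] by metis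
 have [measurable]: "g \<in> Bm borel" by (rule Cc_plus_measurable(1)[OF g])
 have Gm[measurable]: "Gt g t \<in> Bm borel" for t by (rule unit_funD(1)[OF unit_fun_Gt[OF g]])
 have bm: "0 < \<beta> * m" using \<beta>_pos m_gt1 by simp
 have w01: "0 <= 1 - U q (Gt g t) z" "1 - U q (Gt g t) z <= 1" for q t z by (auto simp: U_nonneg U_le_1)
 let ?w = "%t r z. 1 - U (s - r) (Gt g t) z" and ?V = "%r x. 1 - V r (exp (- g x))"
 let ?q = "%t r. Q r (%z. \<Phi> (?w t r z)) 0" and ?M = "el s * (s * (\<beta> * m))" and ?N = "el s * (\<beta> * m * B)"
 define L where "L = (%r. el r * (r * P (%x. \<Phi> (1 - V (s - r) (exp (- g x))))))"
 define D where "D = (%t r. el r * (el t * ?q t r))"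
 have "(%x. 1 - exp (- g x)) \<in> Cc_plus"
  by (rule Cc_plus_comp_Lipschitz[OF g, where L=1]) (auto simp: abs_minus_commute abs_exp_diff_le)
 hence "((%t. el t * Q s (%z. 1 - exp (- g (ereal (z / h t)))) 0) \<longlongrightarrow> s * P (%x. 1 - exp (- g x))) at_top"
  by (rule lim_A1) (rule s)
 hence lim1: "((%t. el s * (el t * Q s (%z. 1 - Gt g t z) 0)) \<longlongrightarrow> el s * (s * P (%x. 1 - exp (- g x)))) at_top"
  unfolding Gt_def by (rule tendsto_mult_left)
 have lim2: "((%t. LBINT r:{0..s}. D t r) \<longlongrightarrow> (LBINT r:{0..s}. L r)) at_top"
  unfolding set_lebesgue_integral_def
 proof (rule integral_dominated_convergence_at_top)
  have "(%r. P (%x. \<Phi> (1 - V (s - r) (exp (- g x))))) \<in> Bm lborel"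
  proof -
   interpret F: finite_measure "\<pi>far dl" by (rule finite_\<pi>far[OF dl(1)])
   have id[measurable]: "(%x. x) \<in> \<pi>far dl \<rightarrow>\<^sub>M borel" by (rule measurable_\<pi>far) simp
   have gm[measurable]: "g \<in> Bm (\<pi>far dl)" by (rule measurable_\<pi>far) simp
   have "P (%x. \<Phi> (1 - V (s - r) (exp (- g x)))) = (LINT x|\<pi>far dl. \<Phi> (1 - V (s - r) (exp (- g x))))" for r
    by (rule P_\<pi>far) (simp add: dl)
   moreover have "(%r. (LINT x|\<pi>far dl. \<Phi> (1 - V (s - r) (exp (- g x))))) \<in> Bm lborel" by measurable
   ultimately show ?thesis by simp
  qed
  thus "(%r. indicat_real {0..s} r *\<^sub>R L r) \<in> Bm lborel" unfolding L_def by measurable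
  show "(%r. indicat_real {0..s} r *\<^sub>R D t r) \<in> Bm lborel" for t unfolding D_def by measurable
  show "integrable lborel (%r. indicat_real {0..s} r *\<^sub>R (?N))"
   by (intro integrable_scaleR_left integrable_real_indicator) (auto simp: emeasure_lborel_Icc_eq)
  \<comment> \<open>\<open>loss_limit\<close> is available strictly between 0 and s; the endpoints
    form a null set.\<close>
  show "AE r in lborel. ((%t. indicat_real {0..s} r *\<^sub>R D t r) \<longlongrightarrow> indicat_real {0..s} r *\<^sub>R L r) at_top"
   using AE_lborel_singleton[of 0] AE_lborel_singleton[of s]
  proof eventually_elim
   case (elim r)
   thus ?case
   proof (cases "r \<in> {0..s}")
    case True
    hence "0 < r" "r < s" using elim by auto
    thus ?thesis unfolding D_def L_def by (intro tendsto_scaleR tendsto_const tendsto_mult_left loss_limit g)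
   qed simp
  qed
  show "eventually (%t. AE r in lborel. norm (indicat_real {0..s} r *\<^sub>R D t r) <= indicat_real {0..s} r *\<^sub>R (?N)) at_top"
   using eventually_gt_at_top[of "max 1 s"]
  proof eventually_elim
   case (elim t)
   have "norm (D t r) <= ?N" if r: "0 <= r" "r <= s" for r
   proof -
    have Q0: "0 <= ?q t r" by (intro Q_nonneg \<Phi>_nonneg w01)
    have "?q t r <= Q r (%z. \<beta> * m * (?w t r z)) 0"
    proof (rule Q_mono[where B="\<beta> * m" and C="\<beta> * m"])
     fix z
     show *: "\<Phi> (?w t r z) <= \<beta> * m * (?w t r z)" by (rule \<Phi>_le[OF w01])
     have **: "\<beta> * m * (?w t r z) <= \<beta> * m" using bm w01 by (intro mult_left_le) auto
     show "\<bar>\<Phi> (?w t r z)\<bar> <= \<beta> * m" using * ** \<Phi>_nonneg[OF w01, of "s - r" t z] by simp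
     show "\<bar>\<beta> * m * (?w t r z)\<bar> <= \<beta> * m"
      using ** bm w01[of "s - r" t z] by (subst abs_of_nonneg) auto
    qed measurable
    hence "el t * ?q t r <= \<beta> * m * (el t * Q r (%z. ?w t r z) 0)"
     by (simp add: Q_cmult mult_left_mono mult.left_commute)
    also have "... <= \<beta> * m * B" using bm B(2)[of t r] elim r by (intro mult_left_mono) auto
    finally have 1: "el t * ?q t r <= \<beta> * m * B" .
    have "D t r <= ?N" unfolding D_def by (rule mult_mono[OF _ 1]) (use r lam_pos Q0 in auto)
    moreover have "0 <= D t r" unfolding D_def using Q0 by simp
    ultimately show ?thesis by simp
   qed
   thus ?case by (intro AE_I2) (auto split: split_indicator)
  qed
 qed
 have eq: "el t * (1 - U s (Gt g t) 0) = el s * (el t * Q s (%z. 1 - Gt g t z) 0) - (LBINT r:{0..s}. D t r)" for t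
 proof -
  have "(LBINT r:{0..s}. D t r) = el t * (LBINT r:{0..s}. el r * ?q t r)"
   unfolding D_def LBINT_Icc_cmult[symmetric] by (rule LBINT_Icc_cong) simp
  moreover have "1 - U s (Gt g t) 0 = el s * Q s (%z. 1 - Gt g t z) 0 -
    (LBINT r:{0..s}. el r * ?q t r)"
   by (rule solves_linear[OF U_solves[OF unit_fun_Gt[OF g]] unit_fun_Gt[OF g]]) (use s in simp)
  ultimately show ?thesis by (simp only: right_diff_distrib mult.left_commute)
 qed
 have "((%t. el t * (1 - U s (Gt g t) 0)) \<longlongrightarrow> el s * (s * P (%x. 1 - exp (- g x))) - (LBINT r:{0..s}. L r)) at_top"
  unfolding eq by (rule tendsto_diff[OF lim1 lim2])
 also have "el s * (s * P (%x. 1 - exp (- g x))) - (LBINT r:{0..s}. L r) =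
   (LBINT r:{0..s}. el (s - r) * P (%x. ?V r x))"
 proof -
  let ?c = "%x. exp (- g x)"
  have c: "0 <= ?c x" "?c x <= 1" for x using Cc_plusD(2)[OF g, of x] by auto
  have Vb: "\<bar>1 - V r c\<bar> <= 1" for r c using V_bounds[of r c] by auto
  let ?f = "%r x. el (s - r) * (1 - V r (?c x))" and ?k = "%r x. el r * (r * \<Phi> (1 - V (s - r) (?c x)))" and ?o = "%x. el s * s * (1 - ?c x)"
  have \<Phi>b: "\<bar>\<Phi> (1 - V r c)\<bar> <= \<beta> * m" for r c
  proof -
   have "\<Phi> (1 - V r c) <= \<beta> * m * (1 - V r c)" by (rule \<Phi>_le) (auto simp: V_bounds)
   moreover have "\<beta> * m * (1 - V r c) <= \<beta> * m" using bm V_bounds[of r c] by (intro mult_left_le) auto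
   moreover have "0 <= \<Phi> (1 - V r c)" by (rule \<Phi>_nonneg) (auto simp: V_bounds)
   ultimately show ?thesis by simp
  qed
  let ?K = "%x. LBINT r:{0..s}. ?k r x"
  have Kb: "\<bar>?k r x\<bar> <= ?M"
   if "0 <= r" "r <= s" for r x unfolding abs_mult using that lam_pos \<Phi>b bm by (intro mult_mono) auto
  have Vren: "(LBINT r:{0..s}. ?f r x) = ?o x - ?K x" for x by (rule V_renewal) (use s c in auto)
  have "(LBINT r:{0..s}. el (s - r) * P (%x. 1 - V r (?c x))) =
   (LBINT r:{0..s}. P (%x. ?f r x))" by (simp add: P_cmult)
  also have "... = P (%x. LBINT r:{0..s}. ?f r x)"
  proof (rule P_LBINT[OF _ _ dl(1), where B="el s"])
   fix r x assume r: "0 <= r" "r <= s"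
   show "\<bar>?f r x\<bar> <= el s" unfolding abs_mult using Vb[of r "?c x"] r lam_pos
    mult_mono[of "el (s - r)" "el s" "\<bar>1 - V r (?c x)\<bar>" 1] by simp
  qed (use dl(2) in \<open>auto\<close>)
  also have "... = P (%x. ?o x - ?K x)" unfolding Vren ..
  also have "... = P (%x. ?o x) - P ?K"
  proof (rule P_diff[OF _ _ _ _ dl(1)])
   show "\<bar>?o x\<bar> <= el s * s" for x using s c[of x] by (simp add: abs_mult mult_left_le)
   have "?K x = ?o x - (LBINT r:{0..s}. ?f r x)" for x unfolding Vren by simp
   show "\<bar>?K x\<bar> <= ?M * s" for x
   proof -
    have "\<bar>?K x\<bar> <= (LBINT r:{0..s}. \<bar>?k r x\<bar>)"
     unfolding set_lebesgue_integral_def by (rule order_trans[OF integral_abs_bound]) (simp add: abs_mult)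
    also have "... <= (LBINT r:{0..s}. ?M)" by (rule LBINT_Icc_mono[where B="?M" and C="?M"])
       (use Kb s bm in \<open>simp_all add: abs_mult\<close>)
    finally show ?thesis using s by (simp add: set_lebesgue_integral_def mult_ac)
   qed
  qed (use dl(2) in \<open>auto simp: set_lebesgue_integral_def\<close>)
  also have "P ?K = (LBINT r:{0..s}. P (%x. ?k r x))" by (rule P_LBINT[OF _ Kb dl(1), symmetric]) (use dl(2) in auto)
  finally show ?thesis by (simp add: P_cmult L_def)
 qed
 finally show ?thesis .
qed

end

section \<open>Sums of point masses\<close>

lemma sets_to_R0bar: "sets (to_R0bar \<mu>) = sets R0bar" by (simp add: to_R0bar_def R0bar_def sets_restrict_space)

lemma sets_point_sum: "sets (point_sum I w x) = sets R0bar" by (simp add: point_sum_def sets_to_R0bar)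

lemma sets_R0bar_iff: "A \<in> sets R0bar \<longleftrightarrow> A \<in> sets borel \<and> 0 \<notin> A"
 unfolding R0bar_def by (subst sets_restrict_space_iff) auto

lemma measurable_R0bar: "f \<in> Bm borel ==> f \<in> Bm R0bar"
 unfolding R0bar_def by (rule measurable_restrict_space1)

lemma measurable_point_sum: "f \<in> Bm borel ==> f \<in> Bm (point_sum I w x)"
 using measurable_R0bar measurable_cong_sets[OF sets_point_sum refl] by blast

lemma nn_integral_to_R0bar:
 assumes [measurable]: "f \<in> Bm borel" and "sets \<mu> = sets borel"
 shows "(\<integral>\<^sup>+x. f x \<partial>to_R0bar \<mu>) = (\<integral>\<^sup>+x. f (ereal x) * indicator (- {0}) x \<partial>\<mu>)"
proof -
 have [measurable]: "ereal \<in> Bm \<mu>" using borel_measurable_ereal[OF measurable_ident_sets[OF assms(2)]] by simp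
 have "(\<integral>\<^sup>+x. f x \<partial>to_R0bar \<mu>) = (\<integral>\<^sup>+x. f x * indicator (- {0}) x \<partial>distr \<mu> borel ereal)"
  unfolding to_R0bar_def by (rule nn_integral_restrict_space) simp
 also have "... = (\<integral>\<^sup>+x. f (ereal x) * indicator (- {0}) (ereal x) \<partial>\<mu>)"
  by (rule nn_integral_distr) measurable
 finally show ?thesis by (auto intro!: nn_integral_cong simp: indicator_def)
qed

lemma nn_integral_point_sum:
 assumes f: "f \<in> Bm borel"
 shows "(\<integral>\<^sup>+y. f y \<partial>point_sum I w x) =
  (\<integral>\<^sup>+i. (if i \<in> I \<and> x i ~= 0 then w i * f (ereal (x i)) else 0) \<partial>count_space UNIV)"
proof -
 have xm: "x \<in> Bm (point_measure I w)" by (simp add: measurable_point_measure_eq1)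
 have [measurable]: "(%y. f (ereal y) * indicator (- {0}) y) \<in> Bm borel" using f by measurable
 have "(\<integral>\<^sup>+y. f y \<partial>point_sum I w x) = (\<integral>\<^sup>+y. f (ereal y) * indicator (- {0}) y \<partial>distr (point_measure I w) borel x)"
  unfolding point_sum_def by (rule nn_integral_to_R0bar[OF f]) simp
 also have "... = (\<integral>\<^sup>+i. f (ereal (x i)) * indicator (- {0}) (x i) \<partial>point_measure I w)"
  by (rule nn_integral_distr[OF xm]) measurable
 also have "... = (\<integral>\<^sup>+i. w i * (f (ereal (x i)) * indicator (- {0}) (x i)) \<partial>count_space I)"
  unfolding point_measure_def by (rule nn_integral_density) auto
 also have "... = (\<integral>\<^sup>+i. w i * (f (ereal (x i)) * indicator (- {0}) (x i)) * indicator I i \<partial>count_space UNIV)"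
  by (rule nn_integral_count_space_indicator) simp
 finally show ?thesis by (auto intro!: nn_integral_cong simp: indicator_def)
qed

lemma integral_point_sum:
 assumes "g \<in> Bm borel" "!!y. 0 <= g y"
 shows "(LINT y|point_sum I w x. g y) =
  enn2real (\<integral>\<^sup>+i. (if i \<in> I \<and> x i ~= 0 then w i * ennreal (g (ereal (x i))) else 0) \<partial>count_space UNIV)"
 using assms by (subst integral_eq_nn_integral) (auto simp: nn_integral_point_sum measurable_point_sum)

lemma nexp_of_nat_mult: "nexp (of_nat n * x) = nexp x ^ n" by (induction n) (simp_all add: nexp_add distrib_right)

section \<open>The branching process on its own probability space\<close>

locale btree = blevy_mean \<beta> p N \<xi> m lam for \<beta> p and N :: "'b measure" and \<xi> m lam +
 fixes M :: "'w measure" and life :: "nat list => 'w => real" and offs :: "nat list => 'w => nat"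
  and motion :: "nat list => real => 'w => real"
 assumes blp: "branching_levy_process M \<beta> p N \<xi> life offs motion"
begin

lemma prob_M: "prob_space M" using blp by (simp add: branching_levy_process_def)

sublocale M: prob_space M by (rule prob_M)

definition tree :: "'w => nat list => real \<times> nat \<times> (real => real)" where
 "tree w = (%v. (life v w, offs v w, path (motion v) w))"

lemma mark_indep: "M.indep_vars (%_. MS) (%v w. (life v w, offs v w, path (motion v) w)) UNIV"
 using blp by (simp add: branching_levy_process_def)

lemma mark_distr: "distr M MS (%w. (life v w, offs v w, path (motion v) w)) = D"
 using blp by (simp add: branching_levy_process_def D_def K_def)

lemma mark_measurable: "(%w. (life v w, offs v w, path (motion v) w)) \<in> M \<rightarrow>\<^sub>M MS"
 using mark_indep by (simp add: M.indep_vars_def)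

lemma tree_measurable [measurable]: "tree \<in> M \<rightarrow>\<^sub>M Pi\<^sub>M UNIV (%_. MS)"
proof -
 have "(%w. \<lambda>v\<in>UNIV. (life v w, offs v w, path (motion v) w)) \<in> M \<rightarrow>\<^sub>M Pi\<^sub>M UNIV (%_. MS)"
  by (intro measurable_restrict mark_measurable)
 thus ?thesis by (simp add: tree_def[abs_def] restrict_UNIV)
qed

lemma distr_tree: "distr M (Pi\<^sub>M UNIV (%_. MS)) tree = TM"
proof -
 have "distr M (Pi\<^sub>M UNIV (%_. MS)) (%w. \<lambda>v\<in>UNIV. (life v w, offs v w, path (motion v) w)) =
   Pi\<^sub>M UNIV (%v. distr M MS (%w. (life v w, offs v w, path (motion v) w)))"
  using mark_indep by (subst (asm) M.indep_vars_iff_distr_eq_PiM') (auto simp: mark_measurable)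
 thus ?thesis by (simp add: tree_def[abs_def] restrict_UNIV mark_distr TM_def)
qed

lemma life_nonneg: "w \<in> space M ==> 0 <= life v w" using blp by (simp add: branching_levy_process_def)

lemma motion_cadlag: "w \<in> space M ==> cadlag (%t. motion v t w)"
 using blp by (simp add: branching_levy_process_def)

text \<open>Valid at every outcome, as all paths are cadlag and all lifetimes nonnegative by the
  definition of the process. Measurability and laws are therefore transferred without exceptional
  sets.\<close>

lemma tot_tree:
 assumes "w \<in> space M"
 shows "tot life offs motion t ph y w = tot cL cO cX t ph y (tree w)"
proof (rule tot_cong)
 show "life v w = cL v (tree w)" "offs v w = cO v (tree w)" for v by (simp_all add: cL_def cO_def tree_def)
 show "0 <= life v w" for v by (rule life_nonneg[OF assms])
 show "motion v s w = cX v s (tree w)" if "0 <= s" for v s unfolding cX_def tree_def snd_conv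
  by (rule ev_path_eq[symmetric, where f="%t. motion v t w"])
    (use that motion_cadlag[OF assms] in \<open>auto simp: path_def\<close>)
qed

lemma tot_M_measurable [measurable (raw)]:
 assumes [measurable]: "ph \<in> Bm borel" "f \<in> Bm A" "k \<in> Bm A" "g \<in> A \<rightarrow>\<^sub>M M"
 shows "(%x. tot life offs motion (f x) ph (k x) (g x)) \<in> Bm A"
proof -
 have "(%x. tot cL cO cX (f x) ph (k x) (tree (g x))) \<in> Bm A" by measurable
 thus ?thesis by (rule measurable_cong[THEN iffD1, rotated]) (use tot_tree measurable_space[OF assms(4)] in auto)
qed

lemma nn_integral_tot:
 assumes "unit_fun G"
 shows "(\<integral>\<^sup>+w. nexp (tot life offs motion t (%z. nlog (G z)) y w) \<partial>M) = ennreal (U t G y)"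
proof -
 have [measurable]: "G \<in> Bm borel" by (rule unit_funD(1)[OF assms])
 have "(\<integral>\<^sup>+w. nexp (tot life offs motion t (%z. nlog (G z)) y w) \<partial>M) =
   (\<integral>\<^sup>+w. nexp (tot cL cO cX t (%z. nlog (G z)) y (tree w)) \<partial>M)"
  by (rule nn_integral_cong) (simp add: tot_tree)
 also have "... = (\<integral>\<^sup>+ta. nexp (tot cL cO cX t (%z. nlog (G z)) y ta) \<partial>TM)"
  unfolding distr_tree[symmetric] by (rule nn_integral_distr[symmetric]) measurable
 finally show ?thesis by (simp add: ennreal_U cU_def)
qed

text \<open>\<open>card\<close> of an infinite set is 0, so \<open>population\<close> cannot detect
  explosion; this count takes the value \<infinity> there.\<close>

definition cnt :: "real => 'w => ennreal" where
 "cnt t w = tot life offs motion t (%_. 1) 0 w"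

lemma cnt_measurable [measurable (raw)]:
 assumes [measurable]: "f \<in> Bm A" "g \<in> A \<rightarrow>\<^sub>M M"
 shows "(%x. cnt (f x) (g x)) \<in> Bm A" unfolding cnt_def by measurable

lemma cnt_eq:
 "cnt t w = (if finite (alive life offs t w) then ennreal (real (population life offs t w)) else \<infinity>)"
proof -
 have "cnt t w = (\<integral>\<^sup>+v. indicator (alive life offs t w) v \<partial>count_space UNIV)"
  unfolding cnt_def tot_def by (rule nn_integral_cong) (simp add: indicator_def)
 thus ?thesis by (auto simp: emeasure_count_space population_def ennreal_of_nat_eq_real_of_nat)
qed

lemma population_eq: "real (population life offs t w) = enn2real (cnt t w)" by (simp add: cnt_eq population_def)

lemma population_measurable [measurable (raw)]:
 assumes [measurable]: "f \<in> Bm A" "g \<in> A \<rightarrow>\<^sub>M M"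
 shows "(%x. population life offs (f x) (g x)) \<in> A \<rightarrow>\<^sub>M count_space UNIV"
proof -
 have "(%x. nat \<lfloor>enn2real (cnt (f x) (g x))\<rfloor>) \<in> A \<rightarrow>\<^sub>M count_space UNIV" by measurable
 thus ?thesis by (simp add: population_eq[symmetric])
qed

text \<open>Non-explosion: the generating function tends to 1 at 1.\<close>

lemma AE_alive_finite:
 assumes t: "0 <= t"
 shows "AE w in M. finite (alive life offs t w)"
proof -
 let ?F = "{w\<in>space M. cnt t w < \<infinity>}"
 have Fm: "?F \<in> sets M" by measurable
 have *: "1 - el t * (1 - exp (- (1 / real (Suc n)))) <= M.prob ?F" for n
 proof -
  let ?c = "exp (- (1 / real (Suc n)))"
  have uf: "unit_fun (%_. ?c)" by simp
  have "ennreal (U t (%_. ?c) 0) = (\<integral>\<^sup>+w. nexp (tot life offs motion t (%z. nlog ?c) 0 w) \<partial>M)"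
   by (rule nn_integral_tot[OF uf, symmetric])
  also have "... <= (\<integral>\<^sup>+w. indicator ?F w \<partial>M)"
  proof (rule nn_integral_mono)
   fix w assume w: "w \<in> space M"
   have e: "tot life offs motion t (%z. nlog ?c) 0 w = nlog ?c * cnt t w" unfolding cnt_def by (rule tot_const)
   have "nlog ?c = ennreal (1 / real (Suc n))" by (rule nlog_exp) simp
   \<comment> \<open>As c < 1, an infinite population contributes 0 to the expectation of
     c^Z.\<close>
   hence "nlog ?c * \<infinity> = \<infinity>" by (simp add: ennreal_mult_top)
   thus "nexp (tot life offs motion t (%z. nlog ?c) 0 w) <= indicator ?F w"
    unfolding e using w nexp_le_1 by (auto simp: less_top[symmetric] indicator_def)
  qed
  also have "... = ennreal (M.prob ?F)" using Fm by (simp add: M.emeasure_eq_measure)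
  finally have "U t (%_. ?c) 0 <= M.prob ?F" by simp
  moreover have "1 - U t (%_. ?c) 0 <= el t * (1 - ?c)" using solves_le[OF U_solves[OF uf] uf t, of 0] by simp
  ultimately show ?thesis by linarith
 qed
 have "(%n. 1 - el t * (1 - exp (- (1 / real (Suc n))))) \<longlonglongrightarrow> 1 - el t * (1 - exp (- 0))"
  using LIMSEQ_inverse_real_of_nat by (intro tendsto_intros) (simp add: inverse_eq_divide)
 hence "1 <= M.prob ?F" by (intro LIMSEQ_le_const2[of _ "1"]) (use * in auto)
 hence "M.prob ?F = 1" by (simp add: antisym)
 hence "AE w in M. cnt t w < \<infinity>" using M.AE_prob_1[of ?F] by auto
 thus ?thesis by eventually_elim (auto simp: cnt_eq split: if_splits)
qed

lemma tot_finite_sum: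
 assumes "finite (alive life offs t w)"
 shows "tot life offs motion t ph y w = (\<Sum>v\<in>alive life offs t w. ph (y + position life motion v t w))"
 unfolding tot_def by (subst nn_integral_count_space'[where A="alive life offs t w"]) (auto simp: assms)

lemma V_eq_expectation:
 assumes t: "0 <= t" and c: "0 <= c" "c <= 1"
 shows "V t c = (LINT w|M. c ^ population life offs t w)"
proof -
 have uf: "unit_fun (%_. c)" using c by simp
 have "ennreal (V t c) = (\<integral>\<^sup>+w. nexp (tot life offs motion t (%z. nlog c) 0 w) \<partial>M)"
  unfolding V_def by (rule nn_integral_tot[OF uf, symmetric])
 also have "... = (\<integral>\<^sup>+w. ennreal (c ^ population life offs t w) \<partial>M)"
  using AE_alive_finite[OF t] by (intro nn_integral_cong_AE, eventually_elim)
    (simp add: tot_finite_sum nexp_of_nat_mult nexp_nlog c population_def ennreal_power)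
 also have "... = ennreal (LINT w|M. c ^ population life offs t w)"
  by (intro nn_integral_eq_integral M.integrable_const_bound[where B=1])
    (use c in \<open>auto simp: power_le_one\<close>)
 finally show ?thesis using c V_bounds by (subst (asm) ennreal_inj) (auto intro!: Bochner_Integration.integral_nonneg)
qed

lemma particle_integral:
 assumes g: "g \<in> Cc_plus"
 shows "(LINT x|particle_measure life offs motion h t w. g x) =
  enn2real (tot life offs motion t (%z. ennreal (g (ereal (z / h t)))) 0 w)"
proof -
 have "g (ereal 0) = 0" using Cc_plusD(3)[OF g] by (simp add: zero_ereal_def)
 thus ?thesis unfolding particle_measure_def tot_def using Cc_plus_measurable(1)[OF g] Cc_plusD(2)[OF g]
  by (subst integral_point_sum) (auto intro!: arg_cong[where f=enn2real] nn_integral_cong)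
qed

lemma particle_integral_measurable:
 assumes g: "g \<in> Cc_plus"
 shows "(%w. LINT x|particle_measure life offs motion h t w. g x) \<in> Bm M"
proof -
 note [measurable] = Cc_plus_measurable(1)[OF g]
 have "(%w. enn2real (tot life offs motion t (%z. ennreal (g (ereal (z / h t)))) 0 w)) \<in> Bm M" by measurable
 thus ?thesis by (simp add: particle_integral[OF g])
qed

lemma Laplace_particle:
 assumes g: "g \<in> Cc_plus" and t: "0 <= t"
 shows "(LINT w|M. exp (- (LINT x|particle_measure life offs motion h t w. g x))) =
  U t (%z. exp (- g (ereal (z / h t)))) 0"
proof -
 note [measurable] = Cc_plus_measurable(1)[OF g] particle_integral_measurable[OF g, of h t]
 let ?G = "%z. exp (- g (ereal (z / h t)))"
 let ?I = "%w. (LINT x|particle_measure life offs motion h t w. g x)"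
 have I0: "0 <= ?I w" for w by (simp add: particle_integral[OF g])
 have uf: "unit_fun ?G" using Cc_plusD(2)[OF g] by (auto simp: unit_fun_def)
 have "ennreal (U t ?G 0) = (\<integral>\<^sup>+w. nexp (tot life offs motion t (%z. nlog (?G z)) 0 w) \<partial>M)"
  by (rule nn_integral_tot[OF uf, symmetric])
 also have "... = (\<integral>\<^sup>+w. ennreal (exp (- ?I w)) \<partial>M)" using AE_alive_finite[OF t]
 proof (intro nn_integral_cong_AE, eventually_elim)
  case (elim w)
  have "tot life offs motion t (%z. nlog (?G z)) 0 w = tot life offs motion t (%z. ennreal (g (ereal (z / h t)))) 0 w"
   by (simp add: nlog_exp Cc_plusD(2)[OF g])
  moreover have "... ~= \<infinity>" by (simp add: tot_finite_sum[OF elim(2)] sum_ennreal Cc_plusD(2)[OF g])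
  ultimately show ?case by (simp add: nexp_def particle_integral[OF g])
 qed
 also have "... = ennreal (LINT w|M. exp (- ?I w))"
  by (intro nn_integral_eq_integral M.integrable_const_bound[where B=1]) (use I0 in auto)
 finally show ?thesis using U_nonneg by (subst (asm) ennreal_inj) (auto intro!: Bochner_Integration.integral_nonneg)
qed

end

section \<open>Cutting the tree: the Laplace functional at large times\<close>

lemma exp_decay_set_integrable:
 assumes "0 < (c::real)"
 shows "set_integrable lborel {0..} (%r. exp (- c * r))"
proof -
 have "prob_space (density lborel (exponential_density c))" by (rule prob_space_exponential_density) (rule assms)
 then interpret E: prob_space "density lborel (exponential_density c)" .
 have "integrable (density lborel (exponential_density c)) (%_. 1 / c :: real)" by simp
 hence "integrable lborel (%r. exponential_density c r *\<^sub>R (1 / c))"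
  by (subst (asm) integrable_density) (use assms in \<open>auto simp: exponential_density_def\<close>)
 thus ?thesis unfolding set_integrable_def by (rule Bochner_Integration.integrable_cong[THEN iffD1, rotated 2])
    (use assms in \<open>auto simp: exponential_density_def indicator_def mult.commute\<close>)
qed

lemma exp_decay_bounded_integrable:
 fixes a :: "real => real"
 assumes "0 < c" and [measurable]: "a \<in> Bm borel" and "!!r. 0 <= r ==> \<bar>a r\<bar> <= B"
 shows "set_integrable lborel {0..} (%r. exp (- c * r) * a r)" unfolding set_integrable_def
proof (rule Bochner_Integration.integrable_bound)
 show "integrable lborel (%r. (indicator {0..} r *\<^sub>R exp (- c * r)) * B)"
  using exp_decay_set_integrable[OF assms(1)] unfolding set_integrable_def by (rule integrable_mult_left)
 show "AE r in lborel. norm (indicator {0..} r *\<^sub>R (exp (- c * r) * a r)) <= norm ((indicator {0..} r *\<^sub>R exp (- c * r)) * B)"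
  using assms(3) by (intro AE_I2) (auto simp: abs_mult indicator_def intro!: mult_left_mono order_trans[OF _ abs_ge_self])
qed measurable

context blevy_lim
begin

definition a :: "(ereal => real) => real => real" where
 "a g r = P (%x. 1 - V r (exp (- g x)))"

text \<open>The factor of W in the exponent of the limiting Laplace functional; 1 - V is the
  innermost expectation in the theorem.\<close>

definition I :: "(ereal => real) => real" where
 "I g = (LBINT r:{0..}. en r * a g r)"

lemma a_far:
 assumes "!!x. \<bar>x\<bar> < ereal dl ==> g x = 0"
 shows "a g r = (LINT x|\<pi>far dl. 1 - V r (exp (- g x)))" unfolding a_def by (rule P_\<pi>far) (simp add: assms)

lemma a_integrable:
 assumes g: "g \<in> Cc_plus" and "0 < dl"
 shows "integrable (\<pi>far dl) (%x. 1 - V r (exp (- g x)))"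
proof -
 interpret F: finite_measure "\<pi>far dl" by (rule finite_\<pi>far[OF assms(2)])
 have [measurable]: "g \<in> Bm (\<pi>far dl)" by (rule measurable_\<pi>far[OF Cc_plus_measurable(1)[OF g]])
 have Vb: "\<bar>1 - V r c\<bar> <= 1" for r c using V_bounds[of r c] by auto
 show ?thesis by (rule F.integrable_const_bound[where B=1]) (use Vb in auto)
qed

lemma a_bounds:
 assumes g: "g \<in> Cc_plus" and dl: "0 < dl" "!!x. \<bar>x\<bar> < ereal dl ==> g x = 0"
 shows "0 <= a g r" "a g r <= measure (\<pi>far dl) (space (\<pi>far dl))"
proof -
 interpret F: finite_measure "\<pi>far dl" by (rule finite_\<pi>far[OF dl(1)])
 show "0 <= a g r" unfolding a_def by (rule P_nonneg) (simp add: V_bounds)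
 have "a g r = (LINT x|\<pi>far dl. 1 - V r (exp (- g x)))" by (rule a_far) (rule dl(2))
 also have "... <= (LINT x|\<pi>far dl. 1)" by (intro integral_mono a_integrable g dl) (auto simp: V_bounds)
 finally have "a g r <= (LINT x|\<pi>far dl. 1)" .
 thus "a g r <= measure (\<pi>far dl) (space (\<pi>far dl))" by simp
qed

lemma a_measurable [measurable]:
 assumes g: "g \<in> Cc_plus"
 shows "a g \<in> Bm borel"
proof -
 obtain dl where dl: "0 < dl" "!!x. \<bar>x\<bar> < ereal dl ==> g x = 0" using Cc_plus_zero[OF g] by metis
 interpret F: finite_measure "\<pi>far dl" by (rule finite_\<pi>far[OF dl(1)])
 have [measurable]: "g \<in> Bm (\<pi>far dl)" by (rule measurable_\<pi>far[OF Cc_plus_measurable(1)[OF g]])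
 have "(%r. (LINT x|\<pi>far dl. 1 - V r (exp (- g x)))) \<in> Bm borel" by measurable
 thus ?thesis by (simp add: a_far[OF dl(2)] cong: measurable_cong)
qed

lemma I_integrable:
 assumes g: "g \<in> Cc_plus"
 shows "set_integrable lborel {0..} (%r. en r * a g r)"
proof -
 obtain dl where dl: "0 < dl" "!!x. \<bar>x\<bar> < ereal dl ==> g x = 0" using Cc_plus_zero[OF g] by metis
 show ?thesis
  by (rule exp_decay_bounded_integrable[OF lam_pos a_measurable[OF g], where B="measure (\<pi>far dl) (space (\<pi>far dl))"])
    (use a_bounds[OF g dl] in auto)
qed

lemma I_nonneg:
 assumes g: "g \<in> Cc_plus"
 shows "0 <= I g"
proof -
 have "0 <= a g r" for r unfolding a_def by (rule P_nonneg) (simp add: V_bounds)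
 thus ?thesis unfolding I_def set_lebesgue_integral_def by (intro Bochner_Integration.integral_nonneg) simp
qed

lemma I_partial_lim:
 assumes g: "g \<in> Cc_plus"
 shows "((%s. (LBINT r:{0..s}. en r * a g r)) \<longlongrightarrow> I g) at_top"
 unfolding I_def by (rule tendsto_set_lebesgue_integral_at_top[OF _ I_integrable[OF g]]) simp

lemma partial_nonneg: "g \<in> Cc_plus ==> 0 <= (LBINT r:{0..s}. en r * a g r)"
 unfolding set_lebesgue_integral_def a_def real_scaleR_def
 by (intro Bochner_Integration.integral_nonneg mult_nonneg_nonneg P_nonneg) (auto simp: V_bounds)

lemma fixed_time_limit':
 assumes g: "g \<in> Cc_plus" and s: "0 < s"
 shows "((%t. el t * (1 - U s (Gt g t) 0)) \<longlongrightarrow>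
   el s * (LBINT r:{0..s}. en r * a g r)) at_top"
proof -
 have "(LBINT r:{0..s}. el (s - r) * a g r) = (LBINT r:{0..s}. el s * (en r * a g r))"
  by (rule LBINT_Icc_cong) (simp add: algebra_simps flip: exp_add)
 thus ?thesis using fixed_time_limit[OF g s] by (simp add: LBINT_Icc_cmult a_def)
qed

text \<open>V is Lipschitz in its argument, so the integrand converges pointwise. All envelopes
  vanish on the common ball of radius dl / 4, whence one finite measure and one majorant for all
  n.\<close>

lemma I_envelope_lim:
 assumes g: "g \<in> Cc_plus" and dl: "0 < dl" "!!x. \<bar>x\<bar> < ereal dl ==> g x = 0" and et: "et \<longlonglongrightarrow> 0"
 shows "(%n. I (envelope g dl (et n))) \<longlonglongrightarrow> I g"
proof -
 let ?e = "%n. envelope g dl (et n)"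
 let ?d = "dl / 4"
 let ?v = "%n r x. V r (exp (- ?e n x))" and ?u = "%r x. V r (exp (- g x))" and ?m = "measure (\<pi>far ?d) (space (\<pi>far ?d))"
 have d: "0 < ?d" using dl by simp
 have e: "?e n \<in> Cc_plus" for n by (rule envelope_Cc_plus[OF g dl(1)])
 have g_z: "g x = 0" if "\<bar>x\<bar> < ereal ?d" for x using that dl by (cases x) auto
 have e_z: "?e n x = 0" if "\<bar>x\<bar> < ereal ?d" for n x
  using g_z[OF that] cutoff_zero[OF dl(1) that] by (simp add: envelope_def)
 interpret F: finite_measure "\<pi>far ?d" by (rule finite_\<pi>far[OF d])
 have gm: "g' \<in> Bm (\<pi>far ?d)" if "g' \<in> Cc_plus" for g'
  by (rule measurable_\<pi>far[OF Cc_plus_measurable(1)[OF that]])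
 have Vlim: "(%n. 1 - ?v n r x) \<longlonglongrightarrow> 1 - ?u r x" if r: "0 <= r" for r x
 proof -
  have "(%n. ?v n r x) \<longlonglongrightarrow> ?u r x"
  proof (rule Lim_transform_bound[where g="%n. el r * \<bar>et n\<bar>", THEN LIM_zero_cancel])
   show "eventually (%n. norm (?v n r x - ?u r x) <= norm (el r * \<bar>et n\<bar>)) sequentially"
   proof (rule always_eventually, rule allI)
    fix n
    have "\<bar>?v n r x - ?u r x\<bar> <= el r * \<bar>exp (- ?e n x) - exp (- g x)\<bar>"
     by (rule V_Lipschitz[OF r]) (use Cc_plusD(2)[OF e] Cc_plusD(2)[OF g] in auto)
    also have "... <= el r * \<bar>et n\<bar>"
     using abs_exp_diff_le[OF Cc_plusD(2)[OF e, of n x] Cc_plusD(2)[OF g, of x]] envelope_dist[of g x dl "et n"] Cc_plusD(2)[OF g, of x]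
     by (intro mult_left_mono) auto
    finally show "norm (?v n r x - ?u r x) <= norm (el r * \<bar>et n\<bar>)" by simp
   qed
   show "(%n. el r * \<bar>et n\<bar>) \<longlonglongrightarrow> 0"
    using tendsto_mult_left[OF tendsto_rabs[OF et], of "el r"] by simp
  qed
  thus ?thesis by (intro tendsto_diff tendsto_const)
 qed
 have a_e: "a (?e n) r = (LINT x|\<pi>far ?d. 1 - ?v n r x)" for n r by (rule a_far) (rule e_z)
 have a_g: "a g r = (LINT x|\<pi>far ?d. 1 - ?u r x)" for r by (rule a_far) (rule g_z)
 have alim: "(%n. a (?e n) r) \<longlonglongrightarrow> a g r" if r: "0 <= r" for r unfolding a_g a_e
 proof (rule integral_dominated_convergence[where w="%_. 1"])
  have Vb: "\<bar>1 - V r c\<bar> <= 1" for r c using V_bounds[of r c] by auto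
  show "AE x in \<pi>far ?d. norm (1 - ?v n r x) <= 1" for n using Vb by simp
  show "AE x in \<pi>far ?d. (%n. 1 - ?v n r x) \<longlonglongrightarrow> 1 - ?u r x" using Vlim[OF r] by simp
 qed (use gm[OF g] gm[OF e] in \<open>auto intro!: borel_measurable_diff V_measurable borel_measurable_exp[THEN measurable_compose[rotated]] borel_measurable_uminus\<close>)
 show ?thesis unfolding I_def set_lebesgue_integral_def
 proof (rule integral_dominated_convergence[where w="%r. indicator {0..} r *\<^sub>R (en r * ?m)"])
  show "integrable lborel (%r. indicator {0..} r *\<^sub>R (en r * ?m))"
   using exp_decay_bounded_integrable[OF lam_pos, of "%_. ?m"] unfolding set_integrable_def by (auto)
  show "AE r in lborel. (%n. indicat_real {0..} r *\<^sub>R (en r * a (?e n) r)) \<longlonglongrightarrow> indicat_real {0..} r *\<^sub>R (en r * a g r)"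
   using alim by (intro AE_I2) (auto simp: indicator_def intro!: tendsto_intros)
  show "AE r in lborel. norm (indicat_real {0..} r *\<^sub>R (en r * a (?e n) r)) <=
    indicat_real {0..} r *\<^sub>R (en r * ?m)" for n
   using a_bounds[OF e d e_z, of n] by (intro AE_I2) (auto simp: abs_mult indicator_def intro!: mult_left_mono)
  show "(%r. indicat_real {0..} r *\<^sub>R (en r * a g r)) \<in> Bm lborel"
   "(%r. indicat_real {0..} r *\<^sub>R (en r * a (?e n) r)) \<in> Bm lborel" for n
   using a_measurable[OF g] a_measurable[OF e, of n] by (auto intro!: borel_measurable_scaleR borel_measurable_times borel_measurable_indicator)
 qed
qed

lemma U_translate: "U s G y = U s (%z. G (y + z)) 0"
 unfolding U_def cU_def tot_def by (simp add: add.assoc cong: if_cong)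

text \<open>The population is observed at time \<open>T - s\<close>; on the event that no particle is then further
 than \<open>ep * h T\<close> from the origin, each of them contributes independently almost as if it were at 0.\<close>

lemma sandwich:
 assumes g: "g \<in> Cc_plus" and dl: "0 < dl" "!!x. \<bar>x\<bar> < ereal dl ==> g x = 0"
  and eps: "0 < ep" "ep <= dl / 2" "!!x y. \<bar>x - y\<bar> <= ep ==> \<bar>g (ereal x) - g (ereal y)\<bar> <= et"
  and s: "0 < s" "s <= T"
 shows "U T (Gt g T) 0 <= V (T - s) (U s (Gt (envelope g dl (- et)) T) 0) + (1 - U (T - s) (in_ball (ep * h T)) 0)"
  "V (T - s) (U s (Gt (envelope g dl et) T) 0) - (1 - U (T - s) (in_ball (ep * h T)) 0) <= U T (Gt g T) 0"
proof -
 have hT: "0 < h T" using s by (intro h_pos) simp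
 note uf = unit_fun_Gt[OF g, of T]
 note e1 = unit_fun_Gt[OF envelope_Cc_plus[OF g dl(1), of "- et"], of T]
 note e2 = unit_fun_Gt[OF envelope_Cc_plus[OF g dl(1), of et], of T]
 let ?U = "%et. U s (Gt (envelope g dl et) T) 0" and ?b = "U (T - s) (in_ball (ep * h T)) 0"
 have shift: "unit_fun (%z. Gt g T (y + z))" for y using uf by (auto simp: unit_fun_def)
 have split: "U T (Gt g T) 0 = U (T - s) (%y. U s (Gt g T) y) 0" using U_semigroup[OF uf, of "T - s" s 0] s by simp
 have cmp: "Gt g T (y + z) <= Gt (envelope g dl (- et)) T z \<and> Gt (envelope g dl et) T z <= Gt g T (y + z)"
  if y: "\<bar>y\<bar> <= ep * h T" for y z
 proof -
  have "(y + z) / h T - z / h T = y / h T" by (simp add: diff_divide_distrib[symmetric])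
  hence "\<bar>(y + z) / h T - z / h T\<bar> <= ep" using y hT by (simp add: field_simps)
  hence "g (ereal ((y + z) / h T)) <= envelope g dl et (ereal (z / h T)) \<and>
    envelope g dl (- et) (ereal (z / h T)) <= g (ereal ((y + z) / h T))"
   using envelope_bounds[where g=g and dl=dl and ep=ep and et=et and x="(y + z) / h T" and y="z / h T"]
    dl Cc_plusD(2)[OF g] eps by blast
  thus ?thesis unfolding Gt_def by simp
 qed
 have "U (T - s) (%y. U s (Gt g T) y) 0 + ?b <=
   U (T - s) (%_. ?U (- et)) 0 + 1"
 proof (rule U_compare[OF unit_fun_U[OF uf]])
  show "unit_fun (%_. ?U (- et))" by (simp add: U_nonneg U_le_1)
  show "U s (Gt g T) y <= ?U (- et)" if "\<bar>y\<bar> <= ep * h T" for y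
   unfolding U_translate[of s "Gt g T" y] by (rule U_mono[OF shift e1]) (use cmp[OF that] in blast)
 qed
 thus "U T (Gt g T) 0 <= V (T - s) (?U (- et)) + (1 - ?b)" by (simp add: split U_const)
 have "U (T - s) (%_. ?U et) 0 + ?b <=
   U (T - s) (%y. U s (Gt g T) y) 0 + 1"
 proof (rule U_compare[OF _ unit_fun_U[OF uf]])
  show "unit_fun (%_. ?U et)" by (simp add: U_nonneg U_le_1)
  show "?U et <= U s (Gt g T) y" if "\<bar>y\<bar> <= ep * h T" for y
   unfolding U_translate[of s "Gt g T" y] by (rule U_mono[OF e2 shift]) (use cmp[OF that] in blast)
 qed
 thus "V (T - s) (?U et) - (1 - ?b) <= U T (Gt g T) 0" by (simp add: split U_const)
qed

text \<open>\<open>U_in_ball_bound\<close> at time T - s. The big-jump term becomes a multiple of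
  e^(-lam s) and is made small by s; the other term vanishes as T grows.\<close>

lemma bad_bound:
 assumes "0 < ep"
 obtains C where "0 <= C" "!!T s. 1 < T ==> 0 <= s ==> s < T ==>
   1 - U (T - s) (in_ball (ep * h T)) 0 <= C * en s + (T + 1) * (C * T)\<^sup>2 * en T"
proof -
 obtain C where C: "0 <= C" "!!t s. 1 < t ==> 0 < s ==> s <= t ==> tail s (h t * (ep / 3)) <= C * s * en t"
  using A3_bound[of "ep / 3"] assms by (metis divide_pos_pos zero_less_numeral)
 define C' where "C' = max C (C * exp lam / lam)"
 have C': "0 <= C'" "C <= C'" "C * exp lam / lam <= C'" using C by (auto simp: C'_def)
 show ?thesis
 proof (rule that[OF C'(1)])
  fix T s :: real assume T: "1 < T" "0 <= s" "s < T"
  have "1 - U (T - s) (in_ball (ep * h T)) 0 <=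
    C * exp lam / lam * el ((T - s) - T) + (T + 1) * (C * T)\<^sup>2 * en T"
  proof (rule U_in_ball_bound)
   show "0 < ep * h T" using assms h_pos[of T] T by simp
   show "tail q (ep * h T / 3) <= C * q * en T" if "0 < q" "q <= T" for q
    using C(2)[of T q] T that by (simp add: mult.commute)
  qed (use T C in auto)
  also have "el ((T - s) - T) = en s" by simp
  also have "C * exp lam / lam * en s + (T + 1) * (C * T)\<^sup>2 * en T <=
    C' * en s + (T + 1) * (C' * T)\<^sup>2 * en T"
  proof (rule add_mono)
   show "C * exp lam / lam * en s <= C' * en s" by (rule mult_right_mono[OF C'(3)]) simp
   show "(T + 1) * (C * T)\<^sup>2 * en T <= (T + 1) * (C' * T)\<^sup>2 * en T"
    using C C' T by (intro mult_right_mono mult_left_mono power_mono) auto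
  qed
  finally show "1 - U (T - s) (in_ball (ep * h T)) 0 <= C' * en s + (T + 1) * (C' * T)\<^sup>2 * en T" .
 qed
qed

end

locale blim = btree \<beta> p N \<xi> m lam M life offs motion + blevy_lim \<beta> p N \<xi> m lam h \<pi>
 for \<beta> p and N :: "'b measure" and \<xi> m lam and M :: "'w measure" and life offs motion h \<pi> +
 fixes W :: "'w => real"
 assumes W_measurable [measurable]: "W \<in> Bm M"
  and W_limit: "AE w in M. ((%t. en t * real (population life offs t w)) \<longlongrightarrow> W w) at_top"
begin

lemma W_nonneg: "AE w in M. 0 <= W w" using W_limit
proof eventually_elim
 case (elim w)
 thus ?case by (rule tendsto_lowerbound) auto
qed

definition L :: "real => real" where
 "L v = (LINT w|M. exp (- (W w * v)))"

lemma L_lim: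
 assumes "v \<longlonglongrightarrow> v0" "!!n. 0 <= v n"
 shows "(%n. L (v n)) \<longlonglongrightarrow> L v0" unfolding L_def
proof (rule integral_dominated_convergence[where w="%_. 1"])
 show "AE z in M. norm (exp (- (W z * v n))) <= 1" for n using W_nonneg by eventually_elim (use assms in simp)
 show "AE z in M. (%n. exp (- (W z * v n))) \<longlonglongrightarrow> exp (- (W z * v0))"
  by (intro AE_I2 tendsto_intros assms)
qed auto

lemma L_lim_at_top:
 assumes "(v \<longlongrightarrow> v0) at_top" "!!s. 0 <= v s"
 shows "((%s. L (v s)) \<longlongrightarrow> L v0) (at_top :: real filter)"
proof (rule tendsto_at_topI_sequentially)
 fix S :: "nat => real" assume "filterlim S at_top sequentially"
 thus "(%n. L (v (S n))) \<longlonglongrightarrow> L v0" by (intro L_lim filterlim_compose[OF assms(1)] assms(2))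
qed

text \<open>The power is the exponential of Z ln (1 - kp T) with Z the population at T - s. Here ln
  (1 - kp T) behaves like - A e^(-lam T) and Z like W e^(lam (T - s)), so the product tends to - W A
  e^(-lam s).\<close>

lemma V_limit:
 assumes kp: "((%T. el T * kp T) \<longlongrightarrow> A) at_top" and kp0: "!!T. 0 <= kp T" "!!T. kp T <= 1"
 shows "((%T. V (T - s) (1 - kp T)) \<longlongrightarrow> L (en s * A)) at_top"
proof -
 let ?Z = "population life offs"
 let ?k = "%T. el T * kp T" and ?l = "%T. el T * ln (1 - kp T)" and ?P = "%T o1. (1 - kp T) ^ ?Z (T - s) o1" and ?z = "%T o1. en (T - s) * real (?Z (T - s) o1)"
 have kplim: "(kp \<longlongrightarrow> 0) at_top"
 proof -
  have "((%T. (1 * en T) * ?k T) \<longlongrightarrow> 0 * A) at_top" by (rule tendsto_mult[OF exp_lim kp])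
  thus ?thesis by (simp add: mult.assoc[symmetric] flip: exp_add)
 qed
 have small: "eventually (%T. kp T < 1 / 2) at_top" by (rule order_tendstoD(2)[OF kplim]) simp
 have lnlim: "((%T. ?l T) \<longlongrightarrow> - A) at_top"
 proof (rule tendsto_sandwich)
  show "eventually (%T. - ?k T - 2 * ?k T * kp T <= ?l T) at_top" using small
  proof eventually_elim
   case (elim T)
   have "el T * (- kp T - 2 * (kp T)\<^sup>2) <= ?l T"
    using elim kp0[of T] by (intro mult_left_mono ln_one_minus_pos_lower_bound) auto
   thus ?case by (simp add: algebra_simps power2_eq_square)
  qed
  show "eventually (%T. ?l T <= - ?k T) at_top" using small
  proof eventually_elim
   case (elim T)
   have "?l T <= el T * (- kp T)" using elim kp0[of T] by (intro mult_left_mono ln_one_minus_pos_upper_bound) auto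
   thus ?case by simp
  qed
  show "((%T. - ?k T) \<longlongrightarrow> - A) at_top" by (intro tendsto_intros kp)
  have "((%T. - ?k T - 2 * ?k T * kp T) \<longlongrightarrow> - A - 2 * A * 0) at_top"
   by (intro tendsto_intros kp kplim)
  thus "((%T. - ?k T - 2 * ?k T * kp T) \<longlongrightarrow> - A) at_top" by simp
 qed
 have "((%T. LINT o1|M. ?P T o1) \<longlongrightarrow> (LINT o1|M. exp (- (W o1 * (en s * A))))) at_top"
 proof (rule integral_dominated_convergence_at_top)
  show "eventually (%T. AE o1 in M. norm (?P T o1) <= 1) at_top"
   using kp0 by (intro always_eventually allI AE_I2) (auto simp: power_abs[symmetric] intro!: power_le_one)
  show "AE o1 in M. ((%T. ?P T o1) \<longlongrightarrow> exp (- (W o1 * (en s * A)))) at_top" using W_limit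
  proof eventually_elim
   case (elim o1)
   have f: "filterlim (%T::real. T - s) at_top at_top"
    using filterlim_tendsto_add_at_top[OF tendsto_const[of "- s"] filterlim_ident] by simp
   have "((%T. ?z T o1) \<longlongrightarrow> W o1) at_top" by (rule filterlim_compose[OF elim f])
   hence "((%T. exp (?z T o1 * (en s * ?l T))) \<longlongrightarrow>
     exp (W o1 * (en s * (- A)))) at_top" by (intro tendsto_intros lnlim)
   moreover have "eventually (%T. exp (?z T o1 * (en s * ?l T)) =
     ?P T o1) at_top" using small
   proof eventually_elim
    case (elim T)
    have "en (T - s) * en s * el T = 1" by (simp add: algebra_simps flip: exp_add)
    moreover have "(x * z) * (y * (w * v)) = (x * y * w) * (z * v)" for x y z w v :: real by simp
    ultimately have "?z T o1 * (en s * ?l T) =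
      real (?Z (T - s) o1) * ln (1 - kp T)" by (simp only: mult_1)
    also have "exp ... = ?P T o1" using elim by (simp add: exp_of_nat_mult)
    finally show ?case .
   qed
   ultimately show ?case by (subst (asm) tendsto_cong) auto
  qed
 qed auto
 hence "((%T. LINT o1|M. ?P T o1) \<longlongrightarrow> L (en s * A)) at_top" by (simp add: L_def)
 moreover have "eventually (%T. (LINT o1|M. ?P T o1) = V (T - s) (1 - kp T)) at_top" using eventually_ge_at_top[of s]
  by eventually_elim (use kp0 in \<open>auto intro!: V_eq_expectation[symmetric]\<close>)
 ultimately show ?thesis by (subst (asm) tendsto_cong) auto
qed

lemma poly_exp_lim: "((%T. (T + 1) * (C * T)\<^sup>2 * en T) \<longlongrightarrow> 0) at_top"
proof -
 have "((%T. (T + 1) * T\<^sup>2 * en T) \<longlongrightarrow> 0) at_top" using lam_pos by real_asymp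
 from tendsto_mult_left[OF this, of "C\<^sup>2"] show ?thesis by (simp add: power_mult_distrib mult_ac)
qed

text \<open>Choices are made in the order: envelope width \<open>et\<close>, radius
  \<open>ep\<close> from uniform continuity, cutting time s, and T last. The tolerance is spent in
  quarters: for \<open>et\<close>, for s, for the limit in T, and for a particle outside the ball,
  the last in two eighths for the two terms of \<open>bad_bound\<close>.\<close>

theorem Laplace_limit:
 assumes g: "g \<in> Cc_plus"
 shows "((%T. U T (Gt g T) 0) \<longlongrightarrow> L (I g)) at_top"
proof (rule tendstoI)
 fix e :: real assume e: "0 < e"
 obtain dl where dl: "0 < dl" "!!x. \<bar>x\<bar> < ereal dl ==> g x = 0" using Cc_plus_zero[OF g] by metis
 have n1: "(%n. 1 / real (Suc n)) \<longlonglongrightarrow> 0"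
  using LIMSEQ_inverse_real_of_nat by (simp add: inverse_eq_divide)
 have ec: "envelope g dl et \<in> Cc_plus" for et by (rule envelope_Cc_plus[OF g dl(1)])
 have "(%n. L (I (envelope g dl (1 / real (Suc n))))) \<longlonglongrightarrow> L (I g)"
  by (intro L_lim I_envelope_lim[OF g dl] n1 I_nonneg ec)
 moreover have "(%n. L (I (envelope g dl (- (1 / real (Suc n)))))) \<longlonglongrightarrow> L (I g)"
  using tendsto_minus[OF n1, unfolded minus_zero] by (intro L_lim I_envelope_lim[OF g dl] I_nonneg ec)
 ultimately have "eventually (%n. dist (L (I (envelope g dl (1 / real (Suc n))))) (L (I g)) < e / 4 \<and>
   dist (L (I (envelope g dl (- (1 / real (Suc n)))))) (L (I g)) < e / 4) sequentially"
  using e by (intro eventually_conj tendstoD) auto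
 then obtain n where n: "dist (L (I (envelope g dl (1 / real (Suc n))))) (L (I g)) < e / 4"
   "dist (L (I (envelope g dl (- (1 / real (Suc n)))))) (L (I g)) < e / 4" by (auto simp: eventually_sequentially)
 define et where "et = 1 / real (Suc n)"
 have et: "0 < et" by (simp add: et_def)
 obtain ep0 where ep0: "0 < ep0" "!!x y. \<bar>x - y\<bar> <= ep0 ==> \<bar>g (ereal x) - g (ereal y)\<bar> <= et"
  using Cc_plus_uniform[OF g et] by metis
 define ep where "ep = min ep0 (dl / 2)"
 have eps: "0 < ep" "ep <= dl / 2" "!!x y. \<bar>x - y\<bar> <= ep ==> \<bar>g (ereal x) - g (ereal y)\<bar> <= et"
  using ep0 dl by (auto simp: ep_def)
 obtain C where C: "0 <= C" "!!T s. 1 < T ==> 0 <= s ==> s < T ==>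
   1 - U (T - s) (in_ball (ep * h T)) 0 <= C * en s + (T + 1) * (C * T)\<^sup>2 * en T"
  using bad_bound[OF eps(1)] by metis
 let ?A = "%g s. (LBINT r:{0..s}. en r * a g r)"
 have Llim: "((%s. L (?A (envelope g dl et') s)) \<longlongrightarrow> L (I (envelope g dl et'))) at_top" for et'
  by (intro L_lim_at_top I_partial_lim partial_nonneg ec)
 have "eventually (%s. dist (L (?A (envelope g dl et) s)) (L (I (envelope g dl et))) < e / 4 \<and>
   dist (L (?A (envelope g dl (- et)) s)) (L (I (envelope g dl (- et)))) < e / 4 \<and>
   dist (C * en s) 0 < e / 8 \<and> 0 < s) at_top"
  using e by (intro eventually_conj tendstoD[OF Llim] tendstoD[OF exp_lim] eventually_gt_at_top) auto
 then obtain s where s: "dist (L (?A (envelope g dl et) s)) (L (I (envelope g dl et))) < e / 4"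
   "dist (L (?A (envelope g dl (- et)) s)) (L (I (envelope g dl (- et)))) < e / 4"
   "dist (C * en s) 0 < e / 8" "0 < s" by (auto simp: eventually_at_top_linorder)
 have Vlim: "((%T. V (T - s) (U s (Gt (envelope g dl et') T) 0)) \<longlongrightarrow> L (?A (envelope g dl et') s)) at_top" for et'
 proof -
  have "((%T. V (T - s) (1 - (1 - U s (Gt (envelope g dl et') T) 0))) \<longlongrightarrow>
    L (en s * (el s * ?A (envelope g dl et') s))) at_top"
   by (rule V_limit[OF fixed_time_limit'[OF ec s(4)]]) (auto simp: U_nonneg U_le_1)
  thus ?thesis by (simp add: mult.assoc[symmetric] flip: exp_add)
 qed
 have "eventually (%T. dist (V (T - s) (U s (Gt (envelope g dl et) T) 0)) (L (?A (envelope g dl et) s)) < e / 4) at_top"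
  "eventually (%T. dist (V (T - s) (U s (Gt (envelope g dl (- et)) T) 0)) (L (?A (envelope g dl (- et)) s)) < e / 4) at_top"
  "eventually (%T. dist ((T + 1) * (C * T)\<^sup>2 * en T) 0 < e / 8) at_top"
  "eventually (%T. max 1 s < T) at_top"
  by (rule tendstoD[OF Vlim] tendstoD[OF poly_exp_lim] eventually_gt_at_top; use e in simp)+
 thus "eventually (%T. dist (U T (Gt g T) 0) (L (I g)) < e) at_top"
 proof eventually_elim
  case (elim T)
  have T: "1 < T" "s < T" using elim by auto
  have bad: "1 - U (T - s) (in_ball (ep * h T)) 0 < e / 4"
   using C(2)[of T s] T s elim(3) by (auto simp: dist_real_def)
  show ?case using sandwich[OF g dl eps s(4), of T] T bad n[folded et_def] s elim
   unfolding dist_real_def abs_less_iff by linarith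
 qed
qed

end

section \<open>Laplace transforms determine limits in distribution\<close>

lemma expectation_close:
 fixes f q :: "real => real"
 assumes R: "prob_space R" and y[measurable]: "y \<in> Bm R" and y0: "!!w. 0 <= y w"
  and [measurable]: "f \<in> Bm borel" "q \<in> Bm borel"
  and B: "!!x. x \<in> {0..1} ==> \<bar>f x\<bar> <= B" and C: "!!x. x \<in> {0..1} ==> \<bar>q x\<bar> <= C"
  and e: "!!x. x \<in> {0..1} ==> \<bar>f x - q x\<bar> <= e"
 shows "\<bar>(LINT w|R. f (exp (- y w))) - (LINT w|R. q (exp (- y w)))\<bar> <= e"
proof -
 interpret R: prob_space R by (rule R)
 have in01: "exp (- y w) \<in> {0..1}" for w using y0 by auto
 have i1: "integrable R (%w. f (exp (- y w)))" by (rule R.integrable_const_bound[where B=B]) (use B[OF in01] in auto)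
 have i2: "integrable R (%w. q (exp (- y w)))" by (rule R.integrable_const_bound[where B=C]) (use C[OF in01] in auto)
 have "\<bar>(LINT w|R. f (exp (- y w))) - (LINT w|R. q (exp (- y w)))\<bar> =
   \<bar>LINT w|R. f (exp (- y w)) - q (exp (- y w))\<bar>"
  by (subst Bochner_Integration.integral_diff[OF i1 i2]) simp
 also have "... <= (LINT w|R. \<bar>f (exp (- y w)) - q (exp (- y w))\<bar>)" by (rule integral_abs_bound)
 also have "... <= (LINT w|R. e)"
  using e[OF in01] i1 i2 by (intro integral_mono integrable_abs Bochner_Integration.integrable_diff) auto
 finally show ?thesis by (simp add: R.prob_space)
qed

text \<open>Convergence at the natural numbers is convergence of the moments of \<open>exp (- Y)\<close>, which
 takes values in the unit interval.\<close>

lemma Laplace_imp_continuous_functional: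
 assumes M: "!!n. prob_space (M n)" and P: "prob_space P"
  and Y: "!!n. Y n \<in> Bm (M n)" "!!n w. 0 <= Y n w"
  and Y': "Y' \<in> Bm P" "!!w. 0 <= Y' w"
  and lim: "!!k::nat. (%n. LINT w|M n. exp (- (real k * Y n w))) \<longlonglongrightarrow> (LINT w|P. exp (- (real k * Y' w)))"
  and f: "continuous_on UNIV (f :: real => real)"
 shows "(%n. LINT w|M n. f (exp (- Y n w))) \<longlonglongrightarrow> (LINT w|P. f (exp (- Y' w)))"
proof -
 interpret M: prob_space "M n" for n by (rule M)
 interpret P: prob_space P by (rule P)
 note [measurable] = Y(1) Y'(1)
 have [measurable]: "f \<in> Bm borel" by (rule borel_measurable_continuous_onI[OF f])
 have in01: "exp (- Y n w) \<in> {0..1}" "exp (- Y' w') \<in> {0..1}" for n w w' using Y(2) Y'(2) by auto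
 have poly: "(%n. LINT w|M n. (\<Sum>i\<le>d. c i * exp (- Y n w) ^ i)) \<longlonglongrightarrow> (LINT w|P. (\<Sum>i\<le>d. c i * exp (- Y' w) ^ i))"
  for d and c :: "nat => real"
 proof -
  have i1: "integrable (M n) (%w. exp (- Y n w) ^ i)" for n i
   by (rule M.integrable_const_bound[where B=1]) (use in01 in \<open>auto intro!: power_le_one\<close>)
  have i2: "integrable P (%w. exp (- Y' w) ^ i)" for i
   by (rule P.integrable_const_bound[where B=1]) (use in01 in \<open>auto intro!: power_le_one\<close>)
  have l: "(%n. LINT w|M n. exp (- Y n w) ^ i) \<longlonglongrightarrow> (LINT w|P. exp (- Y' w) ^ i)" for i
   using lim[of i] by (simp flip: exp_of_nat_mult)
  show ?thesis using i1 i2 by (auto simp: Bochner_Integration.integral_sum intro!: tendsto_sum tendsto_mult_left l)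
 qed
 show ?thesis
 proof (rule tendstoI)
  fix e :: real assume e: "0 < e"
  obtain q where q: "real_polynomial_function q" "!!x. x \<in> {0..1} ==> \<bar>f x - q x\<bar> < e / 4"
   using Stone_Weierstrass_real_polynomial_function[of "{0..1::real}" f "e / 4"] e
   by (metis compact_Icc continuous_on_subset[OF f] subset_UNIV zero_less_divide_iff zero_less_numeral)
  obtain c d where qeq: "q = (%x. \<Sum>i\<le>d. c i * x ^ i)"
   using q(1) by (auto simp: real_polynomial_function_iff_sum)
  have "continuous_on UNIV q" unfolding qeq by (intro continuous_intros)
  hence [measurable]: "q \<in> Bm borel" by (rule borel_measurable_continuous_onI)
  obtain B where B: "!!x. x \<in> {0..1} ==> \<bar>f x\<bar> <= B"
  proof -
   have "compact (f ` {0..1})" by (rule compact_continuous_image) (auto intro: continuous_on_subset[OF f])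
   hence "bounded (f ` {0..1})" by (rule compact_imp_bounded)
   thus ?thesis using that by (force simp: bounded_iff)
  qed
  have Bq: "\<bar>q x\<bar> <= B + e" if "x \<in> {0..1}" for x using B[OF that] q(2)[OF that] e by linarith
  note close = expectation_close[where f=f and q=q and B=B and C="B + e" and e="e / 4"]
  have "eventually (%n. dist (LINT w|M n. q (exp (- Y n w))) (LINT w|P. q (exp (- Y' w))) < e / 4) sequentially"
   unfolding qeq by (rule tendstoD[OF poly]) (use e in simp)
  thus "eventually (%n. dist (LINT w|M n. f (exp (- Y n w))) (LINT w|P. f (exp (- Y' w))) < e) sequentially"
  proof eventually_elim
   case (elim n)
   have "\<bar>(LINT w|M n. f (exp (- Y n w))) - (LINT w|M n. q (exp (- Y n w)))\<bar> <= e / 4"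
    by (rule close[OF M Y]) (use q(2) B Bq in \<open>auto intro: less_imp_le\<close>)
   moreover have "\<bar>(LINT w|P. f (exp (- Y' w))) - (LINT w|P. q (exp (- Y' w)))\<bar> <= e / 4"
    by (rule close[OF P Y']) (use q(2) B Bq in \<open>auto intro: less_imp_le\<close>)
   ultimately show ?case using elim e unfolding dist_real_def by linarith
  qed
 qed
qed

lemma Laplace_imp_converges_in_distribution:
 assumes M: "prob_space M" and P: "prob_space P"
  and Y: "!!t. Y t \<in> Bm M" "!!t w. 0 <= Y t w"
  and Y': "Y' \<in> Bm P" "!!w. 0 <= Y' w"
  and lim: "!!k::nat. ((%t. LINT w|M. exp (- (real k * Y t w))) \<longlongrightarrow> (LINT w|P. exp (- (real k * Y' w)))) at_top"
 shows "converges_in_distribution M Y P Y'" unfolding converges_in_distribution_def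
proof (intro allI impI)
 fix x assume x: "isCont (cdf (distr P borel Y')) x"
 interpret M: prob_space M by (rule M)
 interpret P: prob_space P by (rule P)
 note [measurable] = Y(1) Y'(1)
 show "((%t. cdf (distr M borel (Y t)) x) \<longlongrightarrow> cdf (distr P borel Y') x) at_top"
 proof (rule tendsto_at_topI_sequentially)
  fix S :: "nat => real" assume S: "filterlim S at_top sequentially"
  have "weak_conv_m (%n. distr M borel (Y (S n))) (distr P borel Y')"
  proof (rule integral_cts_step_conv_imp_weak_conv)
   fix a b :: real assume ab: "a < b"
   \<comment> \<open>The step function in the variable u = exp (- y). Truncating at u = exp (- |b|)
     makes the logarithm continuous on the whole line and changes nothing for y >= 0, as the step is
     0 from b on.\<close>
   define k where "k = (%u. cts_step a b (- ln (max u (exp (- \<bar>b\<bar>)))))"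
   have k: "continuous_on UNIV k"
   proof -
    have "continuous_on UNIV (cts_step a b)"
     by (rule uniformly_continuous_imp_continuous[OF cts_step_uniformly_continuous[OF ab]])
    moreover have "continuous_on UNIV (%u::real. - ln (max u (exp (- \<bar>b\<bar>))))"
     by (intro continuous_intros) (auto simp: max_def intro: order.strict_trans2)
    ultimately show ?thesis unfolding k_def by (rule continuous_on_compose2) auto
   qed
   have keq: "cts_step a b y = k (exp (- y))" if "0 <= y" for y
   proof (cases "y <= \<bar>b\<bar>")
    case True
    thus ?thesis by (simp add: k_def max_def)
   next
    case False
    thus ?thesis using ab by (auto simp: k_def max_def cts_step_def)
   qed
   have "(%n. LINT w|M. k (exp (- Y (S n) w))) \<longlonglongrightarrow> (LINT w|P. k (exp (- Y' w)))"
    by (rule Laplace_imp_continuous_functional[OF M P Y Y' filterlim_compose[OF lim S] k])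
   moreover have [measurable]: "cts_step a b \<in> Bm borel"
    by (rule borel_measurable_continuous_onI[OF uniformly_continuous_imp_continuous[OF cts_step_uniformly_continuous[OF ab]]])
   ultimately show "(%n. integral\<^sup>L (distr M borel (Y (S n))) (cts_step a b)) \<longlonglongrightarrow> integral\<^sup>L (distr P borel Y') (cts_step a b)"
    by (simp add: integral_distr keq Y(2) Y'(2))
  qed auto
  thus "(%n. cdf (distr M borel (Y (S n))) x) \<longlonglongrightarrow> cdf (distr P borel Y') x"
   using x by (simp add: weak_conv_m_def weak_conv_def)
 qed
qed

section \<open>Poisson counts from generating functions\<close>

text \<open>Strong induction: once the lower coefficients vanish, dividing by x^k leaves d k plus a
  remainder of size at most 2 C x, and x tends to 0.\<close>

lemma power_series_zero:
 fixes d :: "nat => real"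
 assumes b: "!!n. \<bar>d n\<bar> <= C" and s: "!!x. 0 < x ==> x < 1 ==> (%n. d n * x ^ n) sums 0"
 shows "d k = 0"
proof (induction k rule: less_induct)
 case (less k)
 have C: "0 <= C" using b[of 0] by auto
 have small: "\<bar>d k\<bar> <= 2 * C * x" if x: "0 < x" "x <= 1/2" for x
 proof -
  have "(%n. d (n + k) * x ^ (n + k)) sums 0" using s[of x] x by (subst sums_zero_iff_shift) (auto simp: less)
  hence "(%n. (1 / x ^ k) * (d (n + k) * x ^ (n + k))) sums ((1 / x ^ k) * 0)" by (rule sums_mult)
  hence "(%n. d (n + k) * x ^ n) sums 0" using x by (simp add: power_add)
  hence s': "(%n. d (Suc n + k) * x ^ Suc n) sums (- d k)" by (subst sums_Suc_iff) simp
  have g: "(%n. C * x * x ^ n) sums (C * x * (1 / (1 - x)))" using x by (intro sums_mult geometric_sums) auto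
  have "norm (\<Sum>n. d (Suc n + k) * x ^ Suc n) <= (\<Sum>n. C * x * x ^ n)"
  proof (rule norm_suminf_le[OF _ sums_summable[OF g]])
   show "norm (d (Suc n + k) * x ^ Suc n) <= C * x * x ^ n" for n
    using mult_right_mono[OF b[of "Suc n + k"], of "x ^ Suc n"] x by (simp add: abs_mult mult_ac)
  qed
  hence "\<bar>d k\<bar> <= C * x * (1 / (1 - x))"
   unfolding sums_unique[OF g, symmetric] sums_unique[OF s', symmetric] by simp
  also have "... <= C * x * 2" using x C by (intro mult_left_mono) (auto simp: field_simps)
  finally show ?thesis by (simp add: mult_ac)
 qed
 have "\<bar>d k\<bar> <= 0"
 proof (rule field_le_epsilon)
  fix e :: real assume e: "0 < e"
  have "0 < min (1/2) (e / (2 * (C + 1)))" using e C by auto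
  hence "\<bar>d k\<bar> <= 2 * C * min (1/2) (e / (2 * (C + 1)))" by (rule small) (rule min.cobounded1)
  also have "... <= 2 * C * (e / (2 * (C + 1)))" using C by (intro mult_left_mono) auto
  also have "... <= e" using C e by (simp add: field_simps)
  finally show "\<bar>d k\<bar> <= 0 + e" by simp
 qed
 thus ?case by simp
qed

text \<open>For x in [0, 1] the value at \<infinity> is the limit of x^n, so a count equal to
  \<infinity> is visible only at x = 1.\<close>

definition epow :: "real => enat => real" where
 "epow x k = (case k of enat n => x ^ n | \<infinity> => if x = 1 then 1 else 0)"

definition poisson_gen :: "ennreal => real => real" where
 "poisson_gen a x = (if a = \<infinity> then if x = 1 then 1 else 0 else exp (- enn2real a * (1 - x)))"

lemma epow_bounds: "0 <= x ==> x <= 1 ==> 0 <= epow x k \<and> epow x k <= 1"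
 by (cases k) (auto simp: epow_def power_le_one)

lemma poisson_mass_sums:
 assumes "0 <= x" "x < 1"
 shows "(%n. poisson_mass a (enat n) * x ^ n) sums poisson_gen a x"
proof (cases "a = \<infinity>")
 case False
 let ?a = "enn2real a"
 have "(%n. exp (- ?a) * ((?a * x) ^ n /\<^sub>R fact n)) sums (exp (- ?a) * exp (?a * x))"
  by (intro sums_mult exp_converges)
 thus ?thesis using False by (simp add: poisson_mass_def poisson_gen_def power_mult_distrib field_simps mult_exp_exp)
qed (use assms in \<open>simp add: poisson_mass_def poisson_gen_def\<close>)

lemma poisson_mass_sums_1:
 "(%n. poisson_mass a (enat n)) sums (if a = \<infinity> then 0 else 1)"
proof (cases "a = \<infinity>")
 case False
 let ?a = "enn2real a"
 have "(%n. exp (- ?a) * (?a ^ n /\<^sub>R fact n)) sums (exp (- ?a) * exp ?a)" by (intro sums_mult exp_converges)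
 thus ?thesis using False by (simp add: poisson_mass_def field_simps mult_exp_exp)
qed (simp add: poisson_mass_def)

lemma poisson_mass_nonneg: "0 <= poisson_mass a k" by (cases k) (auto simp: poisson_mass_def)

lemma poisson_mass_le_1: "poisson_mass a k <= 1"
proof (cases k)
 case (enat n)
 have "poisson_mass a (enat n) <= (if a = \<infinity> then 0 else 1)"
  using sum_le_suminf[OF sums_summable[OF poisson_mass_sums_1], of "{n}" a] sums_unique[OF poisson_mass_sums_1, of a]
  by (simp add: poisson_mass_nonneg)
 thus ?thesis using enat by (auto split: if_splits)
qed (auto simp: poisson_mass_def)

text \<open>Coefficients of a generating function are unique, also under a bounded weight H. The
  weight carries the remaining factors when \<open>poisson_counts\<close> treats one count at a
  time.\<close>

lemma (in prob_space) poisson_mass_of_gen: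
 assumes H[measurable]: "H \<in> Bm M" and H01: "!!w. 0 <= H w" "!!w. H w <= (1::real)"
  and K[measurable]: "K \<in> M \<rightarrow>\<^sub>M count_space UNIV"
  and gen: "!!x. 0 <= x ==> x <= 1 ==> expectation (%w. H w * epow x (K w)) = h * poisson_gen a x"
 shows "expectation (%w. H w * of_bool (K w = k)) = h * poisson_mass a k"
proof -
 have Hint: "integrable M H" by (rule integrable_const_bound[where B=1]) (use H01 in auto)
 let ?b = "%x n w. H w * of_bool (K w = enat n) * x ^ n" and ?c = "%x w. H w * (case K w of enat n => x ^ n | \<infinity> => 0)"
 let ?o = "%w. H w * (case K w of enat n => 1 | \<infinity> => 0)"
 have HI: "integrable M (%w. H w * of_bool (K w = k))" for k
  by (rule integrable_const_bound[where B=1]) (use H01 in auto)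
 define c where "c n = expectation (%w. H w * of_bool (K w = enat n))" for n
 have Hh: "expectation H = h"
 proof -
  have e1: "epow 1 k = 1" for k by (cases k) (auto simp: epow_def)
  have g1: "poisson_gen a 1 = 1" by (simp add: poisson_gen_def)
  show ?thesis using gen[of 1] by (simp add: e1 g1)
 qed
 have h01: "0 <= h" "h <= 1"
  using Hh Bochner_Integration.integral_nonneg[of M H] H01 integral_mono[OF Hint, of "%_. 1"] by (auto simp: prob_space)
 have c01: "0 <= c n" "c n <= 1" for n
 proof -
  show "0 <= c n" unfolding c_def by (rule Bochner_Integration.integral_nonneg) (simp add: H01)
  have "c n <= expectation (%_. 1)" unfolding c_def by (rule integral_mono[OF HI]) (use H01 in auto)
  thus "c n <= 1" by (simp add: prob_space)
 qed
 have csums: "(%n. c n * x ^ n) sums expectation (%w. \<Sum>n. ?b x n w)"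
  if x: "0 <= x" "x <= 1" for x
 proof -
  have fin: "summable (%n. norm (?b x n w))" for w
   by (rule summable_finite[of "{n. K w = enat n}"]) (auto intro: finite_subset[of _ "{the_enat (K w)}"])
  have "summable (%n. expectation (%w. norm (?b x n w)))"
  proof (rule summableI_nonneg_bounded)
   fix n
   have "(\<Sum>i<n. expectation (%w. norm (?b x i w))) =
     expectation (%w. \<Sum>i<n. norm (?b x i w))"
    by (rule Bochner_Integration.integral_sum[symmetric]) (intro integrable_norm integrable_mult_left HI)
   also have "... <= expectation (%_. 1)"
   proof (rule integral_mono)
    show "integrable M (%w. \<Sum>i<n. norm (?b x i w))"
     by (intro Bochner_Integration.integrable_sum integrable_norm integrable_mult_left HI)
    fix w
    have "(\<Sum>i<n. norm (?b x i w)) <= (\<Sum>i<n. of_bool (K w = enat i))"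
     using x H01 by (intro sum_mono) (auto simp: abs_mult intro!: mult_le_one power_le_one)
    also have "... <= 1"
    proof (cases "K w")
     case (enat j)
     have "(\<Sum>i<n. of_bool (K w = enat i)) = (\<Sum>i<n. if i = j then 1 else 0 :: real)"
      by (rule sum.cong) (auto simp: enat)
     thus ?thesis by simp
    qed simp
    finally show "(\<Sum>i<n. norm (?b x i w)) <= 1" .
   qed simp
   finally show "(\<Sum>i<n. expectation (%w. norm (?b x i w))) <= 1" by (simp add: prob_space)
  qed simp
  hence "(%n. expectation (%w. ?b x n w)) sums
    expectation (%w. \<Sum>n. ?b x n w)" by (intro sums_integral integrable_mult_left HI AE_I2 fin)
  thus ?thesis by (simp add: c_def)
 qed
 have inner: "(\<Sum>n. ?b x n w) = ?c x w" for w x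
 proof (cases "K w")
  case (enat j)
  have "(\<Sum>n. ?b x n w) = (\<Sum>n\<in>{j}. ?b x n w)" by (rule suminf_finite) (auto simp: enat)
  thus ?thesis by (simp add: enat)
 qed simp
 have cgen: "(%n. c n * x ^ n) sums (h * poisson_gen a x)" if x: "0 <= x" "x < 1" for x
 proof -
  have "expectation (%w. \<Sum>n. ?b x n w) = expectation (%w. H w * epow x (K w))"
   unfolding inner using x by (intro Bochner_Integration.integral_cong) (auto simp: epow_def split: enat.splits)
  thus ?thesis using csums[of x] gen[of x] x by simp
 qed
 have c_eq: "c n = h * poisson_mass a (enat n)" for n
 proof -
  have "c n - h * poisson_mass a (enat n) = 0"
  proof (rule power_series_zero[where C=1])
   show "\<bar>c n - h * poisson_mass a (enat n)\<bar> <= 1" for n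
   proof -
    have "0 <= h * poisson_mass a (enat n)" "h * poisson_mass a (enat n) <= 1"
     using h01 poisson_mass_nonneg poisson_mass_le_1 by (auto intro!: mult_le_one)
    thus ?thesis using c01[of n] by (auto simp: abs_le_iff)
   qed
   fix x :: real assume x: "0 < x" "x < 1"
   have "(%n. c n * x ^ n - h * (poisson_mass a (enat n) * x ^ n)) sums (h * poisson_gen a x - h * poisson_gen a x)"
    using x by (intro sums_diff cgen sums_mult poisson_mass_sums) auto
   thus "(%n. (c n - h * poisson_mass a (enat n)) * x ^ n) sums 0" by (simp add: algebra_simps)
  qed
  thus ?thesis by simp
 qed
 show ?thesis
 proof (cases k)
  case (enat n)
  thus ?thesis using c_eq[of n] by (simp add: c_def)
 next
  case infinity
  \<comment> \<open>The mass at \<infinity> is what the finite values leave over at x = 1.\<close>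
  have "(%n. c n * 1 ^ n) sums expectation ?o" using csums[of 1] inner[of _ 1] by (simp cong: enat.case_cong)
  moreover have "(%n. c n * 1 ^ n) sums (h * (if a = \<infinity> then 0 else 1))"
   unfolding c_eq using sums_mult[OF poisson_mass_sums_1, of h a] by simp
  ultimately have fin: "expectation ?o = h * (if a = \<infinity> then 0 else 1)" by (rule sums_unique2)
  have eq: "H w * of_bool (K w = \<infinity>) = H w - ?o w" for w by (cases "K w") auto
  have i: "integrable M ?o"
   by (rule integrable_const_bound[where B=1]) (use H01 in \<open>auto split: enat.splits\<close>)
  show ?thesis unfolding infinity eq using fin Hh
   by (subst Bochner_Integration.integral_diff[OF Hint i]) (auto simp: poisson_mass_def)
 qed
qed

text \<open>From the joint generating function to the joint law: the factors \<open>epow\<close> are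
  replaced by indicators one after the other; those already replaced and those still to come form
  the weight.\<close>

lemma (in prob_space) poisson_counts:
 fixes n :: nat and K :: "nat => 'a => enat" and a :: "nat => ennreal"
 assumes K[measurable]: "!!i. i < n ==> K i \<in> M \<rightarrow>\<^sub>M count_space UNIV"
  and gen: "!!x. (!!i. i < n ==> 0 <= x i \<and> x i <= 1) ==>
    expectation (%w. \<Prod>i<n. epow (x i) (K i w)) = (\<Prod>i<n. poisson_gen (a i) (x i))"
 shows "prob {w\<in>space M. \<forall>i<n. K i w = k i} = (\<Prod>i<n. poisson_mass (a i) (k i))"
proof -
 let ?b = "%j w. \<Prod>i<j. of_bool (K i w = k i)" and ?e = "%j x w. \<Prod>i\<in>{j..<n}. epow (x i) (K i w)"
 let ?m = "%j. \<Prod>i<j. poisson_mass (a i) (k i)" and ?g = "%j x. \<Prod>i\<in>{j..<n}. poisson_gen (a i) (x i)"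
 have step: "j <= n ==> (!!i. i < n ==> 0 <= x i \<and> x i <= 1) ==>
   expectation (%w. ?b j w * ?e j x w) =
   ?m j * ?g j x" for j and x :: "nat => real"
 proof (induction j arbitrary: x)
  case 0
  thus ?case using gen[of x] by (simp add: atLeast0LessThan)
 next
  case (Suc j)
  let ?H = "%w. ?b j w * ?e (Suc j) x w"
  let ?h = "?m j * ?g (Suc j) x"
  have j: "j < n" using Suc.prems by simp
  have split: "{j..<n} = insert j {Suc j..<n}" using j by auto
  have "expectation (%w. ?H w * of_bool (K j w = k j)) = ?h * poisson_mass (a j) (k j)"
  proof (rule poisson_mass_of_gen)
   have "(%w. epow (x i) (K i w)) \<in> Bm M" "(%w. of_bool (K i w = k i) :: real) \<in> Bm M"
    if "i < n" for i using measurable_compose[OF K[OF that], of "epow (x i)" borel]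
     measurable_compose[OF K[OF that], of "%q. of_bool (q = k i) :: real" borel] by auto
   thus "?H \<in> Bm M" using j by (intro borel_measurable_times borel_measurable_prod) auto
   show "K j \<in> M \<rightarrow>\<^sub>M count_space UNIV" by (rule K[OF j])
   show "0 <= ?H w" for w using epow_bounds Suc.prems(2) by (intro mult_nonneg_nonneg prod_nonneg) auto
   show "?H w <= 1" for w using epow_bounds Suc.prems(2) by (intro mult_le_one prod_le_1 prod_nonneg) auto
   fix y :: real assume y: "0 <= y" "y <= 1"
   have "expectation (%w. ?b j w * ?e j (x(j := y)) w) =
    ?m j * ?g j (x(j := y))" by (rule Suc.IH) (use Suc.prems y in auto)
   thus "expectation (%w. ?H w * epow y (K j w)) = ?h * poisson_gen (a j) y"
   proof -
    have e: "?e (Suc j) (x(j := y)) w = ?e (Suc j) x w" for w by (rule prod.cong) auto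
    have e': "?g (Suc j) (x(j := y)) = ?g (Suc j) x" by (rule prod.cong) auto
    show ?thesis if "expectation (%w. ?b j w * ?e j (x(j := y)) w) =
      ?m j * ?g j (x(j := y))"
     using that unfolding split by (simp add: e e' mult_ac del: fun_upd_apply) (simp add: mult_ac)
   qed
  qed
  thus ?case by (simp add: mult_ac)
 qed
 have "prob {w\<in>space M. \<forall>i<n. K i w = k i} = expectation (indicator {w\<in>space M. \<forall>i<n. K i w = k i})"
  by (simp add: Int_absorb1 subset_eq)
 also have "... = expectation (%w. \<Prod>i<n. of_bool (K i w = k i))"
  by (rule Bochner_Integration.integral_cong) (auto simp: indicator_def prod.neutral)
 also have "... = (\<Prod>i<n. poisson_mass (a i) (k i))" using step[of n "%_. 0"] by simp
 finally show ?thesis .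
qed

section \<open>Limits of \<^const>\<open>nexp\<close>\<close>

lemma nexp_tendsto:
 assumes lim: "s \<longlonglongrightarrow> x" and inc: "incseq s"
 shows "(%n. nexp (s n)) \<longlonglongrightarrow> nexp x"
proof (cases "x = \<infinity>")
 case False
 have le: "s n <= x" for n by (rule incseq_le[OF inc lim])
 hence fin: "s n ~= \<infinity>" for n using False by (metis infinity_ennreal_def neq_top_trans)
 have "(%n. enn2real (s n)) \<longlonglongrightarrow> enn2real x"
  using lim False by (intro tendsto_enn2real) (auto simp: ennreal_enn2real less_top)
 hence "(%n. ennreal (exp (- enn2real (s n)))) \<longlonglongrightarrow> ennreal (exp (- enn2real x))"
  by (intro tendsto_ennrealI tendsto_exp tendsto_minus)
 thus ?thesis using False fin by (simp add: nexp_def)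
next
 case True
 show ?thesis
 proof (rule tendsto_sandwich[where f="%_. 0" and h="%n. nexp (s n)"])
  show "(%n. nexp (s n)) \<longlonglongrightarrow> nexp x"
  proof (rule order_tendstoI)
   fix b assume "nexp x < b"
   hence b: "0 < b" using True by simp
   define q where "q = enn2real (min b 1)"
   have mt: "min b 1 < top" by (simp add: min_less_iff_disj)
   have q: "0 < q" "ennreal q <= b" using b mt by (auto simp: q_def enn2real_positive_iff)
   have "eventually (%n. ennreal (\<bar>ln q\<bar> + 1) < s n) sequentially"
    by (rule order_tendstoD(1)[OF lim]) (simp add: True)
   thus "eventually (%n. nexp (s n) < b) sequentially"
   proof eventually_elim
    case (elim n)
    have "nexp (s n) <= nexp (ennreal (\<bar>ln q\<bar> + 1))" by (rule nexp_antimono) (use elim in simp)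
    also have "... = ennreal (exp (- (\<bar>ln q\<bar> + 1)))" by (rule nexp_ennreal) simp
    also have "... < ennreal (exp (ln q))" by (rule ennreal_lessI) auto
    also have "... <= b" using q by simp
    finally show ?case .
   qed
  next
   fix b assume "b < nexp x"
   thus "eventually (%n. b < nexp (s n)) sequentially" using True by simp
  qed
 qed (use True in auto)
qed

lemma nexp_suminf: "(%n. nexp (\<Sum>i<n. s i)) \<longlonglongrightarrow> nexp (\<Sum>i. s i)" for s :: "nat => ennreal"
 by (rule nexp_tendsto[OF summable_LIMSEQ]) (auto intro!: incseq_SucI simp: add_increasing2)

text \<open>At x = 1 and k = \<infinity> the convention 0 * \<infinity> = 0 agrees with the value 1
  of \<open>epow\<close>.\<close>

lemma nexp_nlog_enat:
 assumes "0 <= x" "x <= 1"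
 shows "nexp (nlog x * ennreal_of_enat k) = ennreal (epow x k)"
proof (cases k)
 case (enat n)
 thus ?thesis using nexp_of_nat_mult[of n "nlog x"] assms
  by (simp add: epow_def nexp_nlog ennreal_of_enat_enat mult.commute ennreal_power)
next
 case infinity
 have "nlog x = 0 \<longleftrightarrow> x = 1" using assms by (auto simp: nlog_def ennreal_eq_0_iff)
 thus ?thesis using infinity by (auto simp: epow_def ennreal_mult_top)
qed

lemma nexp_poisson_gen:
 assumes "0 <= x" "x <= 1"
 shows "nexp (a * (1 - ennreal x)) = ennreal (poisson_gen a x)"
proof -
 have e: "1 - ennreal x = ennreal (1 - x)" using assms by (simp add: ennreal_minus flip: ennreal_1)
 show ?thesis
 proof (cases "a = \<infinity>")
  case True
  thus ?thesis using assms by (auto simp: e poisson_gen_def ennreal_top_mult ennreal_eq_0_iff)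
 next
  case False
  hence "a * ennreal (1 - x) = ennreal (enn2real a * (1 - x))"
   using assms by (subst ennreal_mult) (auto simp: less_top)
  thus ?thesis using False assms by (simp add: e poisson_gen_def nexp_ennreal)
 qed
qed

section \<open>Poisson variables as quantiles\<close>

lemma nlog_nexp: "nlog (enn2real (nexp x)) = x" by (cases x) (auto simp: nexp_ennreal nlog_exp, auto simp: nlog_def)

definition unif :: "real measure" where
 "unif = uniform_measure lborel {0..<1}"

text \<open>The quantile transform. The Poisson means depend on W, so the numbers of points have to
  be measurable functions of the mean and of independent uniform variables whose law does not
  involve it.\<close>

definition npois :: "ennreal => real => nat" where
 "npois a u = (LEAST n. u < (\<Sum>j\<le>n. poisson_mass a (enat j)))"

lemma prob_unif: "prob_space unif" unfolding unif_def by (rule prob_space_uniform_measure) auto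

lemma sets_unif [measurable_cong]: "sets unif = sets borel" by (simp add: unif_def)

lemma poisson_mass_measurable [measurable (raw)]:
 assumes [measurable]: "f \<in> Bm M"
 shows "(%x. poisson_mass (f x) k) \<in> Bm M" unfolding poisson_mass_def by (cases k) auto

lemma npois_measurable [measurable (raw)]:
 assumes [measurable]: "f \<in> Bm M" "g \<in> Bm M"
 shows "(%x. npois (f x) (g x)) \<in> M \<rightarrow>\<^sub>M count_space UNIV" unfolding npois_def by measurable

lemma npois_eq_iff:
 assumes a: "a ~= \<infinity>" and u: "0 <= u" "u < 1"
 shows "npois a u = n \<longleftrightarrow> (\<Sum>j<n. poisson_mass a (enat j)) <= u \<and> u < (\<Sum>j<Suc n. poisson_mass a (enat j))"
proof -
 let ?F = "%n. \<Sum>j<n. poisson_mass a (enat j)"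
 have F: "?F \<longlonglongrightarrow> 1" using poisson_mass_sums_1[of a] a by (simp add: sums_def)
 have "eventually (%n. u < ?F n) sequentially" by (rule order_tendstoD(1)[OF F u(2)])
 then obtain n0 where "u < ?F n0" by (auto simp: eventually_sequentially)
 hence "u < ?F (Suc n0)" using poisson_mass_nonneg[of a "enat n0"] by simp
 hence ex: "\<exists>n. u < (\<Sum>j\<le>n. poisson_mass a (enat j))"
  by (auto simp: lessThan_Suc_atMost simp del: sum.lessThan_Suc)
 have mono: "?F i <= ?F j" if "i <= j" for i j
  by (rule sum_mono2) (use that in \<open>auto simp: poisson_mass_nonneg\<close>)
 have P: "u < ?F (Suc (npois a u))" unfolding npois_def lessThan_Suc_atMost by (rule LeastI_ex[OF ex])
 have L: "?F (npois a u) <= u"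
 proof (cases "npois a u")
  case (Suc k)
  hence "\<not> u < (\<Sum>j\<le>k. poisson_mass a (enat j))" unfolding npois_def by (intro not_less_Least) simp
  thus ?thesis using Suc by (simp add: lessThan_Suc_atMost del: sum.lessThan_Suc)
 qed (use u in simp)
 show ?thesis
 proof
  assume R: "?F n <= u \<and> u < ?F (Suc n)"
  show "npois a u = n"
  proof (rule linorder_cases[of "npois a u" n])
   assume "npois a u < n"
   thus ?thesis using mono[of "Suc (npois a u)" n] P R by linarith
  next
   assume "n < npois a u"
   thus ?thesis using mono[of "Suc n" "npois a u"] L R by linarith
  qed
 qed (use P L in auto)
qed

lemma nn_integral_npois:
 assumes a: "a ~= \<infinity>" and x: "0 <= x" "x <= 1"
 shows "(\<integral>\<^sup>+u. ennreal x ^ npois a u \<partial>unif) = nexp (a * (1 - ennreal x))"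
proof -
 let ?F = "%n. \<Sum>j<n. poisson_mass a (enat j)"
 have F01: "0 <= ?F n" "?F n <= 1" for n
 proof -
  show "0 <= ?F n" by (intro sum_nonneg poisson_mass_nonneg)
  show "?F n <= 1" using sum_le_suminf[OF sums_summable[OF poisson_mass_sums_1], of "{..<n}" a] a
    sums_unique[OF poisson_mass_sums_1, of a] by (simp add: poisson_mass_nonneg)
 qed
 interpret u: prob_space unif by (rule prob_unif)
 have AE: "AE u in unif. 0 <= u \<and> u < 1" unfolding unif_def by (rule AE_uniform_measureI) auto
 have em: "emeasure unif {?F n..<?F (Suc n)} = ennreal (poisson_mass a (enat n))" for n
 proof -
  have "{0..<1} \<inter> {?F n..<?F (Suc n)} = {?F n..<?F (Suc n)}" using F01[of n] F01[of "Suc n"] by auto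
  thus ?thesis unfolding unif_def
   by (subst emeasure_uniform_measure) (auto simp: poisson_mass_nonneg divide_ennreal_def)
 qed
 have "(\<integral>\<^sup>+u. ennreal x ^ npois a u \<partial>unif) =
   (\<integral>\<^sup>+u. (\<Sum>n. ennreal x ^ n * indicator {?F n..<?F (Suc n)} u) \<partial>unif)"
 proof (rule nn_integral_cong_AE, use AE in eventually_elim)
  fix u :: real assume u: "0 <= u \<and> u < 1"
  have "(\<Sum>n. ennreal x ^ n * indicator {?F n..<?F (Suc n)} u) =
    (\<Sum>n\<in>{npois a u}. ennreal x ^ n * indicator {?F n..<?F (Suc n)} u)"
     proof (rule suminf_finite)
   fix n assume "n \<notin> {npois a u}"
   hence "u \<notin> {?F n..<?F (Suc n)}" using npois_eq_iff[OF a, of u n] u by auto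
   thus "ennreal x ^ n * indicator {?F n..<?F (Suc n)} u = 0" by (metis indicator_simps(2) mult_zero_right)
  qed simp
  also have "... = ennreal x ^ npois a u" using npois_eq_iff[OF a, of u "npois a u"] u by (simp add: indicator_def)
  finally show "ennreal x ^ npois a u = (\<Sum>n. ennreal x ^ n * indicator {?F n..<?F (Suc n)} u)" ..
 qed
 also have "... = (\<Sum>n. ennreal x ^ n * emeasure unif {?F n..<?F (Suc n)})"
  by (subst nn_integral_suminf) (auto simp: nn_integral_cmult_indicator)
 also have "... = (\<Sum>n. ennreal (poisson_mass a (enat n) * x ^ n))"
  unfolding em by (simp add: ennreal_mult' ennreal_power x poisson_mass_nonneg mult.commute)
 also have "... = ennreal (poisson_gen a x)"
 proof (cases "x = 1")
  case True
  have "(%n. poisson_mass a (enat n) * x ^ n) sums poisson_gen a x"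
   using poisson_mass_sums_1[of a] True a by (simp add: poisson_gen_def)
  thus ?thesis by (rule suminf_ennreal_eq[rotated]) (use x in \<open>simp add: poisson_mass_nonneg\<close>)
 next
  case False
  thus ?thesis by (intro suminf_ennreal_eq poisson_mass_sums) (use x in \<open>auto simp: poisson_mass_nonneg\<close>)
 qed
 also have "... = nexp (a * (1 - ennreal x))" by (rule nexp_poisson_gen[OF x, symmetric])
 finally show ?thesis .
qed

section \<open>Laplace functionals of independent sums\<close>

lemma nexp_nlog_enn2real: "a <= 1 ==> nexp (nlog (enn2real a)) = a" using enn2real_mono[of a 1]
 by (subst nexp_nlog) (auto intro!: ennreal_enn2real intro: le_less_trans simp: less_top[symmetric])

lemma (in prob_space) nn_integral_nexp_le_1: "(\<integral>\<^sup>+x. nexp (f x) \<partial>M) <= 1"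
 using nn_integral_mono[of M "%x. nexp (f x)" "%_. 1"] by (simp add: nexp_le_1 emeasure_space_1)

abbreviation lap :: "nat pmf => ennreal => ennreal" where
 "lap q y \<equiv> \<integral>\<^sup>+k. nexp (of_nat k * y) \<partial>measure_pmf q"

text \<open>Finite independence followed by bounded convergence. The infinite product of the factors
  is written as \<open>nexp\<close> of a sum of \<open>nlog\<close>, which always exists.\<close>

lemma nexp_PiM:
 fixes E :: "nat => 'a measure"
 assumes E: "!!k. prob_space (E k)" and F[measurable]: "!!k. F k \<in> Bm (E k)"
 shows "(\<integral>\<^sup>+b. nexp (\<Sum>k. F k (b k)) \<partial>Pi\<^sub>M UNIV E) = nexp (\<Sum>k. nlog (enn2real (\<integral>\<^sup>+x. nexp (F k x) \<partial>E k)))"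
proof -
 let ?B = "Pi\<^sub>M UNIV E"
 let ?i = "%k. \<integral>\<^sup>+x. nexp (F k x) \<partial>E k" and ?s = "%n b. nexp (\<Sum>k<n. F k (b k))"
 interpret B: prob_space ?B by (rule prob_space_PiM) (rule E)
 have comp: "distr ?B (E k) (%b. b k) = E k" for k by (rule distr_PiM_component) (use E in auto)
 have "distr ?B (Pi\<^sub>M UNIV E) (%b. \<lambda>k\<in>UNIV. b k) = distr ?B ?B (%b. b)"
  by (rule distr_cong) (auto simp: restrict_UNIV)
 also have "... = Pi\<^sub>M UNIV (%k. distr ?B (E k) (%b. b k))"
  unfolding distr_id by (rule PiM_cong) (use comp in auto)
 finally have "B.indep_vars E (%k b. b k) UNIV" by (subst B.indep_vars_iff_distr_eq_PiM') auto
 hence "B.indep_vars E (%k b. b k) {..<n}" for n by (rule B.indep_vars_subset) simp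
 hence ind: "B.indep_vars (%_. borel) (%k b. nexp (F k (b k))) {..<n}" for n
  by (rule B.indep_vars_compose2) measurable
 have v: "nexp (nlog (enn2real (?i k))) = (?i k)" for k
  by (intro nexp_nlog_enn2real prob_space.nn_integral_nexp_le_1 E)
 have "(%n. \<integral>\<^sup>+b. ?s n b \<partial>?B) \<longlonglongrightarrow> (\<integral>\<^sup>+b. nexp (\<Sum>k. F k (b k)) \<partial>?B)"
 proof (rule nn_integral_dominated_convergence[where w="%_. 1"])
  show "AE b in ?B. (%n. ?s n b) \<longlonglongrightarrow> nexp (\<Sum>k. F k (b k))" by (intro AE_I2 nexp_suminf)
 qed (auto simp: nexp_le_1 B.emeasure_space_1)
 moreover have "(\<integral>\<^sup>+b. ?s n b \<partial>?B) = nexp (\<Sum>k<n. nlog (enn2real (?i k)))" for n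
 proof -
  have "(\<integral>\<^sup>+b. ?s n b \<partial>?B) = (\<Prod>k<n. \<integral>\<^sup>+b. nexp (F k (b k)) \<partial>?B)"
   unfolding nexp_sum[OF finite_lessThan] by (rule B.indep_vars_nn_integral[OF _ ind]) auto
  also have "... = (\<Prod>k<n. \<integral>\<^sup>+x. nexp (F k x) \<partial>distr ?B (E k) (%b. b k))"
   by (intro prod.cong refl nn_integral_distr[symmetric]) measurable
  finally show ?thesis by (simp add: comp nexp_sum v)
 qed
 ultimately show ?thesis using nexp_suminf LIMSEQ_unique by (metis (no_types, lifting) ext)
qed

text \<open>The intensity may be infinite near 0. Cutting the line into countably many pieces of
  finite measure allows a Poisson process to be built from a Poisson number of independent points in
  each.\<close>

locale pieces =
 fixes \<mu> :: "real measure" and A :: "nat => real set"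
 assumes sets_\<mu> [measurable_cong]: "sets \<mu> = sets borel"
  and A_sets [measurable]: "!!k. A k \<in> sets borel"
  and A_disjoint: "disjoint_family A"
  and A_cover: "(\<Union>k. A k) = - {0}"
  and A_finite: "!!k. emeasure \<mu> (A k) < \<infinity>"
  and \<mu>_0: "emeasure \<mu> {0} = 0"
begin

text \<open>In a piece of measure 0 the Poisson number of points is almost surely 0, so the law of
  their places is arbitrary there; the point 1 is chosen because it is not 0.\<close>

definition law :: "nat => real measure" where
 "law k = (if emeasure \<mu> (A k) = 0 then return borel 1 else uniform_measure \<mu> (A k))"

lemma sets_law [measurable_cong]: "sets (law k) = sets borel" by (simp add: law_def sets_\<mu>)

lemma prob_law: "prob_space (law k)"
 using A_finite[of k] by (auto simp: law_def intro!: prob_space_return prob_space_uniform_measure)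

lemma law_nonzero: "AE x in law k. x ~= 0"
proof (cases "emeasure \<mu> (A k) = 0")
 case True
 hence "law k = return borel 1" by (simp add: law_def)
 show ?thesis unfolding \<open>law k = return borel 1\<close> by (subst AE_return) auto
next
 case False
 have "AE x in uniform_measure \<mu> (A k). x ~= 0" by (rule AE_uniform_measureI) (use A_cover in auto)
 moreover have "law k = uniform_measure \<mu> (A k)" using False by (simp add: law_def)
 ultimately show ?thesis by metis
qed

lemma law_integral:
 assumes [measurable]: "f \<in> Bm borel"
 shows "emeasure \<mu> (A k) * (\<integral>\<^sup>+x. f x \<partial>law k) = (\<integral>\<^sup>+x. f x * indicator (A k) x \<partial>\<mu>)"
proof (cases "emeasure \<mu> (A k) = 0")
 case True
 hence "AE x in \<mu>. x \<notin> A k" by (intro AE_not_in) (auto simp: null_sets_def sets_\<mu>)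
 hence "(\<integral>\<^sup>+x. f x * indicator (A k) x \<partial>\<mu>) = (\<integral>\<^sup>+x. 0 \<partial>\<mu>)"
  by (intro nn_integral_cong_AE) (auto elim: eventually_mono)
 thus ?thesis using True by simp
next
 case False
 have "(\<integral>\<^sup>+x. f x \<partial>law k) = (\<integral>\<^sup>+x. f x * indicator (A k) x \<partial>\<mu>) / emeasure \<mu> (A k)"
  using False unfolding law_def by (simp add: nn_integral_uniform_measure mult.commute)
 thus ?thesis using False A_finite[of k]
  by (simp add: ennreal_times_divide ennreal_mult_divide_eq mult.commute[of "emeasure \<mu> (A k)"])
qed

text \<open>The randomness of piece k: a uniform variable for the number of points and a sequence of
  candidates for their places, an initial segment of which is \<open>active\<close>.\<close>

definition PE :: "nat => (real \<times> (nat => real)) measure" where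
 "PE k = unif \<Otimes>\<^sub>M Pi\<^sub>M UNIV (%_. law k)"

definition PB :: "(nat => real \<times> (nat => real)) measure" where
 "PB = Pi\<^sub>M UNIV PE"

definition active :: "ennreal => (nat => real \<times> (nat => real)) => nat => nat => bool" where
 "active c b k i \<longleftrightarrow> i < npois (c * emeasure \<mu> (A k)) (fst (b k))"

text \<open>The value 0 has probability 0 under \<open>law k\<close>, but the representation asks
  for nonzero points at every outcome.\<close>

definition place :: "(nat => real \<times> (nat => real)) => nat => nat => real" where
 "place b k i = (if snd (b k) i = 0 then 1 else snd (b k) i)"

lemma place_nonzero: "place b k i ~= 0" by (simp add: place_def)

lemma prob_PE: "prob_space (PE k)"
proof -
 interpret u: prob_space unif by (rule prob_unif)
 interpret l: prob_space "Pi\<^sub>M UNIV (%_::nat. law k)" by (intro prob_space_PiM prob_law)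
 interpret pair_prob_space unif "Pi\<^sub>M UNIV (%_::nat. law k)" ..
 show ?thesis unfolding PE_def by unfold_locales
qed

lemma prob_PB: "prob_space PB" unfolding PB_def by (intro prob_space_PiM prob_PE)

lemma sets_PE [measurable_cong]: "sets (PE k) = sets (borel \<Otimes>\<^sub>M Pi\<^sub>M UNIV (%_. borel))"
 unfolding PE_def by (intro sets_pair_measure_cong sets_PiM_cong sets_unif sets_law refl)

lemma sets_PB [measurable_cong]: "sets PB = sets (Pi\<^sub>M UNIV (%_. borel \<Otimes>\<^sub>M Pi\<^sub>M UNIV (%_. borel)))"
 unfolding PB_def by (intro sets_PiM_cong sets_PE refl)

text \<open>Given their number, independent points give a power of a single expectation; the Poisson
  generating function averages these powers.\<close>

lemma piece_nexp:
 assumes c: "c ~= \<infinity>" and f[measurable]: "f \<in> Bm borel"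
 shows "(\<integral>\<^sup>+b. nexp (\<Sum>i. if i < npois (c * emeasure \<mu> (A k)) (fst b) then f (if snd b i = 0 then 1 else snd b i) else 0) \<partial>PE k) =
  nexp (c * (\<integral>\<^sup>+x. (1 - nexp (f x)) * indicator (A k) x \<partial>\<mu>))"
proof -
 let ?a = "c * emeasure \<mu> (A k)" and ?f = "%x. f (if x = 0 then 1 else x)"
 let ?L = "Pi\<^sub>M UNIV (%_::nat. law k)"
 let ?ph = "\<integral>\<^sup>+x. nexp (f x) \<partial>law k"
 interpret u: prob_space unif by (rule prob_unif)
 interpret l: prob_space "law k" by (rule prob_law)
 interpret L: prob_space "?L" by (intro prob_space_PiM prob_law)
 interpret P: pair_prob_space unif "?L" ..
 have a: "?a ~= \<infinity>" using c A_finite[of k] by (simp add: ennreal_mult_eq_top_iff less_top)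
 have ph1: "?ph <= 1" by (rule l.nn_integral_nexp_le_1)
 define x where "x = enn2real ?ph"
 have x: "0 <= x" "x <= 1" "?ph = ennreal x"
 proof -
  show "0 <= x" by (simp add: x_def)
  show "x <= 1" using enn2real_mono[OF ph1] by (simp add: x_def)
  show "?ph = ennreal x" unfolding x_def using ph1 by (intro ennreal_enn2real[symmetric]) (auto intro: le_less_trans)
 qed
 have f': "(\<integral>\<^sup>+x. nexp (?f x) \<partial>law k) = ennreal x"
  unfolding x(3)[symmetric] by (rule nn_integral_cong_AE) (use law_nonzero[of k] in eventually_elim, simp)
 have inner: "(\<integral>\<^sup>+X. nexp (\<Sum>i. if i < n then ?f (X i) else 0) \<partial>?L) = ennreal x ^ n" for n
 proof -
  let ?y = "%i. enn2real (\<integral>\<^sup>+y. nexp (if i < n then ?f y else 0) \<partial>law k)"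
  have "(\<integral>\<^sup>+X. nexp (\<Sum>i. if i < n then ?f (X i) else 0) \<partial>?L) =
    nexp (\<Sum>i. nlog (?y i))"
   by (rule nexp_PiM[where E="%_. law k" and F="%i y. if i < n then ?f y else 0"]) (use prob_law in auto)
  also have "(\<Sum>i. nlog (?y i)) = (\<Sum>i<n. nlog x)"
  proof (subst suminf_finite[of "{..<n}"])
   show "nlog (?y i) = 0" if "i \<notin> {..<n}" for i using that by (simp add: l.emeasure_space_1 nlog_def)
   show "(\<Sum>i<n. nlog (?y i)) = (\<Sum>i<n. nlog x)" using f' x(1) by (intro sum.cong) simp_all
  qed simp
  also have "nexp ... = ennreal x ^ n" using x by (simp add: nexp_of_nat_mult nexp_nlog)
  finally show ?thesis .
 qed
 have "(\<integral>\<^sup>+b. nexp (\<Sum>i. if i < npois ?a (fst b) then ?f (snd b i) else 0) \<partial>PE k) =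
   (\<integral>\<^sup>+u. \<integral>\<^sup>+X. nexp (\<Sum>i. if i < npois ?a u then ?f (X i) else 0) \<partial>?L \<partial>unif)"
  unfolding PE_def by (subst L.nn_integral_fst[symmetric]) (auto cong: if_cong)
 also have "... = nexp (?a * (1 - ?ph))" unfolding inner x(3) by (rule nn_integral_npois[OF a x(1,2)])
 also have "1 - ?ph = (\<integral>\<^sup>+x. 1 - nexp (f x) \<partial>law k)"
  by (subst nn_integral_diff) (use ph1 in \<open>auto simp: nexp_le_1 l.emeasure_space_1 top_unique\<close>)
 also have "?a * ... = c * (\<integral>\<^sup>+x. (1 - nexp (f x)) * indicator (A k) x \<partial>\<mu>)"
  by (subst law_integral[symmetric]) (auto simp: mult.assoc)
 finally show ?thesis .
qed

text \<open>The Laplace functional of a Poisson random measure with intensity c \<mu>: the pieces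
  are independent and together carry all of \<mu>.\<close>

lemma nexp_points:
 assumes c: "c ~= \<infinity>" and f[measurable]: "f \<in> Bm borel"
 shows "(\<integral>\<^sup>+b. nexp (\<Sum>k. \<Sum>i. if active c b k i then f (place b k i) else 0) \<partial>PB) =
  nexp (c * (\<integral>\<^sup>+x. 1 - nexp (f x) \<partial>\<mu>))"
proof -
 let ?h = "%k x. (1 - nexp (f x)) * indicator (A k) x" and ?F = "%k b. \<Sum>i. if i < npois (c * emeasure \<mu> (A k)) (fst b) then f (if snd b i = 0 then 1 else snd b i) else 0"
 have "(\<integral>\<^sup>+b. nexp (\<Sum>k. \<Sum>i. if active c b k i then f (place b k i) else 0) \<partial>PB) =
   nexp (\<Sum>k. nlog (enn2real (\<integral>\<^sup>+b. nexp (?F k b) \<partial>PE k)))"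
  unfolding PB_def active_def place_def by (rule nexp_PiM[where F="?F"])
    (use prob_PE in auto)
 also have "... = nexp (\<Sum>k. c * (\<integral>\<^sup>+x. ?h k x \<partial>\<mu>))"
  unfolding piece_nexp[OF assms] nlog_nexp ..
 also have "(\<Sum>k. c * (\<integral>\<^sup>+x. ?h k x \<partial>\<mu>)) =
   c * (\<integral>\<^sup>+x. (\<Sum>k. ?h k x) \<partial>\<mu>)" by (subst nn_integral_suminf) auto
 also have "(\<integral>\<^sup>+x. (\<Sum>k. ?h k x) \<partial>\<mu>) = (\<integral>\<^sup>+x. 1 - nexp (f x) \<partial>\<mu>)"
 proof (rule nn_integral_cong_AE)
  have "AE x in \<mu>. x \<notin> {0}" by (rule AE_not_in) (auto simp: null_sets_def sets_\<mu> \<mu>_0)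
  thus "AE x in \<mu>. (\<Sum>k. ?h k x) = 1 - nexp (f x)"
   by eventually_elim (simp add: suminf_indicator[OF A_disjoint] A_cover)
 qed
 finally show ?thesis .
qed

end

lemma poisson_gen_nonneg: "0 <= poisson_gen a x" by (simp add: poisson_gen_def)

section \<open>Enumerating the points\<close>

definition ecount :: "nat set => enat" where
 "ecount S = (if finite S then enat (card S) else \<infinity>)"

lemma bij_enumerate_ecount: "bij_betw (enumerate S) {j. enat j < ecount S} S"
 using finite_bij_enumerate[of S] bij_enumerate[of S] by (auto simp: ecount_def lessThan_def)

text \<open>For a finite S the values of \<open>enumerate\<close> from the cardinality on are
  meaningless, hence the guard.\<close>

lemma suminf_enumerate:
 fixes f :: "nat => ennreal"
 shows "(\<Sum>j. if enat j < ecount S then f (enumerate S j) else 0) = (\<Sum>l. if l \<in> S then f l else 0)"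
proof -
 have e: "(\<Sum>l. if l \<in> I then g l else 0) = (\<integral>\<^sup>+l. g l \<partial>count_space I)" for I and g :: "nat => ennreal"
  by (subst nn_integral_count_space_nat[symmetric])
    (auto simp: nn_integral_count_space_indicator indicator_def intro!: nn_integral_cong)
 show ?thesis using e[of "{j. enat j < ecount S}" "%j. f (enumerate S j)"] e[of S f]
   nn_integral_bij_count_space[OF bij_enumerate_ecount[of S], where f=f] by simp
qed

lemma enumerate_measurable:
 assumes "!!l. Measurable.pred M (%w. l \<in> S w)"
 shows "(%w. enumerate (S w) n) \<in> M \<rightarrow>\<^sub>M count_space (UNIV :: nat set)" using assms
proof (induction n arbitrary: S)
 case 0
 note [measurable] = 0
 show ?case unfolding enumerate.simps by measurable
next
 case (Suc n)
 note [measurable] = Suc.prems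
 show ?case unfolding enumerate.simps by (rule Suc.IH) (simp only: Diff_iff singleton_iff, measurable)
qed

lemma ennreal_ecount: "ennreal_of_enat (ecount S) = (\<Sum>l. of_bool (l \<in> S))"
proof -
 have "(\<Sum>l. of_bool (l \<in> S) :: ennreal) = (\<integral>\<^sup>+l. indicator S l \<partial>count_space UNIV)"
  by (subst nn_integral_count_space_nat[symmetric]) (rule nn_integral_cong, simp add: indicator_def)
 also have "... = emeasure (count_space UNIV) S" by (rule nn_integral_indicator) simp
 finally show ?thesis by (auto simp: ecount_def emeasure_count_space)
qed

lemma ecount_measurable:
 assumes [measurable]: "!!l. Measurable.pred M (%w. l \<in> S w)"
 shows "(%w. ecount (S w)) \<in> M \<rightarrow>\<^sub>M count_space UNIV"
 unfolding measurable_count_space_eq2_countable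
proof safe
 fix a
 have "(%w. ecount (S w)) -` {a} \<inter> space M = {w\<in>space M. (\<Sum>l. of_bool (l \<in> S w)) = ennreal_of_enat a}"
  by (auto simp: ennreal_ecount[symmetric])
 also have "... \<in> sets M" by measurable
 finally show "(%w. ecount (S w)) -` {a} \<inter> space M \<in> sets M" .
qed simp

context pieces
begin

text \<open>Pairs of a piece and a candidate in it are coded as numbers, since the representation
  demands the points as one sequence.\<close>

definition actset :: "ennreal => (nat => real \<times> (nat => real)) => nat set" where
 "actset c b = {l. active c b (fst (prod_decode l)) (snd (prod_decode l))}"

definition pcount :: "ennreal => (nat => real \<times> (nat => real)) => enat" where
 "pcount c b = ecount (actset c b)"

definition point :: "ennreal => (nat => real \<times> (nat => real)) => nat => real" where
 "point c b j = (let l = enumerate (actset c b) j in place b (fst (prod_decode l)) (snd (prod_decode l)))"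

lemma point_nonzero: "point c b j ~= 0" by (simp add: point_def place_nonzero Let_def)

lemma PB_component_measurable [measurable (raw)]:
 assumes g: "g \<in> M \<rightarrow>\<^sub>M PB"
 shows "(%w. fst (g w k)) \<in> Bm M" "(%w. snd (g w k) i) \<in> Bm M"
proof -
 have "(%b. b k) \<in> PB \<rightarrow>\<^sub>M borel \<Otimes>\<^sub>M Pi\<^sub>M UNIV (%_. borel)"
  using measurable_component_singleton[of k UNIV "%_. borel \<Otimes>\<^sub>M Pi\<^sub>M UNIV (%_. borel)"]
  by (simp cong: measurable_cong_sets add: sets_PB)
 from measurable_compose[OF g this]
 have g'[measurable]: "(%w. g w k) \<in> M \<rightarrow>\<^sub>M borel \<Otimes>\<^sub>M Pi\<^sub>M UNIV (%_. borel)" .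
 show "(%w. fst (g w k)) \<in> Bm M" by measurable
 have "(%w. snd (g w k)) \<in> M \<rightarrow>\<^sub>M Pi\<^sub>M UNIV (%_. borel)" by measurable
 from measurable_compose[OF this measurable_component_singleton[of i UNIV "%_. borel"]]
 show "(%w. snd (g w k) i) \<in> Bm M" by simp
qed

lemma actset_measurable:
 assumes [measurable]: "f \<in> Bm M" "g \<in> M \<rightarrow>\<^sub>M PB"
 shows "Measurable.pred M (%w. l \<in> actset (f w) (g w))"
 unfolding actset_def active_def mem_Collect_eq by measurable

lemma pcount_measurable [measurable (raw)]:
 assumes [measurable]: "f \<in> Bm M" "g \<in> M \<rightarrow>\<^sub>M PB"
 shows "(%w. pcount (f w) (g w)) \<in> M \<rightarrow>\<^sub>M count_space UNIV"
 unfolding pcount_def by (intro ecount_measurable actset_measurable assms)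

lemma point_measurable [measurable (raw)]:
 assumes f: "f \<in> Bm M" and g[measurable]: "g \<in> M \<rightarrow>\<^sub>M PB"
 shows "(%w. point (f w) (g w) j) \<in> Bm M" unfolding point_def Let_def
proof (rule measurable_compose_countable[where f="%l w. place (g w) (fst (prod_decode l)) (snd (prod_decode l))"])
 show "(%w. enumerate (actset (f w) (g w)) j) \<in> M \<rightarrow>\<^sub>M count_space UNIV"
  by (intro enumerate_measurable actset_measurable f g)
 show "(%w. place (g w) (fst (prod_decode l)) (snd (prod_decode l))) \<in> Bm M" for l
  unfolding place_def by measurable
qed

lemma suminf_points:
 "(\<Sum>j. if enat j < pcount c b then f (point c b j) else (0::ennreal)) =
  (\<Sum>k. \<Sum>i. if active c b k i then f (place b k i) else 0)"
proof -
 have "(\<Sum>j. if enat j < pcount c b then f (point c b j) else (0::ennreal)) =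
   (\<Sum>l. if l \<in> actset c b then f (place b (fst (prod_decode l)) (snd (prod_decode l))) else 0)"
  unfolding pcount_def point_def Let_def by (rule suminf_enumerate)
 also have "... = (\<Sum>l. (%(k, i). if active c b k i then f (place b k i) else 0) (prod_decode l))"
  by (simp add: actset_def case_prod_beta)
 also have "... = (\<Sum>k. \<Sum>i. if active c b k i then f (place b k i) else 0)"
  by (rule suminf_ennreal_2dimen) simp
 finally show ?thesis .
qed

lemma nexp_point_process:
 assumes "c ~= \<infinity>" "f \<in> Bm borel"
 shows "(\<integral>\<^sup>+b. nexp (\<Sum>j. if enat j < pcount c b then f (point c b j) else 0) \<partial>PB) =
  nexp (c * (\<integral>\<^sup>+x. 1 - nexp (f x) \<partial>\<mu>))"
 unfolding suminf_points by (rule nexp_points[OF assms])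

definition pnum :: "ennreal => (nat => real \<times> (nat => real)) => real set => enat" where
 "pnum c b B = ecount {j. enat j < pcount c b \<and> point c b j \<in> B}"

lemma ennreal_pnum: "ennreal_of_enat (pnum c b B) = (\<Sum>j. if enat j < pcount c b then indicator B (point c b j) else 0)"
 unfolding pnum_def ennreal_ecount by (intro suminf_cong) (auto simp: indicator_def)

lemma pnum_measurable [measurable (raw)]:
 assumes [measurable]: "f \<in> Bm M" "g \<in> M \<rightarrow>\<^sub>M PB" "B \<in> sets borel"
 shows "(%w. pnum (f w) (g w) B) \<in> M \<rightarrow>\<^sub>M count_space UNIV"
 unfolding pnum_def by (rule ecount_measurable) (simp only: mem_Collect_eq, measurable)

lemma suminf_sum_ennreal: "(\<Sum>j. \<Sum>i<n. f i j) = (\<Sum>i<n. \<Sum>j. f i j :: ennreal)" for n :: nat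
 by (induction n) (simp_all add: suminf_add[symmetric])

text \<open>The Laplace functional at a combination of indicators is the joint generating function
  of the counts. Disjointness of the sets makes 1 - \<open>nexp\<close> of the combination additive
  over them, so the generating function factorizes.\<close>

lemma pnum_poisson:
 fixes n :: nat
 assumes c: "c ~= \<infinity>" and B[measurable]: "!!i. i < n ==> B i \<in> sets borel" and disj: "disjoint_family_on B {..<n}"
 shows "measure PB {b\<in>space PB. \<forall>i<n. pnum c b (B i) = k i} =
  (\<Prod>i<n. poisson_mass (c * emeasure \<mu> (B i)) (k i))"
proof -
 interpret PB: prob_space PB by (rule prob_PB)
 show ?thesis
 proof (rule PB.poisson_counts)
  show "(%b. pnum c b (B i)) \<in> PB \<rightarrow>\<^sub>M count_space UNIV" if "i < n" for i
   using B[OF that] by (intro pnum_measurable) auto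
  fix x :: "nat => real" assume x: "!!i. i < n ==> 0 <= x i \<and> x i <= 1"
  define f where "f y = (\<Sum>i<n. nlog (x i) * indicator (B i) y)" for y
  have f[measurable]: "f \<in> Bm borel" unfolding f_def by (intro borel_measurable_sum) (use B in auto)
  have "ennreal (\<Prod>i<n. epow (x i) (pnum c b (B i))) = nexp (\<Sum>j. if enat j < pcount c b then f (point c b j) else 0)" for b
  proof -
   have "ennreal (\<Prod>i<n. epow (x i) (pnum c b (B i))) = (\<Prod>i<n. nexp (nlog (x i) * ennreal_of_enat (pnum c b (B i))))"
    using x epow_bounds by (subst prod_ennreal[symmetric]) (auto simp: nexp_nlog_enat intro!: prod.cong)
   also have "... = nexp (\<Sum>i<n. \<Sum>j. nlog (x i) * (if enat j < pcount c b then indicator (B i) (point c b j) else 0))"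
    by (simp add: nexp_sum ennreal_pnum)
   also have "(\<Sum>i<n. \<Sum>j. nlog (x i) * (if enat j < pcount c b then indicator (B i) (point c b j) else 0)) =
     (\<Sum>j. if enat j < pcount c b then f (point c b j) else 0)"
    unfolding suminf_sum_ennreal[symmetric] by (intro suminf_cong) (auto simp: f_def)
   finally show ?thesis .
  qed
  hence "(\<integral>\<^sup>+b. ennreal (\<Prod>i<n. epow (x i) (pnum c b (B i))) \<partial>PB) = nexp (c * (\<integral>\<^sup>+y. 1 - nexp (f y) \<partial>\<mu>))"
   using nexp_point_process[OF c f] by simp
  also have "(\<integral>\<^sup>+y. 1 - nexp (f y) \<partial>\<mu>) = (\<integral>\<^sup>+y. (\<Sum>i<n. (1 - ennreal (x i)) * indicator (B i) y) \<partial>\<mu>)"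
  proof (rule nn_integral_cong)
   fix y
   show "1 - nexp (f y) = (\<Sum>i<n. (1 - ennreal (x i)) * indicator (B i) y)"
   proof (cases "\<exists>i<n. y \<in> B i")
    case True
    then obtain i where i: "i < n" "y \<in> B i" by auto
    have o: "indicator (B k) y = (if k = i then 1 else 0 :: ennreal)" if "k < n" for k
     using disj i that by (auto simp: disjoint_family_on_def indicator_def)
    have "f y = (\<Sum>k<n. if k = i then nlog (x i) else 0)" unfolding f_def by (rule sum.cong) (auto simp: o)
    moreover have "(\<Sum>k<n. (1 - ennreal (x k)) * indicator (B k) y) = (\<Sum>k<n. if k = i then 1 - ennreal (x i) else 0)"
     by (rule sum.cong) (auto simp: o)
    ultimately show ?thesis using i x by (simp add: nexp_nlog)
   next
    case False
    thus ?thesis by (simp add: f_def indicator_def)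
   qed
  qed
  also have "... = (\<Sum>i<n. (1 - ennreal (x i)) * emeasure \<mu> (B i))"
   using B by (subst nn_integral_sum) (auto simp: nn_integral_cmult_indicator sets_\<mu>)
  also have "nexp (c * ...) = (\<Prod>i<n. nexp (c * emeasure \<mu> (B i) * (1 - ennreal (x i))))"
   by (simp add: sum_distrib_left nexp_sum mult_ac)
  also have "... = (\<Prod>i<n. ennreal (poisson_gen (c * emeasure \<mu> (B i)) (x i)))"
   using x by (intro prod.cong refl nexp_poisson_gen) auto
  also have "... = ennreal (\<Prod>i<n. poisson_gen (c * emeasure \<mu> (B i)) (x i))"
   using x by (intro prod_ennreal) (auto simp: poisson_gen_def)
  finally have "(\<integral>\<^sup>+b. ennreal (\<Prod>i<n. epow (x i) (pnum c b (B i))) \<partial>PB) =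
    ennreal (\<Prod>i<n. poisson_gen (c * emeasure \<mu> (B i)) (x i))" .
  moreover have "(%b. \<Prod>i<n. epow (x i) (pnum c b (B i))) \<in> Bm PB"
  proof (rule borel_measurable_prod)
   fix i assume "i \<in> {..<n}"
   hence "(%b. pnum c b (B i)) \<in> PB \<rightarrow>\<^sub>M count_space UNIV" using B by (intro pnum_measurable) auto
   thus "(%b. epow (x i) (pnum c b (B i))) \<in> Bm PB" by (rule measurable_compose) simp
  qed
  ultimately show "PB.expectation (%b. \<Prod>i<n. epow (x i) (pnum c b (B i))) =
    (\<Prod>i<n. poisson_gen (c * emeasure \<mu> (B i)) (x i))"
   using x epow_bounds prod_nonneg[of "{..<n}" "%i. poisson_gen (c * emeasure \<mu> (B i)) (x i)"]
   by (subst integral_eq_nn_integral) (auto intro!: prod_nonneg simp: poisson_gen_nonneg)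
 qed
qed

end

section \<open>The marked Poisson process over the branching process\<close>

locale cluster = pieces \<mu> A for \<mu> A +
 fixes M :: "'w measure" and th :: real and W :: "'w => real" and q :: "nat pmf"
 assumes prob_M: "prob_space M" and W_meas [measurable]: "W \<in> Bm M"
begin

sublocale M: prob_space M by (rule prob_M)

definition rate :: "'w => ennreal" where
 "rate w = ennreal (th * W w)"

lemma rate_measurable [measurable]: "rate \<in> Bm M" unfolding rate_def by measurable

lemma rate_finite: "rate w ~= \<infinity>" by (simp add: rate_def)

definition MA :: "(nat => nat) measure" where
 "MA = Pi\<^sub>M UNIV (%_. measure_pmf q)"

definition Om :: "((nat => nat) \<times> 'w \<times> (nat => real \<times> (nat => real))) measure" where
 "Om = MA \<Otimes>\<^sub>M (M \<Otimes>\<^sub>M PB)"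

lemma prob_MA: "prob_space MA" unfolding MA_def by (intro prob_space_PiM prob_space_measure_pmf)

sublocale MA: prob_space MA by (rule prob_MA)
sublocale PB: prob_space PB by (rule prob_PB)
sublocale MPB: pair_prob_space M PB ..
sublocale Om: pair_prob_space MA "M \<Otimes>\<^sub>M PB" ..

lemma sets_MA [measurable_cong]: "sets MA = sets (Pi\<^sub>M UNIV (%_. count_space UNIV))"
 unfolding MA_def by (intro sets_PiM_cong) auto

lemma space_MA: "space MA = UNIV" by (simp add: MA_def space_PiM)

lemma space_PB: "space PB = UNIV" using sets_eq_imp_space_eq[OF sets_PB] by (simp add: space_PiM space_pair_measure)

lemma space_Om: "space Om = UNIV \<times> (space M \<times> UNIV)"
 by (simp add: Om_def space_pair_measure space_MA space_PB)

definition PS :: "('w \<times> (nat => real)) measure" where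
 "PS = M \<Otimes>\<^sub>M Pi\<^sub>M UNIV (%_. borel)"

text \<open>Packs the auxiliary randomness into one real sequence, as the prescribed sample space
  requires: index (k, 0) holds mark k, (k, 1) the uniform variable of piece k, and (k, i + 2) its
  candidate i. \<open>dec\<close> is a left inverse.\<close>

definition enc :: "(nat => nat) \<times> 'w \<times> (nat => real \<times> (nat => real)) => 'w \<times> (nat => real)" where
 "enc z = (fst (snd z), %n. let k = fst (prod_decode n); i = snd (prod_decode n) in
   if i = 0 then real (fst z k) else if i = 1 then fst (snd (snd z) k) else snd (snd (snd z) k) (i - 2))"

definition dec :: "'w \<times> (nat => real) => (nat => nat) \<times> 'w \<times> (nat => real \<times> (nat => real))" where
 "dec w = (%k. nat \<lfloor>snd w (prod_encode (k, 0))\<rfloor>,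
   fst w, %k. (snd w (prod_encode (k, 1)), %i. snd w (prod_encode (k, i + 2))))"

definition P :: "('w \<times> (nat => real)) measure" where
 "P = distr Om PS enc"

lemma dec_enc: "dec (enc z) = z" by (cases z) (auto simp: dec_def enc_def Let_def)

lemma fst_snd_dec: "fst (snd (dec w)) = fst w" by (simp add: dec_def)

lemma MA_component_measurable [measurable (raw)]:
 assumes "g \<in> K \<rightarrow>\<^sub>M MA"
 shows "(%w. g w k) \<in> K \<rightarrow>\<^sub>M count_space UNIV"
proof -
 have "(%b. b k) \<in> MA \<rightarrow>\<^sub>M count_space UNIV"
  using measurable_component_singleton[of k UNIV "%_. count_space UNIV"]
  by (simp cong: measurable_cong_sets add: sets_MA)
 from measurable_compose[OF assms this] show ?thesis .
qed

lemma enc_measurable: "enc \<in> Om \<rightarrow>\<^sub>M PS"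
proof -
 have "(%z. \<lambda>n\<in>UNIV. snd (enc z) n) \<in> Om \<rightarrow>\<^sub>M Pi\<^sub>M UNIV (%_. borel)"
  unfolding enc_def snd_conv Let_def Om_def by (intro measurable_restrict) measurable
 moreover have "(%z. fst (enc z)) \<in> Om \<rightarrow>\<^sub>M M" unfolding enc_def fst_conv Om_def by measurable
 ultimately show ?thesis unfolding PS_def by (intro measurable_pair) (auto simp: comp_def restrict_UNIV)
qed

lemma dec_measurable_PS: "dec \<in> PS \<rightarrow>\<^sub>M Om"
proof -
 have c: "(%w. snd w l) \<in> Bm PS" for l :: nat
  using measurable_compose[OF measurable_snd measurable_component_singleton[of l UNIV "%_. borel"]]
  unfolding PS_def by simp
 note [measurable] = c
 have [measurable]: "(%w. nat \<lfloor>snd w l\<rfloor>) \<in> PS \<rightarrow>\<^sub>M count_space UNIV" for l :: nat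
  by (rule measurable_compose[OF measurable_compose[OF c measurable_real_floor]]) simp
 have 1: "(%w. fst (dec w)) \<in> PS \<rightarrow>\<^sub>M MA"
 proof -
  have "(%w. \<lambda>k\<in>UNIV. fst (dec w) k) \<in> PS \<rightarrow>\<^sub>M Pi\<^sub>M UNIV (%_. count_space UNIV)"
   unfolding dec_def fst_conv by (rule measurable_restrict) measurable
  thus ?thesis by (simp add: restrict_UNIV cong: measurable_cong_sets add: sets_MA)
 qed
 have 2: "(%w. fst (snd (dec w))) \<in> PS \<rightarrow>\<^sub>M M" unfolding dec_def PS_def by simp
 have 3: "(%w. snd (snd (dec w))) \<in> PS \<rightarrow>\<^sub>M PB"
 proof -
  have "(%w. \<lambda>i\<in>UNIV. snd w (prod_encode (k, i + 2))) \<in> PS \<rightarrow>\<^sub>M Pi\<^sub>M UNIV (%_. borel)" for k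
   by (intro measurable_restrict) measurable
  hence [measurable]: "(%w. %i. snd w (prod_encode (k, i + 2))) \<in> PS \<rightarrow>\<^sub>M Pi\<^sub>M UNIV (%_. borel)" for k
   by (simp add: restrict_UNIV)
  have "(%w. \<lambda>k\<in>UNIV. snd (snd (dec w)) k) \<in> PS \<rightarrow>\<^sub>M Pi\<^sub>M UNIV (%_. borel \<Otimes>\<^sub>M Pi\<^sub>M UNIV (%_. borel))"
   unfolding dec_def snd_conv by (intro measurable_restrict) measurable
  thus ?thesis by (simp add: restrict_UNIV cong: measurable_cong_sets add: sets_PB)
 qed
 show ?thesis unfolding Om_def using 1 2 3 by (intro measurable_pair) (auto simp: comp_def)
qed

lemma sets_P [measurable_cong]: "sets P = sets PS" by (simp add: P_def)

lemma prob_P: "prob_space P"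
proof -
 have "prob_space Om" unfolding Om_def by unfold_locales
 thus ?thesis unfolding P_def by (rule prob_space.prob_space_distr) (rule enc_measurable)
qed

sublocale P: prob_space P by (rule prob_P)

lemma dec_measurable: "dec \<in> P \<rightarrow>\<^sub>M Om"
 using dec_measurable_PS by (simp cong: measurable_cong_sets add: sets_P)

lemma distr_dec: "distr P Om dec = Om"
proof -
 have "distr P Om dec = distr Om Om (dec \<circ> enc)"
  unfolding P_def by (rule distr_distr[OF dec_measurable_PS enc_measurable])
 also have "dec \<circ> enc = (%z. z)" by (simp add: fun_eq_iff dec_enc)
 finally show ?thesis by simp
qed

lemma fst_measurable_P [measurable]: "fst \<in> P \<rightarrow>\<^sub>M M"
 by (simp cong: measurable_cong_sets add: sets_P PS_def)

lemma nn_integral_dec: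
 assumes f: "f \<in> Bm Om"
 shows "(\<integral>\<^sup>+w. f (dec w) \<partial>P) = (\<integral>\<^sup>+z. f z \<partial>Om)"
 using nn_integral_distr[OF dec_measurable, of f] f by (simp add: distr_dec)

lemma measure_dec:
 assumes f: "S \<in> sets Om"
 shows "measure P (dec -` S \<inter> space P) = measure Om S"
 using measure_distr[OF dec_measurable f] by (simp add: distr_dec)

lemma distr_snd_Om: "distr Om (M \<Otimes>\<^sub>M PB) snd = M \<Otimes>\<^sub>M PB"
proof (rule measure_eqI)
 fix S assume "S \<in> sets (distr Om (M \<Otimes>\<^sub>M PB) snd)"
 hence S: "S \<in> sets (M \<Otimes>\<^sub>M PB)" by simp
 have "emeasure (distr Om (M \<Otimes>\<^sub>M PB) snd) S = emeasure Om (space MA \<times> S)"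
  using sets.sets_into_space[OF S] S
  by (subst emeasure_distr) (auto simp: Om_def space_pair_measure intro!: arg_cong2[where f=emeasure])
 also have "... = emeasure (M \<Otimes>\<^sub>M PB) S"
  unfolding Om_def using S by (subst MPB.P.emeasure_pair_measure_Times) (auto simp: MA.emeasure_space_1)
 finally show "emeasure (distr Om (M \<Otimes>\<^sub>M PB) snd) S = emeasure (M \<Otimes>\<^sub>M PB) S" .
qed simp

lemma distr_fst: "distr P M fst = M"
proof -
 have "distr P M fst = distr P M ((fst \<circ> snd) \<circ> dec)" by (rule distr_cong) (auto simp: dec_def)
 also have "... = distr (distr P Om dec) M (fst \<circ> snd)"
  by (rule distr_distr[symmetric, OF _ dec_measurable]) (auto simp: Om_def comp_def)
 also have "... = distr (distr Om (M \<Otimes>\<^sub>M PB) snd) M fst"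
  unfolding distr_dec by (rule distr_distr[symmetric]) (auto simp: Om_def)
 also note distr_snd_Om
 also have "distr (M \<Otimes>\<^sub>M PB) M fst = M" by (rule PB.distr_pair_fst)
 finally show ?thesis .
qed

lemma is_extension_P: "is_extension M P fst"
 unfolding is_extension_def using prob_P fst_measurable_P distr_fst by auto

definition J :: "'w \<times> (nat => real) => enat" where
 "J w = pcount (rate (fst w)) (snd (snd (dec w)))"

definition e :: "nat => 'w \<times> (nat => real) => real" where
 "e j w = point (rate (fst w)) (snd (snd (dec w))) j"

definition T :: "nat => 'w \<times> (nat => real) => nat" where
 "T j w = fst (dec w) j"

lemma dec_components [measurable]:
 "(%w. fst (dec w)) \<in> P \<rightarrow>\<^sub>M MA"
 "(%w. snd (dec w)) \<in> P \<rightarrow>\<^sub>M M \<Otimes>\<^sub>M PB"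
 "(%w. snd (snd (dec w))) \<in> P \<rightarrow>\<^sub>M PB" using dec_measurable unfolding Om_def by measurable

lemma J_measurable [measurable]: "J \<in> P \<rightarrow>\<^sub>M count_space UNIV" unfolding J_def by measurable

lemma e_measurable [measurable]: "e j \<in> Bm P" unfolding e_def by measurable

lemma T_measurable [measurable]: "T j \<in> P \<rightarrow>\<^sub>M count_space UNIV" unfolding T_def by measurable

lemma e_nonzero: "e j w ~= 0" by (simp add: e_def point_nonzero)

lemma nexp_marks:
 fixes y :: "nat => ennreal" and n :: enat
 shows "(\<integral>\<^sup>+a. nexp (\<Sum>j. if enat j < n then of_nat (a j) * y j else 0) \<partial>MA) =
  nexp (\<Sum>j. if enat j < n then nlog (enn2real (lap q (y j))) else 0)"
proof -
 have "(\<integral>\<^sup>+a. nexp (\<Sum>j. if enat j < n then of_nat (a j) * y j else 0) \<partial>MA) =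
   nexp (\<Sum>j. nlog (enn2real (\<integral>\<^sup>+k. nexp (if enat j < n then of_nat k * y j else 0) \<partial>measure_pmf q)))"
  unfolding MA_def
  by (rule nexp_PiM[where E="%_. measure_pmf q" and F="%j k. if enat j < n then of_nat k * y j else 0"])
    (auto simp: prob_space_measure_pmf)
 also have "... = nexp (\<Sum>j. if enat j < n then nlog (enn2real (lap q (y j))) else 0)"
  by (intro arg_cong[where f=nexp] suminf_cong) (auto simp: measure_pmf.emeasure_space_1[simplified] nlog_def)
 finally show ?thesis .
qed

text \<open>The marks are integrated first, with the points fixed. This turns f into minus the
  logarithm of the Laplace transform of the mark law at f, and the Laplace functional of the Poisson
  process is applied to that function.\<close>

lemma nexp_cluster:
 assumes f[measurable]: "f \<in> Bm borel"
 shows "(\<integral>\<^sup>+o1. nexp (\<Sum>j. if enat j < J o1 then of_nat (T j o1) * f (e j o1) else 0) \<partial>P) =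
  (\<integral>\<^sup>+w. nexp (rate w * (\<integral>\<^sup>+x. 1 - (lap q (f x)) \<partial>\<mu>)) \<partial>M)"
proof -
 let ?F = "%z. nexp (\<Sum>j. if enat j < pcount (rate (fst (snd z))) (snd (snd z))
   then of_nat (fst z j) * f (point (rate (fst (snd z))) (snd (snd z)) j) else 0)"
 let ?\<psi> = "%x. nlog (enn2real (lap q (f x)))"
 have F: "?F \<in> Bm Om" unfolding Om_def by measurable
 have [measurable]: "?\<psi> \<in> Bm borel" by measurable
 have \<psi>: "nexp (?\<psi> x) = (lap q (f x))" for x by (intro nexp_nlog_enn2real measure_pmf.nn_integral_nexp_le_1)
 have "(\<integral>\<^sup>+o1. nexp (\<Sum>j. if enat j < J o1 then of_nat (T j o1) * f (e j o1) else 0) \<partial>P) = (\<integral>\<^sup>+z. ?F z \<partial>Om)"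
  using nn_integral_dec[OF F] by (simp add: J_def T_def e_def fst_snd_dec cong: if_cong)
 also have "... = (\<integral>\<^sup>+v. \<integral>\<^sup>+a. ?F (a, v) \<partial>MA \<partial>(M \<Otimes>\<^sub>M PB))"
  using F unfolding Om_def by (subst Om.nn_integral_snd[symmetric]) auto
 also have "... = (\<integral>\<^sup>+v. nexp (\<Sum>j. if enat j < pcount (rate (fst v)) (snd v) then ?\<psi> (point (rate (fst v)) (snd v) j) else 0) \<partial>(M \<Otimes>\<^sub>M PB))"
  unfolding fst_conv snd_conv nexp_marks ..
 also have "... = (\<integral>\<^sup>+w. \<integral>\<^sup>+b. nexp (\<Sum>j. if enat j < pcount (rate w) b then ?\<psi> (point (rate w) b j) else 0) \<partial>PB \<partial>M)"
  by (subst PB.nn_integral_fst[symmetric]) (auto cong: if_cong)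
 also have "... = (\<integral>\<^sup>+w. nexp (rate w * (\<integral>\<^sup>+x. 1 - nexp (?\<psi> x) \<partial>\<mu>)) \<partial>M)"
  by (subst nexp_point_process[OF rate_finite]) auto
 finally show ?thesis unfolding \<psi> .
qed

lemma indep_T: "P.indep_vars (%_. count_space UNIV) T UNIV"
proof -
 have MA': "distr P MA (%w. fst (dec w)) = MA"
 proof -
  have "distr P MA (%w. fst (dec w)) = distr (distr P Om dec) MA fst"
   by (subst distr_distr[OF _ dec_measurable]) (auto simp: Om_def comp_def[abs_def])
  also have "... = MA" unfolding distr_dec unfolding Om_def by (rule MPB.P.distr_pair_fst)
  finally show ?thesis .
 qed
 have Tj: "distr P (count_space UNIV) (T j) = measure_pmf q" for j
 proof -
  have "distr P (count_space UNIV) (T j) = distr (distr P MA (%w. fst (dec w))) (count_space UNIV) (%a. a j)"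
   by (subst distr_distr) (auto simp: T_def[abs_def] comp_def)
  also have "... = distr MA (measure_pmf q) (%a. a j)" unfolding MA' by (rule distr_cong) auto
  also have "... = measure_pmf q" unfolding MA_def by (rule distr_PiM_component) (auto simp: prob_space_measure_pmf)
  finally show ?thesis .
 qed
 have "distr P (Pi\<^sub>M UNIV (%_. count_space UNIV)) (%w. \<lambda>j\<in>UNIV. T j w) = distr P MA (%w. fst (dec w))"
  by (rule distr_cong) (auto simp: sets_MA T_def[abs_def] restrict_UNIV)
 also have "... = Pi\<^sub>M UNIV (%j. distr P (count_space UNIV) (T j))" unfolding MA' unfolding MA_def Tj ..
 finally show ?thesis by (subst P.indep_vars_iff_distr_eq_PiM') auto
qed

lemma measure_T: "measure P {w\<in>space P. T j w = k} = pmf q k"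
proof -
 have [measurable]: "(%z. fst z j) \<in> Om \<rightarrow>\<^sub>M count_space UNIV" unfolding Om_def by measurable
 have S: "{z\<in>space Om. fst z j = k} \<in> sets Om" by measurable
 have "measure P {w\<in>space P. T j w = k} = measure P (dec -` {z\<in>space Om. fst z j = k} \<inter> space P)"
  using measurable_space[OF dec_measurable] by (intro arg_cong2[where f=measure] refl) (auto simp: T_def)
 also have "... = measure Om ({a. a j = k} \<times> space (M \<Otimes>\<^sub>M PB))" unfolding measure_dec[OF S]
  by (intro arg_cong2[where f=measure] refl) (auto simp: space_Om space_pair_measure space_PB)
 also have "... = measure MA {a. a j = k}"
 proof -
  have "{a. a j = k} = {a\<in>space MA. a j = k}" by (auto simp: space_MA)
  also have "... \<in> sets MA" by measurable
  finally show ?thesis unfolding Om_def by (subst measure_def, subst MPB.P.emeasure_pair_measure_Times)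
     (auto simp: MPB.P.emeasure_space_1 measure_def)
 qed
 also have "... = measure (distr MA (measure_pmf q) (%a. a j)) {k}"
  by (subst measure_distr) (auto simp: space_MA vimage_def cong: measurable_cong_sets)
 also have "distr MA (measure_pmf q) (%a. a j) = measure_pmf q" unfolding MA_def
  by (rule distr_PiM_component) (auto simp: prob_space_measure_pmf)
 finally show ?thesis by (simp add: measure_pmf_single)
qed

end

context cluster
begin

text \<open>The marks are functions of the first factor of \<open>Om\<close>, while W, the number of
  points and their enumeration are functions of the second. Independence is the product formula for
  rectangles, transported along \<open>dec\<close>.\<close>

lemma indep_marks:
 "P.indep_set (sets (vimage_algebra (space P) (%w j. T j w) (Pi\<^sub>M UNIV (%_. count_space UNIV))))
   (sets (vimage_algebra (space P) (%w. (W (fst w), J w, %j. e j w))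
    (borel \<Otimes>\<^sub>M (count_space UNIV \<Otimes>\<^sub>M Pi\<^sub>M UNIV (%_. borel)))))"
proof -
 define G where "G v = (W (fst v), pcount (rate (fst v)) (snd v), %j. point (rate (fst v)) (snd v) j)" for v
 let ?TS = "borel \<Otimes>\<^sub>M (count_space UNIV \<Otimes>\<^sub>M Pi\<^sub>M UNIV (%_. borel)) :: (real \<times> enat \<times> (nat => real)) measure"
 let ?MP = "M \<Otimes>\<^sub>M PB" and ?A = "Pi\<^sub>M UNIV (%_. count_space UNIV)" and ?f = "%w. fst (dec w)" and ?g = "%w. G (snd (dec w))"
 have "(%v. \<lambda>j\<in>UNIV. point (rate (fst v)) (snd v) j) \<in> ?MP \<rightarrow>\<^sub>M Pi\<^sub>M UNIV (%_. borel)"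
  by (intro measurable_restrict) measurable
 hence [measurable]: "(%v j. point (rate (fst v)) (snd v) j) \<in> ?MP \<rightarrow>\<^sub>M Pi\<^sub>M UNIV (%_. borel)"
  by (simp add: restrict_UNIV)
 have G[measurable]: "G \<in> ?MP \<rightarrow>\<^sub>M ?TS" unfolding G_def by measurable
 have V: "(W (fst w), J w, %j. e j w) = ?g w" for w by (simp add: G_def J_def e_def fst_snd_dec)
 have Tm: "(%w j. T j w) = ?f" by (simp add: T_def fun_eq_iff)
 have space: "w \<in> space P ==> dec w \<in> space Om" for w by (rule measurable_space[OF dec_measurable])
 have fm: "?f \<in> P \<rightarrow>\<^sub>M ?A"
  using dec_components(1) by (simp cong: measurable_cong_sets add: sets_MA)
 have gm: "?g \<in> P \<rightarrow>\<^sub>M ?TS" by measurable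
 have rect: "measure P {w\<in>space P. ?f w \<in> X \<and> ?g w \<in> Y} =
   measure MA X * measure ?MP (G -` Y \<inter> space ?MP)"
  if X: "X \<in> sets MA" and Y: "Y \<in> sets ?TS" for X Y
 proof -
  let ?Y = "G -` Y \<inter> space ?MP"
  have Y': "?Y \<in> sets ?MP" by (rule measurable_sets[OF G Y])
  have "{w\<in>space P. ?f w \<in> X \<and> ?g w \<in> Y} = dec -` (X \<times> ?Y) \<inter> space P"
   using space by (auto simp: space_Om space_pair_measure space_PB mem_Times_iff)
  hence "measure P {w\<in>space P. ?f w \<in> X \<and> ?g w \<in> Y} = measure Om (X \<times> ?Y)"
   using X Y' measure_dec[of "X \<times> ?Y"] by (simp add: Om_def)
  also have "... = measure MA X * measure ?MP ?Y"
   unfolding Om_def measure_def using X Y' by (subst MPB.P.emeasure_pair_measure_Times) (auto simp: enn2real_mult)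
  finally show ?thesis .
 qed
 show ?thesis unfolding P.indep_sets2_eq V Tm
 proof (intro conjI ballI)
  show "sets (vimage_algebra (space P) ?f ?A) \<subseteq> P.events"
   using fm by (auto simp: sets_vimage_algebra2 measurable_def)
  show "sets (vimage_algebra (space P) ?g ?TS) \<subseteq> P.events"
   using gm by (auto simp: sets_vimage_algebra2 measurable_def)
  fix a b
  assume "a \<in> sets (vimage_algebra (space P) ?f ?A)"
  then obtain X where X: "X \<in> sets MA" and a: "a = {w\<in>space P. ?f w \<in> X}"
   using measurable_space[OF fm] by (subst (asm) sets_vimage_algebra2) (auto simp: sets_MA)
  assume "b \<in> sets (vimage_algebra (space P) ?g ?TS)"
  then obtain Y where Y: "Y \<in> sets ?TS" and b: "b = {w\<in>space P. ?g w \<in> Y}"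
   using measurable_space[OF gm] by (subst (asm) sets_vimage_algebra2) auto
  let ?Y = "G -` Y \<inter> space ?MP"
  have a': "P.prob a = measure MA X"
  proof -
   have "G -` space ?TS \<inter> space ?MP = space ?MP" using measurable_space[OF G] by auto
   thus ?thesis using rect[OF X sets.top] measurable_space[OF gm] by (simp add: a MPB.prob_space cong: conj_cong)
  qed
  have b': "P.prob b = measure ?MP ?Y" using rect[OF sets.top Y] MA.prob_space by (simp add: b space_MA)
  show "P.prob (a \<inter> b) = P.prob a * P.prob b"
   unfolding a' b' rect[OF X Y, symmetric] by (rule arg_cong[where f=P.prob]) (auto simp: a b)
 qed
qed

text \<open>At a fixed outcome of the branching process the counts are Poisson by
  \<open>pnum_poisson\<close>. The resulting probability h depends on the outcome only through W, so
  it is already the conditional expectation given W.\<close>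

lemma cond_counts:
 fixes n :: nat and B :: "nat => real set" and k :: "nat => enat"
 defines "F \<equiv> vimage_algebra (space P) (%o1. W (fst o1)) borel"
 defines "E \<equiv> {o1\<in>space P. \<forall>i<n. pnum (rate (fst o1)) (snd (snd (dec o1))) (B i) = k i}"
 assumes B: "!!i. i < n ==> B i \<in> sets borel" and disj: "disjoint_family_on B {..<n}"
 shows "AE o1 in P. real_cond_exp P F (indicator E) o1 =
  (\<Prod>i<n. poisson_mass (rate (fst o1) * emeasure \<mu> (B i)) (k i))"
proof -
 let ?MP = "M \<Otimes>\<^sub>M PB" and ?W = "%o1. W (fst o1)" and ?N = "%v i. pnum (rate (fst v)) (snd v) (B i)"
 have Wm: "?W \<in> Bm P" by measurable
 have sub: "subalgebra P F"
  unfolding subalgebra_def F_def using Wm by (auto simp: sets_vimage_algebra2 measurable_def)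
 interpret F: finite_measure_subalgebra P F by unfold_locales (rule sub)
 define h where "h w = (\<Prod>i<n. poisson_mass (rate w * emeasure \<mu> (B i)) (k i))" for w
 have h01: "0 <= h w" "h w <= 1" for w
  unfolding h_def by (auto intro!: prod_nonneg prod_le_1 simp: poisson_mass_nonneg poisson_mass_le_1)
 have h[measurable]: "h \<in> Bm M" unfolding h_def by measurable
 define C where "C = {v\<in>space ?MP. \<forall>i<n. ?N v i = k i}"
 have pm: "(%v. ?N v i) \<in> ?MP \<rightarrow>\<^sub>M count_space UNIV" if "i < n" for i
  using B[OF that] by measurable
 have C[measurable]: "C \<in> sets ?MP"
 proof -
  have "C = {v\<in>space ?MP. \<forall>i\<in>{..<n}. ?N v i = k i}" by (auto simp: C_def)
  also have "... \<in> sets ?MP"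
   using pm by (intro sets.sets_Collect_finite_All) (auto intro!: measurable_equality_set)
  finally show ?thesis .
 qed
 have space: "o1 \<in> space P ==> snd (dec o1) \<in> space ?MP" for o1
  by (rule measurable_space[OF dec_components(2)])
 have E_C: "o1 \<in> E \<longleftrightarrow> snd (dec o1) \<in> C" if "o1 \<in> space P" for o1
  using space[OF that] that by (auto simp: E_def C_def fst_snd_dec)
 have E[measurable]: "E \<in> sets P"
 proof -
  have "E = (%o1. snd (dec o1)) -` C \<inter> space P" using space by (auto simp: E_def C_def fst_snd_dec)
  thus ?thesis using measurable_sets[OF dec_components(2) C] by simp
 qed
 have Cw: "(\<integral>\<^sup>+b. indicator C (w, b) \<partial>PB) = ennreal (h w)" if "w \<in> space M" for w
 proof -
  have eq: "Pair w -` C = {b\<in>space PB. \<forall>i<n. pnum (rate w) b (B i) = k i}"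
   using that by (auto simp: C_def space_pair_measure)
  have "Pair w -` C \<in> sets PB" by (rule sets_Pair1[OF C])
  hence "(\<integral>\<^sup>+b. indicator (Pair w -` C) b \<partial>PB) = emeasure PB {b\<in>space PB. \<forall>i<n. pnum (rate w) b (B i) = k i}"
   unfolding eq by (rule nn_integral_indicator)
  moreover have "indicator (Pair w -` C) b = (indicator C (w, b) :: ennreal)" for b by (simp add: indicator_def)
  ultimately have "(\<integral>\<^sup>+b. indicator C (w, b) \<partial>PB) = emeasure PB {b\<in>space PB. \<forall>i<n. pnum (rate w) b (B i) = k i}"
   by simp
  thus ?thesis using pnum_poisson[OF rate_finite[of w] B disj, of k] by (simp add: h_def PB.emeasure_eq_measure)
 qed
 have "AE o1 in P. real_cond_exp P F (indicator E) o1 = h (fst o1)"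
 proof (rule F.real_cond_exp_charact)
  show "integrable P (indicator E :: _ => real)" by (simp add: P.emeasure_eq_measure)
  show "integrable P (%o1. h (fst o1))" by (rule P.integrable_const_bound[where B=1]) (use h01 in auto)
  have "?W \<in> Bm F" unfolding F_def by (rule measurable_vimage_algebra1) auto
  thus "(%o1. h (fst o1)) \<in> Bm F" unfolding h_def rate_def by measurable
  fix S assume S: "S \<in> sets F"
  then obtain Y where Y[measurable]: "Y \<in> sets borel" and S_eq: "S = ?W -` Y \<inter> space P"
   unfolding F_def by (subst (asm) sets_vimage_algebra2) auto
  have [measurable]: "S \<in> sets P" using S sub by (auto simp: subalgebra_def)
  have "(\<integral>\<^sup>+o1. ennreal (indicator S o1 *\<^sub>R indicator E o1) \<partial>P) =
    (\<integral>\<^sup>+o1. indicator Y (W (fst (snd (dec o1)))) * indicator C (snd (dec o1)) \<partial>P)"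
   by (intro nn_integral_cong) (auto simp: E_C S_eq fst_snd_dec indicator_def)
  also have "... = (\<integral>\<^sup>+z. indicator Y (W (fst (snd z))) * indicator C (snd z) \<partial>Om)"
   by (rule nn_integral_dec) (simp add: Om_def)
  also have "... = (\<integral>\<^sup>+v. indicator Y (W (fst v)) * indicator C v \<partial>distr Om ?MP snd)"
   by (subst nn_integral_distr) (auto simp: Om_def)
  also have "... = (\<integral>\<^sup>+w. \<integral>\<^sup>+b. indicator Y (W w) * indicator C (w, b) \<partial>PB \<partial>M)"
   unfolding distr_snd_Om by (subst PB.nn_integral_fst[symmetric]) auto
  also have "... = (\<integral>\<^sup>+w. indicator Y (W w) * ennreal (h w) \<partial>M)"
   by (intro nn_integral_cong) (simp add: nn_integral_cmult Cw)
  also have "... = (\<integral>\<^sup>+w. indicator Y (W w) * ennreal (h w) \<partial>distr P M fst)" unfolding distr_fst ..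
  also have "... = (\<integral>\<^sup>+o1. indicator Y (W (fst o1)) * ennreal (h (fst o1)) \<partial>P)"
   by (subst nn_integral_distr) auto
  also have "... = (\<integral>\<^sup>+o1. ennreal (indicator S o1 *\<^sub>R h (fst o1)) \<partial>P)"
   by (intro nn_integral_cong) (auto simp: S_eq indicator_def)
  finally show "set_lebesgue_integral P S (indicator E) = set_lebesgue_integral P S (%o1. h (fst o1))"
   unfolding set_lebesgue_integral_def by (subst (1 2) integral_eq_nn_integral) (auto simp: h01)
 qed
 thus ?thesis by (simp add: h_def)
qed

end

section \<open>The limiting random measure\<close>

text \<open>\<pi> on the finite nonzero points, seen on the real line. Mass at the infinite points
  is dropped, in accordance with the integrals over \<open>R0\<close> in the theorem.\<close>

definition rpart :: "ereal measure => real measure" where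
 "rpart \<pi> = distr (restrict_space \<pi> R0) borel real_of_ereal"

text \<open>Each shell keeps a distance of at least 1 / (k + 1) from 0, where a Radon measure is
  finite.\<close>

definition shell :: "nat => real set" where
 "shell k = {x. x ~= 0 \<and> nat \<lfloor>1 / \<bar>x\<bar>\<rfloor> = k}"

lemma R0_borel: "R0 \<in> sets borel"
proof -
 have "R0 = UNIV - {0, \<infinity>, - \<infinity>}" by (auto simp: R0_def)
 moreover have "UNIV - {0, \<infinity>, - \<infinity>} \<in> sets (borel :: ereal measure)" by (intro sets.Diff) auto
 ultimately show ?thesis by simp
qed

lemma sets_radon: "\<pi> \<in> radon_R0bar ==> sets \<pi> = sets R0bar" by (simp add: radon_R0bar_def)

lemma R0_radon: "\<pi> \<in> radon_R0bar ==> R0 \<in> sets \<pi>"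
 by (simp add: sets_radon sets_R0bar_iff R0_borel) (simp add: R0_def)

lemma measurable_restrict_R0:
 assumes \<pi>: "\<pi> \<in> radon_R0bar" and "f \<in> Bm borel"
 shows "f \<in> Bm (restrict_space \<pi> R0)" using measurable_R0bar[OF assms(2)]
 by (intro measurable_restrict_space1) (simp cong: measurable_cong_sets add: sets_radon[OF \<pi>])

lemma nn_integral_rpart:
 assumes \<pi>: "\<pi> \<in> radon_R0bar" and [measurable]: "f \<in> Bm borel"
 shows "(\<integral>\<^sup>+x. f x \<partial>rpart \<pi>) = (\<integral>\<^sup>+x. f (real_of_ereal x) * indicator R0 x \<partial>\<pi>)"
proof -
 have "real_of_ereal \<in> Bm (restrict_space \<pi> R0)" by (rule measurable_restrict_R0[OF \<pi>]) simp
 hence "(\<integral>\<^sup>+x. f x \<partial>rpart \<pi>) = (\<integral>\<^sup>+x. f (real_of_ereal x) \<partial>restrict_space \<pi> R0)"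
  unfolding rpart_def by (rule nn_integral_distr) simp
 also have "... = (\<integral>\<^sup>+x. f (real_of_ereal x) * indicator R0 x \<partial>\<pi>)"
  using R0_radon[OF \<pi>] by (intro nn_integral_restrict_space) (metis sets.Int_space_eq2)
 finally show ?thesis .
qed

lemma emeasure_rpart:
 assumes \<pi>: "\<pi> \<in> radon_R0bar" and B: "B \<in> sets borel" "B \<subseteq> R0"
 shows "emeasure (rpart \<pi>) (ereal -` B) = emeasure \<pi> B"
proof -
 have [measurable]: "ereal -` B \<in> sets borel" using B(1) measurable_sets[of ereal borel borel B] by simp
 have "emeasure (rpart \<pi>) (ereal -` B) = (\<integral>\<^sup>+x. indicator (ereal -` B) x \<partial>rpart \<pi>)"
  by (rule nn_integral_indicator[symmetric]) (simp add: rpart_def)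
 also have "... = (\<integral>\<^sup>+x. indicator (ereal -` B) (real_of_ereal x) * indicator R0 x \<partial>\<pi>)"
  by (rule nn_integral_rpart[OF \<pi>]) simp
 also have "... = (\<integral>\<^sup>+x. indicator B x \<partial>\<pi>)"
  using B(2) by (intro nn_integral_cong) (auto simp: indicator_def R0_def ereal_real)
 also have "... = emeasure \<pi> B"
  using B by (intro nn_integral_indicator) (auto simp: sets_radon[OF \<pi>] sets_R0bar_iff R0_def)
 finally show ?thesis .
qed

lemma rpart_far_finite:
 assumes \<pi>: "\<pi> \<in> radon_R0bar" and dl: "0 < dl"
 shows "emeasure (rpart \<pi>) {x. dl <= \<bar>x\<bar>} < \<infinity>"
proof -
 let ?K = "{ereal dl..} \<union> {..- ereal dl}"
 have "compact ?K" by (subst compact_eq_closed) auto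
 hence fin: "emeasure \<pi> ?K < \<infinity>" using \<pi> dl by (auto simp: radon_R0bar_def)
 have K: "?K \<in> sets \<pi>" using dl by (auto simp: sets_radon[OF \<pi>] sets_R0bar_iff)
 have "{x. dl <= \<bar>x\<bar>} = ereal -` (?K \<inter> R0)" using dl by (auto simp: R0_def)
 hence "emeasure (rpart \<pi>) {x. dl <= \<bar>x\<bar>} = emeasure \<pi> (?K \<inter> R0)"
  using R0_borel by (subst emeasure_rpart[OF \<pi>, symmetric]) auto
 also have "... <= emeasure \<pi> ?K" by (rule emeasure_mono) (use K in auto)
 finally show ?thesis using fin by (rule le_less_trans)
qed

lemma pieces_rpart:
 assumes \<pi>: "\<pi> \<in> radon_R0bar"
 shows "pieces (rpart \<pi>) shell"
proof
 show "sets (rpart \<pi>) = sets borel" by (simp add: rpart_def)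
 show "shell k \<in> sets borel" for k unfolding shell_def by measurable
 show "disjoint_family shell" by (auto simp: disjoint_family_on_def shell_def)
 show "(\<Union>k. shell k) = - {0}" by (auto simp: shell_def)
 have "emeasure (rpart \<pi>) (ereal -` {}) = emeasure \<pi> {}" by (rule emeasure_rpart[OF \<pi>]) auto
 show "emeasure (rpart \<pi>) {0} = 0"
 proof -
  have "emeasure (rpart \<pi>) {0} = (\<integral>\<^sup>+x. indicator {0} x \<partial>rpart \<pi>)"
   by (rule nn_integral_indicator[symmetric]) (simp add: rpart_def)
  also have "... = (\<integral>\<^sup>+x. indicator {0} (real_of_ereal x) * indicator R0 x \<partial>\<pi>)"
   by (rule nn_integral_rpart[OF \<pi>]) simp
  also have "... = (\<integral>\<^sup>+x. 0 \<partial>\<pi>)"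
   by (intro nn_integral_cong) (auto simp: indicator_def R0_def real_of_ereal_eq_0)
  finally show ?thesis by simp
 qed
 show "emeasure (rpart \<pi>) (shell k) < \<infinity>" for k
 proof -
  have "shell k \<subseteq> {x. 1 / (real k + 1) <= \<bar>x\<bar>}"
  proof safe
   fix x assume "x \<in> shell k"
   hence x: "x ~= 0" "nat \<lfloor>1 / \<bar>x\<bar>\<rfloor> = k" by (auto simp: shell_def)
   hence "1 / \<bar>x\<bar> < real k + 1" by linarith
   thus "1 / (real k + 1) <= \<bar>x\<bar>" using x(1) by (simp add: field_simps)
  qed
  hence "emeasure (rpart \<pi>) (shell k) <= emeasure (rpart \<pi>) {x. 1 / (real k + 1) <= \<bar>x\<bar>}"
   by (rule emeasure_mono) (simp add: rpart_def)
  also have "... < \<infinity>" by (rule rpart_far_finite[OF \<pi>]) simp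
  finally show ?thesis .
 qed
qed

text \<open>The conditional mean is finite, and a Poisson law with finite mean gives no mass to
  \<infinity>.\<close>

lemma (in cluster) AE_pnum_finite:
 assumes B: "B \<in> sets borel" "emeasure \<mu> B < \<infinity>"
 shows "AE w in P. pnum (rate (fst w)) (snd (snd (dec w))) B ~= \<infinity>"
proof -
 let ?F = "vimage_algebra (space P) (%w. W (fst w)) borel"
 define E where "E = {w\<in>space P. pnum (rate (fst w)) (snd (snd (dec w))) B = \<infinity>}"
 have Wm: "(%w. W (fst w)) \<in> Bm P" by measurable
 have sub: "subalgebra P ?F" unfolding subalgebra_def using Wm by (auto simp: sets_vimage_algebra2 measurable_def)
 interpret F: finite_measure_subalgebra P ?F by unfold_locales (rule sub)
 have E: "E \<in> sets P" unfolding E_def using B(1) by measurable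
 have "AE w in P. real_cond_exp P ?F (indicator {w\<in>space P. \<forall>i<Suc 0. pnum (rate (fst w)) (snd (snd (dec w))) B = \<infinity>}) w =
   (\<Prod>i<Suc 0. poisson_mass (rate (fst w) * emeasure \<mu> B) \<infinity>)"
  by (rule cond_counts[where B="%_. B" and k="%_. \<infinity>" and n="Suc 0"]) (auto simp: B disjoint_family_on_def)
 hence "AE w in P. real_cond_exp P ?F (indicator E) w = 0"
 proof eventually_elim
  case (elim w)
  have "rate (fst w) * emeasure \<mu> B ~= \<infinity>" using B(2) rate_finite by (simp add: ennreal_mult_eq_top_iff less_top)
  thus ?case using elim by (simp add: E_def poisson_mass_def)
 qed
 hence "(LINT w|P. real_cond_exp P ?F (indicator E) w) = 0" by (intro integral_eq_zero_AE)
 hence "P.prob E = 0" using F.real_cond_exp_int(2)[of "indicator E"] E by (simp add: P.emeasure_eq_measure)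
 hence "emeasure P E = 0" by (simp add: P.emeasure_eq_measure)
 hence "AE w in P. w \<notin> E" using E by (intro AE_not_in) (simp add: null_sets_def)
 thus ?thesis using AE_space by eventually_elim (simp add: E_def)
qed

locale cluster_radon = cluster "rpart \<pi>" shell M th W q for \<pi> and M :: "'w measure" and th W q +
 assumes radon: "\<pi> \<in> radon_R0bar"
begin

abbreviation numb :: "'w \<times> (nat => real) => real set => enat" where
 "numb w B \<equiv> pnum (rate (fst w)) (snd (snd (dec w))) B"

definition good :: "'w \<times> (nat => real) => bool" where
 "good w \<longleftrightarrow> (\<forall>n. numb w {x. 1 / real (Suc n) <= \<bar>x\<bar>} ~= \<infinity>)"

definition marked :: "'w \<times> (nat => real) => ereal measure" where
 "marked w = point_sum {j. enat j < J w} (%j. of_nat (T j w)) (%j. e j w)"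

text \<open>A random measure has to be Radon at every outcome. Outside the event \<open>good\<close>
  of full probability, points accumulate away from 0, and the zero measure is substituted.\<close>

definition Ninf :: "'w \<times> (nat => real) => ereal measure" where
 "Ninf w = (if good w then marked w else null_measure R0bar)"

definition msum :: "(real => ennreal) => 'w \<times> (nat => real) => ennreal" where
 "msum f w = (\<Sum>j. if enat j < J w then of_nat (T j w) * f (e j w) else 0)"

lemma good_measurable [measurable]: "Measurable.pred P good"
proof -
 have [measurable]: "(%w. numb w {x. 1 / real (Suc n) <= \<bar>x\<bar>}) \<in> P \<rightarrow>\<^sub>M count_space UNIV" for n by measurable
 show ?thesis unfolding good_def by measurable
qed

lemma AE_good: "AE w in P. good w" unfolding good_def AE_all_countable
 by (intro allI AE_pnum_finite rpart_far_finite radon) auto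

lemma msum_measurable [measurable]:
 assumes [measurable]: "f \<in> Bm borel"
 shows "msum f \<in> Bm P" unfolding msum_def by measurable

lemma nn_integral_marked:
 assumes [measurable]: "f \<in> Bm borel"
 shows "(\<integral>\<^sup>+x. f x \<partial>marked w) = msum (%x. f (ereal x)) w" unfolding marked_def msum_def
 by (subst nn_integral_point_sum) (auto simp: e_nonzero nn_integral_count_space_nat intro!: suminf_cong)

lemma msum_finite:
 assumes good: "good w" and f: "!!x. f x ~= \<infinity>" "!!x. \<bar>x\<bar> < dl ==> f x = 0" and dl: "0 < dl"
 shows "msum f w < \<infinity>"
proof -
 obtain n where n: "1 / real (Suc n) < dl" using dl nat_approx_posE by metis
 let ?S = "{j. enat j < J w \<and> 1 / real (Suc n) <= \<bar>e j w\<bar>}"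
 have "numb w {x. 1 / real (Suc n) <= \<bar>x\<bar>} ~= \<infinity>" using good by (simp add: good_def)
 hence S: "finite ?S" unfolding pnum_def ecount_def J_def[symmetric] e_def[symmetric] by (auto split: if_splits)
 have "msum f w = (\<Sum>j\<in>?S. if enat j < J w then of_nat (T j w) * f (e j w) else 0)"
  unfolding msum_def using n f(2) by (intro suminf_finite S) (auto simp: not_le)
 also have "... < \<infinity>" using S f(1) by (auto simp: ennreal_mult_less_top less_top of_nat_less_top)
 finally show ?thesis .
qed

lemma emeasure_Ninf:
 assumes B: "B \<in> sets R0bar"
 shows "emeasure (Ninf w) B = (if good w then msum (%x. indicator B (ereal x)) w else 0)"
proof -
 have [measurable]: "B \<in> sets borel" using B by (simp add: sets_R0bar_iff)
 have "emeasure (marked w) B = (\<integral>\<^sup>+x. indicator B x \<partial>marked w)"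
  by (rule nn_integral_indicator[symmetric]) (simp add: marked_def sets_point_sum B)
 also have "... = msum (%x. indicator B (ereal x)) w" by (rule nn_integral_marked) simp
 finally show ?thesis by (simp add: Ninf_def)
qed

lemma Ninf_radon: "Ninf w \<in> radon_R0bar" unfolding radon_R0bar_def
proof (intro CollectI conjI allI impI)
 show "sets (Ninf w) = sets R0bar" by (simp add: Ninf_def marked_def sets_point_sum)
 fix K :: "ereal set" assume K: "compact K \<and> K \<subseteq> - {0}"
 hence "open (- K)" "0 \<in> - K" by (auto simp: compact_imp_closed)
 then obtain dl where dl: "dl > 0" "{0 - dl<..<0 + dl} \<subseteq> - K" by (rule ereal_open_cont_interval) auto
 obtain d where d: "0 < d" "ereal d <= dl"
  using dl(1) by (metis ereal_dense2 less_imp_le zero_ereal_def ereal_less(2))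
 have K0: "indicator K (ereal x) = (0::ennreal)" if "\<bar>x\<bar> < d" for x
 proof -
  have "ereal \<bar>x\<bar> < dl" using that d(2) by (metis ereal_less_eq(3) less_ereal.simps(1) order_less_le_trans)
  hence "ereal x \<in> {0 - dl<..<0 + dl}" by (cases dl) auto
  thus ?thesis using dl(2) by (auto simp: indicator_def)
 qed
 have B: "K \<in> sets R0bar" using K by (auto simp: sets_R0bar_iff compact_imp_closed)
 have "msum (%x. indicator K (ereal x)) w < \<infinity>" if "good w"
  by (rule msum_finite[OF that _ K0 d(1)]) (auto simp: indicator_def)
 thus "emeasure (Ninf w) K < \<infinity>" by (simp add: emeasure_Ninf[OF B])
qed

lemma random_measure_Ninf: "random_measure_R0bar P Ninf" unfolding random_measure_R0bar_def
proof (intro conjI ballI Ninf_radon)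
 fix B assume B: "B \<in> sets R0bar"
 hence [measurable]: "B \<in> sets borel" by (simp add: sets_R0bar_iff)
 show "(%w. emeasure (Ninf w) B) \<in> Bm P" unfolding emeasure_Ninf[OF B] by measurable
qed

lemma integral_Ninf:
 assumes g: "g \<in> Cc_plus"
 shows "(LINT x|Ninf w. g x) = (if good w then enn2real (msum (%x. ennreal (g (ereal x))) w) else 0)"
proof (cases "good w")
 case True
 note [measurable] = Cc_plus_measurable(1)[OF g]
 have "g \<in> Bm (marked w)" unfolding marked_def by (rule measurable_point_sum) measurable
 thus ?thesis using True Cc_plusD(2)[OF g] nn_integral_marked[of "%x. ennreal (g x)" w]
  by (simp add: Ninf_def integral_eq_nn_integral)
next
 case False
 thus ?thesis by (simp add: Ninf_def)
qed

lemma integral_Ninf_measurable: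
 assumes g: "g \<in> Cc_plus"
 shows "(%w. LINT x|Ninf w. g x) \<in> Bm P"
proof -
 note [measurable] = Cc_plus_measurable(2)[OF g, unfolded comp_def]
 show ?thesis unfolding integral_Ninf[OF g] by measurable
qed

lemma Laplace_Ninf:
 assumes g: "g \<in> Cc_plus"
 shows "ennreal (LINT v|P. exp (- (LINT x|Ninf v. g x))) =
  (\<integral>\<^sup>+w. nexp (rate w * (\<integral>\<^sup>+x. 1 - (lap q (ennreal (g (ereal x)))) \<partial>rpart \<pi>)) \<partial>M)"
proof -
 note [measurable] = Cc_plus_measurable(2)[OF g, unfolded comp_def] integral_Ninf_measurable[OF g]
 obtain dl where dl: "0 < dl" "!!x. \<bar>x\<bar> < ereal dl ==> g x = 0" using Cc_plus_zero[OF g] by metis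
 have nn: "0 <= (LINT x|Ninf v. g x)" for v unfolding integral_Ninf[OF g] by simp
 have "ennreal (LINT v|P. exp (- (LINT x|Ninf v. g x))) = (\<integral>\<^sup>+v. ennreal (exp (- (LINT x|Ninf v. g x))) \<partial>P)"
  by (intro nn_integral_eq_integral[symmetric] P.integrable_const_bound[where B=1]) (use nn in auto)
 also have "... = (\<integral>\<^sup>+v. nexp (msum (%x. ennreal (g (ereal x))) v) \<partial>P)"
 proof (intro nn_integral_cong_AE, use AE_good in eventually_elim)
  fix v assume good: "good v"
  have "msum (%x. ennreal (g (ereal x))) v < \<infinity>" by (rule msum_finite[OF good _ _ dl(1)]) (use dl(2) in auto)
  thus "ennreal (exp (- (LINT x|Ninf v. g x))) = nexp (msum (%x. ennreal (g (ereal x))) v)"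
   using good by (simp add: integral_Ninf[OF g] nexp_def)
 qed
 also have "... = (\<integral>\<^sup>+w. nexp (rate w * (\<integral>\<^sup>+x. 1 - (lap q (ennreal (g (ereal x)))) \<partial>rpart \<pi>)) \<partial>M)"
  unfolding msum_def by (rule nexp_cluster) measurable
 finally show ?thesis .
qed

text \<open>Sets inside \<open>R0\<close> are pulled back to the real line, where
  \<open>cond_counts\<close> gives the joint law of the counts.\<close>

lemma cond_poisson:
 "cond_poisson_random_measure P (vimage_algebra (space P) (%w. W (fst w)) borel) (restrict_space borel R0)
   (%w. scale_measure (ennreal (th * W (fst w))) (restrict_space \<pi> R0))
   (%w. restrict_space (point_sum {j. enat j < J w} (%_. 1) (%j. e j w)) R0)"
 unfolding cond_poisson_random_measure_def
proof (intro conjI ballI allI impI)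
 let ?p = "%w. point_sum {j. enat j < J w} (%_. 1) (%j. e j w)"
 have R0_R0bar: "R0 \<in> sets R0bar" by (simp add: sets_R0bar_iff R0_borel) (simp add: R0_def)
 have setsD: "B \<in> sets borel \<and> B \<subseteq> R0" if "B \<in> sets (restrict_space borel R0)" for B
  using that R0_borel by (auto simp: sets_restrict_space_iff)
 have em: "emeasure (restrict_space (?p w) R0) B = ennreal_of_enat (numb w (ereal -` B))"
  if "B \<in> sets (restrict_space borel R0)" for B w
 proof -
  have B[measurable]: "B \<in> sets borel" and B0: "B \<subseteq> R0" using setsD[OF that] by auto
  have BR: "B \<in> sets R0bar" using B0 by (auto simp: sets_R0bar_iff B R0_def)
  have "emeasure (restrict_space (?p w) R0) B = emeasure (?p w) B"
   using R0_R0bar B0 by (intro emeasure_restrict_space) (auto simp: sets_point_sum)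
  also have "... = (\<integral>\<^sup>+x. indicator B x \<partial>?p w)"
   by (rule nn_integral_indicator[symmetric]) (simp add: sets_point_sum BR)
  also have "... = ennreal_of_enat (numb w (ereal -` B))" unfolding ennreal_pnum J_def[symmetric] e_def[symmetric]
   by (subst nn_integral_point_sum)
     (auto simp: e_nonzero nn_integral_count_space_nat indicator_def intro!: suminf_cong)
  finally show ?thesis .
 qed
 have pre: "ereal -` B \<in> sets borel" if "B \<in> sets (restrict_space borel R0)" for B
  using setsD[OF that] measurable_sets[of ereal borel borel B] by simp
 show "sets (restrict_space (?p w) R0) = sets (restrict_space borel R0)" for w
 proof -
  have "sets (restrict_space (?p w) R0) = sets (restrict_space R0bar R0)"
   by (rule sets_restrict_space_cong) (simp add: sets_point_sum)
  also have "restrict_space R0bar R0 = restrict_space (borel :: ereal measure) (- {0} \<inter> R0)"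
   unfolding R0bar_def by (rule restrict_restrict_space) (use R0_borel in auto)
  also have "- {0} \<inter> R0 = R0" by (auto simp: R0_def)
  finally show ?thesis .
 qed
 show "(%w. emeasure (restrict_space (?p w) R0) B) \<in> Bm P"
  if "B \<in> sets (restrict_space borel R0)" for B
 proof -
  have "(%w. numb w (ereal -` B)) \<in> P \<rightarrow>\<^sub>M count_space UNIV" using pre[OF that] by measurable
  from measurable_compose[OF this, of ennreal_of_enat borel] show ?thesis unfolding em[OF that] by simp
 qed
 fix n :: nat and B :: "nat => ereal set" and k
 assume B: "(\<forall>i<n. B i \<in> sets (restrict_space borel R0)) \<and> disjoint_family_on B {..<n}"
 have "disjoint_family_on (%i. ereal -` B i) {..<n}" using B by (auto simp: disjoint_family_on_def)
 hence AE: "AE w in P. real_cond_exp P (vimage_algebra (space P) (%w. W (fst w)) borel)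
   (indicator {w\<in>space P. \<forall>i<n. numb w (ereal -` B i) = k i}) w =
   (\<Prod>i<n. poisson_mass (rate (fst w) * emeasure (rpart \<pi>) (ereal -` B i)) (k i))"
  using B by (intro cond_counts pre) auto
 have "emeasure (scale_measure (ennreal (th * W (fst w))) (restrict_space \<pi> R0)) (B i) =
   rate (fst w) * emeasure (rpart \<pi>) (ereal -` B i)" (is "?l w i = ?r w i") if "i < n" for i w
 proof -
  have Bi: "B i \<in> sets borel" "B i \<subseteq> R0" using setsD B that by auto
  have "emeasure (restrict_space \<pi> R0) (B i) = emeasure \<pi> (B i)"
   using Bi R0_radon[OF radon] by (intro emeasure_restrict_space) auto
  thus ?thesis by (simp add: rate_def emeasure_rpart[OF radon Bi])
 qed
 hence prod_eq: "(\<Prod>i<n. poisson_mass (?l w i) (k i)) = (\<Prod>i<n. poisson_mass (?r w i) (k i))" for w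
  by (intro prod.cong) auto
 have set_eq: "{w\<in>space P. \<forall>i<n. emeasure (restrict_space (?p w) R0) (B i) = ennreal_of_enat (k i)} =
   {w\<in>space P. \<forall>i<n. numb w (ereal -` B i) = k i}" using B em by auto
 show "AE w in P. real_cond_exp P (vimage_algebra (space P) (%w. W (fst w)) borel)
   (indicator {w\<in>space P. \<forall>i<n. emeasure (restrict_space (?p w) R0) (B i) = ennreal_of_enat (k i)}) w =
   (\<Prod>i<n. poisson_mass (emeasure (scale_measure (ennreal (th * W (fst w))) (restrict_space \<pi> R0)) (B i)) (k i))"
  unfolding set_eq prod_eq by (rule AE)
qed

lemma cluster_representation_Ninf:
 assumes th: "theta_const M lam Z = th"
  and q: "!!k. 1 <= k ==> pmf q k = inverse th * (LBINT r:{0..}. exp (- lam * r) * measure M {w\<in>space M. Z r w = k})"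
 shows "cluster_representation M lam Z \<pi> P (%w. W (fst w)) Ninf" unfolding cluster_representation_def th
proof (rule exI[of _ J], rule exI[of _ e], rule exI[of _ T], intro conjI allI ballI impI)
 show "AE w in P. Ninf w = point_sum {j. enat j < J w} (%j. of_nat (T j w)) (%j. e j w)"
  using AE_good by eventually_elim (simp add: Ninf_def marked_def)
qed (auto simp: e_nonzero cond_poisson indep_T measure_T q indep_marks)

end

section \<open>The law of the cluster sizes\<close>

context btree
begin

text \<open>The branching process together with an independent exponential time of rate lam:
  integrals against lam e^(-lam r) dr become expectations.\<close>

definition ERM :: "(real \<times> 'w) measure" where
 "ERM = density lborel (exponential_density lam) \<Otimes>\<^sub>M M"

definition Zt :: "real \<times> 'w => nat" where
 "Zt z = population life offs (fst z) (snd z)"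

definition th :: real where
 "th = theta_const M lam (population life offs)"

text \<open>The population at an independent exponential time, conditioned to be nonzero. The
  probability of the conditioning event is lam th (\<open>measure_ERM_pos\<close>), and its factor
  lam cancels the one in the exponential density.\<close>

definition cluster_size :: "nat pmf" where
 "cluster_size = Abs_pmf (distr (uniform_measure ERM {z\<in>space ERM. 0 < Zt z}) (count_space UNIV) Zt)"

lemma prob_ERM: "prob_space ERM"
proof -
 have "prob_space (density lborel (exponential_density lam))" by (rule prob_space_exponential_density) (rule lam_pos)
 then interpret R: prob_space "density lborel (exponential_density lam)" .
 interpret pair_prob_space "density lborel (exponential_density lam)" M ..
 show ?thesis unfolding ERM_def by unfold_locales
qed

sublocale ERM: prob_space ERM by (rule prob_ERM)

lemma Zt_measurable [measurable]: "Zt \<in> ERM \<rightarrow>\<^sub>M count_space UNIV"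
 unfolding Zt_def ERM_def by measurable

lemma nn_integral_ERM:
 assumes [measurable]: "f \<in> Bm ERM"
 shows "(\<integral>\<^sup>+z. f z \<partial>ERM) = (\<integral>\<^sup>+r. ennreal (lam * (indicator {0..} r * en r)) * (\<integral>\<^sup>+w. f (r, w) \<partial>M) \<partial>lborel)"
proof -
 have [measurable]: "f \<in> Bm (lborel \<Otimes>\<^sub>M M)"
  using assms by (simp add: ERM_def cong: measurable_cong_sets sets_pair_measure_cong)
 have "(\<integral>\<^sup>+z. f z \<partial>ERM) = (\<integral>\<^sup>+r. \<integral>\<^sup>+w. f (r, w) \<partial>M \<partial>density lborel (exponential_density lam))"
  using assms unfolding ERM_def by (intro M.nn_integral_fst[symmetric])
 also have "... = (\<integral>\<^sup>+r. ennreal (exponential_density lam r) * (\<integral>\<^sup>+w. f (r, w) \<partial>M) \<partial>lborel)"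
  by (subst nn_integral_density) auto
 also have "... = (\<integral>\<^sup>+r. ennreal (lam * (indicator {0..} r * en r)) * (\<integral>\<^sup>+w. f (r, w) \<partial>M) \<partial>lborel)"
  by (intro nn_integral_cong) (auto simp: exponential_density_def indicator_def mult.commute)
 finally show ?thesis .
qed

lemma exp_bounded_integrable:
 assumes [measurable]: "f \<in> Bm borel" and "!!r. 0 <= f r" "!!r. f r <= (1::real)"
 shows "integrable lborel (%r. indicator {0..} r * en r * f r)"
 using exp_decay_bounded_integrable[OF lam_pos assms(1), of 1] assms(2,3)
 unfolding set_integrable_def by (simp add: mult.assoc)

lemma measure_ERM:
 assumes S: "S \<subseteq> UNIV"
 shows "measure ERM {z\<in>space ERM. Zt z \<in> S} =
  lam * (LBINT r:{0..}. en r * measure M {w\<in>space M. population life offs r w \<in> S})"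
proof -
 let ?m = "%r. measure M {w\<in>space M. population life offs r w \<in> S}"
 let ?A = "{z\<in>space ERM. Zt z \<in> S}" and ?e = "%r. indicator {0..} r * en r" and ?Z = "%r. {w\<in>space M. population life offs r w \<in> S}"
 let ?i = "%r. \<integral>\<^sup>+w. indicator ?A (r, w) \<partial>M" and ?b = "%r. LINT w|M. of_bool (population life offs r w \<in> S)"
 have [measurable]: "Measurable.pred (borel \<Otimes>\<^sub>M M) (%z. population life offs (fst z) (snd z) \<in> S)"
 proof -
  have "(%z. population life offs (fst z) (snd z)) \<in> borel \<Otimes>\<^sub>M M \<rightarrow>\<^sub>M count_space UNIV" by measurable
  from measurable_compose[OF this, of "%k. k \<in> S" "count_space UNIV"] show ?thesis by simp
 qed
 have "?m r = ?b r" for r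
 proof -
  have [measurable]: "?Z r \<in> sets M" by measurable
  have "?m r = (LINT w|M. indicator (?Z r) w)" by simp
  also have "... = ?b r" by (rule Bochner_Integration.integral_cong) (auto simp: indicator_def)
  finally show ?thesis .
 qed
 hence [measurable]: "?m \<in> Bm borel" by (subst measurable_cong[where g="?b"]) auto
 have [measurable]: "?A \<in> sets ERM"
  using measurable_sets[OF Zt_measurable, of S] by (simp add: vimage_def Int_def conj_commute)
 have "emeasure ERM ?A = (\<integral>\<^sup>+z. indicator ?A z \<partial>ERM)"
  by (rule nn_integral_indicator[symmetric]) measurable
 also have "... = (\<integral>\<^sup>+r. ennreal (lam * ?e r) *
   ?i r \<partial>lborel)" by (rule nn_integral_ERM) measurable
 also have "... = (\<integral>\<^sup>+r. ennreal (lam * (?e r * ?m r)) \<partial>lborel)"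
 proof (rule nn_integral_cong)
  fix r
  have "?i r =
    (\<integral>\<^sup>+w. indicator (?Z r) w \<partial>M)"
   by (intro nn_integral_cong) (auto simp: indicator_def Zt_def ERM_def space_pair_measure)
  also have "... = emeasure M (?Z r)" by (rule nn_integral_indicator) measurable
  finally have i: "?i r = ennreal (?m r)" by (simp add: M.emeasure_eq_measure)
  show "ennreal (lam * ?e r) *
   ?i r = ennreal (lam * (?e r * ?m r))"
   unfolding i using lam_pos by (subst ennreal_mult[symmetric]) (auto simp: mult.assoc)
 qed
 also have "... = ennreal (LINT r|lborel. lam * (?e r * ?m r))" using lam_pos
  by (intro nn_integral_eq_integral integrable_mult_right exp_bounded_integrable) auto
 also have "(LINT r|lborel. lam * (?e r * ?m r)) =
   lam * (LBINT r:{0..}. en r * ?m r)" by (simp add: set_lebesgue_integral_def mult.assoc)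
 finally have "ennreal (measure ERM ?A) = ennreal (lam * (LBINT r:{0..}. en r * ?m r))"
  by (simp add: ERM.emeasure_eq_measure)
 thus ?thesis using lam_pos
  by (subst (asm) ennreal_inj) (auto simp: set_lebesgue_integral_def intro!: mult_nonneg_nonneg)
qed

lemma measure_ERM_pos: "measure ERM {z\<in>space ERM. 0 < Zt z} = lam * th"
 using measure_ERM[of "{0<..}"] by (simp add: th_def theta_const_def)

text \<open>Extinction by time t requires that the lifetime of the initial particle is over, which
  has probability 1 - e^(- \<beta> t).\<close>

lemma V_0_le:
 assumes t: "0 <= t"
 shows "V t 0 <= 1 - eb t"
proof -
 have uf: "unit_fun (%_. 0)" by (simp add: unit_fun_def)
 let ?p = "%r. \<beta> * pgf (V (t - r) 0)" and ?e = "%r. eb r"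
 have "V t 0 = eb t * Q t (%_. 0) 0 + (LBINT r:{0..t}. ?e r * Q r (%z. \<beta> * pgf (U (t - r) (%_. 0) z)) 0)"
  unfolding V_def using solvesD(10)[OF U_solves[OF uf] t] by simp
 also have "... = (LBINT r:{0..t}. ?e r * ?p r)" by (simp add: U_const Q_const)
 also have "... <= (LBINT r:{0..t}. ?e r * \<beta>)"
 proof (rule LBINT_Icc_mono[where B=\<beta> and C=\<beta>])
  fix r assume r: "0 <= r" "r <= t"
  have p: "0 <= pgf (V (t - r) 0)" "pgf (V (t - r) 0) <= 1" by (auto intro!: pgf_nonneg pgf_le_1 simp: V_bounds)
  show "?e r * ?p r <= ?e r * \<beta>" using p \<beta>_pos by (intro mult_left_mono) auto
  have e: "?e r <= 1" using r \<beta>_pos by simp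
  show "\<bar>?e r * ?p r\<bar> <= \<beta>"
   using p \<beta>_pos mult_mono[OF e, of "?p r" \<beta>] by (auto simp: abs_mult)
  show "\<bar>?e r * \<beta>\<bar> <= \<beta>" using e \<beta>_pos by (auto simp: abs_mult)
 qed measurable
 also have "... = 1 - eb t"
  using LBINT_exp_Icc[of "- \<beta>" 0 t] \<beta>_pos t by (simp add: field_simps set_lebesgue_integral_def)
 finally show ?thesis .
qed

lemma prob_population_pos:
 assumes t: "0 <= t"
 shows "measure M {w\<in>space M. population life offs t w > 0} = 1 - V t 0"
proof -
 let ?n = "{w\<in>space M. \<not> population life offs t w > 0}"
 have "V t 0 = (LINT w|M. 0 ^ population life offs t w)" by (rule V_eq_expectation[OF t]) auto
 also have "... = (LINT w|M. indicator ?n w)" by (rule Bochner_Integration.integral_cong) (auto simp: indicator_def)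
 also have "... = measure M ?n" by simp
 also have "... = 1 - measure M {w\<in>space M. population life offs t w > 0}" by (rule M.prob_neg) measurable
 finally show ?thesis by simp
qed

text \<open>The survival probability is at least e^(- \<beta> r), so th is at least 1 / (lam +
  \<beta>). This justifies dividing by th and conditioning on survival.\<close>

lemma th_pos: "0 < th"
proof -
 let ?p = "%r. measure M {w\<in>space M. population life offs r w > 0}" and ?e = "%r. exp (- (lam + \<beta>) * r)" and ?c = "lam + \<beta>"
 have "(LBINT r:{0..}. ?e r) <= th" unfolding th_def theta_const_def
 proof (rule set_integral_mono)
  show "set_integrable lborel {0..} ?e" by (rule exp_decay_set_integrable) (use lam_pos \<beta>_pos in simp)
  have [measurable]: "(%r. ?p (max 0 r)) \<in> Bm borel" by (subst prob_population_pos) auto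
  have "set_integrable lborel {0..} (%r. en r * ?p (max 0 r))"
   by (rule exp_decay_bounded_integrable[OF lam_pos, where B=1]) auto
  thus "set_integrable lborel {0..} (%r. en r * ?p r)" by (rule set_integrable_cong[THEN iffD1, rotated 3]) auto
  fix r :: real assume r: "r \<in> {0..}"
  have "?e r = en r * eb r" by (simp add: algebra_simps flip: exp_add)
  also have "... <= en r * ?p r" using V_0_le[of r] r by (intro mult_left_mono) (auto simp: prob_population_pos)
  finally show "?e r <= en r * ?p r" .
 qed
 moreover have "(LBINT r:{0..}. ?e r) = 1 / ?c"
 proof -
  interpret R: prob_space "density lborel (exponential_density ?c)"
   by (rule prob_space_exponential_density) (use lam_pos \<beta>_pos in simp)
  have "1 = (LINT x|density lborel (exponential_density ?c). 1 :: real)"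
   by (simp only: lebesgue_integral_const R.prob_space) simp
  also have "... = (LINT r|lborel. exponential_density ?c r *\<^sub>R 1)"
   by (rule integral_density) (use lam_pos \<beta>_pos in \<open>auto simp: exponential_density_def\<close>)
  also have "... = (LINT r|lborel. ?c * (indicator {0..} r *\<^sub>R ?e r))"
   by (rule Bochner_Integration.integral_cong) (auto simp: exponential_density_def indicator_def algebra_simps)
  also have "... = ?c * (LBINT r:{0..}. ?e r)" unfolding set_lebesgue_integral_def by (rule integral_mult_right_zero)
  finally show ?thesis using lam_pos \<beta>_pos by (simp add: field_simps)
 qed
 ultimately show ?thesis using lam_pos \<beta>_pos by (simp add: order_less_le_trans[rotated])
qed

lemma pos_set [measurable]: "{z\<in>space ERM. 0 < Zt z} \<in> sets ERM" by measurable

lemma measure_cluster_size: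
 "measure_pmf cluster_size = distr (uniform_measure ERM {z\<in>space ERM. 0 < Zt z}) (count_space UNIV) Zt"
proof -
 let ?u = "uniform_measure ERM {z\<in>space ERM. 0 < Zt z}"
 have pos: "emeasure ERM {z\<in>space ERM. 0 < Zt z} ~= 0"
  using th_pos lam_pos by (simp add: ERM.emeasure_eq_measure measure_ERM_pos)
 interpret u: prob_space "?u"
  by (rule prob_space_uniform_measure) (use pos in \<open>auto simp: ERM.emeasure_eq_measure\<close>)
 interpret cs: prob_space "distr ?u (count_space UNIV) Zt" by (rule u.prob_space_distr) simp
 show ?thesis unfolding cluster_size_def
  by (rule Abs_pmf_inverse) (auto simp: cs.prob_space_axioms intro!: cs.AE_support_countable[THEN iffD2] exI[of _ UNIV])
qed

lemma nn_integral_cluster_size: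
 "ennreal (lam * th) * (\<integral>\<^sup>+k. F k \<partial>measure_pmf cluster_size) =
  (\<integral>\<^sup>+z. F (Zt z) * indicator {z\<in>space ERM. 0 < Zt z} z \<partial>ERM)"
proof -
 have p: "0 < lam * th" using lam_pos th_pos by simp
 let ?i = "\<integral>\<^sup>+k. F k \<partial>measure_pmf cluster_size" and ?j = "\<integral>\<^sup>+z. F (Zt z) * indicator {z\<in>space ERM. 0 < Zt z} z \<partial>ERM"
 have "?i =
   (\<integral>\<^sup>+z. F (Zt z) \<partial>uniform_measure ERM {z\<in>space ERM. 0 < Zt z})"
  unfolding measure_cluster_size by (subst nn_integral_distr) auto
 also have "... = ?j / ennreal (lam * th)"
  by (subst nn_integral_uniform_measure) (auto simp: ERM.emeasure_eq_measure measure_ERM_pos)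
 finally have "ennreal (lam * th) * ?i =
   ?j * ennreal (lam * th) / ennreal (lam * th)" by (simp add: ennreal_times_divide mult.commute)
 also have "... = ?j"
  by (rule ennreal_mult_divide_eq) (use p in \<open>simp_all add: ennreal_eq_0_iff not_le del: zero_less_mult_iff\<close>)
 finally show ?thesis .
qed

lemma pmf_cluster_size:
 assumes k: "1 <= k"
 shows "pmf cluster_size k = inverse th *
  (LBINT r:{0..}. en r * measure M {w\<in>space M. population life offs r w = k})"
proof -
 let ?A = "{z\<in>space ERM. Zt z = k}" and ?l = "LBINT r:{0..}. en r * measure M {w\<in>space M. population life offs r w = k}"
 have s: "?A \<in> sets ERM" by measurable
 have "ennreal (lam * th) * ennreal (pmf cluster_size k) = (\<integral>\<^sup>+z. indicator {k} (Zt z) * indicator {z\<in>space ERM. 0 < Zt z} z \<partial>ERM)"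
  by (subst nn_integral_cluster_size[symmetric]) (simp add: emeasure_pmf_single)
 also have "... = (\<integral>\<^sup>+z. indicator ?A z \<partial>ERM)"
  by (rule nn_integral_cong) (use k in \<open>auto simp: indicator_def\<close>)
 also have "... = emeasure ERM ?A" by (rule nn_integral_indicator[OF s])
 also have "... = ennreal (lam * ?l)" using measure_ERM[of "{k}"] by (simp add: ERM.emeasure_eq_measure)
 finally have "ennreal (lam * th * pmf cluster_size k) =
   ennreal (lam * ?l)" using lam_pos th_pos by (simp add: ennreal_mult)
 hence "lam * th * pmf cluster_size k = lam * ?l" using lam_pos th_pos
  by (subst (asm) ennreal_inj) (auto simp: set_lebesgue_integral_def intro!: mult_nonneg_nonneg)
 thus ?thesis using lam_pos th_pos by (simp add: field_simps)
qed

text \<open>An empty population contributes 1 - 1 = 0, so conditioning on survival changes the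
  integral only by the normalizing factor.\<close>

lemma cluster_size_Laplace:
 assumes x: "0 <= x"
 shows "ennreal th * (1 - (lap cluster_size (ennreal x))) =
  (\<integral>\<^sup>+r. ennreal (indicator {0..} r * en r * (1 - V r (exp (- x)))) \<partial>lborel)"
proof -
 let ?n = "%k. nexp (of_nat k * ennreal x)" and ?P = "%r w. exp (- x) ^ population life offs r w" and ?V = "%r. 1 - V r (exp (- x))"
 let ?E = "\<integral>\<^sup>+k. ?n k \<partial>measure_pmf cluster_size" and ?e = "%r. indicator {0..} r * en r" and ?z = "%r. \<integral>\<^sup>+w. 1 - ?n (Zt (r, w)) \<partial>M"
 have nx: "?n k = ennreal (exp (- x) ^ k)" for k using x by (simp add: nexp_of_nat_mult nexp_ennreal ennreal_power)
 have le: "?E <= 1" by (rule measure_pmf.nn_integral_nexp_le_1)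
 have "1 - ?E =
   (\<integral>\<^sup>+k. 1 - ?n k \<partial>measure_pmf cluster_size)"
  using le by (subst nn_integral_diff) (auto simp: nexp_le_1 measure_pmf.emeasure_space_1[simplified] top_unique)
 hence "ennreal (lam * th) * (1 - ?E) =
   (\<integral>\<^sup>+z. (1 - ?n (Zt z)) * indicator {z\<in>space ERM. 0 < Zt z} z \<partial>ERM)"
  by (simp add: nn_integral_cluster_size)
 also have "... = (\<integral>\<^sup>+z. 1 - ?n (Zt z) \<partial>ERM)"
  by (rule nn_integral_cong) (auto simp: indicator_def)
 also have "... = (\<integral>\<^sup>+r. ennreal (lam * ?e r) *
   ?z r \<partial>lborel)" by (rule nn_integral_ERM) measurable
 also have "... = (\<integral>\<^sup>+r. ennreal lam * ennreal (?e r * ?V r) \<partial>lborel)"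
 proof (rule nn_integral_cong)
  fix r :: real
  show "ennreal (lam * ?e r) * ?z r =
    ennreal lam * ennreal (?e r * ?V r)"
  proof (cases "0 <= r")
   case True
   have p1: "exp (- x) ^ k <= 1" for k :: nat using x by (intro power_le_one) auto
   have i: "integrable M (?P r)" by (rule M.integrable_const_bound[where B=1]) (use p1 in auto)
   have "?z r =
     (\<integral>\<^sup>+w. ennreal (1 - ?P r w) \<partial>M)" unfolding nx Zt_def fst_conv snd_conv
    by (intro nn_integral_cong) (simp add: ennreal_minus flip: ennreal_1)
   also have "... = ennreal (LINT w|M. 1 - ?P r w)" using i p1 by (intro nn_integral_eq_integral) auto
   also have "(LINT w|M. 1 - ?P r w) = ?V r" using i x by (simp add: V_eq_expectation[OF True] M.prob_space)
   finally show ?thesis using True lam_pos V_bounds[of r "exp (- x)"] by (simp add: ennreal_mult mult.assoc)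
  qed simp
 qed
 also have "... = ennreal lam * (\<integral>\<^sup>+r. ennreal (?e r * ?V r) \<partial>lborel)"
  by (rule nn_integral_cmult) measurable
 finally have "ennreal lam * (ennreal th * (1 - ?E)) =
   ennreal lam * (\<integral>\<^sup>+r. ennreal (?e r * ?V r) \<partial>lborel)"
  using lam_pos th_pos by (simp add: ennreal_mult mult.assoc)
 thus ?thesis using lam_pos by (subst (asm) ennreal_mult_cancel_left) auto
qed

end

section \<open>Identification of the limit\<close>

context blim
begin

lemma radon_\<pi>: "\<pi> \<in> radon_R0bar" using A1 by (simp add: assumption_A1_def)

lemma cluster_radon: "cluster_radon \<pi> M W"
 by (intro cluster_radon.intro cluster.intro pieces_rpart cluster_axioms.intro cluster_radon_axioms.intro
   radon_\<pi> prob_M W_measurable)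

sublocale C: cluster_radon \<pi> M th W cluster_size by (rule cluster_radon)

text \<open>Here the two computations meet: the exponent of the constructed cluster measure is the
  exponent found for the branching process. The integrals over r and x are exchanged on the finite
  measure \<open>\<pi>far\<close>.\<close>

lemma intensity:
 assumes g: "g \<in> Cc_plus"
 shows "ennreal th * (\<integral>\<^sup>+x. 1 - (lap cluster_size (ennreal (g (ereal x)))) \<partial>rpart \<pi>) =
  ennreal (I g)"
proof -
 obtain dl where dl: "0 < dl" "!!x. \<bar>x\<bar> < ereal dl ==> g x = 0" using Cc_plus_zero[OF g] by metis
 interpret F: finite_measure "\<pi>far dl" by (rule finite_\<pi>far[OF dl(1)])
 interpret pair_sigma_finite lborel "\<pi>far dl" ..
 have gm[measurable]: "g \<in> Bm borel" by (rule Cc_plus_measurable(1)[OF g])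
 have gf[measurable]: "g \<in> Bm (\<pi>far dl)" by (rule measurable_\<pi>far[OF gm])
 define k where "k r x = ennreal (indicator {0..} r * en r * (1 - V r (exp (- g x))))" for r x
 define H where "H x = (\<integral>\<^sup>+r. k r x \<partial>lborel)" for x
 have Hm[measurable]: "H \<in> Bm borel" unfolding H_def k_def by measurable
 have H0: "H x = 0" if "\<bar>x\<bar> < ereal dl" for x using dl(2)[OF that] by (simp add: H_def k_def)
 have "ennreal th * (\<integral>\<^sup>+x. 1 - (lap cluster_size (ennreal (g (ereal x)))) \<partial>rpart \<pi>) =
   (\<integral>\<^sup>+x. ennreal th * (1 - (lap cluster_size (ennreal (g (ereal x))))) \<partial>rpart \<pi>)"
  by (rule nn_integral_cmult[symmetric]) measurable
 also have "... = (\<integral>\<^sup>+x. H (ereal x) \<partial>rpart \<pi>)"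
  unfolding H_def k_def by (intro nn_integral_cong cluster_size_Laplace) (simp add: Cc_plusD(2)[OF g])
 also have "... = (\<integral>\<^sup>+x. H (ereal (real_of_ereal x)) * indicator R0 x \<partial>\<pi>)"
  by (rule nn_integral_rpart[OF radon_\<pi>]) measurable
 also have "... = (\<integral>\<^sup>+x. H x * indicator (far dl) x \<partial>\<pi>)"
  by (rule nn_integral_cong) (auto simp: indicator_def far_def R0_def ereal_real H0 not_le)
 also have "... = (\<integral>\<^sup>+x. H x \<partial>\<pi>far dl)"
  unfolding \<pi>far_def using far_sets[of dl] by (intro nn_integral_restrict_space[symmetric]) (metis sets.Int_space_eq2)
 also have "... = (\<integral>\<^sup>+r. \<integral>\<^sup>+x. k r x \<partial>\<pi>far dl \<partial>lborel)"
  unfolding H_def by (rule Fubini') (unfold k_def, measurable)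
 also have "... = (\<integral>\<^sup>+r. ennreal (indicator {0..} r *\<^sub>R (en r * a g r)) \<partial>lborel)"
 proof (rule nn_integral_cong)
  fix r :: real
  have ae: "a g r = (LINT x|\<pi>far dl. 1 - V r (exp (- g x)))" by (rule a_far[OF dl(2)])
  have "(\<integral>\<^sup>+x. k r x \<partial>\<pi>far dl) = (\<integral>\<^sup>+x. ennreal (indicator {0..} r * en r) * ennreal (1 - V r (exp (- g x))) \<partial>\<pi>far dl)"
   unfolding k_def by (intro nn_integral_cong ennreal_mult') (auto simp: V_bounds)
  also have "... = ennreal (indicator {0..} r * en r) * (\<integral>\<^sup>+x. ennreal (1 - V r (exp (- g x))) \<partial>\<pi>far dl)"
   by (rule nn_integral_cmult) measurable
  also have "(\<integral>\<^sup>+x. ennreal (1 - V r (exp (- g x))) \<partial>\<pi>far dl) = ennreal (a g r)"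
   unfolding ae by (intro nn_integral_eq_integral a_integrable g dl) (auto simp: V_bounds)
  finally show "(\<integral>\<^sup>+x. k r x \<partial>\<pi>far dl) = ennreal (indicator {0..} r *\<^sub>R (en r * a g r))"
   using a_bounds(1)[OF g dl] by (simp add: ennreal_mult'[symmetric] mult.assoc)
 qed
 also have "... = ennreal (I g)" unfolding I_def set_lebesgue_integral_def
  using I_integrable[OF g] a_bounds(1)[OF g dl] by (intro nn_integral_eq_integral) (auto simp: set_integrable_def)
 finally show ?thesis .
qed

lemma Laplace_Ninf_L:
 assumes g: "g \<in> Cc_plus"
 shows "(LINT v|C.P. exp (- (LINT x|C.Ninf v. g x))) = L (I g)"
proof -
 have Ig: "0 <= I g" by (rule I_nonneg[OF g])
 have nn: "AE w in M. 0 <= exp (- (W w * I g)) \<and> exp (- (W w * I g)) <= 1"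
  using W_nonneg by eventually_elim (use Ig in simp)
 have "ennreal (LINT v|C.P. exp (- (LINT x|C.Ninf v. g x))) =
  (\<integral>\<^sup>+w. nexp (C.rate w * (\<integral>\<^sup>+x. 1 - (lap cluster_size (ennreal (g (ereal x)))) \<partial>rpart \<pi>)) \<partial>M)"
  by (rule C.Laplace_Ninf[OF g])
 also have "... = (\<integral>\<^sup>+w. ennreal (exp (- (W w * I g))) \<partial>M)"
 proof (rule nn_integral_cong_AE, use W_nonneg in eventually_elim)
  fix w assume w: "0 <= W w"
  have "C.rate w = ennreal (W w) * ennreal th"
   using w th_pos unfolding C.rate_def by (simp add: ennreal_mult[symmetric] mult.commute)
  thus "nexp (C.rate w * (\<integral>\<^sup>+x. 1 - (lap cluster_size (ennreal (g (ereal x)))) \<partial>rpart \<pi>)) =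
    ennreal (exp (- (W w * I g)))"
   using w Ig by (simp add: mult.assoc intensity[OF g] ennreal_mult[symmetric] nexp_ennreal)
 qed
 also have "... = ennreal (L (I g))"
  unfolding L_def by (intro nn_integral_eq_integral M.integrable_const_bound[where B=1]) (use nn in auto)
 finally show ?thesis by (subst (asm) ennreal_inj) (auto simp: L_def)
qed

text \<open>Natural multiples of a test function are test functions, so \<open>Laplace_limit\<close>
  gives the Laplace transform of the integral of g at all natural arguments, which determines the
  limit in distribution.\<close>

lemma converges_Ninf:
 "converges_weakly_R0bar M (particle_measure life offs motion h) C.P C.Ninf" unfolding converges_weakly_R0bar_def
proof
 let ?n = "%t w g. LINT x|particle_measure life offs motion h t w. g x"
 fix g assume g: "g \<in> Cc_plus"
 have kg: "(%x. real k * g x) \<in> Cc_plus" for k by (rule Cc_plus_cmult[OF g]) simp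
 show "converges_in_distribution M (%t w. ?n t w g) C.P (%w. LINT x|C.Ninf w. g x)"
 proof (rule Laplace_imp_converges_in_distribution[OF prob_M C.prob_P])
  show "(%w. ?n t w g) \<in> Bm M" for t by (rule particle_integral_measurable[OF g])
  show "0 <= (?n t w g)" for t w by (simp add: particle_integral[OF g])
  show "(%w. LINT x|C.Ninf w. g x) \<in> Bm C.P" by (rule C.integral_Ninf_measurable[OF g])
  show "0 <= (LINT x|C.Ninf w. g x)" for w by (simp add: C.integral_Ninf[OF g])
  fix k :: nat
  have "((%t. LINT w|M. exp (- (?n t w (%x. real k * g x)))) \<longlongrightarrow> L (I (%x. real k * g x))) at_top"
  proof (rule Lim_transform_eventually[OF Laplace_limit[OF kg[of k]]])
   show "eventually (%t. U t (Gt (%x. real k * g x) t) 0 =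
     (LINT w|M. exp (- (?n t w (%x. real k * g x))))) at_top" using eventually_ge_at_top[of 0]
    by eventually_elim (subst Laplace_particle[OF kg], auto simp: Gt_def[abs_def])
  qed
  thus "((%t. LINT w|M. exp (- (real k * (?n t w g)))) \<longlongrightarrow>
    (LINT w|C.P. exp (- (real k * (LINT x|C.Ninf w. g x))))) at_top"
   unfolding Laplace_Ninf_L[OF kg, symmetric] by simp
 qed
qed

theorem branching_limit_blim:
 "branching_limit M lam (population life offs) W \<pi> (particle_measure life offs motion h)"
 unfolding branching_limit_def
proof (rule exI[of _ C.P], rule exI[of _ C.Ninf], intro conjI ballI)
 show "is_extension M C.P fst" by (rule C.is_extension_P)
 show "random_measure_R0bar C.P C.Ninf" by (rule C.random_measure_Ninf)
 show "converges_weakly_R0bar M (particle_measure life offs motion h) C.P C.Ninf" by (rule converges_Ninf)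
 show "cluster_representation M lam (population life offs) \<pi> C.P (%w. W (fst w)) C.Ninf"
  by (rule C.cluster_representation_Ninf) (auto simp: th_def pmf_cluster_size[unfolded th_def])
 fix g assume g: "g \<in> Cc_plus"
 have g0: "0 <= g x" for x by (rule Cc_plusD(2)[OF g])
 have "(LBINT r:{0..}. en r * (LINT x:R0|\<pi>. (LINT w'|M. 1 - exp (- real (population life offs r w') * g x)))) =
   (LBINT r:{0..}. en r * a g r)"
 proof (rule set_lebesgue_integral_cong)
  show "\<forall>r. r \<in> {0..} --> en r * (LINT x:R0|\<pi>. (LINT w'|M. 1 - exp (- real (population life offs r w') * g x))) =
    en r * a g r"
  proof (intro allI impI)
   fix r :: real assume r: "r \<in> {0..}"
   have "(LINT w'|M. 1 - exp (- real (population life offs r w') * g x)) = 1 - V r (exp (- g x))" for x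
   proof -
    have e: "exp (- real n * g x) = exp (- g x) ^ n" for n by (simp add: exp_of_nat_mult[symmetric])
    have p1: "exp (- g x) ^ n <= 1" for n :: nat using g0[of x] by (intro power_le_one) auto
    have "integrable M (%w. exp (- g x) ^ population life offs r w)"
     by (rule M.integrable_const_bound[where B=1]) (use p1 in auto)
    thus ?thesis unfolding e using r g0[of x] by (simp add: V_eq_expectation M.prob_space)
   qed
   thus "en r * (LINT x:R0|\<pi>. (LINT w'|M. 1 - exp (- real (population life offs r w') * g x))) =
     en r * a g r" by (simp add: a_def P_def)
  qed
 qed simp
 thus "(LINT w|C.P. exp (- (LINT x|C.Ninf w. g x))) =
   (LINT w|M. exp (- W w * (LBINT r:{0..}. en r *
    (LINT x:R0|\<pi>. (LINT w'|M. 1 - exp (- real (population life offs r w') * g x))))))"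
  unfolding Laplace_Ninf_L[OF g] by (simp add: L_def I_def)
qed

end

section \<open>Characteristic functions of a Levy process\<close>

text \<open>The difference is continuous with values in the integer multiples of 2 pi i, a set with
  gaps of length 2 pi, hence constant.\<close>

lemma continuous_log_unique:
 fixes f g :: "real => complex"
 assumes "continuous_on UNIV f" "continuous_on UNIV g" and eq: "!!x. exp (f x) = exp (g x)" and "f 0 = g 0"
 shows "f = g"
proof -
 have "(%x. f x - g x) constant_on UNIV"
 proof (rule continuous_discrete_range_constant)
  show "connected (UNIV :: real set)" by (rule connected_UNIV)
  show "continuous_on UNIV (%x. f x - g x)" using assms by (intro continuous_intros)
  have mult: "\<exists>n::int. f x - g x = 2 * of_int n * of_real pi * \<i>" for x
  proof -
   have "exp (f x - g x) = 1" using eq[of x] by (simp add: exp_diff)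
   then obtain n :: int where "Re (f x - g x) = 0" "Im (f x - g x) = of_int (2 * n) * pi" unfolding exp_eq_1 by auto
   hence "f x - g x = 2 * of_int n * of_real pi * \<i>" by (auto simp: complex_eq_iff)
   thus ?thesis by blast
  qed
  fix x :: real
  show "\<exists>e>0. \<forall>y. y \<in> UNIV \<and> f y - g y ~= f x - g x --> e <= norm (f y - g y - (f x - g x))"
  proof (intro exI[of _ "2 * pi"] conjI allI impI)
   fix y assume ne: "y \<in> UNIV \<and> f y - g y ~= f x - g x"
   obtain n k :: int where n: "f x - g x = 2 * of_int n * of_real pi * \<i>" and k: "f y - g y = 2 * of_int k * of_real pi * \<i>"
    using mult by meson
   have "k ~= n" using ne n k by auto
   have "f y - g y - (f x - g x) = complex_of_real (2 * pi * of_int (k - n)) * \<i>"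
    unfolding n k by (simp add: algebra_simps)
   hence "norm (f y - g y - (f x - g x)) = norm (complex_of_real (2 * pi * of_int (k - n)))"
    by (simp only: norm_mult norm_ii mult_1_right)
   also have "... = 2 * pi * \<bar>of_int (k - n)\<bar>" by (simp only: norm_of_real abs_mult) simp
   also have "1 <= \<bar>real_of_int (k - n)\<bar>" using \<open>k ~= n\<close> by linarith
   hence "2 * pi * 1 <= 2 * pi * \<bar>of_int (k - n)\<bar>" by (intro mult_left_mono) auto
   finally show "2 * pi <= norm (f y - g y - (f x - g x))" by simp
  qed auto
 qed
 then obtain c where "!!x. f x - g x = c" by (auto simp: constant_on_def)
 thus ?thesis using assms(4) by (metis eq_iff_diff_eq_0 ext)
qed

lemma levy_exponent_unique:
 "levy_exponent_of N \<xi> \<psi> ==> levy_exponent_of N \<xi> \<psi>' ==> \<psi> = \<psi>'"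
 by (rule continuous_log_unique) (auto simp: levy_exponent_of_def)

lemma char_uminus: "char M (- t) = cnj (char M t)"
 unfolding char_def by (simp add: exp_cnj del: Bochner_Integration.integral_cnj flip: Bochner_Integration.integral_cnj)

lemma levy_exponent_uminus:
 assumes "levy_exponent_of N \<xi> \<psi>"
 shows "\<psi> (- t) = cnj (\<psi> t)"
proof -
 have c: "continuous_on UNIV \<psi>" using assms by (simp add: levy_exponent_of_def)
 have "levy_exponent_of N \<xi> (%t. cnj (\<psi> (- t)))" unfolding levy_exponent_of_def
 proof (intro conjI allI)
  show "continuous_on UNIV (%t. cnj (\<psi> (- t)))" by (intro continuous_intros continuous_on_compose2[OF c]) auto
  show "char (distr N borel (\<xi> 1)) t = exp (cnj (\<psi> (- t)))" for t
   using assms char_uminus[of "distr N borel (\<xi> 1)" "- t"] by (simp add: levy_exponent_of_def exp_cnj)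
 qed (use assms in \<open>simp add: levy_exponent_of_def\<close>)
 from levy_exponent_unique[OF assms this] have "\<psi> t = cnj (\<psi> (- t))" by (rule fun_cong)
 thus ?thesis by simp
qed

context blevy
begin

definition law :: "real => real measure" where
 "law s = distr N borel (\<xi> s)"

lemma real_distribution_law: "0 <= s ==> real_distribution (law s)"
 unfolding law_def by (intro N.real_distribution_distr \<xi>_measurable)

lemma char_law_0: "char (law 0) t = 1"
proof -
 have "law 0 = distr N borel (%_. 0)"
  unfolding law_def by (rule distr_cong_AE) (use AE_\<xi>0 \<xi>_measurable in auto)
 thus ?thesis by (simp add: char_def integral_distr N.prob_space del: N.distr_const)
qed

lemma char_law_add:
 assumes "0 <= r" "0 <= s"
 shows "char (law (r + s)) t = char (law r) t * char (law s) t"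
proof -
 have [measurable]: "\<xi> r \<in> Bm N" "\<xi> (r + s) \<in> Bm N" "\<xi> 0 \<in> Bm N"
  using assms by (auto intro: \<xi>_measurable)
 have "law (r + s) = distr N borel (%w. (\<xi> r w - \<xi> 0 w) + (\<xi> (r + s) w - \<xi> r w))"
  unfolding law_def by (rule distr_cong_AE) (use AE_\<xi>0 in auto)
 moreover have "distr N borel (%w. \<xi> r w - \<xi> 0 w) = law r"
  unfolding law_def by (rule distr_cong_AE) (use AE_\<xi>0 in auto)
 moreover have "distr N borel (%w. \<xi> (r + s) w - \<xi> r w) = law s"
  unfolding law_def using levy assms by (simp add: levy_process_def)
 ultimately show ?thesis using N.char_distr_add[OF increments_indep[OF assms]] by simp
qed

lemma char_law_mult: "0 <= s ==> char (law (real n * s)) t = char (law s) t ^ n"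
 by (induction n) (simp_all add: char_law_0 char_law_add distrib_right)

text \<open>Right-continuity of the paths and bounded convergence; \<open>char_law_exp\<close>
  approximates s by rational times from above.\<close>

lemma char_law_right_continuous:
 assumes s: "0 <= s" and r: "!!n. s < r n" "r \<longlonglongrightarrow> s"
 shows "(%n. char (law (r n)) t) \<longlonglongrightarrow> char (law s) t"
proof -
 have m[measurable]: "\<xi> (r n) \<in> Bm N" "\<xi> s \<in> Bm N" for n
  using s r(1)[of n] by (auto intro: \<xi>_measurable)
 have "(%n. CLINT v|N. iexp (t * \<xi> (r n) v)) \<longlonglongrightarrow> (CLINT v|N. iexp (t * \<xi> s v))"
 proof (rule integral_dominated_convergence[where w="%_. 1"])
  show "AE v in N. (%n. iexp (t * \<xi> (r n) v)) \<longlonglongrightarrow> iexp (t * \<xi> s v)"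
  proof (rule AE_I2)
   fix v assume "v \<in> space N"
   hence "continuous (at_right s) (%u. \<xi> u v)" using levy s by (auto simp: levy_process_def cadlag_def)
   hence "((%u. \<xi> u v) \<longlongrightarrow> \<xi> s v) (at_right s)" by (simp add: continuous_within)
   moreover have "filterlim r (at_right s) sequentially"
   proof -
    have "r n \<in> {s<..} \<and> r n ~= s" for n using r(1)[of n] by simp
    thus ?thesis using r(2) by (simp add: filterlim_at)
   qed
   ultimately have "(%n. \<xi> (r n) v) \<longlonglongrightarrow> \<xi> s v" by (rule filterlim_compose)
   thus "(%n. iexp (t * \<xi> (r n) v)) \<longlonglongrightarrow> iexp (t * \<xi> s v)" by (intro tendsto_intros)
  qed
 qed auto
 thus ?thesis unfolding law_def char_def by (simp add: integral_distr)
qed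

text \<open>\<psi> is the continuous logarithm at time 1. At time 1 / n the quotient of the
  characteristic function and exp (\<psi> / n) is continuous, takes values in the n-th roots of
  unity and is 1 at frequency 0, which selects the right root. Powers give rational times,
  right-continuity all times.\<close>

lemma char_law_exp:
 assumes \<psi>: "levy_exponent_of N \<xi> \<psi>" and s: "0 <= s"
 shows "char (law s) t = exp (of_real s * \<psi> t)"
proof -
 have c\<psi>: "continuous_on UNIV \<psi>" and \<psi>0: "\<psi> 0 = 0" and \<psi>1: "char (law 1) t = exp (\<psi> t)" for t
  using \<psi> by (auto simp: levy_exponent_of_def law_def)
 have root: "char (law (1 / real n)) t = exp (\<psi> t / of_nat n)" if n: "0 < n" for n t
 proof -
  interpret R: real_distribution "law (1 / real n)" by (rule real_distribution_law) simp
  define q where "q t = char (law (1 / real n)) t * exp (- (\<psi> t / of_nat n))" for t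
  have "q constant_on UNIV"
  proof (rule continuous_finite_range_constant)
   show "connected (UNIV :: real set)" by (rule connected_UNIV)
   have "continuous_on UNIV (char (law (1 / real n)))" by (intro continuous_at_imp_continuous_on ballI R.isCont_char)
   thus "continuous_on UNIV q" unfolding q_def using n by (intro continuous_intros c\<psi>) auto
   have "q t ^ n = 1" for t
   proof -
    have "q t ^ n = char (law (1 / real n)) t ^ n * exp (- (\<psi> t / of_nat n)) ^ n"
     by (simp add: q_def power_mult_distrib)
    also have "char (law (1 / real n)) t ^ n = exp (\<psi> t)"
     using char_law_mult[of "1 / real n" n t] n by (simp add: \<psi>1)
    also have "exp (- (\<psi> t / of_nat n)) ^ n = exp (- \<psi> t)"
     using n by (subst exp_of_nat_mult[symmetric]) simp
    finally show ?thesis by (simp flip: exp_add)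
   qed
   hence "range q \<subseteq> {z. z ^ n = 1}" by auto
   thus "finite (range q)" by (rule finite_subset) (use n in \<open>simp add: finite_roots_unity\<close>)
  qed
  hence "q t = q 0" by (auto simp: constant_on_def)
  also have "q 0 = 1" by (simp add: q_def \<psi>0 R.char_zero)
  finally show ?thesis by (simp add: q_def exp_minus field_simps)
 qed
 have rat: "char (law (real k / real n)) t = exp (of_real (real k / real n) * \<psi> t)" if n: "0 < n" for k n
 proof -
  have "char (law (real k / real n)) t = char (law (1 / real n)) t ^ k"
   using char_law_mult[of "1 / real n" k t] by simp
  also have "... = exp (of_real (real k / real n) * \<psi> t)"
   unfolding root[OF n] by (subst exp_of_nat_mult[symmetric]) simp
  finally show ?thesis .
 qed
 \<comment> \<open>Rational times strictly above s, hence the 1 after the floor.\<close>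
 define r where "r n = real (nat \<lfloor>s * real (Suc n)\<rfloor> + 1) / real (Suc n)" for n
 have r: "s < r n" "r n <= s + 1 / real (Suc n)" for n
 proof -
  have f: "real (nat \<lfloor>s * real (Suc n)\<rfloor>) = of_int \<lfloor>s * real (Suc n)\<rfloor>" using s by simp
  have "s * real (Suc n) < real (nat \<lfloor>s * real (Suc n)\<rfloor> + 1)" unfolding of_nat_add f by linarith
  thus "s < r n" by (simp add: r_def pos_less_divide_eq)
  have "real (nat \<lfloor>s * real (Suc n)\<rfloor> + 1) <= s * real (Suc n) + 1" unfolding of_nat_add f by linarith
  hence "r n <= (s * real (Suc n) + 1) / real (Suc n)" unfolding r_def by (intro divide_right_mono) auto
  thus "r n <= s + 1 / real (Suc n)" by (simp add: add_divide_distrib)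
 qed
 have lim: "r \<longlonglongrightarrow> s"
 proof (rule tendsto_sandwich[where f="%_. s" and h="%n. s + 1 / real (Suc n)"])
  show "(%n. s + 1 / real (Suc n)) \<longlonglongrightarrow> s"
   using tendsto_add[OF tendsto_const[of s] lim_1_over_n[THEN LIMSEQ_Suc]] by simp
  show "\<forall>\<^sub>F n in sequentially. s <= r n" "\<forall>\<^sub>F n in sequentially. r n <= s + 1 / real (Suc n)"
   using r by (auto intro!: always_eventually less_imp_le simp del: of_nat_Suc)
 qed simp
 have "(%n. char (law (r n)) t) \<longlonglongrightarrow> char (law s) t"
  by (rule char_law_right_continuous[OF s r(1) lim])
 moreover have "char (law (r n)) t = exp (of_real (r n) * \<psi> t)" for n unfolding r_def by (rule rat) simp
 moreover have "(%n. exp (of_real (r n) * \<psi> t)) \<longlonglongrightarrow> exp (of_real s * \<psi> t)"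
  by (intro tendsto_intros lim)
 ultimately show ?thesis using LIMSEQ_unique by simp
qed

end

section \<open>Tails of the non-symmetric Cauchy process\<close>

lemma one_minus_cos_le: "1 - cos y <= y\<^sup>2 / 2" for y :: real
proof -
 have "1 - cos y = 2 * (sin (y / 2))\<^sup>2" using cos_double_sin[of "y / 2"] by simp
 also have "(sin (y / 2))\<^sup>2 <= (y / 2)\<^sup>2" unfolding abs_le_square_iff[symmetric] by (rule abs_sin_x_le_abs_x)
 finally show ?thesis by (simp add: power_divide)
qed

lemma Re_char:
 assumes "real_distribution M"
 shows "1 - Re (char M v) = (LINT x|M. 1 - cos (v * x))"
proof -
 interpret M: real_distribution M by fact
 have i: "integrable M (%x. iexp (v * x))" by (rule M.integrable_iexp) auto
 have "Re (char M v) = (LINT x|M. Re (iexp (v * x)))" unfolding char_def by (rule integral_Re[OF i, symmetric])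
 also have "... = (LINT x|M. cos (v * x))" by (simp add: Re_exp)
 finally have e: "Re (char M v) = (LINT x|M. cos (v * x))" .
 have "integrable M (%x. cos (v * x))" by (rule M.integrable_const_bound[where B=1]) auto
 thus ?thesis unfolding e using M.prob_space by (subst Bochner_Integration.integral_diff) auto
qed

text \<open>The truncation inequality: the average of 1 - cos (v x) over v in [0, u] is at least 1/2
  as soon as |x| > 2 / u.\<close>

lemma char_tail:
 assumes M: "real_distribution M" and u: "0 < u" and B: "!!v. 0 <= v ==> v <= u ==> 1 - Re (char M v) <= B"
 shows "measure M {x. 2 / u < \<bar>x\<bar>} <= 2 * B"
proof -
 interpret M: real_distribution M by fact
 interpret pair_sigma_finite M lborel ..
 let ?k = "%x v. ennreal (1 - cos (v * x)) * indicator {0..u} v"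
 have [measurable]: "{x. 2 / u < \<bar>x\<bar>} \<in> sets M" by measurable
 have B0: "0 <= B" using B[of 0] u M.char_zero by simp
 have low: "ennreal (u / 2) * indicator {x. 2 / u < \<bar>x\<bar>} x <= (\<integral>\<^sup>+v. ?k x v \<partial>lborel)" for x
 proof (cases "2 / u < \<bar>x\<bar>")
  case True
  hence x0: "x ~= 0" using u by auto
  have "(\<integral>\<^sup>+v. ?k x v \<partial>lborel) = ennreal ((u - sin (u * x) / x) - (0 - sin (0 * x) / x))"
   by (rule nn_integral_FTC_Icc) (use u x0 in \<open>auto intro!: derivative_eq_intros\<close>)
  moreover have "u / 2 <= u - sin (u * x) / x"
  proof -
   have "sin (u * x) / x <= \<bar>sin (u * x) / x\<bar>" by (rule abs_ge_self)
   also have "... <= 1 / \<bar>x\<bar>" unfolding abs_divide by (intro divide_right_mono) auto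
   also have "... <= u / 2" using True u x0 by (simp add: field_simps)
   finally show ?thesis by simp
  qed
  ultimately show ?thesis using True by (simp add: ennreal_leI)
 qed simp
 have "ennreal (u / 2) * emeasure M {x. 2 / u < \<bar>x\<bar>} = (\<integral>\<^sup>+x. ennreal (u / 2) * indicator {x. 2 / u < \<bar>x\<bar>} x \<partial>M)"
  by (rule nn_integral_cmult_indicator[symmetric]) simp
 also have "... <= (\<integral>\<^sup>+x. \<integral>\<^sup>+v. ?k x v \<partial>lborel \<partial>M)" by (intro nn_integral_mono low)
 also have "... = (\<integral>\<^sup>+v. \<integral>\<^sup>+x. ?k x v \<partial>M \<partial>lborel)" by (rule Fubini'[symmetric]) measurable
 also have "... <= (\<integral>\<^sup>+v. ennreal B * indicator {0..u} v \<partial>lborel)"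
 proof (rule nn_integral_mono)
  fix v
  show "(\<integral>\<^sup>+x. ?k x v \<partial>M) <= ennreal B * indicator {0..u} v"
  proof (cases "v \<in> {0..u}")
   case True
   have "(\<integral>\<^sup>+x. ennreal (1 - cos (v * x)) \<partial>M) = ennreal (LINT x|M. 1 - cos (v * x))"
    by (intro nn_integral_eq_integral M.integrable_const_bound[where B=2])
      (auto simp: abs_le_iff intro: order_trans[OF cos_le_one] order_trans[OF _ cos_ge_minus_one])
   thus ?thesis using True B[of v] by (simp add: Re_char[OF M, symmetric] ennreal_leI)
  qed simp
 qed
 also have "... = ennreal (B * u)" using u B0 by (subst nn_integral_cmult_indicator) (auto simp: ennreal_mult)
 finally have "ennreal (u / 2 * measure M {x. 2 / u < \<bar>x\<bar>}) <= ennreal (B * u)"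
  using u by (simp add: M.emeasure_eq_measure ennreal_mult'[symmetric])
 hence "u / 2 * measure M {x. 2 / u < \<bar>x\<bar>} <= B * u" using u B0 by (subst (asm) ennreal_le_iff) auto
 thus ?thesis using u by (simp add: field_simps)
qed

lemma abs_ln_le:
 assumes "0 < (q::real)"
 shows "\<bar>ln q\<bar> <= q + 1 / q"
proof -
 have "0 < 1 / q" using assms by simp
 hence "ln q < q" "ln (1 / q) < 1 / q" using assms by (auto intro: ln_less_self)
 moreover have "ln (1 / q) = - ln q" using assms by (simp add: ln_div)
 ultimately show ?thesis using assms \<open>0 < 1 / q\<close> by linarith
qed

text \<open>Half a power of v absorbs the squared logarithm. With q the fourth root of v this
  follows from |ln q| <= q + 1/q, as q (q + 1/q) stays bounded.\<close>

lemma log_square_bound: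
 assumes "0 < u0"
 obtains K where "0 <= K" "!!v. 0 < v ==> v <= u0 ==> (v * (a - ln v))\<^sup>2 <= K * (v * sqrt v)"
proof
 define Q where "Q = sqrt (sqrt u0)"
 let ?K = "(\<bar>a\<bar> * Q + 4 * Q\<^sup>2 + 4)\<^sup>2"
 show "0 <= ?K" by simp
 fix v assume v: "0 < v" "v <= u0"
 define q where "q = sqrt (sqrt v)"
 have q: "0 < q" "q <= Q" using v by (auto simp: q_def Q_def)
 have q2: "q\<^sup>2 = sqrt v" using v by (simp add: q_def)
 have q4: "v = q\<^sup>2 * q\<^sup>2" using v by (simp add: q2)
 have ln: "ln v = 4 * ln q" using q by (simp add: q4 ln_mult power2_eq_square)
 have "\<bar>a - ln v\<bar> <= \<bar>a\<bar> + 4 * (q + 1 / q)"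
  using abs_ln_le[OF q(1)] abs_triangle_ineq4[of a "ln v"] unfolding ln by (simp add: abs_mult)
 hence "q * \<bar>a - ln v\<bar> <= q * (\<bar>a\<bar> + 4 * (q + 1 / q))" using q by (intro mult_left_mono) auto
 also have "... = \<bar>a\<bar> * q + 4 * q\<^sup>2 + 4" using q by (simp add: field_simps power2_eq_square)
 also have "... <= \<bar>a\<bar> * Q + 4 * Q\<^sup>2 + 4" using q by (intro add_mono mult_left_mono power_mono) auto
 finally have "(q * \<bar>a - ln v\<bar>)\<^sup>2 <= ?K" using q by (intro power_mono) auto
 hence "q ^ 6 * (q * \<bar>a - ln v\<bar>)\<^sup>2 <= q ^ 6 * ?K" by (intro mult_left_mono) auto
 moreover have "q ^ 6 * (q * \<bar>a - ln v\<bar>)\<^sup>2 = (v * (a - ln v))\<^sup>2"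
  unfolding power_mult_distrib power2_abs q4 by (simp add: power_mult_distrib eval_nat_numeral mult_ac)
 moreover have "q ^ 6 = v * sqrt v" unfolding q2[symmetric] q4 by (simp add: eval_nat_numeral)
 ultimately show "(v * (a - ln v))\<^sup>2 <= ?K * (v * sqrt v)" by (simp add: mult.commute)
qed

text \<open>In the application \<open>c\<close> is pi/2 (c1 + c2) and \<open>dl\<close> is c1 - c2.
  The term v ln v in the imaginary part comes from the asymmetry and destroys exact scaling.\<close>

locale one_stable = blevy \<beta> p N \<xi> for \<beta> p and N :: "'b measure" and \<xi> +
 fixes \<psi> :: "real => complex" and c dl a :: real
 assumes \<psi>: "levy_exponent_of N \<xi> \<psi>" and c: "0 < c"
  and Re_\<psi>: "!!v. 0 < v ==> Re (\<psi> v) = - (c * v)"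
  and Im_\<psi>: "!!v. 0 < v ==> Im (\<psi> v) = dl * (v * (a - ln v))"
begin

lemma char_law: "0 <= s ==> char (law s) t = exp (of_real s * \<psi> t)" by (rule char_law_exp[OF \<psi>])

lemma \<psi>_0: "\<psi> 0 = 0" using \<psi> by (simp add: levy_exponent_of_def)

lemma one_minus_Re_char:
 assumes s: "0 <= s" and v: "0 < v"
 shows "1 - Re (char (law s) v) <= s * c * v + s\<^sup>2 * dl\<^sup>2 * (v * (a - ln v))\<^sup>2 / 2"
proof -
 let ?x = "s * c * v" and ?y = "s * (dl * (v * (a - ln v)))"
 have x: "0 <= ?x" using s v c by simp
 have "Re (char (law s) v) = exp (- ?x) * cos ?y"
  unfolding char_law[OF s] by (simp add: Re_exp Re_\<psi>[OF v] Im_\<psi>[OF v] mult.assoc)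
 moreover have "1 - exp (- ?x) * cos ?y = (1 - exp (- ?x)) + exp (- ?x) * (1 - cos ?y)" by (simp add: algebra_simps)
 moreover have "1 - exp (- ?x) <= ?x" using exp_ge_add_one_self[of "- ?x"] by simp
 moreover have "exp (- ?x) * (1 - cos ?y) <= 1 * (?y\<^sup>2 / 2)" using x by (intro mult_mono one_minus_cos_le) auto
 ultimately have "1 - Re (char (law s) v) <= ?x + ?y\<^sup>2 / 2" by linarith
 thus ?thesis by (simp add: power_mult_distrib mult.assoc)
qed

text \<open>The second term has u to the power 3/2 instead of 2, the price for the logarithm; an
  exponent above 1 is enough for A3.\<close>

lemma Re_char_bound:
 assumes "0 < u0"
 obtains K where "0 <= K" "!!s u v. 0 <= s ==> 0 <= v ==> v <= u ==> u <= u0 ==>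
  1 - Re (char (law s) v) <= K * (s * u + s\<^sup>2 * (u * sqrt u))"
proof -
 obtain K0 where K0: "0 <= K0" "!!v. 0 < v ==> v <= u0 ==> (v * (a - ln v))\<^sup>2 <= K0 * (v * sqrt v)"
  using log_square_bound[OF assms, of a] by metis
 define K where "K = max c (dl\<^sup>2 * K0)"
 have K: "c <= K" "dl\<^sup>2 * K0 <= K" "0 <= K" using c by (auto simp: K_def)
 show ?thesis
 proof (rule that[OF K(3)])
  fix s u v :: real assume s: "0 <= s" and v: "0 <= v" "v <= u" "u <= u0"
  show "1 - Re (char (law s) v) <= K * (s * u + s\<^sup>2 * (u * sqrt u))"
  proof (cases "v = 0")
   case True
   interpret L: real_distribution "law s" by (rule real_distribution_law[OF s])
   show ?thesis using True s v K(3) by (simp add: L.char_zero)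
  next
   case False
   hence v0: "0 < v" using v by simp
   have "1 - Re (char (law s) v) <= s * c * v + s\<^sup>2 * dl\<^sup>2 * (v * (a - ln v))\<^sup>2 / 2"
    by (rule one_minus_Re_char[OF s v0])
   also have "... <= s * K * u + s\<^sup>2 * K * (u * sqrt u)"
   proof (rule add_mono)
    show "s * c * v <= s * K * u" using s v K c v0 by (intro mult_mono) auto
    have "s\<^sup>2 * dl\<^sup>2 * (v * (a - ln v))\<^sup>2 / 2 <= s\<^sup>2 * dl\<^sup>2 * (v * (a - ln v))\<^sup>2" by simp
    also have "... <= s\<^sup>2 * dl\<^sup>2 * (K0 * (v * sqrt v))" using K0(2)[of v] v0 v by (intro mult_left_mono) auto
    also have "... = s\<^sup>2 * (dl\<^sup>2 * K0) * (v * sqrt v)" by simp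
    also have "... <= s\<^sup>2 * K * (u * sqrt u)" using K K0(1) v v0 by (intro mult_mono) auto
    finally show "s\<^sup>2 * dl\<^sup>2 * (v * (a - ln v))\<^sup>2 / 2 <= s\<^sup>2 * K * (u * sqrt u)" .
   qed
   finally show ?thesis by (simp add: algebra_simps)
  qed
 qed
qed

abbreviation ptail :: "real => real => real" where
 "ptail s x \<equiv> measure N {w\<in>space N. \<bar>\<xi> s w\<bar> > x}"

lemma measure_law_tail:
 assumes "0 <= s"
 shows "ptail s x = measure (law s) {y. x < \<bar>y\<bar>}" unfolding law_def using \<xi>_measurable[OF assms]
 by (subst measure_distr) (auto simp: vimage_def Int_def conj_commute)

lemma tail_bound:
 assumes x0: "0 < x0"
 obtains K where "0 <= K" "!!s x. 0 <= s ==> x0 <= x ==>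
  ptail s x <= K * (s / x + s\<^sup>2 / (x * sqrt x))"
proof -
 obtain K where K: "0 <= K" "!!s u v. 0 <= s ==> 0 <= v ==> v <= u ==> u <= 2 / x0 ==>
  1 - Re (char (law s) v) <= K * (s * u + s\<^sup>2 * (u * sqrt u))"
  using Re_char_bound[of "2 / x0"] x0 by (metis divide_pos_pos zero_less_numeral)
 show ?thesis
 proof (rule that[of "8 * K"])
  show "0 <= 8 * K" using K by simp
  fix s x :: real assume s: "0 <= s" and x: "x0 <= x"
  have xp: "0 < x" using x x0 by simp
  have "measure (law s) {y. 2 / (2 / x) < \<bar>y\<bar>} <= 2 * (K * (s * (2 / x) + s\<^sup>2 * ((2 / x) * sqrt (2 / x))))"
  proof (rule char_tail[OF real_distribution_law[OF s]])
   show "0 < 2 / x" using xp by simp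
   show "1 - Re (char (law s) v) <= K * (s * (2 / x) + s\<^sup>2 * ((2 / x) * sqrt (2 / x)))"
    if "0 <= v" "v <= 2 / x" for v using K(2)[OF s that] x x0 by (simp add: frac_le)
  qed
  also have "... <= 2 * (K * (4 * (s / x) + 4 * (s\<^sup>2 / (x * sqrt x))))"
  proof -
   have "sqrt (2 / x) = sqrt 2 / sqrt x" by (rule real_sqrt_divide)
   hence "s\<^sup>2 * ((2 / x) * sqrt (2 / x)) = 2 * sqrt 2 * (s\<^sup>2 / (x * sqrt x))" by simp
   also have "... <= 4 * (s\<^sup>2 / (x * sqrt x))" using xp sqrt2_less_2 by (intro mult_right_mono) auto
   finally have "s * (2 / x) + s\<^sup>2 * ((2 / x) * sqrt (2 / x)) <= 4 * (s / x) + 4 * (s\<^sup>2 / (x * sqrt x))"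
    using s xp by (simp add: field_simps add_mono)
   thus ?thesis using K(1) by (intro mult_left_mono) auto
  qed
  finally show "ptail s x <= 8 * K * (s / x + s\<^sup>2 / (x * sqrt x))"
   using xp by (simp add: measure_law_tail[OF s] algebra_simps)
 qed
qed

lemma A3_exp:
 assumes lam: "0 < lam"
 shows "assumption_A3 N \<xi> lam (%t. exp (lam * t))" unfolding assumption_A3_def
proof (intro allI impI)
 fix th :: real assume th: "0 < th"
 obtain K where K: "0 <= K" "!!s x. 0 <= s ==> th <= x ==>
  ptail s x <= K * (s / x + s\<^sup>2 / (x * sqrt x))" using tail_bound[OF th] by metis
 define C where "C = K * (1 / th + 2 / lam / (th * sqrt th))"
 have "inverse s * exp (lam * t) * ptail s (exp (lam * t) * th) <= C"
  if t: "1 < t" and s: "0 < s" "s <= t" for s t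
 proof -
  \<comment> \<open>After multiplication by e^(lam t) / s the first term of the tail bound is
    constant, and the second is a constant times s / E, bounded since lam s <= lam t <= 2 E.\<close>
  define E where "E = exp (lam * t / 2)"
  have E2: "exp (lam * t) = E * E" by (simp add: E_def flip: exp_add)
  have E1: "1 <= E" "lam * t / 2 <= E"
   using lam t exp_ge_add_one_self[of "lam * t / 2"] by (simp add: E_def, unfold E_def, linarith)
  have Ep: "0 < E" by (simp add: E_def)
  have x: "th <= E * E * th" using E1 th mult_mono[of 1 E 1 E] by simp
  have sq: "sqrt (E * E * th) = E * sqrt th" using Ep by (simp add: real_sqrt_mult)
  have "inverse s * (E * E) * ptail s (E * E * th) <=
    inverse s * (E * E) * (K * (s / (E * E * th) + s\<^sup>2 / (E * E * th * sqrt (E * E * th))))"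
   using s Ep by (intro mult_left_mono K(2) x) auto
  also have "... = K * (1 / th + s / E / (th * sqrt th))"
   unfolding sq using s Ep th by (simp add: field_simps power2_eq_square)
  also have "... <= C"
  proof -
   have "lam * s <= lam * t" using lam s by (intro mult_left_mono) auto
   hence "lam * s <= 2 * E" using E1 by linarith
   hence "s / E <= 2 / lam" using Ep lam by (simp add: field_simps)
   thus ?thesis unfolding C_def using K(1) th by (intro mult_left_mono add_left_mono divide_right_mono) auto
  qed
  finally show ?thesis by (simp add: E2)
 qed
 hence "(SUP t\<in>{1<..}. SUP s\<in>{0<..t}.
   ereal (inverse s * exp (lam * t) * ptail s (exp (lam * t) * th))) <= ereal C" by (intro SUP_least) auto
 thus "(SUP t\<in>{1<..}. SUP s\<in>{0<..t}.
   ereal (inverse s * exp (lam * t) * ptail s (exp (lam * t) * th))) < \<infinity>" by (rule le_less_trans) simp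
qed

lemma A2_exp:
 assumes lam: "0 < lam"
 shows "assumption_A2 N \<xi> lam (%t. exp (lam * t))" unfolding assumption_A2_def
proof (intro allI impI)
 fix th :: real assume th: "0 < th"
 \<comment> \<open>The threshold e^(lam t) th / t never falls below lam th because e^y >= y, so one
   tail bound covers all t.\<close>
 let ?low = "lam * th"
 have x0: "0 < ?low" using lam th by simp
 obtain K where K: "0 <= K" "!!s x. 0 <= s ==> ?low <= x ==>
  ptail s x <= K * (s / x + s\<^sup>2 / (x * sqrt x))" using tail_bound[OF x0] by metis
 define C where "C = K * (1 / th + 1 / (th * sqrt ?low))"
 let ?S = "%t. SUP s\<in>{0..t}. ptail s (exp (lam * t) * th / t)"
 \<comment> \<open>The supremum is of order at most t^3 e^(-lam t), so its square beats the factor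
   e^(lam t).\<close>
 have b: "0 <= ?S t \<and> ?S t <= C * (t ^ 3 * exp (- lam * t))" if t: "1 <= t" for t
 proof -
  let ?x = "exp (lam * t) * th / t"
  have xge: "?low <= ?x"
  proof -
   have "lam * t <= exp (lam * t)" using exp_ge_add_one_self[of "lam * t"] by linarith
   hence "lam * t * th <= exp (lam * t) * th" using th by (intro mult_right_mono) auto
   thus ?thesis using t by (simp add: field_simps)
  qed
  have xp: "0 < ?x" using xge x0 by linarith
  have "ptail s ?x <= C * (t ^ 3 * exp (- lam * t))" if s: "s \<in> {0..t}" for s
  proof -
   have "ptail s ?x <= K * (s / ?x + s\<^sup>2 / (?x * sqrt ?x))" using s xge by (intro K(2)) auto
   also have "... <= K * (t\<^sup>2 / ?x + t\<^sup>2 / (?x * sqrt ?low))"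
   proof (intro mult_left_mono add_mono K(1))
    have "s <= t * t" using s t mult_mono[of 1 t s t] by simp
    thus "s / ?x <= t\<^sup>2 / ?x" using xp by (intro divide_right_mono) (auto simp: power2_eq_square)
    show "s\<^sup>2 / (?x * sqrt ?x) <= t\<^sup>2 / (?x * sqrt ?low)"
     using s xp xge x0 by (intro frac_le power_mono mult_left_mono real_sqrt_le_mono mult_pos_pos) auto
   qed
   also have "... = C * (t ^ 3 * exp (- lam * t))"
    unfolding C_def using t th by (simp add: exp_minus field_simps power2_eq_square power3_eq_cube)
   finally show ?thesis .
  qed
  note le = this
  have bdd: "bdd_above ((%s. ptail s ?x) ` {0..t})"
   by (rule bdd_aboveI2[where M="C * (t ^ 3 * exp (- lam * t))"]) (rule le)
  have "0 <= ?S t" by (rule cSUP_upper2[OF bdd, of 0]) (use t in auto)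
  moreover have "?S t <= C * (t ^ 3 * exp (- lam * t))" by (rule cSUP_least) (use t le in auto)
  ultimately show ?thesis by simp
 qed
 show "((%t. exp (lam * t) * (?S t)\<^sup>2) \<longlongrightarrow> 0) at_top"
 proof (rule tendsto_sandwich[where f="%_. 0" and h="%t. C\<^sup>2 * (t ^ 6 * exp (- lam * t))"])
  show "((%t. C\<^sup>2 * (t ^ 6 * exp (- lam * t))) \<longlongrightarrow> 0) at_top" using lam by real_asymp
  show "\<forall>\<^sub>F t in at_top. exp (lam * t) * (?S t)\<^sup>2 <= C\<^sup>2 * (t ^ 6 * exp (- lam * t))"
   using eventually_ge_at_top[of 1]
  proof eventually_elim
   case (elim t)
   have "exp (lam * t) * (?S t)\<^sup>2 <= exp (lam * t) * (C * (t ^ 3 * exp (- lam * t)))\<^sup>2"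
    using b[OF elim] by (intro mult_left_mono power_mono) auto
   also have "... = C\<^sup>2 * (t ^ 6 * exp (- lam * t))"
    by (simp add: exp_minus field_simps power2_eq_square eval_nat_numeral)
   finally show ?case .
  qed
 qed auto
qed

end

section \<open>Vague convergence of the rescaled laws\<close>

text \<open>Normalization makes Levy's continuity theorem available although the Levy measure itself
  is infinite: a weight that is small at 0 leaves a finite measure.\<close>

lemma weighted_distribution:
 fixes w :: "real => real"
 assumes M[measurable_cong]: "sets M = sets borel" and w: "integrable M w" "!!x. 0 <= w x" and Z: "Z = (LINT x|M. w x)" "0 < Z"
 defines "D \<equiv> density M (%x. ennreal (w x / Z))"
 shows "real_distribution D"
  and "char D t = (CLINT x|M. iexp (t * x) * complex_of_real (w x)) / of_real Z"
  and "f \<in> Bm borel ==> integral\<^sup>L D f = (LINT x|M. w x * f x) / (Z :: real)"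
proof -
 have [measurable]: "w \<in> Bm M" using w(1) by auto
 have "emeasure D (space D) = (\<integral>\<^sup>+x. ennreal (w x / Z) * indicator (space M) x \<partial>M)"
  unfolding D_def by (simp add: emeasure_density)
 also have "... = (\<integral>\<^sup>+x. ennreal (w x / Z) \<partial>M)" by (intro nn_integral_cong) simp
 also have "... = ennreal (LINT x|M. w x / Z)" using w Z(2) by (intro nn_integral_eq_integral) auto
 also have "(LINT x|M. w x / Z) = 1" using Z by simp
 finally have "prob_space D" by (intro prob_spaceI) simp
 thus "real_distribution D" by (intro real_distribution.intro real_distribution_axioms.intro)
    (auto simp: D_def M sets_eq_imp_space_eq[OF M])
 have "char D t = (CLINT x|M. (w x / Z) *\<^sub>R iexp (t * x))"
  unfolding char_def D_def using w Z(2) by (intro integral_density) auto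
 also have "... = (CLINT x|M. iexp (t * x) * complex_of_real (w x) / of_real Z)"
  by (intro Bochner_Integration.integral_cong) (auto simp: scaleR_conv_of_real)
 finally show "char D t = (CLINT x|M. iexp (t * x) * complex_of_real (w x)) / of_real Z" by simp
 show "integral\<^sup>L D f = (LINT x|M. w x * f x) / Z" if [measurable]: "f \<in> Bm borel"
 proof -
  have "integral\<^sup>L D f = (LINT x|M. (w x / Z) *\<^sub>R f x)"
   unfolding D_def using w Z(2) by (intro integral_density) auto
  thus ?thesis by simp
 qed
qed

lemma iexp_second_difference:
 "iexp (t * x) * complex_of_real (1 - cos (u * x)) = iexp (t * x) - (iexp ((t + u) * x) + iexp ((t - u) * x)) / 2"
 by (simp add: complex_eq_iff Re_exp Im_exp cos_add cos_diff sin_add sin_diff algebra_simps)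

text \<open>Weighting by 1 - cos (u x) amounts to a second difference with step u in the frequency,
  which annihilates terms linear in the frequency.\<close>

lemma char_second_difference:
 assumes "real_distribution M"
 shows "(CLINT x|M. iexp (t * x) * complex_of_real (1 - cos (u * x))) =
  char M t - (char M (t + u) + char M (t - u)) / 2"
proof -
 interpret M: real_distribution M by fact
 have i: "integrable M (%x. iexp (v * x))" for v by (rule M.integrable_iexp) auto
 have "(CLINT x|M. iexp (t * x) - (iexp ((t + u) * x) + iexp ((t - u) * x)) / 2) =
   (CLINT x|M. iexp (t * x)) - (CLINT x|M. (iexp ((t + u) * x) + iexp ((t - u) * x)) / 2)"
  by (intro Bochner_Integration.integral_diff Bochner_Integration.integrable_divide_zero Bochner_Integration.integrable_add i)
 also have "(CLINT x|M. (iexp ((t + u) * x) + iexp ((t - u) * x)) / 2) =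
   (CLINT x|M. iexp ((t + u) * x) + iexp ((t - u) * x)) / 2" by (rule integral_divide_zero)
 also have "(CLINT x|M. iexp ((t + u) * x) + iexp ((t - u) * x)) =
   (CLINT x|M. iexp ((t + u) * x)) + (CLINT x|M. iexp ((t - u) * x))" by (intro Bochner_Integration.integral_add i)
 finally show ?thesis unfolding iexp_second_difference char_def .
qed

text \<open>The average of 1 - cos (u x) over u in [0, 1] (\<open>nn_integral_wt\<close>). A single
  1 - cos (u x) vanishes at all multiples of 2 pi / u, the average only at 0.\<close>

definition wt :: "real => real" where
 "wt x = (if x = 0 then 0 else 1 - sin x / x)"

lemma nn_integral_wt:
 "(\<integral>\<^sup>+u. ennreal (1 - cos (u * x)) * indicator {0..1} u \<partial>lborel) = ennreal (wt x)"
proof (cases "x = 0")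
 case False
 have "(\<integral>\<^sup>+u. ennreal (1 - cos (u * x)) * indicator {0..1} u \<partial>lborel) = ennreal ((1 - sin (1 * x) / x) - (0 - sin (0 * x) / x))"
  by (rule nn_integral_FTC_Icc) (use False in \<open>auto intro!: derivative_eq_intros\<close>)
 thus ?thesis using False by (simp add: wt_def)
qed (simp add: wt_def)

lemma wt_minus: "wt (- x) = wt x" by (simp add: wt_def)

text \<open>Up to |x| = 2 the bound sin y / y <= cos (y / 2) decides, beyond it sin y / y <=
  1/2.\<close>

lemma wt_lower:
 assumes dl: "0 < dl" "dl <= 2" and x: "dl <= \<bar>x\<bar>"
 shows "min (1 / 2) (1 - cos (dl / 2)) <= wt x"
proof -
 define y where "y = \<bar>x\<bar>"
 have y: "dl <= y" "wt x = wt y" using x wt_minus[of x] by (auto simp: y_def abs_if)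
 have y0: "0 < y" using y dl by simp
 show ?thesis
 proof (cases "y <= 2")
  case True
  have "sin y = 2 * sin (y / 2) * cos (y / 2)" using sin_double[of "y / 2"] by simp
  also have "... <= 2 * (y / 2) * cos (y / 2)"
   using y0 True pi_gt3 by (intro mult_right_mono mult_left_mono sin_x_le_x cos_ge_zero) auto
  finally have "sin y / y <= cos (y / 2)" using y0 by (simp add: field_simps)
  also have "cos (y / 2) <= cos (dl / 2)" using y dl True pi_gt3 by (intro cos_monotone_0_pi_le) auto
  finally show ?thesis using y0 unfolding y(2) by (simp add: wt_def)
 next
  case False
  have "sin y / y <= 1 / y" using y0 by (intro divide_right_mono) auto
  also have "... <= 1 / 2" using False by (simp add: field_simps)
  finally have "1 / 2 <= wt y" using y0 by (simp add: wt_def)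
  thus ?thesis unfolding y(2) by (rule min.coboundedI1)
 qed
qed

lemma wt_cos_pos: "0 < (dl::real) ==> dl <= 2 ==> 0 < 1 - cos (dl / 2)"
 using cos_monotone_0_pi[of 0 "dl / 2"] pi_gt3 by simp

lemma Cc_plus_bounded:
 assumes "g \<in> Cc_plus"
 obtains B where "0 <= B" "!!x. g x <= B"
proof -
 have "compact (range g)"
  by (rule compact_continuous_image[OF continuous_on_Cc_plus[OF assms]]) (simp add: compact_eq_closed)
 hence "bounded (range g)" by (rule compact_imp_bounded)
 then obtain B where "!!x. \<bar>g x\<bar> <= B" by (auto simp: bounded_iff)
 thus ?thesis using that[of B] by (meson abs_ge_zero abs_le_D1 order_trans)
qed

text \<open>A test function vanishes near 0, the only zero of \<open>wt\<close>, so the quotient is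
  bounded and continuous: weak convergence of the weighted laws can be applied to it.\<close>

lemma Cc_plus_divide_wt:
 assumes g: "g \<in> Cc_plus"
 obtains B where "0 <= B" "!!x. g (ereal x) / wt x <= B" "!!x. 0 <= g (ereal x) / wt x"
  "!!x. isCont (%x. g (ereal x) / wt x) x" "!!x. g (ereal x) / wt x * wt x = g (ereal x)"
proof -
 obtain d where d: "0 < d" "!!x. \<bar>x\<bar> < ereal d ==> g x = 0" using Cc_plus_zero[OF g] by metis
 define dl where "dl = min d 2"
 have dl: "0 < dl" "dl <= 2" "!!x::real. \<bar>x\<bar> < dl ==> g (ereal x) = 0" using d by (auto simp: dl_def)
 define l where "l = min (1 / 2) (1 - cos (dl / 2))"
 have l: "0 < l" using wt_cos_pos[OF dl(1,2)] by (simp add: l_def)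
 have low: "l <= wt x" if "dl <= \<bar>x\<bar>" for x unfolding l_def by (rule wt_lower[OF dl(1,2) that])
 obtain B where B: "0 <= B" "!!x. g x <= B" using Cc_plus_bounded[OF g] by metis
 have g0: "0 <= g x" for x by (rule Cc_plusD(2)[OF g])
 have bnd: "0 <= g (ereal x) / wt x \<and> g (ereal x) / wt x <= B / l \<and> g (ereal x) / wt x * wt x = g (ereal x)" for x
 proof (cases "\<bar>x\<bar> < dl")
  case True
  thus ?thesis using dl(3) B l by simp
 next
  case False
  hence "l <= wt x" by (intro low) simp
  thus ?thesis using g0 B l by (auto intro!: divide_nonneg_nonneg frac_le)
 qed
 have cont: "isCont (%x. g (ereal x) / wt x) x" for x
 proof (cases "x = 0")
  case True
  have "eventually (%y. \<bar>y\<bar> < dl) (nhds (0::real))"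
   using dl(1) by (auto simp: eventually_nhds_metric dist_real_def)
  hence "eventually (%y. g (ereal y) / wt y = 0) (nhds (0::real))" by eventually_elim (simp add: dl(3))
  hence "isCont (%x. g (ereal x) / wt x) 0 = isCont (%_ :: real. 0 :: real) 0"
   by (rule isCont_cong[where f="%x. g (ereal x) / wt x" and g="%_. 0"])
  thus ?thesis using True by simp
 next
  case False
  have "isCont (%x. g (ereal x)) x"
  proof -
   have "continuous_on UNIV (%x. g (ereal x))"
    by (rule continuous_on_compose2[OF continuous_on_Cc_plus[OF g]]) (auto intro!: continuous_intros)
   thus ?thesis by (simp add: continuous_on_eq_continuous_at)
  qed
  moreover have "isCont wt x"
  proof -
   have "eventually (%y. y ~= 0) (nhds x)" using False by (intro t1_space_nhds) auto
   hence "eventually (%y. wt y = 1 - sin y / y) (nhds x)" by eventually_elim (simp add: wt_def)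
   hence "isCont wt x = isCont (%y. 1 - sin y / y) x" by (rule isCont_cong)
   thus ?thesis using False by (auto intro!: continuous_intros)
  qed
  moreover have "wt x ~= 0"
  proof -
   have "0 < min \<bar>x\<bar> 2" using False by simp
   hence "0 < min (1 / 2) (1 - cos (min \<bar>x\<bar> 2 / 2))" using wt_cos_pos[of "min \<bar>x\<bar> 2"] by simp
   also have "... <= wt x" using False by (intro wt_lower) auto
   finally show ?thesis by simp
  qed
  ultimately show ?thesis by (intro continuous_intros) auto
 qed
 show ?thesis by (rule that[of "B / l"]) (use bnd cont B l in auto)
qed

lemma exp_remainder_lim:
 fixes z :: "nat => complex" and n :: "nat => real"
 assumes n: "!!k. 0 <= n k" and lim: "(%k. n k * (norm (z k))\<^sup>2) \<longlonglongrightarrow> 0" and z: "z \<longlonglongrightarrow> 0"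
 shows "(%k. of_real (n k) * (exp (z k) - 1 - z k)) \<longlonglongrightarrow> 0"
proof (rule Lim_null_comparison)
 have "(%k. exp (norm (z k)) * (n k * (norm (z k))\<^sup>2)) \<longlonglongrightarrow> exp (norm (0::complex)) * 0"
  by (intro tendsto_intros z lim)
 thus "(%k. exp (norm (z k)) * (n k * (norm (z k))\<^sup>2)) \<longlonglongrightarrow> 0" by simp
 have "norm (exp w - 1 - w) <= exp (norm w) * (norm w)\<^sup>2" for w :: complex
  using Taylor_exp_field[of w 1] by (simp add: diff_diff_eq power2_eq_square numeral_2_eq_2)
 thus "\<forall>\<^sub>F k in sequentially. norm (of_real (n k) * (exp (z k) - 1 - z k)) <= exp (norm (z k)) * (n k * (norm (z k))\<^sup>2)"
  using n by (intro always_eventually allI)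
   (simp add: norm_mult mult.left_commute mult_left_mono)
qed

context one_stable
begin

lemma \<psi>_uminus: "\<psi> (- v) = cnj (\<psi> v)" by (rule levy_exponent_uminus[OF \<psi>])

text \<open>The logarithmic correction is linear in the frequency, so second differences do not see it.\<close>

lemma \<psi>_scale:
 assumes "0 < n"
 shows "of_real n * \<psi> (v / n) = \<psi> v + \<i> * of_real (dl * v * ln n)"
proof -
 have pos: "of_real n * \<psi> (v / n) = \<psi> v + \<i> * of_real (dl * v * ln n)" if "0 < v" for v
  using that assms Re_\<psi>[of "v / n"] Im_\<psi>[of "v / n"] Re_\<psi>[of v] Im_\<psi>[of v]
  by (simp add: complex_eq_iff ln_div field_simps)
 consider "v = 0" | "0 < v" | "0 < - v" by linarith
 thus ?thesis
 proof cases
  case 3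
  have "of_real n * \<psi> (v / n) = cnj (of_real n * \<psi> (- v / n))" using \<psi>_uminus[of "- v / n"] by simp
  also have "... = \<psi> v + \<i> * of_real (dl * v * ln n)"
   unfolding pos[OF 3] using \<psi>_uminus[of "- v"] by simp
  finally show ?thesis .
 qed (simp_all add: \<psi>_0 pos)
qed

definition slaw :: "real => real => real measure" where
 "slaw s n = distr N borel (%w. \<xi> s w / n)"

lemma real_distribution_slaw: "0 <= s ==> real_distribution (slaw s n)"
 unfolding slaw_def using \<xi>_measurable by (intro N.real_distribution_distr) auto

lemma char_slaw: "0 <= s ==> char (slaw s n) t = char (law s) (t / n)"
 unfolding slaw_def law_def char_def using \<xi>_measurable[of s] by (simp add: integral_distr)

text \<open>In general n (char - 1) has no limit: rescaling leaves a drift proportional to v ln n.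
  With z the exponent, n z is s \<psi>(v) plus this drift, and the remainder n (e^z - 1 - z)
  vanishes because (ln n)^2 / n does.\<close>

lemma char_slaw_lim:
 assumes s: "0 <= s" and n: "!!k. 1 <= n k" "filterlim n at_top sequentially"
 shows "(%k. of_real (n k) * (char (slaw s (n k)) v - 1) - \<i> * of_real (s * (dl * v * ln (n k)))) \<longlonglongrightarrow> of_real s * \<psi> v"
proof -
 define z where "z k = of_real s * \<psi> (v / n k)" for k
 have np: "0 < n k" for k using n(1)[of k] by simp
 have nz: "of_real (n k) * z k = of_real s * \<psi> v + \<i> * of_real (s * (dl * v * ln (n k)))" for k
  using \<psi>_scale[OF np[of k], of v] by (simp add: z_def algebra_simps)
 have "norm (z k) <= (s * norm (\<psi> v) + s * (\<bar>dl\<bar> * \<bar>v\<bar> * ln (n k))) / n k" for k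
 proof -
  have "n k * norm (z k) = norm (of_real (n k) * z k)" using np[of k] by (simp add: norm_mult)
  also have "... <= norm (of_real s * \<psi> v) + norm (\<i> * of_real (s * (dl * v * ln (n k))))"
   unfolding nz by (rule norm_triangle_ineq)
  also have "... = s * norm (\<psi> v) + s * (\<bar>dl\<bar> * \<bar>v\<bar> * ln (n k))"
   using s n(1)[of k] by (simp add: norm_mult abs_mult)
  finally show ?thesis using np[of k] by (simp add: field_simps)
 qed
 note zb = this
 let ?A = "s * norm (\<psi> v)" and ?B = "s * (\<bar>dl\<bar> * \<bar>v\<bar>)"
 have l1: "((%x. (?A + ?B * ln x) / x) \<longlongrightarrow> 0) at_top" by real_asymp
 have l2: "((%x. (?A + ?B * ln x)\<^sup>2 / x) \<longlongrightarrow> 0) at_top"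
 proof (rule Lim_transform_eventually)
  have "((%x::real. 1 / sqrt x) \<longlongrightarrow> 0) at_top" "((%x::real. ln x / sqrt x) \<longlongrightarrow> 0) at_top" by real_asymp+
  hence "((%x. (?A * (1 / sqrt x) + ?B * (ln x / sqrt x))\<^sup>2) \<longlongrightarrow> (?A * 0 + ?B * 0)\<^sup>2) at_top"
   by (intro tendsto_intros)
  thus "((%x. (?A * (1 / sqrt x) + ?B * (ln x / sqrt x))\<^sup>2) \<longlongrightarrow> 0) at_top" by simp
  show "\<forall>\<^sub>F x in at_top. (?A * (1 / sqrt x) + ?B * (ln x / sqrt x))\<^sup>2 = (?A + ?B * ln x)\<^sup>2 / x"
   using eventually_gt_at_top[of 0]
  proof eventually_elim
   case (elim x)
   have "?A * (1 / sqrt x) + ?B * (ln x / sqrt x) = (?A + ?B * ln x) / sqrt x" by (simp add: add_divide_distrib)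
   thus ?case using elim by (simp add: power_divide)
  qed
 qed
 have zlim: "z \<longlonglongrightarrow> 0"
 proof (rule Lim_null_comparison[OF always_eventually])
  show "\<forall>k. norm (z k) <= (?A + ?B * ln (n k)) / n k" using zb by (simp add: mult.assoc)
  show "(%k. (?A + ?B * ln (n k)) / n k) \<longlonglongrightarrow> 0" by (rule filterlim_compose[OF l1 n(2)])
 qed
 have z2: "(%k. n k * (norm (z k))\<^sup>2) \<longlonglongrightarrow> 0"
 proof (rule Lim_null_comparison[OF always_eventually])
  show "\<forall>k. norm (n k * (norm (z k))\<^sup>2) <= (?A + ?B * ln (n k))\<^sup>2 / n k"
  proof
   fix k
   have "(norm (z k))\<^sup>2 <= ((?A + ?B * ln (n k)) / n k)\<^sup>2"
    using zb[of k] by (intro power_mono) (auto simp: mult.assoc)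
   hence "n k * (norm (z k))\<^sup>2 <= n k * ((?A + ?B * ln (n k)) / n k)\<^sup>2"
    using np[of k] by (intro mult_left_mono) auto
   also have "... = (?A + ?B * ln (n k))\<^sup>2 / n k" using np[of k] by (simp add: power2_eq_square)
   finally show "norm (n k * (norm (z k))\<^sup>2) <= (?A + ?B * ln (n k))\<^sup>2 / n k" using np[of k] by simp
  qed
  show "(%k. (?A + ?B * ln (n k))\<^sup>2 / n k) \<longlonglongrightarrow> 0" by (rule filterlim_compose[OF l2 n(2)])
 qed
 have "(%k. of_real (n k) * (exp (z k) - 1 - z k) + of_real s * \<psi> v) \<longlonglongrightarrow> 0 + of_real s * \<psi> v"
  using np by (intro tendsto_add exp_remainder_lim z2 zlim tendsto_const) (auto intro: less_imp_le)
 moreover have "of_real (n k) * (exp (z k) - 1 - z k) + of_real s * \<psi> v =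
   of_real (n k) * (char (slaw s (n k)) v - 1) - \<i> * of_real (s * (dl * v * ln (n k)))" for k
  using nz[of k] unfolding char_slaw[OF s] char_law[OF s] z_def[symmetric] by (simp add: right_diff_distrib)
 ultimately show ?thesis by simp
qed

lemma second_difference_lim:
 assumes s: "0 <= s" and n: "!!k. 1 <= n k" "filterlim n at_top sequentially"
 shows "(%k. of_real (n k) * (CLINT x|slaw s (n k). iexp (t * x) * complex_of_real (1 - cos (u * x)))) \<longlonglongrightarrow>
  of_real s * (\<psi> t - (\<psi> (t + u) + \<psi> (t - u)) / 2)"
proof -
 let ?f = "%v k. of_real (n k) * (char (slaw s (n k)) v - 1) - \<i> * of_real (s * (dl * v * ln (n k)))"
 have "(%k. ?f t k - (?f (t + u) k + ?f (t - u) k) / 2) \<longlonglongrightarrow>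
   of_real s * \<psi> t - (of_real s * \<psi> (t + u) + of_real s * \<psi> (t - u)) / 2"
  by (intro tendsto_intros char_slaw_lim[OF assms]) auto
 moreover have "?f t k - (?f (t + u) k + ?f (t - u) k) / 2 =
   of_real (n k) * (CLINT x|slaw s (n k). iexp (t * x) * complex_of_real (1 - cos (u * x)))" for k
  unfolding char_second_difference[OF real_distribution_slaw[OF s]] by (simp add: field_simps)
 ultimately show ?thesis by (simp add: algebra_simps add_divide_distrib)
qed

end

lemma wt_nonneg: "0 <= wt x"
proof (cases "x = 0")
 case False
 have "sin x / x <= \<bar>sin x / x\<bar>" by (rule abs_ge_self)
 also have "... <= 1" using False abs_sin_x_le_abs_x[of x] by (simp add: abs_divide)
 finally show ?thesis using False by (simp add: wt_def)
qed (simp add: wt_def)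

lemma wt_measurable [measurable]: "wt \<in> Bm borel" unfolding wt_def by measurable

lemma wt_Tonelli:
 fixes f :: "real => real"
 assumes \<mu>: "sigma_finite_measure \<mu>" and sets[measurable_cong]: "sets \<mu> = sets borel"
  and f[measurable]: "f \<in> Bm borel" and f0: "!!x. 0 <= f x"
  and int: "!!u. 0 <= u ==> u <= 1 ==> integrable \<mu> (%x. (1 - cos (u * x)) * f x)"
 shows "(LBINT u:{0..1}. (LINT x|\<mu>. (1 - cos (u * x)) * f x)) = (LINT x|\<mu>. f x * wt x)"
proof -
 interpret \<mu>: sigma_finite_measure \<mu> by fact
 interpret pair_sigma_finite \<mu> lborel ..
 have nn: "0 <= (1 - cos y) * f x" for x y using f0 by simp
 have "(\<integral>\<^sup>+u. ennreal (indicator {0..1} u * (LINT x|\<mu>. (1 - cos (u * x)) * f x)) \<partial>lborel) =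
   (\<integral>\<^sup>+u. (\<integral>\<^sup>+x. ennreal (1 - cos (u * x)) * indicator {0..1} u * ennreal (f x) \<partial>\<mu>) \<partial>lborel)"
 proof (rule nn_integral_cong)
  fix u :: real
  show "ennreal (indicator {0..1} u * (LINT x|\<mu>. (1 - cos (u * x)) * f x)) =
    (\<integral>\<^sup>+x. ennreal (1 - cos (u * x)) * indicator {0..1} u * ennreal (f x) \<partial>\<mu>)"
  proof (cases "u \<in> {0..1}")
   case True
   hence "ennreal (LINT x|\<mu>. (1 - cos (u * x)) * f x) = (\<integral>\<^sup>+x. ennreal ((1 - cos (u * x)) * f x) \<partial>\<mu>)"
    by (intro nn_integral_eq_integral[symmetric] int) (auto simp: nn)
   thus ?thesis using True f0 by (simp add: ennreal_mult)
  qed simp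
 qed
 also have "... = (\<integral>\<^sup>+x. (\<integral>\<^sup>+u. ennreal (1 - cos (u * x)) * indicator {0..1} u * ennreal (f x) \<partial>lborel) \<partial>\<mu>)"
  by (rule Fubini') measurable
 also have "... = (\<integral>\<^sup>+x. ennreal (f x * wt x) \<partial>\<mu>)" using f0
  by (intro nn_integral_cong, subst nn_integral_multc)
    (simp_all add: nn_integral_wt ennreal_mult wt_nonneg mult.commute[of "ennreal (wt _)"])
 finally have eq: "(\<integral>\<^sup>+u. ennreal (indicator {0..1} u * (LINT x|\<mu>. (1 - cos (u * x)) * f x)) \<partial>lborel) =
   (\<integral>\<^sup>+x. ennreal (f x * wt x) \<partial>\<mu>)" .
 have "(LBINT u:{0..1}. (LINT x|\<mu>. (1 - cos (u * x)) * f x)) =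
   enn2real (\<integral>\<^sup>+u. ennreal (indicator {0..1} u * (LINT x|\<mu>. (1 - cos (u * x)) * f x)) \<partial>lborel)"
  unfolding set_lebesgue_integral_def real_scaleR_def
  by (rule integral_eq_nn_integral) (auto intro!: mult_nonneg_nonneg Bochner_Integration.integral_nonneg nn simp del: mult_nonneg_nonneg)
 also have "... = (LINT x|\<mu>. f x * wt x)"
  unfolding eq by (rule integral_eq_nn_integral[symmetric]) (auto simp: f0 wt_nonneg)
 finally show ?thesis .
qed

text \<open>The Levy--Khintchine form of \<psi> identifies the limit of the second differences as an
  integral against the Levy measure.\<close>

locale one_stable_levy = one_stable \<beta> p N \<xi> \<psi> c dl a for \<beta> p and N :: "'b measure" and \<xi> \<psi> c dl a +
 fixes \<nu> :: "real measure" and b \<sigma>2 :: real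
 assumes sets_\<nu> [measurable_cong]: "sets \<nu> = sets borel"
  and sigma_finite_\<nu>: "sigma_finite_measure \<nu>"
  and \<nu>_fin: "(\<integral>\<^sup>+x. ennreal (min 1 (x\<^sup>2)) \<partial>\<nu>) < \<infinity>"
  and \<sigma>2: "0 <= \<sigma>2"
  and LK: "!!th. \<psi> th = \<i> * complex_of_real (b * th) - complex_of_real (\<sigma>2 * th\<^sup>2 / 2)
     + (CLINT x|\<nu>. iexp (th * x) - 1 - (if \<bar>x\<bar> <= 1 then \<i> * complex_of_real (th * x) else 0))"
begin

definition kk :: "real => real => complex" where
 "kk th x = iexp (th * x) - 1 - (if \<bar>x\<bar> <= 1 then \<i> * complex_of_real (th * x) else 0)"

lemma min_integrable: "integrable \<nu> (%x. min 1 (x\<^sup>2))" using \<nu>_fin by (intro integrableI_nonneg) auto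

lemma kk_bound: "norm (kk th x) <= (2 + th\<^sup>2) * min 1 (x\<^sup>2)"
proof (cases "\<bar>x\<bar> <= 1")
 case True
 have m: "min 1 (x\<^sup>2) = x\<^sup>2" using True abs_square_le_1[of x] by simp
 have "norm (iexp (th * x) - 1 - \<i> * complex_of_real (th * x)) <= (th * x)\<^sup>2 / 2"
  using iexp_approx1[of "th * x" 1] by (simp add: diff_diff_eq power2_eq_square numeral_2_eq_2)
 also have "... <= (2 + th\<^sup>2) * x\<^sup>2" by (simp add: power_mult_distrib distrib_right)
 finally show ?thesis using True unfolding m by (simp add: kk_def)
next
 case False
 hence "1 <= x\<^sup>2" using abs_square_le_1[of x] by auto
 hence m: "min 1 (x\<^sup>2) = 1" by simp
 have "norm (iexp (th * x) - 1) <= norm (iexp (th * x)) + norm (1::complex)" by (rule norm_triangle_ineq4)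
 also have "... = 2" by simp
 also have "... <= 2 + th\<^sup>2" by simp
 finally show ?thesis using False unfolding m by (simp add: kk_def)
qed

lemma kk_integrable: "integrable \<nu> (kk th)"
proof (rule Bochner_Integration.integrable_bound)
 show "integrable \<nu> (%x. (2 + th\<^sup>2) * min 1 (x\<^sup>2))" using min_integrable by simp
 show "AE x in \<nu>. norm (kk th x) <= norm ((2 + th\<^sup>2) * min 1 (x\<^sup>2))"
  by (intro AE_I2 order_trans[OF kk_bound]) simp
qed (unfold kk_def, measurable)

lemma cos_integrable: "integrable \<nu> (%x. 1 - cos (u * x))"
proof -
 have "1 - cos (u * x) = - Re (kk u x)" for x by (simp add: kk_def Re_exp)
 thus ?thesis using kk_integrable[of u] by simp
qed

lemma \<psi>_second_difference:
 "\<psi> t - (\<psi> (t + u) + \<psi> (t - u)) / 2 =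
  of_real (\<sigma>2 * u\<^sup>2 / 2) + (CLINT x|\<nu>. iexp (t * x) * complex_of_real (1 - cos (u * x)))"
proof -
 have LK': "\<psi> th = \<i> * complex_of_real (b * th) - complex_of_real (\<sigma>2 * th\<^sup>2 / 2) + (CLINT x|\<nu>. kk th x)" for th
  unfolding kk_def by (rule LK)
 have "(CLINT x|\<nu>. iexp (t * x) * complex_of_real (1 - cos (u * x))) =
   (CLINT x|\<nu>. kk t x - (kk (t + u) x + kk (t - u) x) / 2)"
 proof (rule Bochner_Integration.integral_cong[OF refl])
  fix x
  show "iexp (t * x) * complex_of_real (1 - cos (u * x)) = kk t x - (kk (t + u) x + kk (t - u) x) / 2"
   unfolding iexp_second_difference kk_def by (simp add: field_simps)
 qed
 also have "... = (CLINT x|\<nu>. kk t x) - ((CLINT x|\<nu>. kk (t + u) x) + (CLINT x|\<nu>. kk (t - u) x)) / 2"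
  using kk_integrable by simp
 finally have e: "(CLINT x|\<nu>. iexp (t * x) * complex_of_real (1 - cos (u * x))) =
   (CLINT x|\<nu>. kk t x) - ((CLINT x|\<nu>. kk (t + u) x) + (CLINT x|\<nu>. kk (t - u) x)) / 2" .
 show ?thesis unfolding e LK' by (simp add: field_simps power2_eq_square)
qed

text \<open>The second difference of \<psi> at 0 with step u equals c u and is linear, while a
  Gaussian part contributes a multiple of the square of u and the jumps a nonnegative amount. Large
  u exclude the Gaussian part.\<close>

lemma \<sigma>2_eq_0: "\<sigma>2 = 0"
proof (rule ccontr)
 assume "\<sigma>2 ~= 0"
 hence s: "0 < \<sigma>2" using \<sigma>2 by simp
 define u where "u = 2 * c / \<sigma>2 + 1"
 have u: "0 < u" using c s by (simp add: u_def add_pos_pos)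
 have "complex_of_real (c * u) = of_real (\<sigma>2 * u\<^sup>2 / 2) + (CLINT x|\<nu>. complex_of_real (1 - cos (u * x)))"
  using \<psi>_second_difference[of 0 u] \<psi>_uminus[of u] Re_\<psi>[OF u] by (simp add: \<psi>_0 complex_eq_iff)
 also have "(CLINT x|\<nu>. complex_of_real (1 - cos (u * x))) = of_real (LINT x|\<nu>. 1 - cos (u * x))"
  by (rule integral_complex_of_real)
 finally have "complex_of_real (c * u) = complex_of_real (\<sigma>2 * u\<^sup>2 / 2 + (LINT x|\<nu>. 1 - cos (u * x)))" by simp
 hence "c * u = \<sigma>2 * u\<^sup>2 / 2 + (LINT x|\<nu>. 1 - cos (u * x))" by (simp only: of_real_eq_iff)
 moreover have "0 <= (LINT x|\<nu>. 1 - cos (u * x))" by (rule Bochner_Integration.integral_nonneg) simp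
 ultimately have "\<sigma>2 * u\<^sup>2 / 2 <= c * u" by linarith
 hence "\<sigma>2 * u <= 2 * c" using u by (simp add: power2_eq_square)
 thus False using s mult_pos_pos[OF s s] by (simp add: u_def field_simps)
qed

lemma \<psi>_\<nu>:
 "\<psi> t - (\<psi> (t + u) + \<psi> (t - u)) / 2 = (CLINT x|\<nu>. iexp (t * x) * complex_of_real (1 - cos (u * x)))"
 using \<psi>_second_difference[of t u] by (simp add: \<sigma>2_eq_0)

lemma \<nu>_cos:
 assumes u: "0 < u"
 shows "(LINT x|\<nu>. 1 - cos (u * x)) = c * u"
proof -
 have "complex_of_real (c * u) = (CLINT x|\<nu>. complex_of_real (1 - cos (u * x)))"
  using \<psi>_\<nu>[of 0 u] \<psi>_uminus[of u] Re_\<psi>[OF u] by (simp add: \<psi>_0 complex_eq_iff)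
 also have "... = of_real (LINT x|\<nu>. 1 - cos (u * x))" by (rule integral_complex_of_real)
 finally show ?thesis by (simp only: of_real_eq_iff)
qed

lemma slaw_cos:
 assumes s: "0 <= s"
 shows "(LINT x|slaw s n. 1 - cos (u * x)) = 1 - Re (char (law s) (u / n))"
 using Re_char[OF real_distribution_slaw[OF s], where v=u] by (simp add: char_slaw[OF s])

lemma slaw_cos_pos:
 assumes s: "0 < s" and n: "0 < n" and u: "0 < u"
 shows "0 < (LINT x|slaw s n. 1 - cos (u * x))"
proof -
 have "Re (char (law s) (u / n)) <= norm (char (law s) (u / n))" by (rule complex_Re_le_cmod)
 also have "... = exp (- (s * (c * (u / n))))" using s n u by (simp add: char_law norm_exp_eq_Re Re_\<psi>)
 also have "... < 1" using s n u c by simp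
 finally show ?thesis using s by (simp add: slaw_cos)
qed

text \<open>Both sides are normalized by their total weight, the second difference at t = 0. Since n
  times the normalizing constant converges to s c u, the normalization can be undone in the
  limit.\<close>

lemma weighted_weak_limit:
 assumes s: "0 < s" and n: "!!k. 1 <= n k" "filterlim n at_top sequentially" and u: "0 < u"
  and f: "!!x. isCont f x" "!!x. \<bar>f x\<bar> <= (B::real)"
 shows "(%k. n k * (LINT x|slaw s (n k). (1 - cos (u * x)) * f x)) \<longlonglongrightarrow> s * (LINT x|\<nu>. (1 - cos (u * x)) * f x)"
proof -
 have fm: "f \<in> Bm borel"
  by (rule borel_measurable_continuous_onI) (simp add: continuous_at_imp_continuous_on f(1))
 have s0: "0 <= s" using s by simp
 have np: "0 < n k" for k using n(1)[of k] by simp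
 let ?w = "%x. 1 - cos (u * x)"
 define Z where "Z k = (LINT x|slaw s (n k). ?w x)" for k
 define D where "D k = density (slaw s (n k)) (%x. ennreal (?w x / Z k))" for k
 define D' where "D' = density \<nu> (%x. ennreal (?w x / (c * u)))"
 have Zp: "0 < Z k" for k unfolding Z_def by (rule slaw_cos_pos[OF s np u])
 have wi: "integrable (slaw s (n k)) ?w" for k
 proof -
  interpret S: real_distribution "slaw s (n k)" by (rule real_distribution_slaw[OF s0])
  show ?thesis by (rule S.integrable_const_bound[where B=2])
   (auto simp: abs_le_iff intro: order_trans[OF cos_le_one] order_trans[OF _ cos_ge_minus_one])
 qed
 have Sb: "sets (slaw s (n k)) = sets borel" for k by (simp add: slaw_def)
 note wd = weighted_distribution[OF Sb wi _ Z_def Zp]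
 have cu: "0 < c * u" using c u by simp
 note wd' = weighted_distribution[OF sets_\<nu> cos_integrable[of u] _ \<nu>_cos[OF u, symmetric] cu]
 let ?C = "%t k. CLINT x|slaw s (n k). iexp (t * x) * complex_of_real (?w x)"
 have C: "(%k. of_real (n k) * ?C t k) \<longlonglongrightarrow> of_real s * (CLINT x|\<nu>. iexp (t * x) * complex_of_real (?w x))" for t
  unfolding \<psi>_\<nu>[symmetric] by (rule second_difference_lim[OF s0 n])
 have C0: "?C 0 k = of_real (Z k)" for k unfolding Z_def by (simp flip: integral_complex_of_real)
 have nZ: "(%k. n k * Z k) \<longlonglongrightarrow> s * (c * u)"
 proof -
  have "(%k. complex_of_real (n k * Z k)) \<longlonglongrightarrow> complex_of_real (s * (c * u))"
   using C[of 0] unfolding C0 \<nu>_cos[OF u, symmetric] by (simp flip: integral_complex_of_real)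
  thus ?thesis by (simp only: tendsto_of_real_iff)
 qed
 have "weak_conv_m D D'"
 proof (rule levy_continuity)
  show "real_distribution (D k)" for k unfolding D_def by (rule wd(1)) simp
  show "real_distribution D'" unfolding D'_def by (rule wd'(1)) simp
  fix t
  have "(%k. (of_real (n k) * ?C t k) / complex_of_real (n k * Z k)) \<longlonglongrightarrow>
    (of_real s * (CLINT x|\<nu>. iexp (t * x) * complex_of_real (?w x))) / complex_of_real (s * (c * u))"
   by (intro tendsto_divide C tendsto_of_real nZ) (use s c u in simp)
  moreover have "(of_real (n k) * ?C t k) / complex_of_real (n k * Z k) = char (D k) t" for k
   unfolding D_def by (subst wd(2)) (use np[of k] in simp_all)
  moreover have "(of_real s * (CLINT x|\<nu>. iexp (t * x) * complex_of_real (?w x))) / complex_of_real (s * (c * u)) = char D' t"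
   unfolding D'_def by (subst wd'(2)) (use s in simp_all)
  ultimately show "(%k. char (D k) t) \<longlonglongrightarrow> char D' t" by simp
 qed
 hence "(%k. integral\<^sup>L (D k) f) \<longlonglongrightarrow> integral\<^sup>L D' f"
 proof -
  assume wc: "weak_conv_m D D'"
  have rD: "real_distribution (D k)" for k unfolding D_def by (rule wd(1)) simp
  have rD': "real_distribution D'" unfolding D'_def by (rule wd'(1)) simp
  show ?thesis by (rule weak_conv_imp_integral_bdd_continuous_conv[OF rD rD' wc f(1)]) (use f(2) in simp)
 qed
 hence "(%k. (n k * Z k) * integral\<^sup>L (D k) f) \<longlonglongrightarrow> (s * (c * u)) * integral\<^sup>L D' f"
  by (intro tendsto_mult nZ)
 moreover have "(n k * Z k) * integral\<^sup>L (D k) f = n k * (LINT x|slaw s (n k). ?w x * f x)" for k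
  unfolding D_def by (subst wd(3)[OF _ fm]) (use Zp[of k] in simp_all)
 moreover have "(s * (c * u)) * integral\<^sup>L D' f = s * (LINT x|\<nu>. ?w x * f x)"
  unfolding D'_def by (subst wd'(3)[OF _ fm]) (use c u in simp_all)
 ultimately show ?thesis by simp
qed

text \<open>Integrates \<open>weighted_weak_limit\<close> over u in [0, 1]. The majorant comes from
  \<open>Re_char_bound\<close>: n (1 - Re char) at u / n stays bounded uniformly in n and u.\<close>

lemma wt_limit:
 assumes s: "0 < s" and n: "!!k. 1 <= n k" "filterlim n at_top sequentially"
  and f: "!!x. isCont f x" "!!x. 0 <= f x" "!!x. f x <= (B::real)"
 shows "(%k. n k * (LINT x|slaw s (n k). f x * wt x)) \<longlonglongrightarrow> s * (LINT x|\<nu>. f x * wt x)"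
proof -
 let ?w = "%u x. 1 - cos (u * x)" and ?f = "%u x. (1 - cos (u * x)) * f x"
 have fm[measurable]: "f \<in> Bm borel"
  by (rule borel_measurable_continuous_onI) (simp add: continuous_at_imp_continuous_on f(1))
 have s0: "0 <= s" using s by simp
 have np: "0 < n k" for k using n(1)[of k] by simp
 have B0: "0 <= B" using f(2,3)[of 0] by linarith
 interpret S: real_distribution "slaw s (n k)" for k by (rule real_distribution_slaw[OF s0])
 interpret \<nu>: sigma_finite_measure \<nu> by (rule sigma_finite_\<nu>)
 have wi: "integrable (slaw s (n k)) (?w u)" for k u by (rule S.integrable_const_bound[where B=2])
   (auto simp: abs_le_iff intro: order_trans[OF cos_le_one] order_trans[OF _ cos_ge_minus_one])
 have fi: "integrable M (?f u)"
  if i: "integrable M (?w u)" and M: "sets M = sets borel" for M u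
 proof (rule Bochner_Integration.integrable_bound)
  show "integrable M (%x. (?w u x) * B)" using i by simp
  show "(?f u) \<in> Bm M" using fm by (simp add: measurable_cong_sets[OF M refl])
  show "AE x in M. norm (?f u x) <= norm ((?w u x) * B)"
   using f B0 by (intro AE_I2) (simp add: abs_mult mult_left_mono)
 qed
 let ?F = "%k u. n k * (LINT x|slaw s (n k). ?f u x)"
 let ?G = "%u. s * (LINT x|\<nu>. ?f u x)"
 obtain K where K: "0 <= K" "!!s u v. 0 <= s ==> 0 <= v ==> v <= u ==> u <= 1 ==>
  1 - Re (char (law s) v) <= K * (s * u + s\<^sup>2 * (u * sqrt u))"
  using Re_char_bound[of 1] by (metis zero_less_one)
 have Fb: "0 <= ?F k u \<and> ?F k u <= B * (K * (s + s\<^sup>2))" if u: "0 <= u" "u <= 1" for k u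
 proof
  show "0 <= ?F k u" using np[of k] f(2) by (intro mult_nonneg_nonneg Bochner_Integration.integral_nonneg) auto
  have "(LINT x|slaw s (n k). ?f u x) <= (LINT x|slaw s (n k). (?w u x) * B)"
   by (intro integral_mono fi wi integrable_mult_left mult_left_mono f) (auto simp: slaw_def)
  also have "... = B * (1 - Re (char (law s) (u / n k)))"
   using slaw_cos[OF s0, of "n k" u] by (simp add: mult.commute)
  also have "... <= B * (K * (s * (1 / n k) + s\<^sup>2 * (1 / n k * sqrt (1 / n k))))"
   using u np[of k] n(1)[of k] by (intro mult_left_mono B0 K(2) s0) (auto simp: divide_right_mono)
  also have "... <= B * (K * (s * (1 / n k) + s\<^sup>2 * (1 / n k * 1)))"
   using n(1)[of k] np[of k] B0 K(1) s0 by (intro mult_left_mono add_left_mono) auto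
  also have "... = B * (K * (s + s\<^sup>2)) / n k" by (simp add: algebra_simps add_divide_distrib)
  finally show "?F k u <= B * (K * (s + s\<^sup>2))" using np[of k] by (simp add: field_simps)
 qed
 have lim: "(%k. ?F k u) \<longlonglongrightarrow> ?G u" if "0 <= u" for u
 proof (cases "u = 0")
  case False
  thus ?thesis using f(2,3) that by (intro weighted_weak_limit[OF s n _ f(1), where B=B]) auto
 qed simp
 have Gm: "(%u. LINT x|\<nu>. ?f u x) \<in> Bm borel" by measurable
 have Fm: "(%u. LINT x|slaw s (n k). ?f u x) \<in> Bm borel" for k
 proof -
  have [measurable_cong]: "sets (slaw s (n k)) = sets borel" by (simp add: slaw_def)
  show ?thesis by measurable
 qed
 have "(%k. LBINT u. indicator {0..1} u * ?F k u) \<longlonglongrightarrow> (LBINT u. indicator {0..1} u * ?G u)"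
 proof (rule integral_dominated_convergence[where w="%u. indicator {0..1} u * (B * (K * (s + s\<^sup>2)))"])
  show "integrable lborel (%u::real. indicator {0..1} u * (B * (K * (s + s\<^sup>2))) :: real)"
   by (intro integrable_mult_left integrable_real_indicator) auto
  show "AE u in lborel. (%k. indicator {0..1} u * ?F k u) \<longlonglongrightarrow> indicator {0..1} u * ?G u"
   by (intro AE_I2) (auto simp: indicator_def intro!: lim)
  show "AE u in lborel. norm (indicator {0..1} u * ?F k u) <= indicator {0..1} u * (B * (K * (s + s\<^sup>2)))" for k
   using Fb by (intro AE_I2) (auto simp: indicator_def)
 qed (use Gm Fm in simp_all)
 moreover have "(LBINT u. indicator {0..1} u * ?F k u) = n k * (LINT x|slaw s (n k). f x * wt x)" for k
 proof -
  have "(LBINT u. indicator {0..1} u * ?F k u) = n k * (LBINT u:{0..1}. (LINT x|slaw s (n k). ?f u x))"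
   unfolding set_lebesgue_integral_def by (simp add: mult.left_commute)
  also have "(LBINT u:{0..1}. (LINT x|slaw s (n k). ?f u x)) = (LINT x|slaw s (n k). f x * wt x)"
   by (intro wt_Tonelli S.sigma_finite_measure_axioms fm f(2) fi wi) (auto simp: slaw_def)
  finally show ?thesis .
 qed
 moreover have "(LBINT u. indicator {0..1} u * ?G u) = s * (LINT x|\<nu>. f x * wt x)"
 proof -
  have "(LBINT u. indicator {0..1} u * ?G u) = s * (LBINT u:{0..1}. (LINT x|\<nu>. ?f u x))"
   unfolding set_lebesgue_integral_def by (simp add: mult.left_commute)
  also have "(LBINT u:{0..1}. (LINT x|\<nu>. ?f u x)) = (LINT x|\<nu>. f x * wt x)"
   by (intro wt_Tonelli sigma_finite_\<nu> sets_\<nu> fm f(2) fi cos_integrable)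
  finally show ?thesis .
 qed
 ultimately show ?thesis by simp
qed

lemma vague_limit:
 assumes s: "0 < s" and n: "!!k. 1 <= n k" "filterlim n at_top sequentially" and g: "g \<in> Cc_plus"
 shows "(%k. n k * (LINT w|N. g (ereal (\<xi> s w / n k)))) \<longlonglongrightarrow> s * (LINT x|\<nu>. g (ereal x))"
proof -
 obtain B where B: "!!x. g (ereal x) / wt x <= B" "!!x. 0 <= g (ereal x) / wt x"
  "!!x. isCont (%x. g (ereal x) / wt x) x" "!!x. g (ereal x) / wt x * wt x = g (ereal x)"
  using Cc_plus_divide_wt[OF g] by metis
 have "(%k. n k * (LINT x|slaw s (n k). g (ereal x) / wt x * wt x)) \<longlonglongrightarrow> s * (LINT x|\<nu>. g (ereal x) / wt x * wt x)"
  by (rule wt_limit[OF s n B(3,2,1)])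
 moreover have "(LINT x|slaw s (n k). g (ereal x)) = (LINT w|N. g (ereal (\<xi> s w / n k)))" for k
  unfolding slaw_def using \<xi>_measurable[of s] s Cc_plus_measurable(2)[OF g] by (intro integral_distr) auto
 ultimately show ?thesis unfolding B(4) by simp
qed

end

context one_stable_levy
begin

lemma \<nu>_far_finite:
 assumes d: "0 < d"
 shows "emeasure \<nu> {x. d <= \<bar>x\<bar>} < \<infinity>"
proof -
 let ?m = "min 1 (d\<^sup>2)"
 have m: "0 < ?m" using d by simp
 have S: "{x. d <= \<bar>x\<bar>} \<in> sets \<nu>" by measurable
 have le: "ennreal ?m * indicator {x. d <= \<bar>x\<bar>} x <= ennreal (min 1 (x\<^sup>2))" for x
 proof (cases "d <= \<bar>x\<bar>")
  case True
  hence "d\<^sup>2 <= x\<^sup>2" using abs_le_square_iff[of d x] d by simp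
  hence "?m <= min 1 (x\<^sup>2)" by simp
  thus ?thesis using True by (simp add: ennreal_leI)
 qed simp
 have "ennreal ?m * emeasure \<nu> {x. d <= \<bar>x\<bar>} = (\<integral>\<^sup>+x. ennreal ?m * indicator {x. d <= \<bar>x\<bar>} x \<partial>\<nu>)"
  by (rule nn_integral_cmult_indicator[OF S, symmetric])
 also have "... <= (\<integral>\<^sup>+x. ennreal (min 1 (x\<^sup>2)) \<partial>\<nu>)" by (intro nn_integral_mono le)
 also have "... < \<infinity>" by (rule \<nu>_fin)
 finally show ?thesis using m by (auto simp: ennreal_mult_less_top)
qed

lemma to_R0bar_radon: "to_R0bar \<nu> \<in> radon_R0bar" unfolding radon_R0bar_def
proof (intro CollectI conjI allI impI)
 show "sets (to_R0bar \<nu>) = sets R0bar" by (rule sets_to_R0bar)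
 fix K :: "ereal set" assume K: "compact K \<and> K \<subseteq> - {0}"
 hence "open (- K)" "0 \<in> - K" by (auto simp: compact_imp_closed)
 then obtain dl where dl: "dl > 0" "{0 - dl<..<0 + dl} \<subseteq> - K" by (rule ereal_open_cont_interval) auto
 obtain d where d: "0 < d" "ereal d <= dl"
  using dl(1) by (metis ereal_dense2 less_imp_le zero_ereal_def ereal_less(2))
 have Kd: "indicator K (ereal x) * indicator (- {0}) (ereal x) <= (indicator {x. d <= \<bar>x\<bar>} x :: ennreal)" for x
 proof (cases "\<bar>x\<bar> < d")
  case True
  hence "ereal \<bar>x\<bar> < dl" using d(2) by (metis ereal_less_eq(3) less_ereal.simps(1) order_less_le_trans)
  hence "ereal x \<in> {0 - dl<..<0 + dl}" by (cases dl) auto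
  hence "ereal x \<notin> K" using dl(2) by auto
  thus ?thesis by simp
 qed (auto simp: indicator_def)
 have B: "K \<in> sets borel" "K \<in> sets R0bar" using K by (auto simp: sets_R0bar_iff compact_imp_closed)
 have "emeasure (to_R0bar \<nu>) K = (\<integral>\<^sup>+x. indicator K x \<partial>to_R0bar \<nu>)"
  by (rule nn_integral_indicator[symmetric]) (simp add: sets_to_R0bar B)
 also have "... = (\<integral>\<^sup>+x. indicator K (ereal x) * indicator (- {0}) x \<partial>\<nu>)"
  using B(1) by (intro nn_integral_to_R0bar sets_\<nu>) simp
 also have "... <= (\<integral>\<^sup>+x. indicator {x. d <= \<bar>x\<bar>} x \<partial>\<nu>)"
  using Kd by (intro nn_integral_mono) (auto simp: indicator_def)
 also have "... = emeasure \<nu> {x. d <= \<bar>x\<bar>}" by (rule nn_integral_indicator) measurable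
 also have "... < \<infinity>" by (rule \<nu>_far_finite[OF d(1)])
 finally show "emeasure (to_R0bar \<nu>) K < \<infinity>" .
qed

lemma integral_to_R0bar:
 assumes g: "g \<in> Cc_plus"
 shows "(LINT x:R0|to_R0bar \<nu>. g x) = (LINT x|\<nu>. g (ereal x))"
proof -
 note gm[measurable] = Cc_plus_measurable[OF g]
 have g0: "0 <= g x" "g 0 = 0" for x using Cc_plusD[OF g] by auto
 have [measurable]: "R0 \<in> sets borel" by (rule R0_borel)
 have "(LINT x:R0|to_R0bar \<nu>. g x) = enn2real (\<integral>\<^sup>+x. ennreal (indicator R0 x * g x) \<partial>to_R0bar \<nu>)"
  unfolding set_lebesgue_integral_def real_scaleR_def
 proof (rule integral_eq_nn_integral)
  have "(%x. indicator R0 x * g x) \<in> Bm R0bar" by (rule measurable_R0bar) measurable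
  thus "(%x. indicator R0 x * g x) \<in> Bm (to_R0bar \<nu>)" by (simp cong: measurable_cong_sets add: sets_to_R0bar)
 qed (simp add: g0)
 also have "(\<integral>\<^sup>+x. ennreal (indicator R0 x * g x) \<partial>to_R0bar \<nu>) =
   (\<integral>\<^sup>+x. ennreal (indicator R0 (ereal x) * g (ereal x)) * indicator (- {0}) x \<partial>\<nu>)"
  by (rule nn_integral_to_R0bar[OF _ sets_\<nu>]) measurable
 also have "... = (\<integral>\<^sup>+x. ennreal (g (ereal x)) \<partial>\<nu>)"
  by (rule nn_integral_cong) (auto simp: indicator_def R0_def g0 zero_ereal_def[symmetric])
 also have "enn2real ... = (LINT x|\<nu>. g (ereal x))" by (rule integral_eq_nn_integral[symmetric]) (auto simp: g0)
 finally show ?thesis .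
qed

lemma A1_exp:
 assumes lam: "0 < lam"
 shows "assumption_A1 N \<xi> lam (%t. exp (lam * t)) (to_R0bar \<nu>)" unfolding assumption_A1_def
proof (intro conjI allI impI ballI to_R0bar_radon)
 show "mono_on {0<..} (%t. exp (lam * t))" using lam by (auto intro!: mono_onI)
 show "filterlim (%t. exp (lam * t)) at_top at_top" using lam by real_asymp
 fix s :: real and g assume s: "0 < s" and g: "g \<in> Cc_plus"
 show "((%t. exp (lam * t) * (LINT w|N. g (ereal (\<xi> s w / exp (lam * t))))) \<longlongrightarrow> s * (LINT x:R0|to_R0bar \<nu>. g x)) at_top"
 proof (rule tendsto_at_topI_sequentially)
  fix S :: "nat => real" assume S: "filterlim S at_top sequentially"
  \<comment> \<open>\<open>vague_limit\<close> asks for scales of at least 1 from the first index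
    on; along an arbitrary sequence S this holds only eventually.\<close>
  let ?n = "%k. max 1 (exp (lam * S k))"
  have ev: "\<forall>\<^sub>F k in sequentially. ?n k = exp (lam * S k)"
  proof -
   have "\<forall>\<^sub>F k in sequentially. 0 <= S k" using S by (auto simp: filterlim_at_top)
   thus ?thesis by eventually_elim (use lam in \<open>simp add: max_def\<close>)
  qed
  have "filterlim (%k. exp (lam * S k)) at_top sequentially"
   by (rule filterlim_compose[OF _ S]) (use lam in real_asymp)
  hence lim: "filterlim ?n at_top sequentially" by (rule filterlim_at_top_mono) simp
  have "(%k. ?n k * (LINT w|N. g (ereal (\<xi> s w / ?n k)))) \<longlonglongrightarrow> s * (LINT x|\<nu>. g (ereal x))"
   by (rule vague_limit[OF s _ lim g]) simp
  thus "(%k. exp (lam * S k) * (LINT w|N. g (ereal (\<xi> s w / exp (lam * S k))))) \<longlonglongrightarrow> s * (LINT x:R0|to_R0bar \<nu>. g x)"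
   unfolding integral_to_R0bar[OF g] by (rule Lim_transform_eventually) (use ev in eventually_elim, simp)
 qed
qed simp

end

text \<open>The explicit formula gives the real and imaginary parts, the Levy--Khintchine formula
  the Levy measure. Both are exponents of the same process and coincide by
  \<open>levy_exponent_unique\<close>.\<close>

lemma one_stable_levy_of_nonsymmetric:
 assumes bl: "blevy \<beta> N \<xi>" and st: "nonsymmetric_1_stable c1 c2 a N \<xi>"
 obtains \<psi> b \<sigma>2 where
  "one_stable_levy \<beta> N \<xi> \<psi> (pi / 2 * (c1 + c2)) (c1 - c2) a (cauchy_levy_measure c1 c2) b \<sigma>2"
proof -
 let ?\<nu> = "cauchy_levy_measure c1 c2"
 obtain \<psi> where \<psi>: "levy_exponent_of N \<xi> \<psi>"
  and \<psi>_eq: "!!th. 0 < th ==> \<psi> th = - complex_of_real (pi / 2 * (c1 + c2) * th)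
      - \<i> * complex_of_real ((c1 - c2) * th * ln th)
      + \<i> * complex_of_real (a * (c1 - c2) * th)" using st unfolding nonsymmetric_1_stable_def by blast
 have lm: "levy_measure_of N \<xi> ?\<nu>" and pos: "0 < c1 + c2" using st unfolding nonsymmetric_1_stable_def by auto
 obtain b \<sigma>2 where \<sigma>2: "0 <= \<sigma>2" and LK: "levy_exponent_of N \<xi> (%th. \<i> * complex_of_real (b * th) - complex_of_real (\<sigma>2 * th\<^sup>2 / 2)
     + (CLINT x|?\<nu>. iexp (th * x) - 1 - (if \<bar>x\<bar> <= 1 then \<i> * complex_of_real (th * x) else 0)))"
  using lm unfolding levy_measure_of_def by blast
 have "one_stable_levy \<beta> N \<xi> \<psi> (pi / 2 * (c1 + c2)) (c1 - c2) a ?\<nu> b \<sigma>2"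
 proof (intro one_stable_levy.intro one_stable.intro one_stable_axioms.intro one_stable_levy_axioms.intro bl \<psi> \<sigma>2)
  show "0 < pi / 2 * (c1 + c2)" using pos by simp
  show "Re (\<psi> v) = - (pi / 2 * (c1 + c2) * v)" if "0 < v" for v by (simp add: \<psi>_eq[OF that])
  show "Im (\<psi> v) = (c1 - c2) * (v * (a - ln v))" if "0 < v" for v by (simp add: \<psi>_eq[OF that] algebra_simps)
  show "sets ?\<nu> = sets borel" by (simp add: cauchy_levy_measure_def)
  show "sigma_finite_measure ?\<nu>"
  proof -
   have [measurable]: "(%x::real. x powi (- 2)) \<in> Bm borel" by (simp add: power_int_def)
   have [measurable]: "(%x::real. \<bar>x\<bar> powi (- 2)) \<in> Bm borel" by (simp add: power_int_def)
   show ?thesis unfolding cauchy_levy_measure_def by (subst sigma_finite_measure.sigma_finite_iff_density_finite[OF sigma_finite_lborel]) auto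
  qed
  show "(\<integral>\<^sup>+x. ennreal (min 1 (x\<^sup>2)) \<partial>?\<nu>) < \<infinity>" using lm by (simp add: levy_measure_of_def)
  show "\<psi> th = \<i> * complex_of_real (b * th) - complex_of_real (\<sigma>2 * th\<^sup>2 / 2)
     + (CLINT x|?\<nu>. iexp (th * x) - 1 - (if \<bar>x\<bar> <= 1 then \<i> * complex_of_real (th * x) else 0))" for th
   by (rule fun_cong[OF levy_exponent_unique[OF \<psi> LK]])
 qed
 thus ?thesis by (rule that)
qed

text \<open>From k = 3 on ln k is at least 1. Summability also ensures that
  \<open>offspring_mean\<close>, an infinite sum of reals, is the actual mean and not a default
  value.\<close>

lemma LlogL_imp_mean:
 assumes "summable (%k. real k * ln (real k) * pmf p k)"
 shows "(%k. real k * pmf p k) sums offspring_mean p"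
proof -
 have "summable (%k. real k * pmf p k)"
 proof (rule summable_comparison_test_ev[OF _ assms])
  show "\<forall>\<^sub>F k in sequentially. norm (real k * pmf p k) <= real k * ln (real k) * pmf p k"
   using eventually_ge_at_top[of 3]
  proof eventually_elim
   case (elim k)
   have "1 <= ln (real k)" using exp_le elim by (subst ln_ge_iff) auto
   hence "real k * pmf p k * 1 <= real k * pmf p k * ln (real k)" by (intro mult_left_mono) auto
   thus ?case by (simp add: mult_ac)
  qed
 qed
 thus ?thesis unfolding offspring_mean_def by (rule summable_sums)
qed

theorem mainTheorem5:
  fixes M :: "'w measure" and N :: "'b measure"
    and \<beta> lam :: real and p :: "nat pmf"
    and \<xi> :: "real \<Rightarrow> 'b \<Rightarrow> real"
    and life :: "nat list \<Rightarrow> 'w \<Rightarrow> real"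
    and offs :: "nat list \<Rightarrow> 'w \<Rightarrow> nat"
    and motion :: "nat list \<Rightarrow> real \<Rightarrow> 'w \<Rightarrow> real"
    and Z :: "real \<Rightarrow> 'w \<Rightarrow> nat"
    and W :: "'w \<Rightarrow> real"
  assumes blp: "branching_levy_process M \<beta> p N \<xi> life offs motion"
    and supercritical: "offspring_mean p > 1"
    and LlogL: "summable (\<lambda>k. real k * ln (real k) * pmf p k)"
    and lam_def: "lam = growth_rate \<beta> p"
    and Z_def: "Z = population life offs"
    and W_measurable: "W \<in> borel_measurable M"
    and W_limit: "AE \<omega> in M. ((\<lambda>t. exp (- lam * t) * real (Z t \<omega>)) \<longlongrightarrow> W \<omega>) at_top"
  shows
    "(\<forall>h \<pi>. assumption_A1 N \<xi> lam h \<pi> \<and> assumption_A2 N \<xi> lam h \<and> assumption_A3 N \<xi> lam h \<longrightarrow>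
        branching_limit M lam Z W \<pi> (particle_measure life offs motion h)) \<and>
     (\<forall>c1 c2 a. nonsymmetric_1_stable c1 c2 a N \<xi> \<longrightarrow>
        (let h = (\<lambda>t. exp (lam * t)); n = to_R0bar (cauchy_levy_measure c1 c2)
         in assumption_A1 N \<xi> lam h n \<and> assumption_A2 N \<xi> lam h \<and> assumption_A3 N \<xi> lam h \<and>
            branching_limit M lam Z W n (particle_measure life offs motion h)))"
proof -
 have bl: "blevy \<beta> N \<xi>" using blp by (intro blevy.intro) (auto simp: branching_levy_process_def)
 have bm: "blevy_mean \<beta> p N \<xi> (offspring_mean p) lam"
  by (intro blevy_mean.intro blevy_mean_axioms.intro bl LlogL_imp_mean[OF LlogL] supercritical)
    (simp add: lam_def growth_rate_def)
 interpret bm: blevy_mean \<beta> p N \<xi> "offspring_mean p" lam by (rule bm)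
 have main: "branching_limit M lam Z W \<pi> (particle_measure life offs motion h)"
  if "assumption_A1 N \<xi> lam h \<pi>" "assumption_A3 N \<xi> lam h" for h \<pi> unfolding Z_def
  by (rule blim.branching_limit_blim,
    intro blim.intro btree.intro btree_axioms.intro blevy_lim.intro blevy_lim_axioms.intro blim_axioms.intro)
    (fact bm blp that W_measurable W_limit[unfolded Z_def])+
 show ?thesis unfolding Let_def
 proof (intro conjI allI impI)
  fix h \<pi> assume "assumption_A1 N \<xi> lam h \<pi> \<and> assumption_A2 N \<xi> lam h \<and> assumption_A3 N \<xi> lam h"
  thus "branching_limit M lam Z W \<pi> (particle_measure life offs motion h)" by (intro main) auto
 next
  fix c1 c2 a assume "nonsymmetric_1_stable c1 c2 a N \<xi>"
  then obtain \<psi> b \<sigma>2 where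
   "one_stable_levy \<beta> N \<xi> \<psi> (pi / 2 * (c1 + c2)) (c1 - c2) a (cauchy_levy_measure c1 c2) b \<sigma>2"
   by (rule one_stable_levy_of_nonsymmetric[OF bl])
  then interpret S: one_stable_levy \<beta> p N \<xi> \<psi> "pi / 2 * (c1 + c2)" "c1 - c2" a "cauchy_levy_measure c1 c2" b \<sigma>2 .
  show A1: "assumption_A1 N \<xi> lam (%t. exp (lam * t)) (to_R0bar (cauchy_levy_measure c1 c2))"
   by (rule S.A1_exp[OF bm.lam_pos])
  show "assumption_A2 N \<xi> lam (%t. exp (lam * t))" by (rule S.A2_exp[OF bm.lam_pos])
  show A3: "assumption_A3 N \<xi> lam (%t. exp (lam * t))" by (rule S.A3_exp[OF bm.lam_pos])
  show "branching_limit M lam Z W (to_R0bar (cauchy_levy_measure c1 c2)) (particle_measure life offs motion (%t. exp (lam * t)))"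
   by (rule main[OF A1 A3])
 qed
qed

end
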